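(* Let $A,B$ be bounded bicomplexes. \begin{enumerate} \item There is a natural short exact sequence \[ 0\longrightarrow\frac{H_{BC}(A)\otimes H_{BC}(B)}{\partial\bar\partial(H_A(A)\otimes H_A(B))}\longrightarrow H_{BC}(A\otimes B)\longrightarrow K\longrightarrow0, \] where \[ K:=(\ker\partial\cap\ker\bar\partial)\bigl(\widetilde{H}_A(A)\otimes H_{BC}(B)\oplus H_{BC}(A)\otimes\widetilde{H}_A(B)\bigr). \] \item There is a natural short exact sequence \[ 0\longrightarrow L\longrightarrow H_A(A\otimes B)\longrightarrow(\ker\partial\bar\partial)\bigl(H_A(A)\otimes H_A(B)\bigr)\longrightarrow0, \] where \[ L:=\frac{\widetilde{H}_{BC}(A)\otimes H_A(B)\oplus H_A(A)\otimes\widetilde{H}_{BC}(B)}{\partial(H_A(A)\otimes H_A(B))+\bar\partial(H_A(A)\otimes H_A(B))}. \] \end{enumerate}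
   Context: A bicomplex is a bigraded $\mathbb{C}$-vector space $A=\bigoplus_{p,q\in\mathbb{Z}}A^{p,q}$ with linear endomorphisms $\partial$ of bidegree $(1,0)$ and $\bar\partial$ of bidegree $(0,1)$ such that $d=\partial+\bar\partial$ satisfies $d^2=0$. It is bounded if it is nonzero in only finitely many bidegrees. Tensor products carry the differential $d(a\otimes b)=da\otimes b+(-1)^{|a|}a\otimes db$, $|a|$ being the total degree (and similarly for its components $\partial$ and $\bar\partial$). $H_{BC}=\frac{\ker\partial\cap\ker\bar\partial}{\operatorname{im}\partial\bar\partial}$, $H_A=\frac{\ker\partial\bar\partial}{\operatorname{im}\partial+\operatorname{im}\bar\partial}$. The identity induces a natural map $H_{BC}\to H_A$; $\widetilde{H}_{BC}$ denotes its kernel and $\widetilde{H}_A$ its cokernel. The differentials induce maps $\partial,\bar\partial:H_A(A)\to H_{BC}(A)$, which take values in $\widetilde{H}_{BC}(A)$ and factor through $\widetilde{H}_A(A)$. In this way $H_{ABC}(A):=H_A(A)\oplus\widetilde{H}_{BC}(A)$ and $H_{BCA}(A):=H_{BC}(A)\oplus\widetilde{H}_A(A)$ become bicomplexes (with $\partial,\bar\partial$ zero on $\widetilde{H}_{BC}$, resp. $H_{BC}$, and mapping $H_A\to\widetilde{H}_{BC}$, resp. $\widetilde{H}_A\to H_{BC}$). All expressions involving $\partial,\bar\partial$ in the claim are formed in the tensor product bicomplexes $H_{ABC}(A)\otimes H_{ABC}(B)$ and $H_{BCA}(A)\otimes H_{BCA}(B)$: e.g. $\partial\bar\partial(H_A(A)\otimes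 H_A(B))\subseteq\widetilde{H}_{BC}(A)\otimes\widetilde{H}_{BC}(B)\subseteq H_{BC}(A)\otimes H_{BC}(B)$, $K$ is the subspace of elements of $\widetilde{H}_A(A)\otimes H_{BC}(B)\oplus H_{BC}(A)\otimes\widetilde{H}_A(B)$ annihilated by both $\partial$ and $\bar\partial$ (with values in $H_{BC}(A)\otimes H_{BC}(B)$), and $(\ker\partial\bar\partial)(H_A(A)\otimes H_A(B))$ is the kernel of $\partial\bar\partial:H_A(A)\otimes H_A(B)\to\widetilde{H}_{BC}(A)\otimes\widetilde{H}_{BC}(B)$. *)

theory Defs
  imports Complex_Main "HOL-Algebra.AbelCoset" "Jordan_Normal_Form.VS_Connect" "HOL-Library.Poly_Mapping"
begin

section \<open>Bigraded vector spaces and bicomplexes\<close>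

abbreviation CC :: "complex ring" where
  "CC \<equiv> class_ring"

text \<open>
  Vector spaces are the carrier-based modules of HOL-Algebra. The record type of modules
  extends that of rings; its fields \<open>mult\<close> and \<open>one\<close> play no role and are
  filled with dummies below.
\<close>

record 'a bigraded = "(complex, 'a) module" +
  grade :: "int \<Rightarrow> int \<Rightarrow> 'a set"

record 'a bicomplex = "'a bigraded" +
  del :: "'a \<Rightarrow> 'a"
  delbar :: "'a \<Rightarrow> 'a"

definition decomposition ::
    "('a, 'm) bigraded_scheme \<Rightarrow> (int \<times> int \<Rightarrow> 'a) \<Rightarrow> 'a \<Rightarrow> bool" where
  "decomposition V c x \<longleftrightarrow>
     (\<forall>p q. c (p, q) \<in> grade V p q) \<and> finite {i. c i \<noteq> \<zero>\<^bsub>V\<^esub>} \<and>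
     x = (\<Oplus>\<^bsub>V\<^esub> i \<in> {i. c i \<noteq> \<zero>\<^bsub>V\<^esub>}. c i)"

definition bigraded_space :: "('a, 'm) bigraded_scheme \<Rightarrow> bool" where
  "bigraded_space V \<longleftrightarrow>
     vectorspace CC V \<and>
     (\<forall>p q. VectorSpace.subspace CC (grade V p q) V) \<and>
     (\<forall>x \<in> carrier V. \<exists>!c. decomposition V c x)"

definition bicomplex :: "'a bicomplex \<Rightarrow> bool" where
  "bicomplex A \<longleftrightarrow>
     bigraded_space A \<and>
     linear_map CC A A (del A) \<and> linear_map CC A A (delbar A) \<and>
     (\<forall>p q. del A ` grade A p q \<subseteq> grade A (p + 1) q) \<and>
     (\<forall>p q. delbar A ` grade A p q \<subseteq> grade A p (q + 1)) \<and>
     (let d = (\<lambda>x. del A x \<oplus>\<^bsub>A\<^esub> delbar A x)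
      in \<forall>x \<in> carrier A. d (d x) = \<zero>\<^bsub>A\<^esub>)"

definition bounded_bicomplex :: "'a bicomplex \<Rightarrow> bool" where
  "bounded_bicomplex A \<longleftrightarrow>
     bicomplex A \<and> finite {(p, q). grade A p q \<noteq> {\<zero>\<^bsub>A\<^esub>}}"

definition graded_linear_map ::
    "('a, 'm) bigraded_scheme \<Rightarrow> ('b, 'n) bigraded_scheme \<Rightarrow> ('a \<Rightarrow> 'b) \<Rightarrow> bool" where
  "graded_linear_map V W f \<longleftrightarrow>
     linear_map CC V W f \<and> (\<forall>p q. f ` grade V p q \<subseteq> grade W p q)"

definition bicomplex_morphism :: "'a bicomplex \<Rightarrow> 'b bicomplex \<Rightarrow> ('a \<Rightarrow> 'b) \<Rightarrow> bool" where
  "bicomplex_morphism A B f \<longleftrightarrow>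
     graded_linear_map A B f \<and>
     (\<forall>x \<in> carrier A. f (del A x) = del B (f x) \<and> f (delbar A x) = delbar B (f x))"


section \<open>Subspaces, quotients and direct sums\<close>

definition sub_space :: "('a, 'm) bigraded_scheme \<Rightarrow> 'a set \<Rightarrow> ('a, 'm) bigraded_scheme" where
  "sub_space V U = V\<lparr>carrier := U, grade := (\<lambda>p q. grade V p q \<inter> U)\<rparr>"

definition quot_module ::
    "(complex, 'a, 'm) module_scheme \<Rightarrow> 'a set \<Rightarrow> (complex, 'a set) module" where
  "quot_module V U =
     \<lparr>carrier = a_rcosets\<^bsub>V\<^esub> U, mult = (\<lambda>X Y. U), one = U, zero = U, add = set_add V,
      smult = (\<lambda>c X. U <+>\<^bsub>V\<^esub> (\<lambda>x. c \<odot>\<^bsub>V\<^esub> x) ` X)\<rparr>"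

definition quot_space :: "('a, 'm) bigraded_scheme \<Rightarrow> 'a set \<Rightarrow> 'a set bigraded" where
  "quot_space V U =
     module.extend (quot_module V U)
       (bigraded.fields (\<lambda>p q. (\<lambda>x. U +>\<^bsub>V\<^esub> x) ` grade V p q))"

text \<open>
  The map of quotients \<open>V / U \<rightarrow> V' / U'\<close> induced by a linear map \<open>f\<close> from \<open>V\<close> to \<open>V'\<close>
  with \<open>f ` U \<subseteq> U'\<close>: it sends the coset of \<open>x\<close> to \<open>U' + f x + f ` U\<close>, the coset
  of \<open>f x\<close>. Only the target occurs as an argument.
\<close>

definition quot_map ::
    "(complex, 'b, 'm) module_scheme \<Rightarrow> 'b set \<Rightarrow> ('a \<Rightarrow> 'b) \<Rightarrow> 'a set \<Rightarrow> 'b set" where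
  "quot_map V' U' f X = U' <+>\<^bsub>V'\<^esub> f ` X"

definition sum_space ::
    "('a, 'm) bigraded_scheme \<Rightarrow> ('b, 'n) bigraded_scheme \<Rightarrow> ('a \<times> 'b) bigraded" where
  "sum_space V W =
     module.extend (direct_sum V W) (bigraded.fields (\<lambda>p q. grade V p q \<times> grade W p q))"


section \<open>Tensor products\<close>

definition free_module :: "'x set \<Rightarrow> (complex, 'x \<Rightarrow>\<^sub>0 complex) module" where
  "free_module S =
     \<lparr>carrier = {u. Poly_Mapping.keys u \<subseteq> S}, mult = (\<lambda>u v. 0), one = 0, zero = 0,
      add = (+), smult = (\<lambda>c. Poly_Mapping.map ((*) c))\<rparr>"

definition free_map :: "('x \<Rightarrow> 'y) \<Rightarrow> ('x \<Rightarrow>\<^sub>0 complex) \<Rightarrow> ('y \<Rightarrow>\<^sub>0 complex)" where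
  "free_map h u =
     (\<Sum>k \<in> Poly_Mapping.keys u. Poly_Mapping.single (h k) (Poly_Mapping.lookup u k))"

abbreviation free_basis :: "'x \<Rightarrow> 'x \<Rightarrow>\<^sub>0 complex" where
  "free_basis k \<equiv> Poly_Mapping.single k 1"

definition bilinear_relations ::
    "(complex, 'a, 'm) module_scheme \<Rightarrow> (complex, 'b, 'n) module_scheme \<Rightarrow>
     ('a \<times> 'b \<Rightarrow>\<^sub>0 complex) set" where
  "bilinear_relations V W =
     {free_basis (v \<oplus>\<^bsub>V\<^esub> v', w) - free_basis (v, w) - free_basis (v', w) | v v' w.
        v \<in> carrier V \<and> v' \<in> carrier V \<and> w \<in> carrier W} \<union>
     {free_basis (v, w \<oplus>\<^bsub>W\<^esub> w') - free_basis (v, w) - free_basis (v, w') | v w w'.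
        v \<in> carrier V \<and> w \<in> carrier W \<and> w' \<in> carrier W} \<union>
     {free_basis (c \<odot>\<^bsub>V\<^esub> v, w) - Poly_Mapping.single (v, w) c | c v w.
        v \<in> carrier V \<and> w \<in> carrier W} \<union>
     {free_basis (v, c \<odot>\<^bsub>W\<^esub> w) - Poly_Mapping.single (v, w) c | c v w.
        v \<in> carrier V \<and> w \<in> carrier W}"

definition tensor_kernel ::
    "(complex, 'a, 'm) module_scheme \<Rightarrow> (complex, 'b, 'n) module_scheme \<Rightarrow>
     ('a \<times> 'b \<Rightarrow>\<^sub>0 complex) set" where
  "tensor_kernel V W =
     LinearCombinations.module.span CC (free_module (carrier V \<times> carrier W)) (bilinear_relations V W)"

definition tensor_module ::
    "(complex, 'a, 'm) module_scheme \<Rightarrow> (complex, 'b, 'n) module_scheme \<Rightarrow>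
     (complex, ('a \<times> 'b \<Rightarrow>\<^sub>0 complex) set) module" where
  "tensor_module V W =
     quot_module (free_module (carrier V \<times> carrier W)) (tensor_kernel V W)"

definition pure_tensor ::
    "(complex, 'a, 'm) module_scheme \<Rightarrow> (complex, 'b, 'n) module_scheme \<Rightarrow>
     'a \<Rightarrow> 'b \<Rightarrow> ('a \<times> 'b \<Rightarrow>\<^sub>0 complex) set" where
  "pure_tensor V W v w =
     tensor_kernel V W +>\<^bsub>free_module (carrier V \<times> carrier W)\<^esub> free_basis (v, w)"

definition tensor_space ::
    "('a, 'm) bigraded_scheme \<Rightarrow> ('b, 'n) bigraded_scheme \<Rightarrow>
     ('a \<times> 'b \<Rightarrow>\<^sub>0 complex) set bigraded" where
  "tensor_space V W =
     module.extend (tensor_module V W)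
       (bigraded.fields (\<lambda>p q. LinearCombinations.module.span CC (tensor_module V W)
          {pure_tensor V W v w | v w i j k l.
             i + k = p \<and> j + l = q \<and> v \<in> grade V i j \<and> w \<in> grade W k l}))"

text \<open>The map \<open>f \<otimes> g\<close> into \<open>V' \<otimes> W'\<close>.\<close>

definition tensor_map ::
    "(complex, 'c, 'm) module_scheme \<Rightarrow> (complex, 'd, 'n) module_scheme \<Rightarrow>
     ('a \<Rightarrow> 'c) \<Rightarrow> ('b \<Rightarrow> 'd) \<Rightarrow>
     ('a \<times> 'b \<Rightarrow>\<^sub>0 complex) set \<Rightarrow> ('c \<times> 'd \<Rightarrow>\<^sub>0 complex) set" where
  "tensor_map V' W' f g =
     quot_map (free_module (carrier V' \<times> carrier W')) (tensor_kernel V' W')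
       (free_map (map_prod f g))"

text \<open>
  For subspaces \<open>S\<close> of \<open>V\<close> and \<open>T\<close> of \<open>W\<close>, the tensor product \<open>S \<otimes> T\<close> as a subspace
  of \<open>V \<otimes> W\<close> (over a field the canonical map \<open>S \<otimes> T \<rightarrow> V \<otimes> W\<close> is injective, and
  this is its image).
\<close>

definition tensor_sub ::
    "(complex, 'a, 'm) module_scheme \<Rightarrow> (complex, 'b, 'n) module_scheme \<Rightarrow>
     'a set \<Rightarrow> 'b set \<Rightarrow> ('a \<times> 'b \<Rightarrow>\<^sub>0 complex) set set" where
  "tensor_sub V W S T =
     LinearCombinations.module.span CC (tensor_module V W) {pure_tensor V W v w | v w. v \<in> S \<and> w \<in> T}"

text \<open>The linear operator that acts as \<open>(-1)\<close> to the power \<open>p + q\<close> in bidegree \<open>(p, q)\<close>.\<close>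

definition degree_sign :: "('a, 'm) bigraded_scheme \<Rightarrow> 'a \<Rightarrow> 'a" where
  "degree_sign V x =
     (let c = (THE c. decomposition V c x) in
      \<Oplus>\<^bsub>V\<^esub> i \<in> {i. c i \<noteq> \<zero>\<^bsub>V\<^esub>}.
        if even (fst i + snd i) then c i else \<ominus>\<^bsub>V\<^esub> c i)"

definition tensor_diff ::
    "('a, 'm) bigraded_scheme \<Rightarrow> ('b, 'n) bigraded_scheme \<Rightarrow> ('a \<Rightarrow> 'a) \<Rightarrow> ('b \<Rightarrow> 'b) \<Rightarrow>
     ('a \<times> 'b \<Rightarrow>\<^sub>0 complex) set \<Rightarrow> ('a \<times> 'b \<Rightarrow>\<^sub>0 complex) set" where
  "tensor_diff V W f g X =
     tensor_map V W f (\<lambda>w. w) X \<oplus>\<^bsub>tensor_module V W\<^esub> tensor_map V W (degree_sign V) g X"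

definition tensor_bicomplex ::
    "'a bicomplex \<Rightarrow> 'b bicomplex \<Rightarrow> ('a \<times> 'b \<Rightarrow>\<^sub>0 complex) set bicomplex" where
  "tensor_bicomplex A B =
     bigraded.extend (tensor_space A B)
       (bicomplex.fields (tensor_diff A B (del A) (del B)) (tensor_diff A B (delbar A) (delbar B)))"


section \<open>Bott-Chern and Aeppli cohomology\<close>

definition ker_both :: "'a bicomplex \<Rightarrow> 'a set" where
  "ker_both A = {x \<in> carrier A. del A x = \<zero>\<^bsub>A\<^esub> \<and> delbar A x = \<zero>\<^bsub>A\<^esub>}"

definition im_deldelbar :: "'a bicomplex \<Rightarrow> 'a set" where
  "im_deldelbar A = (\<lambda>x. del A (delbar A x)) ` carrier A"

definition ker_deldelbar :: "'a bicomplex \<Rightarrow> 'a set" where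
  "ker_deldelbar A = {x \<in> carrier A. del A (delbar A x) = \<zero>\<^bsub>A\<^esub>}"

definition im_sum :: "'a bicomplex \<Rightarrow> 'a set" where
  "im_sum A = del A ` carrier A <+>\<^bsub>A\<^esub> delbar A ` carrier A"

definition H_BC :: "'a bicomplex \<Rightarrow> 'a set bigraded" where
  "H_BC A = quot_space (sub_space A (ker_both A)) (im_deldelbar A)"

definition H_A :: "'a bicomplex \<Rightarrow> 'a set bigraded" where
  "H_A A = quot_space (sub_space A (ker_deldelbar A)) (im_sum A)"

definition BC_to_A :: "'a bicomplex \<Rightarrow> 'a set \<Rightarrow> 'a set" where
  "BC_to_A A = quot_map A (im_sum A) (\<lambda>x. x)"

text \<open>The kernel and the cokernel of the natural map from \<open>H_BC\<close> to \<open>H_A\<close>.\<close>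

definition tilde_H_BC :: "'a bicomplex \<Rightarrow> 'a set bigraded" where
  "tilde_H_BC A =
     sub_space (H_BC A) {X \<in> carrier (H_BC A). BC_to_A A X = \<zero>\<^bsub>H_A A\<^esub>}"

definition tilde_H_A :: "'a bicomplex \<Rightarrow> 'a set set bigraded" where
  "tilde_H_A A = quot_space (H_A A) (BC_to_A A ` carrier (H_BC A))"

text \<open>The maps \<open>H_A \<rightarrow> H_BC\<close> induced by an operator \<open>D\<close>, which is \<open>del A\<close> or \<open>delbar A\<close>.\<close>

definition A_to_BC :: "'a bicomplex \<Rightarrow> ('a \<Rightarrow> 'a) \<Rightarrow> 'a set \<Rightarrow> 'a set" where
  "A_to_BC A D = quot_map A (im_deldelbar A) D"

text \<open>
  The factorisation of \<^term>\<open>A_to_BC A D\<close> through \<^term>\<open>tilde_H_A A\<close>: the former is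
  constant on every coset \<open>Z\<close> that is an element of the latter.
\<close>

definition tilde_A_to_BC :: "'a bicomplex \<Rightarrow> ('a \<Rightarrow> 'a) \<Rightarrow> 'a set set \<Rightarrow> 'a set" where
  "tilde_A_to_BC A D Z = the_elem (A_to_BC A D ` Z)"

definition H_ABC :: "'a bicomplex \<Rightarrow> ('a set \<times> 'a set) bicomplex" where
  "H_ABC A =
     bigraded.extend (sum_space (H_A A) (tilde_H_BC A))
       (bicomplex.fields
          (\<lambda>(X, Y). (\<zero>\<^bsub>H_A A\<^esub>, A_to_BC A (del A) X))
          (\<lambda>(X, Y). (\<zero>\<^bsub>H_A A\<^esub>, A_to_BC A (delbar A) X)))"

definition H_BCA :: "'a bicomplex \<Rightarrow> ('a set \<times> 'a set set) bicomplex" where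
  "H_BCA A =
     bigraded.extend (sum_space (H_BC A) (tilde_H_A A))
       (bicomplex.fields
          (\<lambda>(X, Z). (tilde_A_to_BC A (del A) Z, \<zero>\<^bsub>tilde_H_A A\<^esub>))
          (\<lambda>(X, Z). (tilde_A_to_BC A (delbar A) Z, \<zero>\<^bsub>tilde_H_A A\<^esub>)))"

text \<open>
  Functoriality. As in \<^const>\<open>quot_map\<close>, only the target \<open>A'\<close> of the morphism \<open>f\<close> is needed.
\<close>

definition H_BC_map :: "'b bicomplex \<Rightarrow> ('a \<Rightarrow> 'b) \<Rightarrow> 'a set \<Rightarrow> 'b set" where
  "H_BC_map A' f = quot_map A' (im_deldelbar A') f"

definition H_A_map :: "'b bicomplex \<Rightarrow> ('a \<Rightarrow> 'b) \<Rightarrow> 'a set \<Rightarrow> 'b set" where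
  "H_A_map A' f = quot_map A' (im_sum A') f"

definition tilde_H_A_map :: "'b bicomplex \<Rightarrow> ('a \<Rightarrow> 'b) \<Rightarrow> 'a set set \<Rightarrow> 'b set set" where
  "tilde_H_A_map A' f =
     quot_map (H_A A') (BC_to_A A' ` carrier (H_BC A')) (H_A_map A' f)"

definition H_ABC_map ::
    "'b bicomplex \<Rightarrow> ('a \<Rightarrow> 'b) \<Rightarrow> 'a set \<times> 'a set \<Rightarrow> 'b set \<times> 'b set" where
  "H_ABC_map A' f = map_prod (H_A_map A' f) (H_BC_map A' f)"

definition H_BCA_map ::
    "'b bicomplex \<Rightarrow> ('a \<Rightarrow> 'b) \<Rightarrow> 'a set \<times> 'a set set \<Rightarrow> 'b set \<times> 'b set set" where
  "H_BCA_map A' f = map_prod (H_BC_map A' f) (tilde_H_A_map A' f)"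


section \<open>The terms of the two sequences\<close>

abbreviation ABC_tensor ::
    "'a bicomplex \<Rightarrow> 'b bicomplex \<Rightarrow>
     (('a set \<times> 'a set) \<times> ('b set \<times> 'b set) \<Rightarrow>\<^sub>0 complex) set bicomplex" where
  "ABC_tensor A B \<equiv> tensor_bicomplex (H_ABC A) (H_ABC B)"

abbreviation BCA_tensor ::
    "'a bicomplex \<Rightarrow> 'b bicomplex \<Rightarrow>
     (('a set \<times> 'a set set) \<times> ('b set \<times> 'b set set) \<Rightarrow>\<^sub>0 complex) set bicomplex" where
  "BCA_tensor A B \<equiv> tensor_bicomplex (H_BCA A) (H_BCA B)"

text \<open>
  The summands \<open>H_A\<close> and \<open>tilde_H_BC\<close> of \<open>H_ABC\<close>, and \<open>H_BC\<close> and \<open>tilde_H_A\<close> of \<open>H_BCA\<close>,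
  as subsets of the direct sums.
\<close>

definition A_in_ABC :: "'a bicomplex \<Rightarrow> ('a set \<times> 'a set) set" where
  "A_in_ABC A = carrier (H_A A) \<times> {\<zero>\<^bsub>tilde_H_BC A\<^esub>}"

definition BC_in_ABC :: "'a bicomplex \<Rightarrow> ('a set \<times> 'a set) set" where
  "BC_in_ABC A = {\<zero>\<^bsub>H_A A\<^esub>} \<times> carrier (tilde_H_BC A)"

definition BC_in_BCA :: "'a bicomplex \<Rightarrow> ('a set \<times> 'a set set) set" where
  "BC_in_BCA A = carrier (H_BC A) \<times> {\<zero>\<^bsub>tilde_H_A A\<^esub>}"

definition A_in_BCA :: "'a bicomplex \<Rightarrow> ('a set \<times> 'a set set) set" where
  "A_in_BCA A = {\<zero>\<^bsub>H_BC A\<^esub>} \<times> carrier (tilde_H_A A)"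

text \<open>\<open>H_A(A) \<otimes> H_A(B)\<close> as a subspace of \<open>H_ABC(A) \<otimes> H_ABC(B)\<close>\<close>

definition A_tensor_A ::
    "'a bicomplex \<Rightarrow> 'b bicomplex \<Rightarrow>
     (('a set \<times> 'a set) \<times> ('b set \<times> 'b set) \<Rightarrow>\<^sub>0 complex) set set" where
  "A_tensor_A A B = tensor_sub (H_ABC A) (H_ABC B) (A_in_ABC A) (A_in_ABC B)"

text \<open>
  The subspace \<open>del delbar (H_A(A) \<otimes> H_A(B))\<close> of \<open>H_ABC(A) \<otimes> H_ABC(B)\<close> is contained in
  \<open>tilde_H_BC(A) \<otimes> tilde_H_BC(B)\<close>. It is carried over to \<open>H_BC(A) \<otimes> H_BC(B)\<close> by
  \<open>snd \<otimes> snd\<close>, where \<open>snd\<close> is the projection of \<open>H_ABC\<close> to \<open>tilde_H_BC\<close>, which is a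
  subspace of \<open>H_BC\<close>.
\<close>

definition deldelbar_A_tensor_A ::
    "'a bicomplex \<Rightarrow> 'b bicomplex \<Rightarrow> ('a set \<times> 'b set \<Rightarrow>\<^sub>0 complex) set set" where
  "deldelbar_A_tensor_A A B =
     tensor_map (H_BC A) (H_BC B) snd snd `
       (\<lambda>x. del (ABC_tensor A B) (delbar (ABC_tensor A B) x)) ` A_tensor_A A B"

definition BC_quotient ::
    "'a bicomplex \<Rightarrow> 'b bicomplex \<Rightarrow> ('a set \<times> 'b set \<Rightarrow>\<^sub>0 complex) set set bigraded" where
  "BC_quotient A B =
     quot_space (tensor_space (H_BC A) (H_BC B)) (deldelbar_A_tensor_A A B)"

definition BC_quotient_map ::
    "'c bicomplex \<Rightarrow> 'd bicomplex \<Rightarrow> ('a \<Rightarrow> 'c) \<Rightarrow> ('b \<Rightarrow> 'd) \<Rightarrow>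
     ('a set \<times> 'b set \<Rightarrow>\<^sub>0 complex) set set \<Rightarrow> ('c set \<times> 'd set \<Rightarrow>\<^sub>0 complex) set set" where
  "BC_quotient_map A' B' f g =
     quot_map (tensor_space (H_BC A') (H_BC B')) (deldelbar_A_tensor_A A' B')
       (tensor_map (H_BC A') (H_BC B') (H_BC_map A' f) (H_BC_map B' g))"

definition K_space ::
    "'a bicomplex \<Rightarrow> 'b bicomplex \<Rightarrow>
     (('a set \<times> 'a set set) \<times> ('b set \<times> 'b set set) \<Rightarrow>\<^sub>0 complex) set bicomplex" where
  "K_space A B =
     sub_space (BCA_tensor A B)
       {x \<in> tensor_sub (H_BCA A) (H_BCA B) (A_in_BCA A) (BC_in_BCA B)
             <+>\<^bsub>BCA_tensor A B\<^esub>
             tensor_sub (H_BCA A) (H_BCA B) (BC_in_BCA A) (A_in_BCA B).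
          del (BCA_tensor A B) x = \<zero>\<^bsub>BCA_tensor A B\<^esub> \<and>
          delbar (BCA_tensor A B) x = \<zero>\<^bsub>BCA_tensor A B\<^esub>}"

definition K_map ::
    "'c bicomplex \<Rightarrow> 'd bicomplex \<Rightarrow> ('a \<Rightarrow> 'c) \<Rightarrow> ('b \<Rightarrow> 'd) \<Rightarrow>
     (('a set \<times> 'a set set) \<times> ('b set \<times> 'b set set) \<Rightarrow>\<^sub>0 complex) set \<Rightarrow>
     (('c set \<times> 'c set set) \<times> ('d set \<times> 'd set set) \<Rightarrow>\<^sub>0 complex) set" where
  "K_map A' B' f g = tensor_map (H_BCA A') (H_BCA B') (H_BCA_map A' f) (H_BCA_map B' g)"

definition L_denominator ::
    "'a bicomplex \<Rightarrow> 'b bicomplex \<Rightarrow>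
     (('a set \<times> 'a set) \<times> ('b set \<times> 'b set) \<Rightarrow>\<^sub>0 complex) set set" where
  "L_denominator A B =
     del (ABC_tensor A B) ` A_tensor_A A B
     <+>\<^bsub>ABC_tensor A B\<^esub>
     delbar (ABC_tensor A B) ` A_tensor_A A B"

definition L_space ::
    "'a bicomplex \<Rightarrow> 'b bicomplex \<Rightarrow>
     (('a set \<times> 'a set) \<times> ('b set \<times> 'b set) \<Rightarrow>\<^sub>0 complex) set set bigraded" where
  "L_space A B =
     quot_space
       (sub_space (ABC_tensor A B)
          (tensor_sub (H_ABC A) (H_ABC B) (BC_in_ABC A) (A_in_ABC B)
           <+>\<^bsub>ABC_tensor A B\<^esub>
           tensor_sub (H_ABC A) (H_ABC B) (A_in_ABC A) (BC_in_ABC B)))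
       (L_denominator A B)"

definition ABC_tensor_map ::
    "'c bicomplex \<Rightarrow> 'd bicomplex \<Rightarrow> ('a \<Rightarrow> 'c) \<Rightarrow> ('b \<Rightarrow> 'd) \<Rightarrow>
     (('a set \<times> 'a set) \<times> ('b set \<times> 'b set) \<Rightarrow>\<^sub>0 complex) set \<Rightarrow>
     (('c set \<times> 'c set) \<times> ('d set \<times> 'd set) \<Rightarrow>\<^sub>0 complex) set" where
  "ABC_tensor_map A' B' f g =
     tensor_map (H_ABC A') (H_ABC B') (H_ABC_map A' f) (H_ABC_map B' g)"

definition L_map ::
    "'c bicomplex \<Rightarrow> 'd bicomplex \<Rightarrow> ('a \<Rightarrow> 'c) \<Rightarrow> ('b \<Rightarrow> 'd) \<Rightarrow>
     (('a set \<times> 'a set) \<times> ('b set \<times> 'b set) \<Rightarrow>\<^sub>0 complex) set set \<Rightarrow>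
     (('c set \<times> 'c set) \<times> ('d set \<times> 'd set) \<Rightarrow>\<^sub>0 complex) set set" where
  "L_map A' B' f g =
     quot_map (ABC_tensor A' B') (L_denominator A' B') (ABC_tensor_map A' B' f g)"

definition ker_deldelbar_A_tensor_A ::
    "'a bicomplex \<Rightarrow> 'b bicomplex \<Rightarrow>
     (('a set \<times> 'a set) \<times> ('b set \<times> 'b set) \<Rightarrow>\<^sub>0 complex) set bicomplex" where
  "ker_deldelbar_A_tensor_A A B =
     sub_space (ABC_tensor A B)
       {x \<in> A_tensor_A A B.
          del (ABC_tensor A B) (delbar (ABC_tensor A B) x) = \<zero>\<^bsub>ABC_tensor A B\<^esub>}"

definition H_BC_tensor ::
    "'a bicomplex \<Rightarrow> 'b bicomplex \<Rightarrow> ('a \<times> 'b \<Rightarrow>\<^sub>0 complex) set set bigraded" where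
  "H_BC_tensor A B = H_BC (tensor_bicomplex A B)"

definition H_BC_tensor_map ::
    "'c bicomplex \<Rightarrow> 'd bicomplex \<Rightarrow> ('a \<Rightarrow> 'c) \<Rightarrow> ('b \<Rightarrow> 'd) \<Rightarrow>
     ('a \<times> 'b \<Rightarrow>\<^sub>0 complex) set set \<Rightarrow> ('c \<times> 'd \<Rightarrow>\<^sub>0 complex) set set" where
  "H_BC_tensor_map A' B' f g = H_BC_map (tensor_bicomplex A' B') (tensor_map A' B' f g)"

definition H_A_tensor ::
    "'a bicomplex \<Rightarrow> 'b bicomplex \<Rightarrow> ('a \<times> 'b \<Rightarrow>\<^sub>0 complex) set set bigraded" where
  "H_A_tensor A B = H_A (tensor_bicomplex A B)"

definition H_A_tensor_map ::
    "'c bicomplex \<Rightarrow> 'd bicomplex \<Rightarrow> ('a \<Rightarrow> 'c) \<Rightarrow> ('b \<Rightarrow> 'd) \<Rightarrow>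
     ('a \<times> 'b \<Rightarrow>\<^sub>0 complex) set set \<Rightarrow> ('c \<times> 'd \<Rightarrow>\<^sub>0 complex) set set" where
  "H_A_tensor_map A' B' f g = H_A_map (tensor_bicomplex A' B') (tensor_map A' B' f g)"


section \<open>Natural short exact sequences\<close>

definition short_exact ::
    "('x, 'l) bigraded_scheme \<Rightarrow> ('x \<Rightarrow> 'y) \<Rightarrow> ('y, 'm) bigraded_scheme \<Rightarrow> ('y \<Rightarrow> 'z) \<Rightarrow>
     ('z, 'n) bigraded_scheme \<Rightarrow> bool" where
  "short_exact U i V p W \<longleftrightarrow>
     graded_linear_map U V i \<and> graded_linear_map V W p \<and>
     inj_on i (carrier U) \<and>
     i ` carrier U = {v \<in> carrier V. p v = \<zero>\<^bsub>W\<^esub>} \<and>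
     p ` carrier V = carrier W"

text \<open>
  The families \<open>i\<close> and \<open>p\<close> form a short exact sequence \<open>0 \<rightarrow> F \<rightarrow> G \<rightarrow> H \<rightarrow> 0\<close> of functors
  in two bounded bicomplexes: it is exact for all \<open>A\<close> and \<open>B\<close>, and the two squares given by
  any morphisms \<open>f\<close> from \<open>A\<close> to \<open>A'\<close> and \<open>g\<close> from \<open>B\<close> to \<open>B'\<close> commute. \<open>Fm\<close>, \<open>Gm\<close> and \<open>Hm\<close> are
  the actions of the functors on morphisms, which depend on the targets only.
\<close>

definition natural_short_exact ::
    "('a bicomplex \<Rightarrow> 'b bicomplex \<Rightarrow> ('x, 'l) bigraded_scheme) \<Rightarrow>
     ('a bicomplex \<Rightarrow> 'b bicomplex \<Rightarrow> ('a \<Rightarrow> 'a) \<Rightarrow> ('b \<Rightarrow> 'b) \<Rightarrow> 'x \<Rightarrow> 'x) \<Rightarrow>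
     ('a bicomplex \<Rightarrow> 'b bicomplex \<Rightarrow> 'x \<Rightarrow> 'y) \<Rightarrow>
     ('a bicomplex \<Rightarrow> 'b bicomplex \<Rightarrow> ('y, 'm) bigraded_scheme) \<Rightarrow>
     ('a bicomplex \<Rightarrow> 'b bicomplex \<Rightarrow> ('a \<Rightarrow> 'a) \<Rightarrow> ('b \<Rightarrow> 'b) \<Rightarrow> 'y \<Rightarrow> 'y) \<Rightarrow>
     ('a bicomplex \<Rightarrow> 'b bicomplex \<Rightarrow> 'y \<Rightarrow> 'z) \<Rightarrow>
     ('a bicomplex \<Rightarrow> 'b bicomplex \<Rightarrow> ('z, 'n) bigraded_scheme) \<Rightarrow>
     ('a bicomplex \<Rightarrow> 'b bicomplex \<Rightarrow> ('a \<Rightarrow> 'a) \<Rightarrow> ('b \<Rightarrow> 'b) \<Rightarrow> 'z \<Rightarrow> 'z) \<Rightarrow> bool" where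
  "natural_short_exact F Fm i G Gm p H Hm \<longleftrightarrow>
     (\<forall>A B. bounded_bicomplex A \<and> bounded_bicomplex B \<longrightarrow>
        short_exact (F A B) (i A B) (G A B) (p A B) (H A B)) \<and>
     (\<forall>A A' B B' f g.
        bounded_bicomplex A \<and> bounded_bicomplex A' \<and>
        bounded_bicomplex B \<and> bounded_bicomplex B' \<and>
        bicomplex_morphism A A' f \<and> bicomplex_morphism B B' g \<longrightarrow>
        (\<forall>x \<in> carrier (F A B). i A' B' (Fm A' B' f g x) = Gm A' B' f g (i A B x)) \<and>
        (\<forall>y \<in> carrier (G A B). p A' B' (Gm A' B' f g y) = Hm A' B' f g (p A B y)))"

end

theory Submission
  imports Defs
begin

text \<open>
  A graded generalised inverse of \<open>del delbar\<close> yields an operator \<open>g\<close> whose trace over the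
  exterior algebra of \<open>del\<close> and \<open>delbar\<close> is \<open>1 - e\<close>, where \<open>e\<close> is an idempotent that commutes
  with both differentials and projects onto a complement of the squares of \<open>A\<close>. Splitting this
  complement further exhibits \<open>H_BCA A\<close> and \<open>H_ABC A\<close> as retracts of \<open>A\<close>, with \<open>r q = e\<close>.
  The tensor product \<open>R Q\<close> of two such retracts differs from the identity by sums of traces. A
  trace vanishes modulo \<open>im (del delbar)\<close> on elements killed by \<open>del\<close> and \<open>delbar\<close>, and modulo
  \<open>im del + im delbar\<close> on elements killed by \<open>del delbar\<close>. Hence \<open>A \<otimes> B\<close> may be
  replaced by \<open>H_BCA A \<otimes> H_BCA B\<close> or \<open>H_ABC A \<otimes> H_ABC B\<close>. These are filtered
  in three steps, each differential passing from one step to the next, and the two exact sequences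
  are read off from the filtration. The retracts are not natural, but the maps that they induce
  between the graded pieces of the filtrations are.
\<close>

section \<open>Vector spaces over the complex numbers\<close>

text \<open>A bicomplex is a graded module over the exterior algebra on two generators, whose free
  modules are the sums of squares. By Higman's criterion the traces are exactly the endomorphisms
  that factor through a free module. They allow a single generalised inverse to replace the
  structure theory of bicomplexes, and they suit tensor products: for \<open>g\<close> of even
  degree the trace of \<open>g \<otimes> 1\<close> is the trace of \<open>g\<close> tensored with
  the identity.

  On a complement \<open>C\<close> of the squares \<open>del delbar\<close> vanishes. Let
  \<open>Z\<close> be the common kernel of the differentials and \<open>M\<close> the sum of their
  images. Then \<open>H_BC\<close>, \<open>tilde_H_A\<close>, \<open>H_A\<close> and
  \<open>tilde_H_BC\<close> of \<open>C\<close> are \<open>Z\<close>, \<open>C / Z\<close>,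
  \<open>C / M\<close> and \<open>M\<close>. So \<open>C\<close> carries two two-step filtrations,
  one for each sequence. In the first, \<open>C / Z\<close> is detected by the differentials, so
  closed elements of the tensor product have no part in \<open>C / Z \<otimes> C / Z\<close>. In the
  second, \<open>M\<close> consists of sums of images, so \<open>M \<otimes> M\<close> dies in
  Aeppli cohomology. The two models meet only in the denominator of the Bott-Chern sequence.\<close>

abbreviation vs :: "(complex, 'a, 'm) module_scheme \<Rightarrow> bool" where
  "vs V \<equiv> vectorspace CC V"

abbreviation lin ::
    "(complex, 'a, 'm) module_scheme \<Rightarrow> (complex, 'b, 'n) module_scheme \<Rightarrow> ('a \<Rightarrow> 'b) \<Rightarrow> bool" where
  "lin V W f \<equiv> linear_map CC V W f"

abbreviation subsp :: "(complex, 'a, 'm) module_scheme \<Rightarrow> 'a set \<Rightarrow> bool" where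
  "subsp V U \<equiv> VectorSpace.subspace CC U V"

lemma lin_iff:
  "lin V W f \<longleftrightarrow> vs V \<and> vs W \<and> (\<forall>x\<in>carrier V. f x \<in> carrier W) \<and>
     (\<forall>x\<in>carrier V. \<forall>y\<in>carrier V. f (x \<oplus>\<^bsub>V\<^esub> y) = f x \<oplus>\<^bsub>W\<^esub> f y) \<and>
     (\<forall>c. \<forall>x\<in>carrier V. f (c \<odot>\<^bsub>V\<^esub> x) = c \<odot>\<^bsub>W\<^esub> f x)"
  by (auto simp: linear_map_def mod_hom_def mod_hom_axioms_def LinearCombinations.module_hom_def vectorspace_def)

lemma subsp_iff:
  "subsp V U \<longleftrightarrow> vs V \<and> U \<subseteq> carrier V \<and> \<zero>\<^bsub>V\<^esub> \<in> U \<and>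
     (\<forall>x\<in>U. \<forall>y\<in>U. x \<oplus>\<^bsub>V\<^esub> y \<in> U) \<and> (\<forall>c. \<forall>x\<in>U. c \<odot>\<^bsub>V\<^esub> x \<in> U)"
  by (auto simp: VectorSpace.subspace_def submodule_def vectorspace_def)

lemma vs_abelian: "vs V \<Longrightarrow> abelian_group V"
  by (simp add: vectorspace_def Module.module_def)

lemma vs_module: "vs V \<Longrightarrow> Module.module CC V"
  by (simp add: vectorspace_def)

lemma vsI:
  fixes V :: "(complex, 'a, 'm) module_scheme"
  assumes "abelian_group V"
    and "\<And>c x. x \<in> carrier V \<Longrightarrow> c \<odot>\<^bsub>V\<^esub> x \<in> carrier V"
    and "\<And>a b x. x \<in> carrier V \<Longrightarrow> (a + b) \<odot>\<^bsub>V\<^esub> x = a \<odot>\<^bsub>V\<^esub> x \<oplus>\<^bsub>V\<^esub> b \<odot>\<^bsub>V\<^esub> x"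
    and "\<And>a x y. x \<in> carrier V \<Longrightarrow> y \<in> carrier V \<Longrightarrow>
           a \<odot>\<^bsub>V\<^esub> (x \<oplus>\<^bsub>V\<^esub> y) = a \<odot>\<^bsub>V\<^esub> x \<oplus>\<^bsub>V\<^esub> a \<odot>\<^bsub>V\<^esub> y"
    and "\<And>a b x. x \<in> carrier V \<Longrightarrow> (a * b) \<odot>\<^bsub>V\<^esub> x = a \<odot>\<^bsub>V\<^esub> (b \<odot>\<^bsub>V\<^esub> x)"
    and "\<And>x. x \<in> carrier V \<Longrightarrow> 1 \<odot>\<^bsub>V\<^esub> x = x"
  shows "vs V"
  unfolding vectorspace_def Module.module_def Module.module_axioms_def
  using assms class_field class_cring.is_cring by auto

text \<open>Carries the vector space structure between records that share these fields, for instance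
  from \<open>tensor_module\<close> to \<open>tensor_bicomplex\<close>.\<close>

lemma vs_eqv:
  fixes V :: "(complex, 'a, 'm) module_scheme" and W :: "(complex, 'a, 'n) module_scheme"
  assumes "vs V" "carrier W = carrier V" "add W = add V" "zero W = zero V" "smult W = smult V"
  shows "vs W"
proof -
  interpret V: vectorspace CC V by fact
  show ?thesis
  proof (rule vsI)
    show "abelian_group W"
      by (rule abelian_groupI)
        (use assms in \<open>auto simp: V.M.a_ac intro!: bexI[of _ "\<ominus>\<^bsub>V\<^esub> _"] V.M.l_neg\<close>)
  qed (use assms V.smult_closed V.smult_l_distr V.smult_r_distr V.smult_assoc1 V.smult_one[simplified] in auto)
qed

section \<open>Formal linear combinations and the embedding into a type\<close>

definition pscale :: "complex \<Rightarrow> ('a \<Rightarrow>\<^sub>0 complex) \<Rightarrow> ('a \<Rightarrow>\<^sub>0 complex)" where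
  "pscale c = Poly_Mapping.map ((*) c)"

lemma lookup_pscale [simp]: "Poly_Mapping.lookup (pscale c u) k = c * Poly_Mapping.lookup u k"
  by (simp add: pscale_def Poly_Mapping.map.rep_eq when_def)

lemma keys_pscale: "Poly_Mapping.keys (pscale c u) \<subseteq> Poly_Mapping.keys u"
  by (auto simp: in_keys_iff)

text \<open>With \<open>pscale\<close> the finitely supported functions form a vector space on a
  whole type, where complements of subspaces and one-sided inverses of linear maps are at
  hand.\<close>

interpretation pm: vector_space pscale
  by unfold_locales (auto intro!: poly_mapping_eqI simp: lookup_add algebra_simps)

interpretation pmp: vector_space_pair pscale pscale ..

lemma pscale_single: "pscale c (Poly_Mapping.single k a) = Poly_Mapping.single k (c * a)"
  by (rule poly_mapping_eqI) (simp add: lookup_single when_def)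

text \<open>The canonical surjection onto \<open>V\<close> from the free vector space on its
  elements.\<close>

definition vs_eval :: "(complex, 'a, 'm) module_scheme \<Rightarrow> ('a \<Rightarrow>\<^sub>0 complex) \<Rightarrow> 'a" where
  "vs_eval V u = (\<Oplus>\<^bsub>V\<^esub> k \<in> Poly_Mapping.keys u. Poly_Mapping.lookup u k \<odot>\<^bsub>V\<^esub> k)"

lemma vs_eval_superset:
  assumes "vs V" "finite K" "Poly_Mapping.keys u \<subseteq> K" "K \<subseteq> carrier V"
  shows "vs_eval V u = (\<Oplus>\<^bsub>V\<^esub> k \<in> K. Poly_Mapping.lookup u k \<odot>\<^bsub>V\<^esub> k)"
proof -
  interpret V: vectorspace CC V by fact
  show ?thesis
    unfolding vs_eval_def
    by (rule V.M.add.finprod_mono_neutral_cong_left)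
      (use assms in \<open>auto simp: in_keys_iff V.lmult_0[simplified]\<close>)
qed

lemma vs_eval_add:
  assumes "vs V" "Poly_Mapping.keys u \<subseteq> carrier V" "Poly_Mapping.keys v \<subseteq> carrier V"
  shows "vs_eval V (u + v) = vs_eval V u \<oplus>\<^bsub>V\<^esub> vs_eval V v"
proof -
  interpret V: vectorspace CC V by fact
  let ?K = "Poly_Mapping.keys u \<union> Poly_Mapping.keys v"
  have K: "finite ?K" "?K \<subseteq> carrier V" using assms by auto
  have "vs_eval V (u + v) = (\<Oplus>\<^bsub>V\<^esub> k \<in> ?K. Poly_Mapping.lookup (u + v) k \<odot>\<^bsub>V\<^esub> k)"
    by (rule vs_eval_superset) (use assms K Poly_Mapping.keys_add[of u v] in auto)
  also have "\<dots> = (\<Oplus>\<^bsub>V\<^esub> k \<in> ?K. Poly_Mapping.lookup u k \<odot>\<^bsub>V\<^esub> k \<oplus>\<^bsub>V\<^esub> Poly_Mapping.lookup v k \<odot>\<^bsub>V\<^esub> k)"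
    by (rule V.M.finsum_cong')
      (use K V.smult_l_distr in \<open>auto simp: lookup_add intro!: V.M.a_closed V.smult_closed\<close>)
  also have "\<dots> = (\<Oplus>\<^bsub>V\<^esub> k \<in> ?K. Poly_Mapping.lookup u k \<odot>\<^bsub>V\<^esub> k) \<oplus>\<^bsub>V\<^esub>
                  (\<Oplus>\<^bsub>V\<^esub> k \<in> ?K. Poly_Mapping.lookup v k \<odot>\<^bsub>V\<^esub> k)"
    by (rule V.M.finsum_addf) (use K in \<open>auto intro!: V.smult_closed\<close>)
  also have "\<dots> = vs_eval V u \<oplus>\<^bsub>V\<^esub> vs_eval V v"
    using vs_eval_superset[OF assms(1) K(1) _ K(2), of u]
      vs_eval_superset[OF assms(1) K(1) _ K(2), of v] by simp
  finally show ?thesis .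
qed

lemma vs_eval_scale:
  assumes "vs V" "Poly_Mapping.keys u \<subseteq> carrier V"
  shows "vs_eval V (pscale c u) = c \<odot>\<^bsub>V\<^esub> vs_eval V u"
proof -
  interpret V: vectorspace CC V by fact
  have "vs_eval V (pscale c u) =
      (\<Oplus>\<^bsub>V\<^esub> k \<in> Poly_Mapping.keys u. Poly_Mapping.lookup (pscale c u) k \<odot>\<^bsub>V\<^esub> k)"
    by (rule vs_eval_superset) (use assms keys_pscale[of c u] in auto)
  also have "\<dots> = (\<Oplus>\<^bsub>V\<^esub> k \<in> Poly_Mapping.keys u. c \<odot>\<^bsub>V\<^esub> (Poly_Mapping.lookup u k \<odot>\<^bsub>V\<^esub> k))"
    by (rule V.M.finsum_cong') (use assms V.smult_assoc1 in \<open>auto intro!: V.smult_closed\<close>)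
  also have "\<dots> = c \<odot>\<^bsub>V\<^esub> vs_eval V u"
    unfolding vs_eval_def
    by (rule V.finsum_smult[symmetric]) (use assms in \<open>auto intro!: V.smult_closed\<close>)
  finally show ?thesis .
qed

lemma vs_eval_single:
  assumes "vs V" "x \<in> carrier V"
  shows "vs_eval V (Poly_Mapping.single x a) = a \<odot>\<^bsub>V\<^esub> x"
proof -
  interpret V: vectorspace CC V by fact
  have "vs_eval V (Poly_Mapping.single x a) =
      (\<Oplus>\<^bsub>V\<^esub> k \<in> {x}. Poly_Mapping.lookup (Poly_Mapping.single x a) k \<odot>\<^bsub>V\<^esub> k)"
    by (rule vs_eval_superset) (use assms in auto)
  then show ?thesis using assms by (simp add: V.M.finsum_insert V.smult_closed)
qed

text \<open>\<open>V\<close> is the quotient of the free space on its elements by the kernel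
  \<open>N\<close> of evaluation. Over a field \<open>N\<close> has a complement, and this
  complement is a copy of \<open>V\<close> inside the type of finitely supported functions.\<close>

lemma vs_embedding:
  fixes V :: "(complex, 'a, 'm) module_scheme"
  assumes V: "vs V"
  obtains \<iota> :: "'a \<Rightarrow> 'a \<Rightarrow>\<^sub>0 complex" where "inj_on \<iota> (carrier V)"
    and "\<And>x y. x \<in> carrier V \<Longrightarrow> y \<in> carrier V \<Longrightarrow> \<iota> (x \<oplus>\<^bsub>V\<^esub> y) = \<iota> x + \<iota> y"
    and "\<And>c x. x \<in> carrier V \<Longrightarrow> \<iota> (c \<odot>\<^bsub>V\<^esub> x) = pscale c (\<iota> x)"
proof -
  interpret V: vectorspace CC V by fact
  define N where "N = {u. Poly_Mapping.keys u \<subseteq> carrier V \<and> vs_eval V u = \<zero>\<^bsub>V\<^esub>}"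
  have N: "pm.subspace N"
  proof (rule pm.subspaceI)
    show "0 \<in> N" by (simp add: N_def vs_eval_def)
  next
    fix u v assume "u \<in> N" "v \<in> N"
    then show "u + v \<in> N"
      using Poly_Mapping.keys_add[of u v] by (auto simp: N_def vs_eval_add[OF V])
  next
    fix c u assume "u \<in> N"
    then show "pscale c u \<in> N"
      using keys_pscale[of c u] by (auto simp: N_def vs_eval_scale[OF V])
  qed
  have "Vector_Spaces.linear pscale pscale (id :: ('a \<Rightarrow>\<^sub>0 complex) \<Rightarrow> _)"
    by (rule pm.linear_id)
  \<comment> \<open>A left inverse of the identity on \<open>N\<close>, defined everywhere with
    values in \<open>N\<close>, is a projection onto \<open>N\<close>.\<close>
  from pmp.linear_exists_left_inverse_on[OF this N]
  obtain P where P: "range P \<subseteq> N" "Vector_Spaces.linear pscale pscale P" "\<And>v. v \<in> N \<Longrightarrow> P v = v"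
    by auto
  interpret P: Vector_Spaces.linear pscale pscale P by fact
  \<comment> \<open>The part of a basis vector in the complement of \<open>N\<close>. Combinations
    of equal value differ by an element of \<open>N\<close>, so by \<open>key\<close> they have the
    same part there; this makes \<open>\<iota>\<close> linear.\<close>
  define \<iota> where "\<iota> x = Poly_Mapping.single x 1 - P (Poly_Mapping.single x 1)" for x :: 'a
  have key: "u - P u = v - P v" if "u - v \<in> N" for u v
    using P(3)[OF that] by (simp add: P.diff algebra_simps)
  have NI: "u - v \<in> N" if "Poly_Mapping.keys u \<subseteq> carrier V" "Poly_Mapping.keys v \<subseteq> carrier V"
    "vs_eval V u = vs_eval V v" for u v
  proof -
    have m: "u - v = u + pscale (-1) v" by (rule poly_mapping_eqI) (simp add: lookup_add lookup_minus)
    have c: "vs_eval V v \<in> carrier V"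
      unfolding vs_eval_def by (rule V.M.finsum_closed) (use that in \<open>auto intro!: V.smult_closed\<close>)
    have "(-1) \<odot>\<^bsub>V\<^esub> vs_eval V v = \<ominus>\<^bsub>V\<^esub> vs_eval V v"
      using V.smult_minus_1[OF c] by (simp add: class_ring_simps)
    moreover have "vs_eval V (u - v) = vs_eval V u \<oplus>\<^bsub>V\<^esub> (-1) \<odot>\<^bsub>V\<^esub> vs_eval V v"
      unfolding m vs_eval_scale[OF V that(2), symmetric]
      by (rule vs_eval_add[OF V that(1)]) (use that(2) keys_pscale[of "-1" v] in blast)
    ultimately show ?thesis
      using that Poly_Mapping.keys_diff[of u v] c by (auto simp: N_def V.M.r_neg)
  qed
  show thesis
  proof (rule that[of \<iota>])
    fix x y assume xy: "x \<in> carrier V" "y \<in> carrier V"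
    have "Poly_Mapping.single (x \<oplus>\<^bsub>V\<^esub> y) 1 - (Poly_Mapping.single x 1 + Poly_Mapping.single y 1) \<in> N"
    proof (rule NI)
      show "Poly_Mapping.keys (Poly_Mapping.single x 1 + Poly_Mapping.single y (1::complex)) \<subseteq> carrier V"
        using Poly_Mapping.keys_add[of "Poly_Mapping.single x 1" "Poly_Mapping.single y (1::complex)"] xy by auto
    qed (use xy in \<open>auto simp: vs_eval_add[OF V] vs_eval_single[OF V] V.smult_one[simplified]\<close>)
    from key[OF this] show "\<iota> (x \<oplus>\<^bsub>V\<^esub> y) = \<iota> x + \<iota> y"
      by (simp add: \<iota>_def P.add)
  next
    fix c x assume x: "x \<in> carrier V"
    have "Poly_Mapping.single (c \<odot>\<^bsub>V\<^esub> x) 1 - pscale c (Poly_Mapping.single x 1) \<in> N"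
      by (rule NI) (use x V.smult_closed V.smult_one[simplified] in \<open>auto simp: vs_eval_scale[OF V] vs_eval_single[OF V] pscale_single\<close>)
    from key[OF this] show "\<iota> (c \<odot>\<^bsub>V\<^esub> x) = pscale c (\<iota> x)"
      by (simp add: \<iota>_def P.scale pm.scale_right_diff_distrib)
  next
    show "inj_on \<iota> (carrier V)"
    proof (rule inj_onI)
      fix x y assume xy: "x \<in> carrier V" "y \<in> carrier V" and eq: "\<iota> x = \<iota> y"
      let ?u = "Poly_Mapping.single x (1::complex) - Poly_Mapping.single y 1"
      have "?u = P ?u" using eq by (simp add: \<iota>_def P.diff algebra_simps)
      then have "?u \<in> N" using P(1) by (metis rangeI subsetD)
      have "Poly_Mapping.single x (1::complex) = ?u + Poly_Mapping.single y 1" by simp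
      then have "vs_eval V (Poly_Mapping.single x (1::complex)) = vs_eval V ?u \<oplus>\<^bsub>V\<^esub> vs_eval V (Poly_Mapping.single y 1)"
        using vs_eval_add[OF V, of ?u "Poly_Mapping.single y 1"] \<open>?u \<in> N\<close> xy by (simp add: N_def)
      then show "x = y" using xy \<open>?u \<in> N\<close> V.smult_one by (simp add: N_def vs_eval_single[OF V])
    qed
  qed
qed

text \<open>
  An additive embedding into finitely supported functions turns identities in a carrier into
  identities in a type, where the simplifier normalises sums.
\<close>

definition vs_emb :: "(complex, 'a, 'm) module_scheme \<Rightarrow> 'a \<Rightarrow> 'a \<Rightarrow>\<^sub>0 complex" where
  "vs_emb V = (SOME \<iota>. inj_on \<iota> (carrier V) \<and>
     (\<forall>x\<in>carrier V. \<forall>y\<in>carrier V. \<iota> (x \<oplus>\<^bsub>V\<^esub> y) = \<iota> x + \<iota> y) \<and>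
     (\<forall>c. \<forall>x\<in>carrier V. \<iota> (c \<odot>\<^bsub>V\<^esub> x) = pscale c (\<iota> x)))"

lemma vs_emb:
  fixes V :: "(complex, 'a, 'm) module_scheme"
  assumes "vs V"
  shows vs_emb_inj: "inj_on (vs_emb V) (carrier V)"
    and vs_emb_add: "\<And>x y. x \<in> carrier V \<Longrightarrow> y \<in> carrier V \<Longrightarrow> vs_emb V (x \<oplus>\<^bsub>V\<^esub> y) = vs_emb V x + vs_emb V y"
    and vs_emb_smult: "\<And>c x. x \<in> carrier V \<Longrightarrow> vs_emb V (c \<odot>\<^bsub>V\<^esub> x) = pscale c (vs_emb V x)"
proof -
  let ?P = "\<lambda>\<iota> :: 'a \<Rightarrow> 'a \<Rightarrow>\<^sub>0 complex. inj_on \<iota> (carrier V) \<and>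
     (\<forall>x\<in>carrier V. \<forall>y\<in>carrier V. \<iota> (x \<oplus>\<^bsub>V\<^esub> y) = \<iota> x + \<iota> y) \<and>
     (\<forall>c. \<forall>x\<in>carrier V. \<iota> (c \<odot>\<^bsub>V\<^esub> x) = pscale c (\<iota> x))"
  have "\<exists>\<iota>. ?P \<iota>"
  proof (rule vs_embedding[OF assms])
    fix \<iota> :: "'a \<Rightarrow> 'a \<Rightarrow>\<^sub>0 complex"
    assume "inj_on \<iota> (carrier V)"
      and "\<And>x y. x \<in> carrier V \<Longrightarrow> y \<in> carrier V \<Longrightarrow> \<iota> (x \<oplus>\<^bsub>V\<^esub> y) = \<iota> x + \<iota> y"
      and "\<And>c x. x \<in> carrier V \<Longrightarrow> \<iota> (c \<odot>\<^bsub>V\<^esub> x) = pscale c (\<iota> x)"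
    then have "?P \<iota>" by simp
    then show ?thesis by (rule exI[of _ \<iota>])
  qed
  then have "?P (vs_emb V)" unfolding vs_emb_def by (rule someI_ex)
  then show "inj_on (vs_emb V) (carrier V)"
    and "\<And>x y. x \<in> carrier V \<Longrightarrow> y \<in> carrier V \<Longrightarrow> vs_emb V (x \<oplus>\<^bsub>V\<^esub> y) = vs_emb V x + vs_emb V y"
    and "\<And>c x. x \<in> carrier V \<Longrightarrow> vs_emb V (c \<odot>\<^bsub>V\<^esub> x) = pscale c (vs_emb V x)"
    by simp_all
qed

lemma vs_smult_minus1:
  assumes "vs V" "x \<in> carrier V"
  shows "(-1) \<odot>\<^bsub>V\<^esub> x = \<ominus>\<^bsub>V\<^esub> x"
proof -
  interpret V: vectorspace CC V by fact
  show ?thesis using V.smult_minus_1[OF assms(2)] by (simp add: class_ring_simps)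
qed

lemma vs_closed [simp]:
  assumes "vs V"
  shows "\<zero>\<^bsub>V\<^esub> \<in> carrier V"
    and "x \<in> carrier V \<Longrightarrow> y \<in> carrier V \<Longrightarrow> x \<oplus>\<^bsub>V\<^esub> y \<in> carrier V"
    and "x \<in> carrier V \<Longrightarrow> y \<in> carrier V \<Longrightarrow> x \<ominus>\<^bsub>V\<^esub> y \<in> carrier V"
    and "x \<in> carrier V \<Longrightarrow> \<ominus>\<^bsub>V\<^esub> x \<in> carrier V"
    and "x \<in> carrier V \<Longrightarrow> c \<odot>\<^bsub>V\<^esub> x \<in> carrier V"
proof -
  interpret V: vectorspace CC V by fact
  show "\<zero>\<^bsub>V\<^esub> \<in> carrier V"
    and "x \<in> carrier V \<Longrightarrow> y \<in> carrier V \<Longrightarrow> x \<oplus>\<^bsub>V\<^esub> y \<in> carrier V"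
    and "x \<in> carrier V \<Longrightarrow> y \<in> carrier V \<Longrightarrow> x \<ominus>\<^bsub>V\<^esub> y \<in> carrier V"
    and "x \<in> carrier V \<Longrightarrow> \<ominus>\<^bsub>V\<^esub> x \<in> carrier V"
    and "x \<in> carrier V \<Longrightarrow> c \<odot>\<^bsub>V\<^esub> x \<in> carrier V"
    by auto
qed

lemma vs_emb_more:
  assumes "vs V"
  shows vs_emb_zero: "vs_emb V \<zero>\<^bsub>V\<^esub> = 0"
    and vs_emb_uminus: "x \<in> carrier V \<Longrightarrow> vs_emb V (\<ominus>\<^bsub>V\<^esub> x) = - vs_emb V x"
    and vs_emb_minus: "x \<in> carrier V \<Longrightarrow> y \<in> carrier V \<Longrightarrow> vs_emb V (x \<ominus>\<^bsub>V\<^esub> y) = vs_emb V x - vs_emb V y"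
    and vs_emb_eq: "x \<in> carrier V \<Longrightarrow> y \<in> carrier V \<Longrightarrow> x = y \<longleftrightarrow> vs_emb V x = vs_emb V y"
proof -
  interpret V: vectorspace CC V by fact
  have "vs_emb V \<zero>\<^bsub>V\<^esub> = vs_emb V \<zero>\<^bsub>V\<^esub> + vs_emb V \<zero>\<^bsub>V\<^esub>"
    using vs_emb_add[OF assms, of "\<zero>\<^bsub>V\<^esub>" "\<zero>\<^bsub>V\<^esub>"] by simp
  then show z: "vs_emb V \<zero>\<^bsub>V\<^esub> = 0" by simp
  show u: "vs_emb V (\<ominus>\<^bsub>V\<^esub> x) = - vs_emb V x" if "x \<in> carrier V" for x
  proof -
    have "vs_emb V x + vs_emb V (\<ominus>\<^bsub>V\<^esub> x) = 0"
      using vs_emb_add[OF assms that V.M.a_inv_closed[OF that]] V.M.r_neg[OF that] z by simp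
    then show ?thesis by (rule minus_unique[symmetric])
  qed
  show "x \<in> carrier V \<Longrightarrow> y \<in> carrier V \<Longrightarrow> vs_emb V (x \<ominus>\<^bsub>V\<^esub> y) = vs_emb V x - vs_emb V y"
    by (simp add: a_minus_def vs_emb_add[OF assms] u)
  show "x \<in> carrier V \<Longrightarrow> y \<in> carrier V \<Longrightarrow> x = y \<longleftrightarrow> vs_emb V x = vs_emb V y"
    by (rule inj_on_eq_iff[OF vs_emb_inj[OF assms], symmetric])
qed

lemmas emb_simps = vs_emb_zero vs_emb_uminus vs_emb_minus vs_emb_add vs_emb_smult

lemma vs_eqI: "vs V \<Longrightarrow> x \<in> carrier V \<Longrightarrow> y \<in> carrier V \<Longrightarrow> vs_emb V x = vs_emb V y \<Longrightarrow> x = y"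
  using vs_emb_eq[of V x y] by simp

section \<open>Linear maps and subspaces\<close>

lemma linI:
  assumes "vs V" "vs W" "\<And>x. x \<in> carrier V \<Longrightarrow> f x \<in> carrier W"
    and "\<And>x y. x \<in> carrier V \<Longrightarrow> y \<in> carrier V \<Longrightarrow> f (x \<oplus>\<^bsub>V\<^esub> y) = f x \<oplus>\<^bsub>W\<^esub> f y"
    and "\<And>c x. x \<in> carrier V \<Longrightarrow> f (c \<odot>\<^bsub>V\<^esub> x) = c \<odot>\<^bsub>W\<^esub> f x"
  shows "lin V W f"
  using assms by (simp add: lin_iff)

lemma lin_closed: "lin V W f \<Longrightarrow> x \<in> carrier V \<Longrightarrow> f x \<in> carrier W"
  by (simp add: lin_iff)

lemma lin_dom: "lin V W f \<Longrightarrow> vs V" and lin_cod: "lin V W f \<Longrightarrow> vs W"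
  by (simp_all add: lin_iff)

lemma lin_add: "lin V W f \<Longrightarrow> x \<in> carrier V \<Longrightarrow> y \<in> carrier V \<Longrightarrow> f (x \<oplus>\<^bsub>V\<^esub> y) = f x \<oplus>\<^bsub>W\<^esub> f y"
  by (simp add: lin_iff)

lemma lin_smult: "lin V W f \<Longrightarrow> x \<in> carrier V \<Longrightarrow> f (c \<odot>\<^bsub>V\<^esub> x) = c \<odot>\<^bsub>W\<^esub> f x"
  by (simp add: lin_iff)

lemma lin_uminus: "lin V W f \<Longrightarrow> x \<in> carrier V \<Longrightarrow> f (\<ominus>\<^bsub>V\<^esub> x) = \<ominus>\<^bsub>W\<^esub> f x"
  using lin_smult[of V W f x "-1"] by (simp add: lin_dom lin_cod lin_closed vs_smult_minus1)

lemma lin_minus: "lin V W f \<Longrightarrow> x \<in> carrier V \<Longrightarrow> y \<in> carrier V \<Longrightarrow> f (x \<ominus>\<^bsub>V\<^esub> y) = f x \<ominus>\<^bsub>W\<^esub> f y"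
  by (simp add: a_minus_def lin_add lin_uminus lin_dom)

lemma vs_r_neg: "vs V \<Longrightarrow> x \<in> carrier V \<Longrightarrow> x \<ominus>\<^bsub>V\<^esub> x = \<zero>\<^bsub>V\<^esub>"
  by (rule vs_eqI[of V]) (simp_all add: emb_simps)

lemma lin_zero:
  assumes f: "lin V W f"
  shows "f \<zero>\<^bsub>V\<^esub> = \<zero>\<^bsub>W\<^esub>"
proof -
  have V: "vs V" and W: "vs W" using f by (rule lin_dom, rule lin_cod)
  have c: "\<zero>\<^bsub>V\<^esub> \<in> carrier V" using V by (rule vs_closed(1))
  have "f (\<zero>\<^bsub>V\<^esub> \<ominus>\<^bsub>V\<^esub> \<zero>\<^bsub>V\<^esub>) = f \<zero>\<^bsub>V\<^esub> \<ominus>\<^bsub>W\<^esub> f \<zero>\<^bsub>V\<^esub>"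
    using f c c by (rule lin_minus)
  then show ?thesis by (simp add: vs_r_neg[OF V c] vs_r_neg[OF W lin_closed[OF f c]])
qed

lemmas lin_simps = lin_closed lin_add lin_smult lin_uminus lin_minus lin_zero

lemma lin_comp: "lin V W f \<Longrightarrow> lin W X g \<Longrightarrow> lin V X (\<lambda>x. g (f x))"
  by (simp add: lin_iff)

lemma lin_id: "vs V \<Longrightarrow> lin V V (\<lambda>x. x)"
  by (simp add: lin_iff)

lemma lin_0:
  assumes V: "vs V" and W: "vs W"
  shows "lin V W (\<lambda>x. \<zero>\<^bsub>W\<^esub>)"
  by (rule linI[OF V W]; (rule vs_eqI[OF W])?) (simp_all add: W emb_simps[OF W])

lemma lin_sum:
  assumes f: "lin V W f" and g: "lin V W g"
  shows "lin V W (\<lambda>x. f x \<oplus>\<^bsub>W\<^esub> g x)"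
  by (intro linI lin_dom[OF f] lin_cod[OF f]; (rule vs_eqI[OF lin_cod[OF f]])?)
    (simp_all add: lin_dom[OF f] lin_cod[OF f] lin_simps[OF f] lin_simps[OF g] emb_simps[OF lin_cod[OF f]] pm.scale_right_distrib)

lemma lin_diff:
  assumes f: "lin V W f" and g: "lin V W g"
  shows "lin V W (\<lambda>x. f x \<ominus>\<^bsub>W\<^esub> g x)"
  by (intro linI lin_dom[OF f] lin_cod[OF f]; (rule vs_eqI[OF lin_cod[OF f]])?)
    (simp_all add: lin_dom[OF f] lin_cod[OF f] lin_simps[OF f] lin_simps[OF g] emb_simps[OF lin_cod[OF f]] pm.scale_right_diff_distrib)

lemma lin_neg:
  assumes f: "lin V W f"
  shows "lin V W (\<lambda>x. \<ominus>\<^bsub>W\<^esub> f x)"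
  by (intro linI lin_dom[OF f] lin_cod[OF f]; (rule vs_eqI[OF lin_cod[OF f]])?)
    (simp_all add: lin_dom[OF f] lin_cod[OF f] lin_simps[OF f] emb_simps[OF lin_cod[OF f]])

lemma lin_cong: "lin V W f \<Longrightarrow> (\<And>x. x \<in> carrier V \<Longrightarrow> f x = g x) \<Longrightarrow> lin V W g"
  by (auto simp: lin_iff)

lemma subspI:
  assumes "vs V" "U \<subseteq> carrier V" "\<zero>\<^bsub>V\<^esub> \<in> U"
    and "\<And>x y. x \<in> U \<Longrightarrow> y \<in> U \<Longrightarrow> x \<oplus>\<^bsub>V\<^esub> y \<in> U" and "\<And>c x. x \<in> U \<Longrightarrow> c \<odot>\<^bsub>V\<^esub> x \<in> U"
  shows "subsp V U"
  using assms by (simp add: subsp_iff)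

lemma subspD:
  assumes "subsp V U"
  shows "vs V" "\<zero>\<^bsub>V\<^esub> \<in> U" "x \<in> U \<Longrightarrow> x \<in> carrier V"
    and "x \<in> U \<Longrightarrow> y \<in> U \<Longrightarrow> x \<oplus>\<^bsub>V\<^esub> y \<in> U" and "x \<in> U \<Longrightarrow> c \<odot>\<^bsub>V\<^esub> x \<in> U"
  using assms by (auto simp: subsp_iff)

lemma vs_zero_simps:
  assumes "vs V"
  shows "\<zero>\<^bsub>V\<^esub> \<oplus>\<^bsub>V\<^esub> \<zero>\<^bsub>V\<^esub> = \<zero>\<^bsub>V\<^esub>" "c \<odot>\<^bsub>V\<^esub> \<zero>\<^bsub>V\<^esub> = \<zero>\<^bsub>V\<^esub>"
    "x \<in> carrier V \<Longrightarrow> x \<oplus>\<^bsub>V\<^esub> \<zero>\<^bsub>V\<^esub> = x" "x \<in> carrier V \<Longrightarrow> \<zero>\<^bsub>V\<^esub> \<oplus>\<^bsub>V\<^esub> x = x"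
    "\<ominus>\<^bsub>V\<^esub> \<zero>\<^bsub>V\<^esub> = \<zero>\<^bsub>V\<^esub>" "x \<in> carrier V \<Longrightarrow> x \<ominus>\<^bsub>V\<^esub> \<zero>\<^bsub>V\<^esub> = x"
  by (rule vs_eqI[OF assms]; simp add: assms emb_simps[OF assms])+

lemma subsp_image:
  assumes f: "lin V W f" and U: "subsp V U"
  shows "subsp W (f ` U)"
proof (rule subspI)
  show "\<zero>\<^bsub>W\<^esub> \<in> f ` U" using lin_zero[OF f] subspD(2)[OF U] by force
  show "x \<oplus>\<^bsub>W\<^esub> y \<in> f ` U" if "x \<in> f ` U" "y \<in> f ` U" for x y
    using that by (auto simp: lin_add[OF f, symmetric] subspD(3)[OF U] intro!: imageI subspD(4)[OF U])
  show "c \<odot>\<^bsub>W\<^esub> x \<in> f ` U" if "x \<in> f ` U" for c x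
    using that by (auto simp: lin_smult[OF f, symmetric] subspD(3)[OF U] intro!: imageI subspD(5)[OF U])
qed (use subspD(3)[OF U] lin_closed[OF f] lin_cod[OF f] in auto)

lemma subsp_carrier: "vs V \<Longrightarrow> subsp V (carrier V)"
  by (simp add: subsp_iff)

lemma subsp_ker:
  assumes f: "lin V W f"
  shows "subsp V {x \<in> carrier V. f x = \<zero>\<^bsub>W\<^esub>}"
  by (rule subspI) (auto simp: lin_dom[OF f] lin_simps[OF f] vs_zero_simps[OF lin_cod[OF f]])

lemma subsp_Int: "subsp V U \<Longrightarrow> subsp V U' \<Longrightarrow> subsp V (U \<inter> U')"
  by (auto simp: subsp_iff)

lemma subsp_uminus: "subsp V U \<Longrightarrow> x \<in> U \<Longrightarrow> \<ominus>\<^bsub>V\<^esub> x \<in> U"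
  using vs_smult_minus1[of V x] subspD(1)[of U V] subspD(3)[of U V x] subspD(5)[of U V x "-1"] by simp

lemma subsp_minus: "subsp V U \<Longrightarrow> x \<in> U \<Longrightarrow> y \<in> U \<Longrightarrow> x \<ominus>\<^bsub>V\<^esub> y \<in> U"
  unfolding a_minus_def by (intro subspD(4) subsp_uminus)

lemma set_add_eq: "H <+>\<^bsub>V\<^esub> K = {h \<oplus>\<^bsub>V\<^esub> k | h k. h \<in> H \<and> k \<in> K}"
  by (auto simp: set_add_def')

lemma subsp_set_add:
  assumes U: "subsp V U" and W: "subsp V W"
  shows "subsp V (U <+>\<^bsub>V\<^esub> W)"
proof (rule subspI)
  show V: "vs V" using U by (rule subspD)
  show "U <+>\<^bsub>V\<^esub> W \<subseteq> carrier V"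
    using subspD(3)[OF U] subspD(3)[OF W] V by (auto simp: set_add_eq)
  show "\<zero>\<^bsub>V\<^esub> \<in> U <+>\<^bsub>V\<^esub> W"
    using subspD(2)[OF U] subspD(2)[OF W] vs_zero_simps(1)[OF V] unfolding set_add_eq by force
  show "x \<oplus>\<^bsub>V\<^esub> y \<in> U <+>\<^bsub>V\<^esub> W" if xy: "x \<in> U <+>\<^bsub>V\<^esub> W" "y \<in> U <+>\<^bsub>V\<^esub> W" for x y
  proof -
    from xy obtain u w u' w' where *: "x = u \<oplus>\<^bsub>V\<^esub> w" "y = u' \<oplus>\<^bsub>V\<^esub> w'" "u \<in> U" "w \<in> W" "u' \<in> U" "w' \<in> W"
      by (auto simp: set_add_eq)
    have "x \<oplus>\<^bsub>V\<^esub> y = (u \<oplus>\<^bsub>V\<^esub> u') \<oplus>\<^bsub>V\<^esub> (w \<oplus>\<^bsub>V\<^esub> w')"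
      by (rule vs_eqI[OF V]) (use * subspD(3)[OF U] subspD(3)[OF W] in \<open>simp_all add: V emb_simps[OF V]\<close>)
    then show ?thesis using * subspD(4)[OF U] subspD(4)[OF W] unfolding set_add_eq by blast
  qed
  show "c \<odot>\<^bsub>V\<^esub> x \<in> U <+>\<^bsub>V\<^esub> W" if x: "x \<in> U <+>\<^bsub>V\<^esub> W" for c x
  proof -
    from x obtain u w where *: "x = u \<oplus>\<^bsub>V\<^esub> w" "u \<in> U" "w \<in> W" by (auto simp: set_add_eq)
    have "c \<odot>\<^bsub>V\<^esub> x = c \<odot>\<^bsub>V\<^esub> u \<oplus>\<^bsub>V\<^esub> c \<odot>\<^bsub>V\<^esub> w"
      by (rule vs_eqI[OF V])
        (use * subspD(3)[OF U] subspD(3)[OF W] in \<open>simp_all add: V emb_simps[OF V] pm.scale_right_distrib\<close>)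
    then show ?thesis using * subspD(5)[OF U] subspD(5)[OF W] unfolding set_add_eq by blast
  qed
qed

text \<open>Inverting \<open>f\<close> from its image to a complement of its kernel, and extending
  linearly, gives \<open>g\<close>. The complements exist on the type level, so \<open>f\<close> is
  transported there and the result is brought back.\<close>

lemma lin_generalized_inverse:
  fixes V :: "(complex, 'a, 'm) module_scheme" and W :: "(complex, 'b, 'n) module_scheme"
  assumes f: "lin V W f"
  obtains g where "lin W V g" "\<And>x. x \<in> carrier V \<Longrightarrow> f (g (f x)) = f x"
proof -
  have V: "vs V" and W: "vs W" using f by (rule lin_dom, rule lin_cod)
  let ?U = "vs_emb V ` carrier V"
  define \<kappa> where "\<kappa> = inv_into (carrier V) (vs_emb V)"
  have \<kappa>: "\<kappa> (vs_emb V x) = x" if "x \<in> carrier V" for x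
    unfolding \<kappa>_def using vs_emb_inj[OF V] that by (rule inv_into_f_f)
  have \<kappa>U: "\<kappa> u \<in> carrier V" "vs_emb V (\<kappa> u) = u" if "u \<in> ?U" for u using that \<kappa> by auto
  have Uadd: "u + v \<in> ?U" "\<kappa> (u + v) = \<kappa> u \<oplus>\<^bsub>V\<^esub> \<kappa> v" if "u \<in> ?U" "v \<in> ?U" for u v
  proof -
    have "vs_emb V (\<kappa> u \<oplus>\<^bsub>V\<^esub> \<kappa> v) = u + v" using that \<kappa>U by (simp add: vs_emb_add[OF V])
    then show "u + v \<in> ?U" "\<kappa> (u + v) = \<kappa> u \<oplus>\<^bsub>V\<^esub> \<kappa> v"
      using \<kappa>[of "\<kappa> u \<oplus>\<^bsub>V\<^esub> \<kappa> v"] that \<kappa>U V by (metis imageI vs_closed(2))+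
  qed
  have Uscale: "pscale c u \<in> ?U" "\<kappa> (pscale c u) = c \<odot>\<^bsub>V\<^esub> \<kappa> u" if "u \<in> ?U" for u c
  proof -
    have "vs_emb V (c \<odot>\<^bsub>V\<^esub> \<kappa> u) = pscale c u" using that \<kappa>U by (simp add: vs_emb_smult[OF V])
    then show "pscale c u \<in> ?U" "\<kappa> (pscale c u) = c \<odot>\<^bsub>V\<^esub> \<kappa> u"
      using \<kappa>[of "c \<odot>\<^bsub>V\<^esub> \<kappa> u"] that \<kappa>U V by (metis imageI vs_closed(5))+
  qed
  have U0: "0 \<in> ?U" using vs_emb_zero[OF V] vs_closed(1)[OF V] by (metis imageI)
  have U: "pm.subspace ?U"
    by (rule pm.subspaceI) (rule U0 Uadd(1) Uscale(1); assumption)+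
  have "Vector_Spaces.linear pscale pscale (id :: ('a \<Rightarrow>\<^sub>0 complex) \<Rightarrow> _)"
    by (rule pm.linear_id)
  from pmp.linear_exists_left_inverse_on[OF this U inj_on_id]
  obtain P where "range P \<subseteq> ?U \<and> Vector_Spaces.linear pscale pscale P \<and> (\<forall>v\<in>?U. P (id v) = v)"
    by (rule exE)
  then have P: "range P \<subseteq> ?U" "Vector_Spaces.linear pscale pscale P" "\<And>v. v \<in> ?U \<Longrightarrow> P v = v"
    by auto
  interpret P: Vector_Spaces.linear pscale pscale P by fact
  have PU: "P u \<in> ?U" for u using P(1) by auto
  \<comment> \<open>\<open>f\<close> on the embedded copies, extended by the projection
    \<open>P\<close> to the whole type, because the theorem on right inverses speaks of maps defined
    everywhere.\<close>
  define f' where "f' u = vs_emb W (f (\<kappa> (P u)))" for u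
  have f': "Vector_Spaces.linear pscale pscale f'"
  proof
    show "f' (u + v) = f' u + f' v" for u v
      using PU[of u] PU[of v] \<kappa>U
      by (simp add: f'_def P.add Uadd lin_simps[OF f] vs_emb_add[OF W])
    show "f' (pscale c u) = pscale c (f' u)" for c u
      using PU[of u] \<kappa>U
      by (simp add: f'_def P.scale Uscale lin_simps[OF f] vs_emb_smult[OF W])
  qed
  have f'e: "f' (vs_emb V x) = vs_emb W (f x)" if "x \<in> carrier V" for x
    using that P(3)[of "vs_emb V x"] by (simp add: f'_def \<kappa>)
  from pmp.linear_exists_right_inverse_on[OF f' U]
  obtain g' where "range g' \<subseteq> ?U \<and> Vector_Spaces.linear pscale pscale g' \<and> (\<forall>v\<in>f' ` ?U. f' (g' v) = v)"
    by (rule exE)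
  then have g': "range g' \<subseteq> ?U" "Vector_Spaces.linear pscale pscale g'" "\<And>v. v \<in> f' ` ?U \<Longrightarrow> f' (g' v) = v"
    by auto
  interpret g': Vector_Spaces.linear pscale pscale g' by fact
  have g'U: "g' u \<in> ?U" for u using g'(1) by auto
  define g where "g w = \<kappa> (g' (vs_emb W w))" for w
  show thesis
  proof (rule that[of g])
    show "lin W V g"
      by (rule linI[OF W V])
        (simp_all add: g_def vs_emb_add[OF W] vs_emb_smult[OF W] g'.add g'.scale Uadd Uscale \<kappa>U g'U)
    fix x assume x: "x \<in> carrier V"
    have "vs_emb W (f (g (f x))) = f' (vs_emb V (g (f x)))"
      by (rule f'e[symmetric]) (simp add: g_def \<kappa>U g'U)
    also have "\<dots> = f' (g' (vs_emb W (f x)))" by (simp add: g_def \<kappa>U g'U)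
    also have "\<dots> = vs_emb W (f x)" using x f'e[OF x] by (intro g'(3)) (metis imageI)
    finally show "f (g (f x)) = f x"
      by (rule vs_eqI[OF W, rotated 2]) (simp_all add: x lin_simps[OF f] g_def \<kappa>U g'U)
  qed
qed

section \<open>Cosets, quotients and induced maps\<close>

lemma coset_iff: "z \<in> U +>\<^bsub>V\<^esub> x \<longleftrightarrow> (\<exists>u\<in>U. z = u \<oplus>\<^bsub>V\<^esub> x)"
  by (auto simp: a_r_coset_def')

lemma coset_self: "subsp V U \<Longrightarrow> x \<in> carrier V \<Longrightarrow> x \<in> U +>\<^bsub>V\<^esub> x"
  using vs_zero_simps(4)[of V x] by (auto simp: coset_iff subspD intro!: bexI[of _ "\<zero>\<^bsub>V\<^esub>"])

lemma coset_eq_iff: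
  assumes U: "subsp V U" and x: "x \<in> carrier V" and y: "y \<in> carrier V"
  shows "U +>\<^bsub>V\<^esub> x = U +>\<^bsub>V\<^esub> y \<longleftrightarrow> x \<ominus>\<^bsub>V\<^esub> y \<in> U"
proof
  note V = subspD(1)[OF U]
  assume "U +>\<^bsub>V\<^esub> x = U +>\<^bsub>V\<^esub> y"
  then obtain u where u: "u \<in> U" "x = u \<oplus>\<^bsub>V\<^esub> y" using coset_self[OF U x] by (auto simp: coset_iff)
  have "x \<ominus>\<^bsub>V\<^esub> y = u"
    by (rule vs_eqI[OF V]) (use u subspD(3)[OF U u(1)] y in \<open>simp_all add: V emb_simps[OF V]\<close>)
  then show "x \<ominus>\<^bsub>V\<^esub> y \<in> U" using u by simp
next
  note V = subspD(1)[OF U]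
  have main: "U +>\<^bsub>V\<^esub> a \<subseteq> U +>\<^bsub>V\<^esub> b"
    if "a \<ominus>\<^bsub>V\<^esub> b \<in> U" "a \<in> carrier V" "b \<in> carrier V" for a b
  proof
    fix z assume "z \<in> U +>\<^bsub>V\<^esub> a"
    then obtain u where u: "u \<in> U" "z = u \<oplus>\<^bsub>V\<^esub> a" by (auto simp: coset_iff)
    have "z = (u \<oplus>\<^bsub>V\<^esub> (a \<ominus>\<^bsub>V\<^esub> b)) \<oplus>\<^bsub>V\<^esub> b"
      by (rule vs_eqI[OF V]) (use u subspD(3)[OF U u(1)] that in \<open>simp_all add: V emb_simps[OF V]\<close>)
    moreover have "u \<oplus>\<^bsub>V\<^esub> (a \<ominus>\<^bsub>V\<^esub> b) \<in> U" using U u(1) that(1) by (rule subspD)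
    ultimately show "z \<in> U +>\<^bsub>V\<^esub> b" unfolding coset_iff by blast
  qed
  assume d: "x \<ominus>\<^bsub>V\<^esub> y \<in> U"
  have "y \<ominus>\<^bsub>V\<^esub> x = \<ominus>\<^bsub>V\<^esub> (x \<ominus>\<^bsub>V\<^esub> y)"
    by (rule vs_eqI[OF V]) (use x y in \<open>simp_all add: V emb_simps[OF V]\<close>)
  then have "y \<ominus>\<^bsub>V\<^esub> x \<in> U" using subsp_uminus[OF U d] by simp
  then show "U +>\<^bsub>V\<^esub> x = U +>\<^bsub>V\<^esub> y" using main[OF d x y] main[of y x] x y by blast
qed

lemma coset_zero:
  assumes U: "subsp V U" and x: "x \<in> carrier V"
  shows "U +>\<^bsub>V\<^esub> x = U \<longleftrightarrow> x \<in> U"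
proof -
  note V = subspD(1)[OF U]
  have "U +>\<^bsub>V\<^esub> \<zero>\<^bsub>V\<^esub> = U"
  proof (rule Set.set_eqI)
    show "z \<in> U +>\<^bsub>V\<^esub> \<zero>\<^bsub>V\<^esub> \<longleftrightarrow> z \<in> U" for z
      using vs_zero_simps(3)[OF V] subspD(3)[OF U] by (auto simp: coset_iff)
  qed
  then show ?thesis
    using coset_eq_iff[OF U x, of "\<zero>\<^bsub>V\<^esub>"] by (simp add: V vs_zero_simps[OF V] x)
qed

text \<open>The set is \<open>U' + f U + f x\<close>; since \<open>f U\<close> contains zero and
  lies in \<open>U'\<close>, it is absorbed and a single coset remains.\<close>

lemma quot_map_coset:
  assumes "subsp W U'" "f x \<in> carrier W" "\<zero>\<^bsub>V\<^esub> \<in> U" "f \<zero>\<^bsub>V\<^esub> = \<zero>\<^bsub>W\<^esub>"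
    and "\<And>u. u \<in> U \<Longrightarrow> f u \<in> U'" and "\<And>u. u \<in> U \<Longrightarrow> f (u \<oplus>\<^bsub>V\<^esub> x) = f u \<oplus>\<^bsub>W\<^esub> f x"
  shows "quot_map W U' f (U +>\<^bsub>V\<^esub> x) = U' +>\<^bsub>W\<^esub> f x"
proof (rule Set.set_eqI)
  note W = subspD(1)[OF assms(1)]
  have a: "u' \<oplus>\<^bsub>W\<^esub> (f u \<oplus>\<^bsub>W\<^esub> f x) = (u' \<oplus>\<^bsub>W\<^esub> f u) \<oplus>\<^bsub>W\<^esub> f x" if "u' \<in> U'" "u \<in> U" for u u'
    by (rule vs_eqI[OF W])
      (use subspD(3)[OF assms(1)] assms(2,5) that in \<open>simp_all add: W emb_simps[OF W]\<close>)
  fix z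
  have "z \<in> quot_map W U' f (U +>\<^bsub>V\<^esub> x) \<longleftrightarrow> (\<exists>u'\<in>U'. \<exists>u\<in>U. z = u' \<oplus>\<^bsub>W\<^esub> f (u \<oplus>\<^bsub>V\<^esub> x))"
    by (simp add: quot_map_def set_add_eq Bex_def coset_iff image_iff) blast
  also have "\<dots> \<longleftrightarrow> (\<exists>u'\<in>U'. \<exists>u\<in>U. z = (u' \<oplus>\<^bsub>W\<^esub> f u) \<oplus>\<^bsub>W\<^esub> f x)"
    using a assms(6) by simp
  also have "\<dots> \<longleftrightarrow> (\<exists>u'\<in>U'. z = u' \<oplus>\<^bsub>W\<^esub> f x)"
  proof
    assume "\<exists>u'\<in>U'. \<exists>u\<in>U. z = (u' \<oplus>\<^bsub>W\<^esub> f u) \<oplus>\<^bsub>W\<^esub> f x"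
    then show "\<exists>u'\<in>U'. z = u' \<oplus>\<^bsub>W\<^esub> f x" using subspD(4)[OF assms(1)] assms(5) by blast
  next
    assume "\<exists>u'\<in>U'. z = u' \<oplus>\<^bsub>W\<^esub> f x"
    then obtain u' where u': "u' \<in> U'" "z = u' \<oplus>\<^bsub>W\<^esub> f x" by blast
    have "u' \<oplus>\<^bsub>W\<^esub> f \<zero>\<^bsub>V\<^esub> = u'"
      unfolding assms(4) using vs_zero_simps(3)[OF W] subspD(3)[OF assms(1)] u' by blast
    then show "\<exists>u'\<in>U'. \<exists>u\<in>U. z = (u' \<oplus>\<^bsub>W\<^esub> f u) \<oplus>\<^bsub>W\<^esub> f x" using u' assms(3) by force
  qed
  finally show "z \<in> quot_map W U' f (U +>\<^bsub>V\<^esub> x) \<longleftrightarrow> z \<in> U' +>\<^bsub>W\<^esub> f x" by (simp add: coset_iff)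
qed

lemma set_add_cosets:
  assumes U: "subsp V U" and "x \<in> carrier V" "y \<in> carrier V"
  shows "(U +>\<^bsub>V\<^esub> x) <+>\<^bsub>V\<^esub> (U +>\<^bsub>V\<^esub> y) = U +>\<^bsub>V\<^esub> (x \<oplus>\<^bsub>V\<^esub> y)"
proof -
  note V = subspD(1)[OF U]
  have "abelian_subgroup U V"
  proof (rule abelian_subgroupI3)
    show "abelian_group V" using V by (rule vs_abelian)
    interpret abelian_group V by fact
    show "additive_subgroup U V"
      by (rule additive_subgroupI, rule add.subgroupI)
        (use subspD(2,3,4)[OF U] subsp_uminus[OF U] in auto)
  qed
  then show ?thesis using assms(2,3) by (rule abelian_subgroup.a_rcos_sum)
qed

lemma quot_module_simps [simp]:
  "carrier (quot_module V U) = (\<lambda>x. U +>\<^bsub>V\<^esub> x) ` carrier V"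
  "\<zero>\<^bsub>quot_module V U\<^esub> = U"
  by (auto simp: quot_module_def A_RCOSETS_def')

lemma quot_module_add:
  assumes "subsp V U" "x \<in> carrier V" "y \<in> carrier V"
  shows "(U +>\<^bsub>V\<^esub> x) \<oplus>\<^bsub>quot_module V U\<^esub> (U +>\<^bsub>V\<^esub> y) = U +>\<^bsub>V\<^esub> (x \<oplus>\<^bsub>V\<^esub> y)"
  using assms by (simp add: quot_module_def set_add_cosets)

lemma quot_module_smult:
  assumes U: "subsp V U" and x: "x \<in> carrier V"
  shows "c \<odot>\<^bsub>quot_module V U\<^esub> (U +>\<^bsub>V\<^esub> x) = U +>\<^bsub>V\<^esub> (c \<odot>\<^bsub>V\<^esub> x)"
proof -
  note V = subspD(1)[OF U]
  have "quot_map V U (\<lambda>x. c \<odot>\<^bsub>V\<^esub> x) (U +>\<^bsub>V\<^esub> x) = U +>\<^bsub>V\<^esub> (c \<odot>\<^bsub>V\<^esub> x)"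
  proof (rule quot_map_coset[OF U])
    show "c \<odot>\<^bsub>V\<^esub> (u \<oplus>\<^bsub>V\<^esub> x) = c \<odot>\<^bsub>V\<^esub> u \<oplus>\<^bsub>V\<^esub> c \<odot>\<^bsub>V\<^esub> x" if "u \<in> U" for u
      by (rule vs_eqI[OF V])
        (use subspD(3)[OF U that] x in \<open>simp_all add: V emb_simps[OF V] pm.scale_right_distrib\<close>)
  qed (use V x subspD(2,5)[OF U] vs_zero_simps(2)[OF V] in auto)
  then show ?thesis by (simp add: quot_module_def quot_map_def)
qed

lemma vs_quot_module:
  assumes U: "subsp V U"
  shows "vs (quot_module V U)"
proof (rule vsI)
  note V = subspD(1)[OF U]
  have z: "U = U +>\<^bsub>V\<^esub> \<zero>\<^bsub>V\<^esub>" using coset_zero[OF U, of "\<zero>\<^bsub>V\<^esub>"] subspD(2)[OF U] V by simp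
  interpret V: vectorspace CC V by (rule V)
  note rw = quot_module_add[OF U] quot_module_smult[OF U]
  show "abelian_group (quot_module V U)"
  proof (rule abelian_groupI)
    show "\<zero>\<^bsub>quot_module V U\<^esub> \<in> carrier (quot_module V U)" using z V by auto
    show "\<exists>Y\<in>carrier (quot_module V U). Y \<oplus>\<^bsub>quot_module V U\<^esub> X = \<zero>\<^bsub>quot_module V U\<^esub>"
      if X: "X \<in> carrier (quot_module V U)" for X
    proof -
      obtain x where x: "x \<in> carrier V" "X = U +>\<^bsub>V\<^esub> x" using X by auto
      then have "(U +>\<^bsub>V\<^esub> (\<ominus>\<^bsub>V\<^esub> x)) \<oplus>\<^bsub>quot_module V U\<^esub> X = \<zero>\<^bsub>quot_module V U\<^esub>"
        using z by (simp add: rw V V.M.l_neg)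
      then show ?thesis using x V by (intro bexI[of _ "U +>\<^bsub>V\<^esub> (\<ominus>\<^bsub>V\<^esub> x)"]) auto
    qed
    show "\<zero>\<^bsub>quot_module V U\<^esub> \<oplus>\<^bsub>quot_module V U\<^esub> X = X" if "X \<in> carrier (quot_module V U)" for X
      using that rw(1)[of "\<zero>\<^bsub>V\<^esub>"] z by (auto simp: V)
  qed (auto simp: rw V V.M.a_ac)
  show "(a + b) \<odot>\<^bsub>quot_module V U\<^esub> X = a \<odot>\<^bsub>quot_module V U\<^esub> X \<oplus>\<^bsub>quot_module V U\<^esub> b \<odot>\<^bsub>quot_module V U\<^esub> X"
    if "X \<in> carrier (quot_module V U)" for a b X
    using that V.smult_l_distr[simplified] by (auto simp: rw V)
  show "a \<odot>\<^bsub>quot_module V U\<^esub> (X \<oplus>\<^bsub>quot_module V U\<^esub> Y) =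
      a \<odot>\<^bsub>quot_module V U\<^esub> X \<oplus>\<^bsub>quot_module V U\<^esub> a \<odot>\<^bsub>quot_module V U\<^esub> Y"
    if "X \<in> carrier (quot_module V U)" "Y \<in> carrier (quot_module V U)" for a X Y
    using that V.smult_r_distr[simplified] by (auto simp: rw V)
  show "(a * b) \<odot>\<^bsub>quot_module V U\<^esub> X = a \<odot>\<^bsub>quot_module V U\<^esub> (b \<odot>\<^bsub>quot_module V U\<^esub> X)"
    if "X \<in> carrier (quot_module V U)" for a b X
    using that V.smult_assoc1[simplified] by (auto simp: rw V)
  show "1 \<odot>\<^bsub>quot_module V U\<^esub> X = X" if "X \<in> carrier (quot_module V U)" for X
    using that V.smult_one[simplified] by (auto simp: rw V)
  show "c \<odot>\<^bsub>quot_module V U\<^esub> X \<in> carrier (quot_module V U)" if "X \<in> carrier (quot_module V U)" for c X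
    using that by (auto simp: rw V)
qed

lemma lin_coset: "subsp V U \<Longrightarrow> lin V (quot_module V U) (\<lambda>x. U +>\<^bsub>V\<^esub> x)"
  by (rule linI) (auto simp: subspD vs_quot_module quot_module_add quot_module_smult)

text \<open>The common value of \<open>f\<close> on a coset where it is constant, hence the map
  induced on a quotient by an \<open>f\<close> that vanishes on the subspace.
  \<open>tilde_A_to_BC\<close> has the same form and is treated as an instance.\<close>

definition quot_lift :: "('a \<Rightarrow> 'b) \<Rightarrow> 'a set \<Rightarrow> 'b" where
  "quot_lift f X = the_elem (f ` X)"

lemma quot_lift_coset:
  assumes f: "lin V W f" and U: "subsp V U" and "\<And>u. u \<in> U \<Longrightarrow> f u = \<zero>\<^bsub>W\<^esub>" and x: "x \<in> carrier V"
  shows "quot_lift f (U +>\<^bsub>V\<^esub> x) = f x"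
proof -
  have "f z = f x" if "z \<in> U +>\<^bsub>V\<^esub> x" for z
  proof -
    obtain u where u: "u \<in> U" "z = u \<oplus>\<^bsub>V\<^esub> x" using \<open>z \<in> U +>\<^bsub>V\<^esub> x\<close> unfolding coset_iff by blast
    have "f z = f u \<oplus>\<^bsub>W\<^esub> f x" unfolding u(2) using f subspD(3)[OF U u(1)] x by (rule lin_add)
    then show ?thesis
      unfolding assms(3)[OF u(1)] using vs_zero_simps(4)[OF lin_cod[OF f] lin_closed[OF f x]] by simp
  qed
  then have "f ` (U +>\<^bsub>V\<^esub> x) = {f x}" using coset_self[OF U x] by blast
  then show ?thesis by (simp add: quot_lift_def)
qed

lemma lin_quot_lift:
  assumes f: "lin V W f" and U: "subsp V U" and "\<And>u. u \<in> U \<Longrightarrow> f u = \<zero>\<^bsub>W\<^esub>"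
  shows "lin (quot_module V U) W (quot_lift f)"
  by (rule linI[OF vs_quot_module[OF U] lin_cod[OF f]])
    (auto simp: quot_lift_coset[OF f U assms(3)] lin_simps[OF f] quot_module_add[OF U]
      quot_module_smult[OF U] lin_dom[OF f])

lemma lin_quot_map:
  assumes f: "lin V W f" and U: "subsp V U" and U': "subsp W U'" and "\<And>u. u \<in> U \<Longrightarrow> f u \<in> U'"
  shows "lin (quot_module V U) (quot_module W U') (quot_map W U' f)"
    and "x \<in> carrier V \<Longrightarrow> quot_map W U' f (U +>\<^bsub>V\<^esub> x) = U' +>\<^bsub>W\<^esub> f x"
proof -
  show *: "x \<in> carrier V \<Longrightarrow> quot_map W U' f (U +>\<^bsub>V\<^esub> x) = U' +>\<^bsub>W\<^esub> f x" for x
    by (rule quot_map_coset[where f = f, OF U' lin_closed[OF f] subspD(2)[OF U] lin_zero[OF f] assms(4)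
          lin_add[OF f subspD(3)[OF U]]])
  show "lin (quot_module V U) (quot_module W U') (quot_map W U' f)"
    by (rule linI[OF vs_quot_module[OF U] vs_quot_module[OF U']])
      (auto simp: * lin_simps[OF f] quot_module_add[OF U] quot_module_smult[OF U]
        quot_module_add[OF U'] quot_module_smult[OF U'] lin_dom[OF f])
qed

section \<open>Spans and free modules\<close>

abbreviation vspan :: "(complex, 'a, 'm) module_scheme \<Rightarrow> 'a set \<Rightarrow> 'a set" where
  "vspan V S \<equiv> LinearCombinations.module.span CC V S"

lemma subsp_span: "vs V \<Longrightarrow> S \<subseteq> carrier V \<Longrightarrow> subsp V (vspan V S)"
  by (simp add: VectorSpace.subspace_def vs_module Module.module.axioms LinearCombinations.module.span_is_submodule)

lemma span_base: "vs V \<Longrightarrow> S \<subseteq> carrier V \<Longrightarrow> x \<in> S \<Longrightarrow> x \<in> vspan V S"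
  using LinearCombinations.module.in_own_span[OF vs_module, of V S] by blast

lemma span_least: "subsp V U \<Longrightarrow> S \<subseteq> U \<Longrightarrow> vspan V S \<subseteq> U"
  using LinearCombinations.module.span_is_subset[OF vs_module, of V S U] subspD(1)[of U V]
  by (simp add: VectorSpace.subspace_def)

lemma subsp_preimage:
  assumes f: "lin V W f" and U: "subsp W U"
  shows "subsp V {x \<in> carrier V. f x \<in> U}"
  by (rule subspI[OF lin_dom[OF f]])
    (auto simp: lin_dom[OF f] lin_simps[OF f] subspD(2)[OF U] intro: subspD(4)[OF U] subspD(5)[OF U])

lemma lin_span:
  assumes f: "lin V W f" and S: "S \<subseteq> carrier V" and "\<And>x. x \<in> S \<Longrightarrow> f x \<in> U" and U: "subsp W U"
    and x: "x \<in> vspan V S"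
  shows "f x \<in> U"
proof -
  have "vspan V S \<subseteq> {x \<in> carrier V. f x \<in> U}"
    by (rule span_least[OF subsp_preimage[OF f U]]) (use assms(2,3) in blast)
  then show ?thesis using x by blast
qed

lemma free_module_simps [simp]:
  "carrier (free_module S) = {u. Poly_Mapping.keys u \<subseteq> S}"
  "add (free_module S) = (+)" "\<zero>\<^bsub>free_module S\<^esub> = 0" "smult (free_module S) = pscale"
  by (simp_all add: free_module_def pscale_def fun_eq_iff)

lemma vs_free_module: "vs (free_module S)"
proof (rule vsI)
  have a: "Poly_Mapping.keys (u + v) \<subseteq> S" if "Poly_Mapping.keys u \<subseteq> S" "Poly_Mapping.keys v \<subseteq> S"
    for u v :: "'a \<Rightarrow>\<^sub>0 complex"
    using that Poly_Mapping.keys_add[of u v] by blast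
  show "abelian_group (free_module S)"
  proof (rule abelian_groupI)
    show "\<exists>v\<in>carrier (free_module S). v \<oplus>\<^bsub>free_module S\<^esub> u = \<zero>\<^bsub>free_module S\<^esub>"
      if "u \<in> carrier (free_module S)" for u
    proof (rule bexI[of _ "pscale (-1) u"])
      show "pscale (-1) u \<oplus>\<^bsub>free_module S\<^esub> u = \<zero>\<^bsub>free_module S\<^esub>"
        by simp
    qed (use that keys_pscale[of "-1" u] in auto)
  qed (simp_all add: a add_ac)
  show "c \<odot>\<^bsub>free_module S\<^esub> u \<in> carrier (free_module S)" if "u \<in> carrier (free_module S)" for c u
    using that keys_pscale[of c u] by auto
qed (simp_all add: pm.scale_left_distrib pm.scale_right_distrib)

lemma free_module_induct:
  assumes U: "subsp (free_module S) U" and s: "\<And>k. k \<in> S \<Longrightarrow> free_basis k \<in> U"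
  shows "carrier (free_module S) \<subseteq> U"
proof
  fix u :: "'a \<Rightarrow>\<^sub>0 complex"
  assume "u \<in> carrier (free_module S)"
  then have "Poly_Mapping.keys u \<subseteq> S" by simp
  then show "u \<in> U"
  proof (induction u rule: update_induct)
    case const
    then show ?case using subspD(2)[OF U] by simp
  next
    case (update u k c)
    have eq: "Poly_Mapping.update k c u = u + pscale c (free_basis k)"
      using update.hyps
      by (intro poly_mapping_eqI) (auto simp: lookup_update lookup_add lookup_single in_keys_iff when_def)
    have k: "Poly_Mapping.keys (Poly_Mapping.update k c u) = insert k (Poly_Mapping.keys u)"
      using update.hyps by (simp add: keys_update)
    have "u \<in> U" "free_basis k \<in> U" using update k s by auto
    then show ?case
      unfolding eq using subspD(4)[OF U, of u "pscale c (free_basis k)"] subspD(5)[OF U, of "free_basis k" c] by simp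
  qed
qed

lemma free_map_superset:
  assumes "finite K" "Poly_Mapping.keys u \<subseteq> K"
  shows "free_map h u = (\<Sum>k\<in>K. Poly_Mapping.single (h k) (Poly_Mapping.lookup u k))"
  unfolding free_map_def by (rule sum.mono_neutral_left) (use assms in \<open>auto simp: in_keys_iff\<close>)

lemma free_map_add: "free_map h (u + v) = free_map h u + free_map h v"
proof -
  let ?K = "Poly_Mapping.keys u \<union> Poly_Mapping.keys v"
  have "free_map h (u + v) = (\<Sum>k\<in>?K. Poly_Mapping.single (h k) (Poly_Mapping.lookup (u + v) k))"
    by (rule free_map_superset) (use Poly_Mapping.keys_add[of u v] in auto)
  then show ?thesis
    by (simp add: free_map_superset[of ?K u] free_map_superset[of ?K v] lookup_add single_add sum.distrib)
qed

lemma free_map_pscale: "free_map h (pscale c u) = pscale c (free_map h u)"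
proof -
  have "free_map h (pscale c u) = (\<Sum>k\<in>Poly_Mapping.keys u. Poly_Mapping.single (h k) (Poly_Mapping.lookup (pscale c u) k))"
    by (rule free_map_superset) (simp_all add: keys_pscale)
  then show ?thesis
    by (simp add: free_map_def pm.scale_sum_right pscale_single)
qed

lemma free_map_single: "free_map h (Poly_Mapping.single k c) = Poly_Mapping.single (h k) c"
  by (cases "c = 0") (simp_all add: free_map_def)

lemma lin_free_map:
  assumes "\<And>k. k \<in> S \<Longrightarrow> h k \<in> S'"
  shows "lin (free_module S) (free_module S') (free_map h)"
proof (rule linI[OF vs_free_module vs_free_module])
  fix u assume "u \<in> carrier (free_module S)"
  then have "Poly_Mapping.keys u \<subseteq> S" by simp
  moreover have "Poly_Mapping.keys (free_map h u) \<subseteq> (\<Union>k\<in>Poly_Mapping.keys u. Poly_Mapping.keys (Poly_Mapping.single (h k) (Poly_Mapping.lookup u k)))"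
    unfolding free_map_def by (rule keys_sum)
  ultimately show "free_map h u \<in> carrier (free_module S')" using assms by (auto split: if_splits)
qed (simp_all add: free_map_add free_map_pscale)

section \<open>The tensor product of two vector spaces\<close>

context
  fixes V :: "(complex, 'a, 'm) module_scheme" and W :: "(complex, 'b, 'n) module_scheme"
  assumes V: "vs V" and W: "vs W"
begin

lemma bilinear_relations_carrier:
  "bilinear_relations V W \<subseteq> carrier (free_module (carrier V \<times> carrier W))"
proof -
  have s: "Poly_Mapping.single k c \<in> carrier (free_module (carrier V \<times> carrier W))"
    if "fst k \<in> carrier V" "snd k \<in> carrier W" for k and c :: complex
    using that by (auto split: if_splits simp: mem_Times_iff)
  have d: "u - v \<in> carrier (free_module (carrier V \<times> carrier W))"
    if "u \<in> carrier (free_module (carrier V \<times> carrier W))" "v \<in> carrier (free_module (carrier V \<times> carrier W))" for u v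
    using that Poly_Mapping.keys_diff[of u v] by auto
  show ?thesis
    unfolding bilinear_relations_def
    by (intro Un_least subsetI; elim CollectE exE conjE; hypsubst; intro d s; simp add: V W)
qed

lemma subsp_tensor_kernel: "subsp (free_module (carrier V \<times> carrier W)) (tensor_kernel V W)"
  unfolding tensor_kernel_def by (rule subsp_span[OF vs_free_module bilinear_relations_carrier])

lemma vs_tensor_module: "vs (tensor_module V W)"
  unfolding tensor_module_def by (rule vs_quot_module[OF subsp_tensor_kernel])

lemma pure_tensor_closed:
  "v \<in> carrier V \<Longrightarrow> w \<in> carrier W \<Longrightarrow> pure_tensor V W v w \<in> carrier (tensor_module V W)"
  unfolding pure_tensor_def tensor_module_def by auto

text \<open>Pure tensors are the classes of the basis vectors of the free module, so the preimage of
  \<open>U\<close> there contains a basis.\<close>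

lemma tensor_induct:
  assumes U: "subsp (tensor_module V W) U"
    and pure: "\<And>v w. v \<in> carrier V \<Longrightarrow> w \<in> carrier W \<Longrightarrow> pure_tensor V W v w \<in> U"
  shows "carrier (tensor_module V W) \<subseteq> U"
proof -
  let ?F = "free_module (carrier V \<times> carrier W)"
  have l: "lin ?F (tensor_module V W) (\<lambda>u. tensor_kernel V W +>\<^bsub>?F\<^esub> u)"
    unfolding tensor_module_def by (rule lin_coset[OF subsp_tensor_kernel])
  have "carrier ?F \<subseteq> {u \<in> carrier ?F. tensor_kernel V W +>\<^bsub>?F\<^esub> u \<in> U}"
    by (rule free_module_induct[OF subsp_preimage[OF l U]])
      (use pure in \<open>auto simp: pure_tensor_def\<close>)
  then show ?thesis unfolding tensor_module_def quot_module_simps by blast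
qed

text \<open>The subspace where two linear maps agree contains all pure tensors. Identities between
  operators on a tensor product are reduced by this rule to computations on pure tensors.\<close>

lemma tensor_lin_eq:
  assumes f: "lin (tensor_module V W) X f" and g: "lin (tensor_module V W) X g"
    and pure: "\<And>v w. v \<in> carrier V \<Longrightarrow> w \<in> carrier W \<Longrightarrow>
      f (pure_tensor V W v w) = g (pure_tensor V W v w)"
    and t: "t \<in> carrier (tensor_module V W)"
  shows "f t = g t"
proof -
  note X = lin_cod[OF f]
  note d = lin_diff[OF f g]
  have "carrier (tensor_module V W) \<subseteq> {t \<in> carrier (tensor_module V W). f t \<ominus>\<^bsub>X\<^esub> g t = \<zero>\<^bsub>X\<^esub>}"
    by (rule tensor_induct[OF subsp_ker[OF d]])
      (use pure pure_tensor_closed vs_r_neg[OF X] lin_closed[OF g] in auto)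
  then have "f t \<ominus>\<^bsub>X\<^esub> g t = \<zero>\<^bsub>X\<^esub>" using t by blast
  then have "vs_emb X (f t \<ominus>\<^bsub>X\<^esub> g t) = vs_emb X \<zero>\<^bsub>X\<^esub>" by simp
  then show ?thesis
    using lin_closed[OF f t] lin_closed[OF g t]
    by (intro vs_eqI[OF X]) (simp_all add: emb_simps[OF X])
qed

lemma coset_kernel_eq:
  assumes "u - v \<in> bilinear_relations V W" "u \<in> carrier (free_module (carrier V \<times> carrier W))"
    "v \<in> carrier (free_module (carrier V \<times> carrier W))"
  shows "tensor_kernel V W +>\<^bsub>free_module (carrier V \<times> carrier W)\<^esub> u =
    tensor_kernel V W +>\<^bsub>free_module (carrier V \<times> carrier W)\<^esub> v"
proof -
  let ?F = "free_module (carrier V \<times> carrier W)"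
  \<comment> \<open>Links the subtraction of the module record, in which cosets are compared, with
    that of the type, in which the relations are written.\<close>
  have "u \<ominus>\<^bsub>?F\<^esub> v = u \<oplus>\<^bsub>?F\<^esub> ((-1) \<odot>\<^bsub>?F\<^esub> v)"
    unfolding a_minus_def using vs_smult_minus1[OF vs_free_module assms(3)] by simp
  also have "\<dots> = u - v" by simp
  finally have "u \<ominus>\<^bsub>?F\<^esub> v \<in> tensor_kernel V W"
    using assms(1) span_base[OF vs_free_module bilinear_relations_carrier] by (simp add: tensor_kernel_def)
  then show ?thesis using coset_eq_iff[OF subsp_tensor_kernel assms(2,3)] by blast
qed

lemma single_closed:
  "v \<in> carrier V \<Longrightarrow> w \<in> carrier W \<Longrightarrow> Poly_Mapping.single (v, w) c \<in> carrier (free_module (carrier V \<times> carrier W))"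
  by (auto split: if_splits)

lemma plus_closed:
  "u \<in> carrier (free_module (carrier V \<times> carrier W)) \<Longrightarrow> u' \<in> carrier (free_module (carrier V \<times> carrier W)) \<Longrightarrow>
   u + u' \<in> carrier (free_module (carrier V \<times> carrier W))"
  using vs_closed(2)[OF vs_free_module, of u "carrier V \<times> carrier W" u'] by simp

lemma pure_tensor_add_left:
  assumes "v \<in> carrier V" "v' \<in> carrier V" "w \<in> carrier W"
  shows "pure_tensor V W (v \<oplus>\<^bsub>V\<^esub> v') w = pure_tensor V W v w \<oplus>\<^bsub>tensor_module V W\<^esub> pure_tensor V W v' w"
proof -
  let ?F = "free_module (carrier V \<times> carrier W)"
  have "pure_tensor V W (v \<oplus>\<^bsub>V\<^esub> v') w = tensor_kernel V W +>\<^bsub>?F\<^esub> (free_basis (v, w) + free_basis (v', w))"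
    unfolding pure_tensor_def
    by (rule coset_kernel_eq)
      (use assms V in \<open>auto intro!: plus_closed single_closed simp: bilinear_relations_def diff_diff_eq simp del: free_module_simps\<close>)
  also have "\<dots> = pure_tensor V W v w \<oplus>\<^bsub>tensor_module V W\<^esub> pure_tensor V W v' w"
    unfolding pure_tensor_def tensor_module_def
    using quot_module_add[OF subsp_tensor_kernel, of "free_basis (v, w)" "free_basis (v', w)"]
      single_closed[of v w 1] single_closed[of v' w 1] assms by simp
  finally show ?thesis .
qed

lemma pure_tensor_add_right:
  assumes "v \<in> carrier V" "w \<in> carrier W" "w' \<in> carrier W"
  shows "pure_tensor V W v (w \<oplus>\<^bsub>W\<^esub> w') = pure_tensor V W v w \<oplus>\<^bsub>tensor_module V W\<^esub> pure_tensor V W v w'"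
proof -
  let ?F = "free_module (carrier V \<times> carrier W)"
  have "pure_tensor V W v (w \<oplus>\<^bsub>W\<^esub> w') = tensor_kernel V W +>\<^bsub>?F\<^esub> (free_basis (v, w) + free_basis (v, w'))"
    unfolding pure_tensor_def
    by (rule coset_kernel_eq)
      (use assms W in \<open>auto intro!: plus_closed single_closed simp: bilinear_relations_def diff_diff_eq simp del: free_module_simps\<close>)
  also have "\<dots> = pure_tensor V W v w \<oplus>\<^bsub>tensor_module V W\<^esub> pure_tensor V W v w'"
    unfolding pure_tensor_def tensor_module_def
    using quot_module_add[OF subsp_tensor_kernel, of "free_basis (v, w)" "free_basis (v, w')"]
      single_closed[of v w 1] single_closed[of v w' 1] assms by simp
  finally show ?thesis .
qed

lemma pure_tensor_smult:
  assumes "v \<in> carrier V" "w \<in> carrier W"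
  shows "pure_tensor V W (c \<odot>\<^bsub>V\<^esub> v) w = c \<odot>\<^bsub>tensor_module V W\<^esub> pure_tensor V W v w"
    and "pure_tensor V W v (c \<odot>\<^bsub>W\<^esub> w) = c \<odot>\<^bsub>tensor_module V W\<^esub> pure_tensor V W v w"
proof -
  let ?F = "free_module (carrier V \<times> carrier W)"
  have *: "tensor_kernel V W +>\<^bsub>?F\<^esub> Poly_Mapping.single (v, w) c = c \<odot>\<^bsub>tensor_module V W\<^esub> pure_tensor V W v w"
    unfolding pure_tensor_def tensor_module_def
    using quot_module_smult[OF subsp_tensor_kernel, of "free_basis (v, w)" c]
      single_closed[OF assms, of 1] by (simp add: pscale_single)
  have "pure_tensor V W (c \<odot>\<^bsub>V\<^esub> v) w = tensor_kernel V W +>\<^bsub>?F\<^esub> Poly_Mapping.single (v, w) c"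
    unfolding pure_tensor_def
    by (rule coset_kernel_eq)
      (use assms V in \<open>auto intro!: single_closed simp: bilinear_relations_def simp del: free_module_simps\<close>)
  then show "pure_tensor V W (c \<odot>\<^bsub>V\<^esub> v) w = c \<odot>\<^bsub>tensor_module V W\<^esub> pure_tensor V W v w" using * by simp
  have "pure_tensor V W v (c \<odot>\<^bsub>W\<^esub> w) = tensor_kernel V W +>\<^bsub>?F\<^esub> Poly_Mapping.single (v, w) c"
    unfolding pure_tensor_def
    by (rule coset_kernel_eq)
      (use assms W in \<open>auto intro!: single_closed simp: bilinear_relations_def simp del: free_module_simps\<close>)
  then show "pure_tensor V W v (c \<odot>\<^bsub>W\<^esub> w) = c \<odot>\<^bsub>tensor_module V W\<^esub> pure_tensor V W v w" using * by simp
qed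

lemma lin_pure_left: "w \<in> carrier W \<Longrightarrow> lin V (tensor_module V W) (\<lambda>v. pure_tensor V W v w)"
  by (rule linI[OF V vs_tensor_module])
    (simp_all add: pure_tensor_closed pure_tensor_add_left pure_tensor_smult)

lemma lin_pure_right: "v \<in> carrier V \<Longrightarrow> lin W (tensor_module V W) (\<lambda>w. pure_tensor V W v w)"
  by (rule linI[OF W vs_tensor_module])
    (simp_all add: pure_tensor_closed pure_tensor_add_right pure_tensor_smult)

end

section \<open>Maps of tensor products\<close>

text \<open>As \<open>f\<close> and \<open>g\<close> are linear, \<open>free_map\<close> sends each
  of the four kinds of bilinear relation to a relation of the same kind, and so descends to the
  quotients.\<close>

lemma tensor_map:
  assumes f: "lin V V' f" and g: "lin W W' g"
  shows lin_tensor_map: "lin (tensor_module V W) (tensor_module V' W') (tensor_map V' W' f g)"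
    and tensor_map_pure: "\<And>v w. v \<in> carrier V \<Longrightarrow> w \<in> carrier W \<Longrightarrow>
      tensor_map V' W' f g (pure_tensor V W v w) = pure_tensor V' W' (f v) (g w)"
proof -
  note V = lin_dom[OF f] and V' = lin_cod[OF f] and W = lin_dom[OF g] and W' = lin_cod[OF g]
  note K = subsp_tensor_kernel[OF V W] and K' = subsp_tensor_kernel[OF V' W']
  let ?F = "free_module (carrier V \<times> carrier W)" and ?F' = "free_module (carrier V' \<times> carrier W')"
  have h: "lin ?F ?F' (free_map (map_prod f g))"
    by (rule lin_free_map) (auto simp: lin_closed[OF f] lin_closed[OF g])
  have d: "free_map (map_prod f g) (u - v) = free_map (map_prod f g) u - free_map (map_prod f g) v" for u v
    using free_map_add[of "map_prod f g" "u - v" v] by simp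
  have rel: "free_map (map_prod f g) u \<in> bilinear_relations V' W'" if "u \<in> bilinear_relations V W" for u
    using that unfolding bilinear_relations_def
    by (elim UnE CollectE exE conjE; hypsubst; simp add: d free_map_single lin_simps[OF f] lin_simps[OF g])
      (use lin_closed[OF f] lin_closed[OF g] in blast)+
  have ker: "free_map (map_prod f g) u \<in> tensor_kernel V' W'" if "u \<in> tensor_kernel V W" for u
    using lin_span[OF h bilinear_relations_carrier[OF V W] _ K' that[unfolded tensor_kernel_def]]
      span_base[OF vs_free_module bilinear_relations_carrier[OF V' W']] rel
    by (simp add: tensor_kernel_def)
  note q = lin_quot_map[OF h K K' ker]
  show "lin (tensor_module V W) (tensor_module V' W') (tensor_map V' W' f g)"
    unfolding tensor_module_def tensor_map_def by (rule q(1))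
  show "tensor_map V' W' f g (pure_tensor V W v w) = pure_tensor V' W' (f v) (g w)"
    if "v \<in> carrier V" "w \<in> carrier W" for v w
    unfolding pure_tensor_def tensor_map_def
    using q(2)[of "free_basis (v, w)"] that by (simp add: free_map_single)
qed

lemma vs_minus_minus: "vs V \<Longrightarrow> x \<in> carrier V \<Longrightarrow> \<ominus>\<^bsub>V\<^esub> (\<ominus>\<^bsub>V\<^esub> x) = x"
  by (rule vs_eqI[of V]) (simp_all add: emb_simps)

lemma tensor_map_comp:
  assumes f: "lin V V' f" and g: "lin W W' g" and f': "lin V' V'' f'" and g': "lin W' W'' g'"
    and t: "t \<in> carrier (tensor_module V W)"
  shows "tensor_map V'' W'' f' g' (tensor_map V' W' f g t) = tensor_map V'' W'' (\<lambda>x. f' (f x)) (\<lambda>x. g' (g x)) t"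
  by (rule tensor_lin_eq[OF lin_dom[OF f] lin_dom[OF g] lin_comp[OF lin_tensor_map[OF f g] lin_tensor_map[OF f' g']]
        lin_tensor_map[OF lin_comp[OF f f'] lin_comp[OF g g']] _ t])
    (simp add: tensor_map_pure[OF f g] tensor_map_pure[OF f' g'] tensor_map_pure[OF lin_comp[OF f f'] lin_comp[OF g g']]
      lin_closed[OF f] lin_closed[OF g])

lemma tensor_map_id:
  assumes V: "vs V" and W: "vs W" and "\<And>v. v \<in> carrier V \<Longrightarrow> f v = v" "\<And>w. w \<in> carrier W \<Longrightarrow> g w = w"
    and t: "t \<in> carrier (tensor_module V W)"
  shows "tensor_map V W f g t = t"
proof -
  have f: "lin V V f" and g: "lin W W g"
    using lin_cong[OF lin_id[OF V], of f] lin_cong[OF lin_id[OF W], of g] assms(3,4) by auto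
  show ?thesis
    by (rule tensor_lin_eq[OF V W lin_tensor_map[OF f g] lin_id[OF vs_tensor_module[OF V W]] _ t])
      (simp add: tensor_map_pure[OF f g] assms(3,4))
qed

lemma pure_tensor_zero:
  assumes V: "vs V" and W: "vs W"
  shows "w \<in> carrier W \<Longrightarrow> pure_tensor V W \<zero>\<^bsub>V\<^esub> w = \<zero>\<^bsub>tensor_module V W\<^esub>"
    and "v \<in> carrier V \<Longrightarrow> pure_tensor V W v \<zero>\<^bsub>W\<^esub> = \<zero>\<^bsub>tensor_module V W\<^esub>"
  using lin_zero[OF lin_pure_left[OF V W]] lin_zero[OF lin_pure_right[OF V W]] by auto

lemma pure_tensor_uminus:
  assumes V: "vs V" and W: "vs W" and "v \<in> carrier V" "w \<in> carrier W"
  shows "pure_tensor V W (\<ominus>\<^bsub>V\<^esub> v) w = \<ominus>\<^bsub>tensor_module V W\<^esub> pure_tensor V W v w"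
    and "pure_tensor V W v (\<ominus>\<^bsub>W\<^esub> w) = \<ominus>\<^bsub>tensor_module V W\<^esub> pure_tensor V W v w"
  using lin_uminus[OF lin_pure_left[OF V W]] lin_uminus[OF lin_pure_right[OF V W]] assms(3,4) by auto

lemma pure_tensor_minus:
  assumes V: "vs V" and W: "vs W"
  shows "v \<in> carrier V \<Longrightarrow> v' \<in> carrier V \<Longrightarrow> w \<in> carrier W \<Longrightarrow>
      pure_tensor V W (v \<ominus>\<^bsub>V\<^esub> v') w = pure_tensor V W v w \<ominus>\<^bsub>tensor_module V W\<^esub> pure_tensor V W v' w"
    and "v \<in> carrier V \<Longrightarrow> w \<in> carrier W \<Longrightarrow> w' \<in> carrier W \<Longrightarrow>
      pure_tensor V W v (w \<ominus>\<^bsub>W\<^esub> w') = pure_tensor V W v w \<ominus>\<^bsub>tensor_module V W\<^esub> pure_tensor V W v w'"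
  using lin_minus[OF lin_pure_left[OF V W]] lin_minus[OF lin_pure_right[OF V W]] by auto

lemmas pure_tensor_simps =
  pure_tensor_closed pure_tensor_add_left pure_tensor_add_right pure_tensor_zero pure_tensor_uminus pure_tensor_minus

lemma tensor_sub_carrier:
  "V0 \<subseteq> carrier V \<Longrightarrow> W0 \<subseteq> carrier W \<Longrightarrow> vs V \<Longrightarrow> vs W \<Longrightarrow>
   {pure_tensor V W v w | v w. v \<in> V0 \<and> w \<in> W0} \<subseteq> carrier (tensor_module V W)"
  by (auto intro!: pure_tensor_closed)

lemma subsp_tensor_sub:
  assumes "vs V" "vs W" "V0 \<subseteq> carrier V" "W0 \<subseteq> carrier W"
  shows "subsp (tensor_module V W) (tensor_sub V W V0 W0)"
  unfolding tensor_sub_def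
  by (rule subsp_span[OF vs_tensor_module tensor_sub_carrier]) (use assms in auto)

lemma tensor_map_in_tensor_sub:
  assumes f: "lin V V' f" and g: "lin W W' g"
    and "V0 \<subseteq> carrier V'" "W0 \<subseteq> carrier W'"
    and fV: "\<And>v. v \<in> carrier V \<Longrightarrow> f v \<in> V0" and gW: "\<And>w. w \<in> carrier W \<Longrightarrow> g w \<in> W0"
    and t: "t \<in> carrier (tensor_module V W)"
  shows "tensor_map V' W' f g t \<in> tensor_sub V' W' V0 W0"
proof -
  note V' = lin_cod[OF f] and W' = lin_cod[OF g]
  have "carrier (tensor_module V W) \<subseteq>
    {t \<in> carrier (tensor_module V W). tensor_map V' W' f g t \<in> tensor_sub V' W' V0 W0}"
  proof (rule tensor_induct[OF lin_dom[OF f] lin_dom[OF g]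
        subsp_preimage[OF lin_tensor_map[OF f g] subsp_tensor_sub[OF V' W' assms(3,4)]]])
    fix v w assume v: "v \<in> carrier V" and w: "w \<in> carrier W"
    have "pure_tensor V' W' (f v) (g w) \<in> tensor_sub V' W' V0 W0"
      unfolding tensor_sub_def
      by (rule span_base[OF vs_tensor_module[OF V' W'] tensor_sub_carrier[OF assms(3,4) V' W']])
        (use fV[OF v] gW[OF w] in blast)
    then show "pure_tensor V W v w \<in>
      {t \<in> carrier (tensor_module V W). tensor_map V' W' f g t \<in> tensor_sub V' W' V0 W0}"
      using v w by (simp add: tensor_map_pure[OF f g] pure_tensor_closed[OF lin_dom[OF f] lin_dom[OF g]])
  qed
  then show ?thesis using t by blast
qed

text \<open>With \<open>tensor_map_in_tensor_sub\<close> it identifies, for projections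
  \<open>f\<close> onto \<open>V0\<close> and \<open>g\<close> onto \<open>W0\<close>, the span
  \<open>tensor_sub\<close> with the fixed points of \<open>tensor_map V W f g\<close>.\<close>

lemma tensor_map_fixes_tensor_sub:
  assumes f: "lin V V f" and g: "lin W W g"
    and "V0 \<subseteq> carrier V" "W0 \<subseteq> carrier W"
    and fV: "\<And>v. v \<in> V0 \<Longrightarrow> f v = v" and gW: "\<And>w. w \<in> W0 \<Longrightarrow> g w = w"
    and t: "t \<in> tensor_sub V W V0 W0"
  shows "tensor_map V W f g t = t"
proof -
  note V = lin_cod[OF f] and W = lin_cod[OF g]
  note T = vs_tensor_module[OF V W]
  note F = lin_tensor_map[OF f g]
  have tc: "t \<in> carrier (tensor_module V W)" using subspD(3)[OF subsp_tensor_sub[OF V W assms(3,4)] t] .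
  have "tensor_map V W f g t \<ominus>\<^bsub>tensor_module V W\<^esub> t \<in> {\<zero>\<^bsub>tensor_module V W\<^esub>}"
  proof (rule lin_span[OF lin_diff[OF F lin_id[OF T]] tensor_sub_carrier[OF assms(3,4) V W]
        _ _ t[unfolded tensor_sub_def]])
    show "subsp (tensor_module V W) {\<zero>\<^bsub>tensor_module V W\<^esub>}"
      by (rule subspI[OF T]) (auto simp: T vs_zero_simps[OF T])
  next
    fix x assume "x \<in> {pure_tensor V W v w |v w. v \<in> V0 \<and> w \<in> W0}"
    then obtain v w where x: "x = pure_tensor V W v w" "v \<in> V0" "w \<in> W0" by blast
    have c: "v \<in> carrier V" "w \<in> carrier W" using x assms(3,4) by auto
    show "tensor_map V W f g x \<ominus>\<^bsub>tensor_module V W\<^esub> x \<in> {\<zero>\<^bsub>tensor_module V W\<^esub>}"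
      unfolding x(1) tensor_map_pure[OF f g c] fV[OF x(2)] gW[OF x(3)]
      using vs_r_neg[OF T pure_tensor_closed[OF V W c]] by simp
  qed
  then have "vs_emb (tensor_module V W) (tensor_map V W f g t \<ominus>\<^bsub>tensor_module V W\<^esub> t) = vs_emb (tensor_module V W) \<zero>\<^bsub>tensor_module V W\<^esub>"
    by simp
  then show ?thesis
    using tc lin_closed[OF F tc] by (intro vs_eqI[OF T]) (simp_all add: T emb_simps[OF T])
qed

section \<open>Traces\<close>

text \<open>
  The trace of \<open>g\<close> is the alternating sum of the products of a subset of the two differentials,
  \<open>g\<close> and the complementary subset.
\<close>

definition htrace ::
    "(complex, 'a, 'm) module_scheme \<Rightarrow> ('a \<Rightarrow> 'a) \<Rightarrow> ('a \<Rightarrow> 'a) \<Rightarrow> ('a \<Rightarrow> 'a) \<Rightarrow> 'a \<Rightarrow> 'a" where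
  "htrace V d b g x = (g (d (b x)) \<ominus>\<^bsub>V\<^esub> d (g (b x))) \<oplus>\<^bsub>V\<^esub> (b (g (d x)) \<oplus>\<^bsub>V\<^esub> d (b (g x)))"

lemma lin_htrace:
  assumes d: "lin V V d" and b: "lin V V b" and g: "lin V V g"
  shows "lin V V (htrace V d b g)"
  unfolding htrace_def
  by (intro lin_sum lin_diff lin_comp[OF lin_comp[OF b d] g] lin_comp[OF lin_comp[OF b g] d]
      lin_comp[OF lin_comp[OF d g] b] lin_comp[OF lin_comp[OF g b] d])

text \<open>In every term with \<open>d2\<close> or \<open>b2\<close> the map \<open>g\<close> can
  be moved past that operator. The terms with \<open>d1\<close>, \<open>b2\<close>, those with
  \<open>d2\<close>, \<open>b1\<close> and those with \<open>d2\<close>, \<open>b2\<close> then each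
  consist of two opposite terms and an anticommutator composed with \<open>g\<close>, which
  vanishes.\<close>

lemma htrace_add:
  assumes l: "lin V V d1" "lin V V d2" "lin V V b1" "lin V V b2" "lin V V g"
    and r: "\<And>x. x \<in> carrier V \<Longrightarrow> g (d2 x) = d2 (g x)" "\<And>x. x \<in> carrier V \<Longrightarrow> g (b2 x) = b2 (g x)"
      "\<And>x. x \<in> carrier V \<Longrightarrow> d2 (b1 x) = \<ominus>\<^bsub>V\<^esub> b1 (d2 x)" "\<And>x. x \<in> carrier V \<Longrightarrow> b2 (d1 x) = \<ominus>\<^bsub>V\<^esub> d1 (b2 x)"
      "\<And>x. x \<in> carrier V \<Longrightarrow> b2 (d2 x) = \<ominus>\<^bsub>V\<^esub> d2 (b2 x)"
    and x: "x \<in> carrier V"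
  shows "htrace V (\<lambda>x. d1 x \<oplus>\<^bsub>V\<^esub> d2 x) (\<lambda>x. b1 x \<oplus>\<^bsub>V\<^esub> b2 x) g x = htrace V d1 b1 g x"
proof -
  note V = lin_dom[OF l(1)]
  note s = lin_simps[OF l(1)] lin_simps[OF l(2)] lin_simps[OF l(3)] lin_simps[OF l(4)] lin_simps[OF l(5)]
  show ?thesis
    by (rule vs_eqI[OF V]) (simp_all add: htrace_def x V s r(1,2)[symmetric] r(3-5) emb_simps[OF V])
qed

text \<open>\<open>s\<close> abstracts the sign of the total degree to what the Koszul rule
  requires: an involution that anticommutes with both differentials.\<close>

locale double_complex =
  fixes V :: "(complex, 'a, 'm) module_scheme" and d b s :: "'a \<Rightarrow> 'a"
  assumes lin_d: "lin V V d" and lin_b: "lin V V b" and lin_s: "lin V V s"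
    and dd: "x \<in> carrier V \<Longrightarrow> d (d x) = \<zero>\<^bsub>V\<^esub>"
    and bb: "x \<in> carrier V \<Longrightarrow> b (b x) = \<zero>\<^bsub>V\<^esub>"
    and bd: "x \<in> carrier V \<Longrightarrow> b (d x) = \<ominus>\<^bsub>V\<^esub> d (b x)"
    and ss: "x \<in> carrier V \<Longrightarrow> s (s x) = x"
    and ds: "x \<in> carrier V \<Longrightarrow> d (s x) = \<ominus>\<^bsub>V\<^esub> s (d x)"
    and bs: "x \<in> carrier V \<Longrightarrow> b (s x) = \<ominus>\<^bsub>V\<^esub> s (b x)"
begin

lemma V: "vs V" by (rule lin_dom[OF lin_d])

lemmas op_simps = lin_simps[OF lin_d] lin_simps[OF lin_b] lin_simps[OF lin_s] dd bb bd ss ds bs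
  vs_closed[OF V] vs_zero_simps[OF V]

lemmas emb = emb_simps[OF V]

end

locale double_complex_pair = A: double_complex A dA bA sA + B: double_complex B dB bB sB
  for A :: "(complex, 'a, 'm) module_scheme" and dA bA sA
    and B :: "(complex, 'b, 'n) module_scheme" and dB bB sB
begin

abbreviation "T \<equiv> tensor_module A B"
abbreviation "tm \<equiv> tensor_map A B"

definition "D t = tm dA (\<lambda>x. x) t \<oplus>\<^bsub>T\<^esub> tm sA dB t"
definition "Db t = tm bA (\<lambda>x. x) t \<oplus>\<^bsub>T\<^esub> tm sA bB t"

lemmas lin_idA = lin_id[OF A.V] and lin_idB = lin_id[OF B.V]
lemmas T = vs_tensor_module[OF A.V B.V]
lemmas Temb = emb_simps[OF T]

lemma lin_tm: "lin A A f \<Longrightarrow> lin B B g \<Longrightarrow> lin T T (tm f g)"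
  by (rule lin_tensor_map)

lemma tm_pure: "lin A A f \<Longrightarrow> lin B B g \<Longrightarrow> v \<in> carrier A \<Longrightarrow> w \<in> carrier B \<Longrightarrow>
    tm f g (pure_tensor A B v w) = pure_tensor A B (f v) (g w)"
  by (rule tensor_map_pure)

lemma lin_D: "lin T T D" and lin_Db: "lin T T Db"
  unfolding D_def Db_def
  by (intro lin_sum lin_tm lin_idB A.lin_d A.lin_b A.lin_s B.lin_d B.lin_b)+

lemmas T_simps = lin_simps[OF lin_D] lin_simps[OF lin_Db] vs_closed[OF T] vs_zero_simps[OF T]
lemmas pure_simps = pure_tensor_simps[OF A.V B.V] vs_minus_minus[OF T]

lemma D_pure: "v \<in> carrier A \<Longrightarrow> w \<in> carrier B \<Longrightarrow>
    D (pure_tensor A B v w) = pure_tensor A B (dA v) w \<oplus>\<^bsub>T\<^esub> pure_tensor A B (sA v) (dB w)"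
  by (simp add: D_def tm_pure A.lin_d A.lin_s B.lin_d lin_idB)

lemma Db_pure: "v \<in> carrier A \<Longrightarrow> w \<in> carrier B \<Longrightarrow>
    Db (pure_tensor A B v w) = pure_tensor A B (bA v) w \<oplus>\<^bsub>T\<^esub> pure_tensor A B (sA v) (bB w)"
  by (simp add: Db_def tm_pure A.lin_b A.lin_s B.lin_b lin_idB)

lemma DD: "t \<in> carrier T \<Longrightarrow> D (D t) = \<zero>\<^bsub>T\<^esub>"
  by (rule tensor_lin_eq[OF A.V B.V lin_comp[OF lin_D lin_D] lin_0[OF T T]]; (rule vs_eqI[OF T])?)
    (simp_all add: T_simps D_pure pure_simps A.op_simps B.op_simps Temb)

lemma DbDb: "t \<in> carrier T \<Longrightarrow> Db (Db t) = \<zero>\<^bsub>T\<^esub>"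
  by (rule tensor_lin_eq[OF A.V B.V lin_comp[OF lin_Db lin_Db] lin_0[OF T T]]; (rule vs_eqI[OF T])?)
    (simp_all add: T_simps Db_pure pure_simps A.op_simps B.op_simps Temb)

lemma DbD: "t \<in> carrier T \<Longrightarrow> Db (D t) = \<ominus>\<^bsub>T\<^esub> D (Db t)"
  by (rule tensor_lin_eq[OF A.V B.V lin_comp[OF lin_D lin_Db] lin_neg[OF lin_comp[OF lin_Db lin_D]]]; (rule vs_eqI[OF T])?)
    (simp_all add: T_simps D_pure Db_pure pure_simps A.op_simps B.op_simps Temb)

text \<open>In a tensor product the mixed terms of the trace cancel.\<close>

lemma htrace_left:
  assumes g: "lin A A g" and gs: "\<And>x. x \<in> carrier A \<Longrightarrow> g (sA x) = sA (g x)" and t: "t \<in> carrier T"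
  shows "htrace T D Db (tm g (\<lambda>x. x)) t = tm (htrace A dA bA g) (\<lambda>x. x) t"
proof -
  note l = lin_tm[OF A.lin_d lin_idB] lin_tm[OF A.lin_s B.lin_d] lin_tm[OF A.lin_b lin_idB]
    lin_tm[OF A.lin_s B.lin_b] lin_tm[OF g lin_idB]
  note lt = lin_htrace[OF A.lin_d A.lin_b g]
  note s = lin_simps[OF l(1)] lin_simps[OF l(2)] lin_simps[OF l(3)] lin_simps[OF l(4)] lin_simps[OF l(5)]
    tm_pure[OF A.lin_d lin_idB] tm_pure[OF A.lin_s B.lin_d] tm_pure[OF A.lin_b lin_idB]
    tm_pure[OF A.lin_s B.lin_b] tm_pure[OF g lin_idB] tm_pure[OF lt lin_idB]
  have "htrace T D Db (tm g (\<lambda>x. x)) t = htrace T (tm dA (\<lambda>x. x)) (tm bA (\<lambda>x. x)) (tm g (\<lambda>x. x)) t"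
    unfolding D_def Db_def
    by (rule htrace_add[OF l _ _ _ _ _ t];
        (rule tensor_lin_eq[OF A.V B.V lin_comp[OF l(2) l(5)] lin_comp[OF l(5) l(2)]]
          | rule tensor_lin_eq[OF A.V B.V lin_comp[OF l(4) l(5)] lin_comp[OF l(5) l(4)]]
          | rule tensor_lin_eq[OF A.V B.V lin_comp[OF l(3) l(2)] lin_neg[OF lin_comp[OF l(2) l(3)]]]
          | rule tensor_lin_eq[OF A.V B.V lin_comp[OF l(1) l(4)] lin_neg[OF lin_comp[OF l(4) l(1)]]]
          | rule tensor_lin_eq[OF A.V B.V lin_comp[OF l(2) l(4)] lin_neg[OF lin_comp[OF l(4) l(2)]]]);
        simp add: s pure_simps A.op_simps B.op_simps lin_simps[OF g] gs)
  also have "\<dots> = tm (htrace A dA bA g) (\<lambda>x. x) t"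
    by (rule tensor_lin_eq[OF A.V B.V lin_htrace[OF l(1,3,5)] lin_tm[OF lt lin_idB] _ t])
      (simp add: s htrace_def pure_simps A.op_simps B.op_simps lin_simps[OF g])
  finally show ?thesis .
qed

text \<open>Now \<open>dA \<otimes> 1\<close> and \<open>bA \<otimes> 1\<close> are the summands
  that commute with the homotopy. Every term of the remaining trace contains both
  \<open>sA \<otimes> dB\<close> and \<open>sA \<otimes> bB\<close>, whose signs multiply to the
  identity.\<close>

lemma htrace_right:
  assumes g: "lin B B g" and t: "t \<in> carrier T"
  shows "htrace T D Db (tm (\<lambda>x. x) g) t = tm (\<lambda>x. x) (htrace B dB bB g) t"
proof -
  note l = lin_tm[OF A.lin_s B.lin_d] lin_tm[OF A.lin_d lin_idB] lin_tm[OF A.lin_s B.lin_b]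
    lin_tm[OF A.lin_b lin_idB] lin_tm[OF lin_idA g]
  note lt = lin_htrace[OF B.lin_d B.lin_b g]
  note s = lin_simps[OF l(1)] lin_simps[OF l(2)] lin_simps[OF l(3)] lin_simps[OF l(4)] lin_simps[OF l(5)]
    tm_pure[OF A.lin_d lin_idB] tm_pure[OF A.lin_s B.lin_d] tm_pure[OF A.lin_b lin_idB]
    tm_pure[OF A.lin_s B.lin_b] tm_pure[OF lin_idA g] tm_pure[OF lin_idA lt]
  \<comment> \<open>\<open>htrace_add\<close> keeps the first summands, so the summands of both
    differentials are exchanged.\<close>
  have eq: "htrace T D Db h t = htrace T (\<lambda>t. tm sA dB t \<oplus>\<^bsub>T\<^esub> tm dA (\<lambda>x. x) t)
      (\<lambda>t. tm sA bB t \<oplus>\<^bsub>T\<^esub> tm bA (\<lambda>x. x) t) h t" if h: "lin T T h" for h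
    by (rule vs_eqI[OF T])
      (use t in \<open>simp_all add: htrace_def D_def Db_def lin_simps[OF h] s T_simps Temb\<close>)
  have "htrace T D Db (tm (\<lambda>x. x) g) t = htrace T (tm sA dB) (tm sA bB) (tm (\<lambda>x. x) g) t"
    unfolding eq[OF l(5)]
    by (rule htrace_add[OF l _ _ _ _ _ t];
        (rule tensor_lin_eq[OF A.V B.V lin_comp[OF l(2) l(5)] lin_comp[OF l(5) l(2)]]
          | rule tensor_lin_eq[OF A.V B.V lin_comp[OF l(4) l(5)] lin_comp[OF l(5) l(4)]]
          | rule tensor_lin_eq[OF A.V B.V lin_comp[OF l(3) l(2)] lin_neg[OF lin_comp[OF l(2) l(3)]]]
          | rule tensor_lin_eq[OF A.V B.V lin_comp[OF l(1) l(4)] lin_neg[OF lin_comp[OF l(4) l(1)]]]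
          | rule tensor_lin_eq[OF A.V B.V lin_comp[OF l(2) l(4)] lin_neg[OF lin_comp[OF l(4) l(2)]]]);
        simp add: s pure_simps A.op_simps B.op_simps lin_simps[OF g])
  also have "\<dots> = tm (\<lambda>x. x) (htrace B dB bB g) t"
    by (rule tensor_lin_eq[OF A.V B.V lin_htrace[OF l(1,3,5)] lin_tm[OF lin_idA lt] _ t])
      (simp add: s htrace_def pure_simps A.op_simps B.op_simps lin_simps[OF g])
  finally show ?thesis .
qed

end

section \<open>Retracts up to a trace and their tensor products\<close>

locale trace_retract = A: double_complex A dA bA sA + H: double_complex H dH bH sH
  for A :: "(complex, 'a, 'm) module_scheme" and dA bA sA
    and H :: "(complex, 'h, 'n) module_scheme" and dH bH sH +
  fixes q :: "'a \<Rightarrow> 'h" and r :: "'h \<Rightarrow> 'a" and g :: "'a \<Rightarrow> 'a"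
  assumes lin_q: "lin A H q" and lin_r: "lin H A r" and lin_g: "lin A A g"
    and qr: "x \<in> carrier H \<Longrightarrow> q (r x) = x"
    and qd: "a \<in> carrier A \<Longrightarrow> q (dA a) = dH (q a)"
    and qb: "a \<in> carrier A \<Longrightarrow> q (bA a) = bH (q a)"
    and qs: "a \<in> carrier A \<Longrightarrow> q (sA a) = sH (q a)"
    and rd: "x \<in> carrier H \<Longrightarrow> r (dH x) = dA (r x)"
    and rb: "x \<in> carrier H \<Longrightarrow> r (bH x) = bA (r x)"
    and rs: "x \<in> carrier H \<Longrightarrow> r (sH x) = sA (r x)"
    and gs: "a \<in> carrier A \<Longrightarrow> g (sA a) = sA (g a)"
    and gtr: "a \<in> carrier A \<Longrightarrow> htrace A dA bA g a = a \<ominus>\<^bsub>A\<^esub> r (q a)"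

text \<open>
  \<open>k0\<close> and \<open>k1\<close> are the projections of \<open>H_BCA = H_BC \<oplus> tilde_H_A\<close> or
  \<open>H_ABC = tilde_H_BC \<oplus> H_A\<close> onto the target and the source of the differentials.
\<close>

locale two_step = trace_retract +
  fixes k0 k1
  assumes lin_k0: "lin H H k0" and lin_k1: "lin H H k1"
    and k_sum: "x \<in> carrier H \<Longrightarrow> k0 x \<oplus>\<^bsub>H\<^esub> k1 x = x"
    and k00: "x \<in> carrier H \<Longrightarrow> k0 (k0 x) = k0 x" and k11: "x \<in> carrier H \<Longrightarrow> k1 (k1 x) = k1 x"
    and k01: "x \<in> carrier H \<Longrightarrow> k0 (k1 x) = \<zero>\<^bsub>H\<^esub>" and k10: "x \<in> carrier H \<Longrightarrow> k1 (k0 x) = \<zero>\<^bsub>H\<^esub>"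
    and dk0: "x \<in> carrier H \<Longrightarrow> dH (k0 x) = \<zero>\<^bsub>H\<^esub>" and bk0: "x \<in> carrier H \<Longrightarrow> bH (k0 x) = \<zero>\<^bsub>H\<^esub>"
    and k1d: "x \<in> carrier H \<Longrightarrow> k1 (dH x) = \<zero>\<^bsub>H\<^esub>" and k1b: "x \<in> carrier H \<Longrightarrow> k1 (bH x) = \<zero>\<^bsub>H\<^esub>"
    and sk0: "x \<in> carrier H \<Longrightarrow> sH (k0 x) = k0 (sH x)" and sk1: "x \<in> carrier H \<Longrightarrow> sH (k1 x) = k1 (sH x)"
begin

lemma dk1: "x \<in> carrier H \<Longrightarrow> dH (k1 x) = dH x"
  using arg_cong[OF k_sum[of x], of dH]
  by (simp add: H.op_simps dk0 lin_closed[OF lin_k0] lin_closed[OF lin_k1])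

lemma bk1: "x \<in> carrier H \<Longrightarrow> bH (k1 x) = bH x"
  using arg_cong[OF k_sum[of x], of bH]
  by (simp add: H.op_simps bk0 lin_closed[OF lin_k0] lin_closed[OF lin_k1])

lemma k0d: "x \<in> carrier H \<Longrightarrow> k0 (dH x) = dH x"
  using k_sum[of "dH x"] by (simp add: H.op_simps k1d lin_closed[OF lin_k0])

lemma k0b: "x \<in> carrier H \<Longrightarrow> k0 (bH x) = bH x"
  using k_sum[of "bH x"] by (simp add: H.op_simps k1b lin_closed[OF lin_k0])

lemmas k_simps = lin_simps[OF lin_k0] lin_simps[OF lin_k1] k00 k11 k01 k10 dk0 bk0 k1d k1b sk0 sk1 dk1 bk1 k0d k0b

end

locale trace_retract_pair = X: trace_retract A dA bA sA HA dHA bHA sHA qA rA gA + Y: trace_retract B dB bB sB HB dHB bHB sHB qB rB gB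
  for A :: "(complex, 'a, 'm) module_scheme" and dA bA sA
    and HA :: "(complex, 'h, 'n) module_scheme" and dHA bHA sHA qA rA gA
    and B :: "(complex, 'b, 'o) module_scheme" and dB bB sB
    and HB :: "(complex, 'k, 'p) module_scheme" and dHB bHB sHB qB rB gB
begin

sublocale TA: double_complex_pair A dA bA sA B dB bB sB ..
sublocale TH: double_complex_pair HA dHA bHA sHA HB dHB bHB sHB ..

abbreviation "T \<equiv> tensor_module A B"
abbreviation "S \<equiv> tensor_module HA HB"

definition "Q = tensor_map HA HB qA qB"
definition "R = tensor_map A B rA rB"

lemma lin_Q: "lin T S Q" and lin_R: "lin S T R"
  unfolding Q_def R_def by (rule lin_tensor_map X.lin_q Y.lin_q X.lin_r Y.lin_r)+

lemma Q_pure: "v \<in> carrier A \<Longrightarrow> w \<in> carrier B \<Longrightarrow> Q (pure_tensor A B v w) = pure_tensor HA HB (qA v) (qB w)"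
  unfolding Q_def by (rule tensor_map_pure[OF X.lin_q Y.lin_q])

lemma R_pure: "v \<in> carrier HA \<Longrightarrow> w \<in> carrier HB \<Longrightarrow> R (pure_tensor HA HB v w) = pure_tensor A B (rA v) (rB w)"
  unfolding R_def by (rule tensor_map_pure[OF X.lin_r Y.lin_r])

lemmas QR_simps = lin_simps[OF lin_Q] lin_simps[OF lin_R] lin_simps[OF X.lin_q] lin_simps[OF X.lin_r]
  lin_simps[OF Y.lin_q] lin_simps[OF Y.lin_r] Q_pure R_pure

lemma QR: "s \<in> carrier S \<Longrightarrow> Q (R s) = s"
  by (rule tensor_lin_eq[OF X.H.V Y.H.V lin_comp[OF lin_R lin_Q] lin_id[OF TH.T]])
    (simp_all add: QR_simps X.qr Y.qr)

lemma QD: "t \<in> carrier T \<Longrightarrow> Q (TA.D t) = TH.D (Q t)"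
  by (rule tensor_lin_eq[OF X.A.V Y.A.V lin_comp[OF TA.lin_D lin_Q] lin_comp[OF lin_Q TH.lin_D]])
    (simp_all add: QR_simps TA.D_pure TH.D_pure TA.pure_simps X.A.op_simps Y.A.op_simps X.qd Y.qd X.qs)

lemma QDb: "t \<in> carrier T \<Longrightarrow> Q (TA.Db t) = TH.Db (Q t)"
  by (rule tensor_lin_eq[OF X.A.V Y.A.V lin_comp[OF TA.lin_Db lin_Q] lin_comp[OF lin_Q TH.lin_Db]])
    (simp_all add: QR_simps TA.Db_pure TH.Db_pure TA.pure_simps X.A.op_simps Y.A.op_simps X.qb Y.qb X.qs)

lemma RD: "t \<in> carrier S \<Longrightarrow> R (TH.D t) = TA.D (R t)"
  by (rule tensor_lin_eq[OF X.H.V Y.H.V lin_comp[OF TH.lin_D lin_R] lin_comp[OF lin_R TA.lin_D]])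
    (simp_all add: QR_simps TA.D_pure TH.D_pure TH.pure_simps X.H.op_simps Y.H.op_simps X.rd Y.rd X.rs)

lemma RDb: "t \<in> carrier S \<Longrightarrow> R (TH.Db t) = TA.Db (R t)"
  by (rule tensor_lin_eq[OF X.H.V Y.H.V lin_comp[OF TH.lin_Db lin_R] lin_comp[OF lin_R TA.lin_Db]])
    (simp_all add: QR_simps TA.Db_pure TH.Db_pure TH.pure_simps X.H.op_simps Y.H.op_simps X.rb Y.rb X.rs)

definition "GA = tensor_map A B gA (\<lambda>x. x)"
definition "GB = tensor_map A B (\<lambda>x. x) gB"
text \<open>The retraction carried out in the first factor only. The way from the identity to
  \<open>R Q\<close> passes through it, so that each half is a trace in one factor.\<close>

definition "EA = tensor_map A B (\<lambda>x. rA (qA x)) (\<lambda>x. x)"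

lemma lin_GA: "lin T T GA" and lin_GB: "lin T T GB" and lin_EA: "lin T T EA"
  unfolding GA_def GB_def EA_def
  by (rule lin_tensor_map X.lin_g Y.lin_g TA.lin_idA TA.lin_idB lin_comp[OF X.lin_q X.lin_r])+

lemma EA_pure: "v \<in> carrier A \<Longrightarrow> w \<in> carrier B \<Longrightarrow> EA (pure_tensor A B v w) = pure_tensor A B (rA (qA v)) w"
  unfolding EA_def by (rule tensor_map_pure[OF lin_comp[OF X.lin_q X.lin_r] TA.lin_idB])

lemma htrace_GA: "t \<in> carrier T \<Longrightarrow> htrace T TA.D TA.Db GA t = t \<ominus>\<^bsub>T\<^esub> EA t"
proof -
  assume t: "t \<in> carrier T"
  note l = lin_htrace[OF X.A.lin_d X.A.lin_b X.lin_g]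
  have "htrace T TA.D TA.Db GA t = tensor_map A B (htrace A dA bA gA) (\<lambda>x. x) t"
    unfolding GA_def by (rule TA.htrace_left[OF X.lin_g X.gs t])
  also have "\<dots> = t \<ominus>\<^bsub>T\<^esub> EA t"
    by (rule tensor_lin_eq[OF X.A.V Y.A.V lin_tensor_map[OF l TA.lin_idB] lin_diff[OF lin_id[OF TA.T] lin_EA] _ t])
      (simp add: tensor_map_pure[OF l TA.lin_idB] EA_pure X.gtr QR_simps TA.pure_simps)
  finally show ?thesis .
qed

text \<open>The trace of \<open>1 \<otimes> gB\<close> is \<open>1 \<otimes> (1 - rB qB)\<close>; on
  the image of \<open>EA\<close> this is the second half of the way from the identity to
  \<open>R Q\<close>.\<close>

lemma htrace_GB: "t \<in> carrier T \<Longrightarrow> htrace T TA.D TA.Db GB (EA t) = EA t \<ominus>\<^bsub>T\<^esub> R (Q t)"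
proof -
  assume t: "t \<in> carrier T"
  note l = lin_htrace[OF Y.A.lin_d Y.A.lin_b Y.lin_g]
  have "htrace T TA.D TA.Db GB (EA t) = tensor_map A B (\<lambda>x. x) (htrace B dB bB gB) (EA t)"
    unfolding GB_def by (rule TA.htrace_right[OF Y.lin_g lin_closed[OF lin_EA t]])
  also have "\<dots> = EA t \<ominus>\<^bsub>T\<^esub> R (Q t)"
    by (rule tensor_lin_eq[OF X.A.V Y.A.V lin_comp[OF lin_EA lin_tensor_map[OF TA.lin_idA l]]
          lin_diff[OF lin_EA lin_comp[OF lin_Q lin_R]] _ t])
      (simp add: tensor_map_pure[OF TA.lin_idA l] EA_pure Y.gtr QR_simps TA.pure_simps)
  finally show ?thesis .
qed

lemma EA_D: "t \<in> carrier T \<Longrightarrow> TA.D (EA t) = EA (TA.D t)"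
  by (rule tensor_lin_eq[OF X.A.V Y.A.V lin_comp[OF lin_EA TA.lin_D] lin_comp[OF TA.lin_D lin_EA]])
    (simp_all add: QR_simps TA.D_pure TA.pure_simps X.A.op_simps Y.A.op_simps lin_simps[OF lin_EA] EA_pure X.qd X.rd X.qs X.rs)

lemma EA_Db: "t \<in> carrier T \<Longrightarrow> TA.Db (EA t) = EA (TA.Db t)"
  by (rule tensor_lin_eq[OF X.A.V Y.A.V lin_comp[OF lin_EA TA.lin_Db] lin_comp[OF TA.lin_Db lin_EA]])
    (simp_all add: QR_simps TA.Db_pure TA.pure_simps X.A.op_simps Y.A.op_simps lin_simps[OF lin_EA] EA_pure X.qb X.rb X.qs X.rs)

lemmas G_simps = lin_simps[OF lin_GA] lin_simps[OF lin_GB] lin_simps[OF lin_EA] lin_simps[OF lin_Q] lin_simps[OF lin_R] TA.T_simps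

text \<open>Three of the four terms of a trace begin by applying a differential to \<open>t\<close>;
  only \<open>d b g\<close> survives. \<open>EA t\<close> is closed as well, since \<open>EA\<close>
  commutes with the differentials, so both halves have this form.\<close>

lemma closed_homotopy:
  assumes t: "t \<in> carrier T" and d: "TA.D t = \<zero>\<^bsub>T\<^esub>" and b: "TA.Db t = \<zero>\<^bsub>T\<^esub>"
  obtains y where "y \<in> carrier T" "t = R (Q t) \<oplus>\<^bsub>T\<^esub> TA.D (TA.Db y)"
proof
  show "GA t \<oplus>\<^bsub>T\<^esub> GB (EA t) \<in> carrier T" using t by (simp add: G_simps)
  have 1: "t \<ominus>\<^bsub>T\<^esub> EA t = TA.D (TA.Db (GA t))"
    using htrace_GA[OF t] t by (simp add: htrace_def d b G_simps)
  have 2: "EA t \<ominus>\<^bsub>T\<^esub> R (Q t) = TA.D (TA.Db (GB (EA t)))"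
    using htrace_GB[OF t] t by (simp add: htrace_def EA_D EA_Db d b G_simps)
  have "t = R (Q t) \<oplus>\<^bsub>T\<^esub> ((t \<ominus>\<^bsub>T\<^esub> EA t) \<oplus>\<^bsub>T\<^esub> (EA t \<ominus>\<^bsub>T\<^esub> R (Q t)))"
    by (rule vs_eqI[OF TA.T]) (use t in \<open>simp_all add: G_simps TA.Temb\<close>)
  then show "t = R (Q t) \<oplus>\<^bsub>T\<^esub> TA.D (TA.Db (GA t \<oplus>\<^bsub>T\<^esub> GB (EA t)))"
    unfolding 1 2 using t by (simp add: G_simps)
qed

text \<open>The term \<open>g d b\<close> of a trace drops out, and the other three end with a
  differential. \<open>?y\<close> collects what \<open>TA.D\<close> is applied to, and
  \<open>?z\<close> what \<open>TA.Db\<close> is applied to.\<close>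

lemma ddb_homotopy:
  assumes t: "t \<in> carrier T" and db: "TA.D (TA.Db t) = \<zero>\<^bsub>T\<^esub>"
  obtains y z where "y \<in> carrier T" "z \<in> carrier T" "t = R (Q t) \<oplus>\<^bsub>T\<^esub> (TA.D y \<oplus>\<^bsub>T\<^esub> TA.Db z)"
proof
  let ?y = "(TA.Db (GA t) \<ominus>\<^bsub>T\<^esub> GA (TA.Db t)) \<oplus>\<^bsub>T\<^esub> (TA.Db (GB (EA t)) \<ominus>\<^bsub>T\<^esub> GB (TA.Db (EA t)))"
  let ?z = "GA (TA.D t) \<oplus>\<^bsub>T\<^esub> GB (TA.D (EA t))"
  show "?y \<in> carrier T" "?z \<in> carrier T" using t by (simp_all add: G_simps)
  have db': "TA.D (TA.Db (EA t)) = \<zero>\<^bsub>T\<^esub>" using t db by (simp add: EA_Db EA_D G_simps)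
  have "t = R (Q t) \<oplus>\<^bsub>T\<^esub> ((t \<ominus>\<^bsub>T\<^esub> EA t) \<oplus>\<^bsub>T\<^esub> (EA t \<ominus>\<^bsub>T\<^esub> R (Q t)))"
    by (rule vs_eqI[OF TA.T]) (use t in \<open>simp_all add: G_simps TA.Temb\<close>)
  then have eq: "t = R (Q t) \<oplus>\<^bsub>T\<^esub> (htrace T TA.D TA.Db GA t \<oplus>\<^bsub>T\<^esub> htrace T TA.D TA.Db GB (EA t))"
    by (simp only: htrace_GA[OF t] htrace_GB[OF t])
  have "htrace T TA.D TA.Db GA t \<oplus>\<^bsub>T\<^esub> htrace T TA.D TA.Db GB (EA t) = TA.D ?y \<oplus>\<^bsub>T\<^esub> TA.Db ?z"
    by (rule vs_eqI[OF TA.T]) (use t in \<open>simp_all add: htrace_def db db' G_simps TA.Temb\<close>)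
  then show "t = R (Q t) \<oplus>\<^bsub>T\<^esub> (TA.D ?y \<oplus>\<^bsub>T\<^esub> TA.Db ?z)" using eq by (simp only:)
qed

end

section \<open>The three-step filtration of a tensor product of two-step complexes\<close>

locale two_step_pair = X: two_step A dA bA sA HA dHA bHA sHA qA rA gA kA0 kA1
    + Y: two_step B dB bB sB HB dHB bHB sHB qB rB gB kB0 kB1
  for A :: "(complex, 'a, 'm) module_scheme" and dA bA sA
    and HA :: "(complex, 'h, 'n) module_scheme" and dHA bHA sHA qA rA gA kA0 kA1
    and B :: "(complex, 'b, 'o) module_scheme" and dB bB sB
    and HB :: "(complex, 'k, 'p) module_scheme" and dHB bHB sHB qB rB gB kB0 kB1
begin

sublocale trace_retract_pair A dA bA sA HA dHA bHA sHA qA rA gA B dB bB sB HB dHB bHB sHB qB rB gB ..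

abbreviation "tS \<equiv> tensor_map HA HB"

text \<open>The differentials pass from the range of \<open>P2\<close> to that of \<open>P1\<close> and on to that of \<open>P0\<close>.\<close>

definition "P2 = tS kA1 kB1"
definition "P1 t = tS kA1 kB0 t \<oplus>\<^bsub>S\<^esub> tS kA0 kB1 t"
definition "P0 = tS kA0 kB0"

lemma lin_k: "lin S S (tS kA1 kB1)" "lin S S (tS kA1 kB0)" "lin S S (tS kA0 kB1)" "lin S S (tS kA0 kB0)"
  by (rule lin_tensor_map X.lin_k0 X.lin_k1 Y.lin_k0 Y.lin_k1)+

lemma lin_P2: "lin S S P2" and lin_P1: "lin S S P1" and lin_P0: "lin S S P0"
  unfolding P2_def P1_def P0_def by (rule lin_k lin_sum)+

lemma P_pure:
  assumes "v \<in> carrier HA" "w \<in> carrier HB"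
  shows "P2 (pure_tensor HA HB v w) = pure_tensor HA HB (kA1 v) (kB1 w)"
    and "P1 (pure_tensor HA HB v w) = pure_tensor HA HB (kA1 v) (kB0 w) \<oplus>\<^bsub>S\<^esub> pure_tensor HA HB (kA0 v) (kB1 w)"
    and "P0 (pure_tensor HA HB v w) = pure_tensor HA HB (kA0 v) (kB0 w)"
  using assms by (simp_all add: P2_def P1_def P0_def tensor_map_pure X.lin_k0 X.lin_k1 Y.lin_k0 Y.lin_k1)

lemmas P_lin_simps = lin_simps[OF lin_P2] lin_simps[OF lin_P1] lin_simps[OF lin_P0]
lemmas P_simps = P_lin_simps P_pure
  X.k_simps Y.k_simps TH.D_pure TH.Db_pure TH.pure_simps X.H.op_simps Y.H.op_simps TH.T_simps

lemma P_sum: "t \<in> carrier S \<Longrightarrow> P2 t \<oplus>\<^bsub>S\<^esub> (P1 t \<oplus>\<^bsub>S\<^esub> P0 t) = t"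
proof (rule tensor_lin_eq[OF X.H.V Y.H.V lin_sum[OF lin_P2 lin_sum[OF lin_P1 lin_P0]] lin_id[OF TH.T]])
  fix v w assume v: "v \<in> carrier HA" and w: "w \<in> carrier HB"
  let ?p = "pure_tensor HA HB"
  have "?p v w = ?p (kA0 v \<oplus>\<^bsub>HA\<^esub> kA1 v) (kB0 w \<oplus>\<^bsub>HB\<^esub> kB1 w)"
    using v w by (simp add: X.k_sum Y.k_sum)
  also have "\<dots> = P2 (?p v w) \<oplus>\<^bsub>S\<^esub> (P1 (?p v w) \<oplus>\<^bsub>S\<^esub> P0 (?p v w))"
    by (rule vs_eqI[OF TH.T]) (use v w in \<open>simp_all add: P_simps TH.Temb\<close>)
  finally show "P2 (?p v w) \<oplus>\<^bsub>S\<^esub> (P1 (?p v w) \<oplus>\<^bsub>S\<^esub> P0 (?p v w)) = ?p v w" by simp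
qed

lemma P_idem:
  assumes "t \<in> carrier S"
  shows "P2 (P2 t) = P2 t" "P1 (P1 t) = P1 t" "P0 (P0 t) = P0 t"
    and "P2 (P1 t) = \<zero>\<^bsub>S\<^esub>" "P2 (P0 t) = \<zero>\<^bsub>S\<^esub>" "P1 (P2 t) = \<zero>\<^bsub>S\<^esub>" "P1 (P0 t) = \<zero>\<^bsub>S\<^esub>"
    and "P0 (P2 t) = \<zero>\<^bsub>S\<^esub>" "P0 (P1 t) = \<zero>\<^bsub>S\<^esub>"
proof -
  note r = tensor_lin_eq[OF X.H.V Y.H.V _ _ _ assms]
  note z = lin_0[OF TH.T TH.T]
  show "P2 (P2 t) = P2 t" by (rule r[OF lin_comp[OF lin_P2 lin_P2] lin_P2]) (simp add: P_simps)
  show "P1 (P1 t) = P1 t" by (rule r[OF lin_comp[OF lin_P1 lin_P1] lin_P1]) (simp add: P_simps)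
  show "P0 (P0 t) = P0 t" by (rule r[OF lin_comp[OF lin_P0 lin_P0] lin_P0]) (simp add: P_simps)
  show "P2 (P1 t) = \<zero>\<^bsub>S\<^esub>" by (rule r[OF lin_comp[OF lin_P1 lin_P2] z]) (simp add: P_simps)
  show "P2 (P0 t) = \<zero>\<^bsub>S\<^esub>" by (rule r[OF lin_comp[OF lin_P0 lin_P2] z]) (simp add: P_simps)
  show "P1 (P2 t) = \<zero>\<^bsub>S\<^esub>" by (rule r[OF lin_comp[OF lin_P2 lin_P1] z]) (simp add: P_simps)
  show "P1 (P0 t) = \<zero>\<^bsub>S\<^esub>" by (rule r[OF lin_comp[OF lin_P0 lin_P1] z]) (simp add: P_simps)
  show "P0 (P2 t) = \<zero>\<^bsub>S\<^esub>" by (rule r[OF lin_comp[OF lin_P2 lin_P0] z]) (simp add: P_simps)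
  show "P0 (P1 t) = \<zero>\<^bsub>S\<^esub>" by (rule r[OF lin_comp[OF lin_P1 lin_P0] z]) (simp add: P_simps)
qed

lemma P_D:
  assumes "t \<in> carrier S"
  shows "P2 (TH.D t) = \<zero>\<^bsub>S\<^esub>" "P2 (TH.Db t) = \<zero>\<^bsub>S\<^esub>" "TH.D (P0 t) = \<zero>\<^bsub>S\<^esub>" "TH.Db (P0 t) = \<zero>\<^bsub>S\<^esub>"
    and "P1 (TH.D t) = TH.D (P2 t)" "P1 (TH.Db t) = TH.Db (P2 t)"
    and "P0 (TH.D t) = TH.D (P1 t)" "P0 (TH.Db t) = TH.Db (P1 t)"
proof -
  note r = tensor_lin_eq[OF X.H.V Y.H.V _ _ _ assms]
  note z = lin_0[OF TH.T TH.T]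
  show "P2 (TH.D t) = \<zero>\<^bsub>S\<^esub>" by (rule r[OF lin_comp[OF TH.lin_D lin_P2] z]) (simp add: P_simps)
  show "P2 (TH.Db t) = \<zero>\<^bsub>S\<^esub>" by (rule r[OF lin_comp[OF TH.lin_Db lin_P2] z]) (simp add: P_simps)
  show "TH.D (P0 t) = \<zero>\<^bsub>S\<^esub>" by (rule r[OF lin_comp[OF lin_P0 TH.lin_D] z]) (simp add: P_simps)
  show "TH.Db (P0 t) = \<zero>\<^bsub>S\<^esub>" by (rule r[OF lin_comp[OF lin_P0 TH.lin_Db] z]) (simp add: P_simps)
  have *: "x = y" if "vs_emb S x = vs_emb S y" "x \<in> carrier S" "y \<in> carrier S" for x y
    by (rule vs_eqI[OF TH.T]) (use that in auto)
  show "P1 (TH.D t) = TH.D (P2 t)"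
    by (rule r[OF lin_comp[OF TH.lin_D lin_P1] lin_comp[OF lin_P2 TH.lin_D]], rule *) (simp_all add: P_simps TH.Temb)
  show "P1 (TH.Db t) = TH.Db (P2 t)"
    by (rule r[OF lin_comp[OF TH.lin_Db lin_P1] lin_comp[OF lin_P2 TH.lin_Db]], rule *) (simp_all add: P_simps TH.Temb)
  show "P0 (TH.D t) = TH.D (P1 t)"
    by (rule r[OF lin_comp[OF TH.lin_D lin_P0] lin_comp[OF lin_P1 TH.lin_D]], rule *) (simp_all add: P_simps TH.Temb)
  show "P0 (TH.Db t) = TH.Db (P1 t)"
    by (rule r[OF lin_comp[OF TH.lin_Db lin_P0] lin_comp[OF lin_P1 TH.lin_Db]], rule *) (simp_all add: P_simps TH.Temb)
qed

text \<open>If \<open>kA1 x\<close> is recovered from the differentials of \<open>x\<close>, then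
  \<open>P2 t\<close> is recovered from those of \<open>t\<close>: using \<open>kB1\<close> in the
  second factor removes the contributions of \<open>dHB\<close> and \<open>bHB\<close>, because
  \<open>kB1\<close> vanishes on their images.\<close>

lemma P2_closed:
  assumes h: "lin HA HA h" "lin HA HA h'" and k1: "\<And>x. x \<in> carrier HA \<Longrightarrow> kA1 x = h (dHA x) \<oplus>\<^bsub>HA\<^esub> h' (bHA x)"
    and t: "t \<in> carrier S" and d: "TH.D t = \<zero>\<^bsub>S\<^esub>" and b: "TH.Db t = \<zero>\<^bsub>S\<^esub>"
  shows "P2 t = \<zero>\<^bsub>S\<^esub>"
proof -
  note l = lin_tensor_map[OF h(1) Y.lin_k1] lin_tensor_map[OF h(2) Y.lin_k1]
  have "P2 t = tS h kB1 (TH.D t) \<oplus>\<^bsub>S\<^esub> tS h' kB1 (TH.Db t)"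
    by (rule tensor_lin_eq[OF X.H.V Y.H.V lin_P2 lin_sum[OF lin_comp[OF TH.lin_D l(1)] lin_comp[OF TH.lin_Db l(2)]] _ t])
      (simp add: P_simps lin_simps[OF l(1)] lin_simps[OF l(2)] lin_simps[OF h(1)] lin_simps[OF h(2)]
        tensor_map_pure[OF h(1) Y.lin_k1] tensor_map_pure[OF h(2) Y.lin_k1] k1)
  then show ?thesis by (simp add: d b lin_zero[OF l(1)] lin_zero[OF l(2)] vs_zero_simps[OF TH.T])
qed

text \<open>Dual to \<open>P2_closed\<close>: \<open>dHB\<close> and \<open>bHB\<close> vanish on
  the range of \<open>kB0\<close>, so an expression of \<open>kA0\<close> by images of the
  differentials gives one of \<open>P0\<close>.\<close>

lemma P0_im:
  assumes h: "lin HA HA h" "lin HA HA h'" and k0: "\<And>x. x \<in> carrier HA \<Longrightarrow> kA0 x = dHA (h x) \<oplus>\<^bsub>HA\<^esub> bHA (h' x)"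
    and t: "t \<in> carrier S"
  obtains y z where "y \<in> carrier S" "z \<in> carrier S" "P0 t = TH.D y \<oplus>\<^bsub>S\<^esub> TH.Db z"
proof
  note l = lin_tensor_map[OF h(1) Y.lin_k0] lin_tensor_map[OF h(2) Y.lin_k0]
  show "tS h kB0 t \<in> carrier S" "tS h' kB0 t \<in> carrier S" using t by (simp_all add: lin_closed[OF l(1)] lin_closed[OF l(2)])
  show "P0 t = TH.D (tS h kB0 t) \<oplus>\<^bsub>S\<^esub> TH.Db (tS h' kB0 t)"
    by (rule tensor_lin_eq[OF X.H.V Y.H.V lin_P0 lin_sum[OF lin_comp[OF l(1) TH.lin_D] lin_comp[OF l(2) TH.lin_Db]] _ t])
      (simp add: P_simps lin_simps[OF h(1)] lin_simps[OF h(2)]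
        tensor_map_pure[OF h(1) Y.lin_k0] tensor_map_pure[OF h(2) Y.lin_k0] k0)
qed

end

section \<open>Bigraded spaces\<close>

lemma finsum_in_subsp:
  assumes U: "subsp V U" and K: "finite K" "\<And>i. i \<in> K \<Longrightarrow> f i \<in> U"
  shows "finsum V f K \<in> U"
proof -
  interpret V: vectorspace CC V by (rule subspD(1)[OF U])
  have c: "\<And>i. i \<in> K \<Longrightarrow> f i \<in> carrier V" using K(2) subspD(3)[OF U] by blast
  show ?thesis using K c
  proof (induction K rule: finite_induct)
    case empty
    then show ?case using subspD(2)[OF U] by simp
  next
    case (insert i K)
    then have "finsum V f (insert i K) = f i \<oplus>\<^bsub>V\<^esub> finsum V f K"
      by (intro V.M.finsum_insert) auto
    then show ?case using insert by (simp add: subspD(4)[OF U])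
  qed
qed

lemma finsum_zero_ext:
  assumes V: "vs V" and "finite K" "J \<subseteq> K" "\<And>i. i \<in> K \<Longrightarrow> f i \<in> carrier V" "\<And>i. i \<in> K - J \<Longrightarrow> f i = \<zero>\<^bsub>V\<^esub>"
  shows "finsum V f J = finsum V f K"
proof -
  interpret V: vectorspace CC V by (rule V)
  show ?thesis by (rule V.M.add.finprod_mono_neutral_cong_left) (use assms in auto)
qed

lemma lin_finsum:
  assumes f: "lin V W f" and K: "finite K" "\<And>i. i \<in> K \<Longrightarrow> x i \<in> carrier V"
  shows "f (finsum V x K) = finsum W (\<lambda>i. f (x i)) K"
proof -
  interpret V: vectorspace CC V by (rule lin_dom[OF f])
  interpret W: vectorspace CC W by (rule lin_cod[OF f])
  show ?thesis using K
  proof (induction K rule: finite_induct)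
    case empty
    then show ?case using lin_zero[OF f] by simp
  next
    case (insert i K)
    have "finsum V x (insert i K) = x i \<oplus>\<^bsub>V\<^esub> finsum V x K"
      using insert by (intro V.M.finsum_insert) auto
    moreover have "finsum W (\<lambda>i. f (x i)) (insert i K) = f (x i) \<oplus>\<^bsub>W\<^esub> finsum W (\<lambda>i. f (x i)) K"
      using insert by (intro W.M.finsum_insert) (auto simp: lin_closed[OF f])
    moreover have "finsum V x K \<in> carrier V" using insert by (intro V.M.finsum_closed) auto
    ultimately show ?case using insert by (simp add: lin_add[OF f])
  qed
qed

definition component :: "('a, 'm) bigraded_scheme \<Rightarrow> int \<times> int \<Rightarrow> 'a \<Rightarrow> 'a" where
  "component V i x = (THE c. decomposition V c x) i"

abbreviation support :: "('a, 'm) bigraded_scheme \<Rightarrow> 'a \<Rightarrow> (int \<times> int) set" where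
  "support V x \<equiv> {i. component V i x \<noteq> \<zero>\<^bsub>V\<^esub>}"

text \<open>For linear \<open>F i\<close> this is the linear map that acts as \<open>F i\<close> in
  bidegree \<open>i\<close>. Homogeneous parts are taken exactly as in the definition of
  \<open>degree_sign\<close>, which thereby becomes an instance.\<close>

definition component_sum ::
    "('a, 'm) bigraded_scheme \<Rightarrow> (complex, 'b, 'n) module_scheme \<Rightarrow> (int \<times> int \<Rightarrow> 'a \<Rightarrow> 'b) \<Rightarrow> 'a \<Rightarrow> 'b" where
  "component_sum V W F x = (\<Oplus>\<^bsub>W\<^esub> i \<in> support V x. F i (component V i x))"

abbreviation gr :: "('a, 'm) bigraded_scheme \<Rightarrow> int \<times> int \<Rightarrow> 'a set" where
  "gr V i \<equiv> grade V (fst i) (snd i)"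

locale graded_space =
  fixes V :: "('a, 'm) bigraded_scheme"
  assumes bigraded: "bigraded_space V"
begin

lemma V: "vs V"
  using bigraded by (simp add: bigraded_space_def)

lemma subsp_grade: "subsp V (grade V p q)"
  using bigraded by (simp add: bigraded_space_def)

lemma grade_carrier: "x \<in> grade V p q \<Longrightarrow> x \<in> carrier V"
  by (rule subspD(3)[OF subsp_grade])

lemma decomposition_component:
  assumes "x \<in> carrier V"
  shows "decomposition V (\<lambda>i. component V i x) x"
proof -
  have "\<exists>!c. decomposition V c x" using bigraded assms by (simp add: bigraded_space_def)
  from theI'[OF this] show ?thesis by (simp add: component_def)
qed

lemma component_unique:
  assumes x: "x \<in> carrier V" and c: "decomposition V c x"
  shows "component V i x = c i"
proof -
  have "\<exists>!c. decomposition V c x" using bigraded x by (simp add: bigraded_space_def)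
  then have "(THE c. decomposition V c x) = c" using c by (intro the1_equality)
  then show ?thesis by (simp add: component_def)
qed

lemma component_grade: "x \<in> carrier V \<Longrightarrow> component V i x \<in> gr V i"
  using decomposition_component[of x] by (cases i) (simp add: decomposition_def)

lemma component_closed: "x \<in> carrier V \<Longrightarrow> component V i x \<in> carrier V"
  using component_grade grade_carrier by blast

lemma finite_support: "x \<in> carrier V \<Longrightarrow> finite (support V x)"
  using decomposition_component[of x] by (simp add: decomposition_def)

lemma sum_components: "x \<in> carrier V \<Longrightarrow> (\<Oplus>\<^bsub>V\<^esub> i \<in> support V x. component V i x) = x"
  using decomposition_component[of x] unfolding decomposition_def by metis

text \<open>The finite set \<open>K\<close> may exceed the support, as it does for a sum of two
  elements where the union of both supports is taken.\<close>

lemma decompositionI: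
  assumes "finite K" "\<And>i. c i \<in> gr V i" "\<And>i. i \<notin> K \<Longrightarrow> c i = \<zero>\<^bsub>V\<^esub>" "x = (\<Oplus>\<^bsub>V\<^esub> i \<in> K. c i)"
  shows "decomposition V c x"
  unfolding decomposition_def
proof (intro conjI allI)
  show "c (p, q) \<in> grade V p q" for p q using assms(2)[of "(p, q)"] by simp
  have s: "{i. c i \<noteq> \<zero>\<^bsub>V\<^esub>} \<subseteq> K" using assms(3) by auto
  show "finite {i. c i \<noteq> \<zero>\<^bsub>V\<^esub>}" using s assms(1) by (rule finite_subset)
  show "x = (\<Oplus>\<^bsub>V\<^esub> i \<in> {i. c i \<noteq> \<zero>\<^bsub>V\<^esub>}. c i)"
    unfolding assms(4)
    by (rule finsum_zero_ext[symmetric, OF V assms(1) s grade_carrier[OF assms(2)]]) simp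
qed

lemma component_homogeneous:
  assumes x: "x \<in> gr V j"
  shows "component V i x = (if i = j then x else \<zero>\<^bsub>V\<^esub>)"
proof -
  interpret V: vectorspace CC V by (rule V)
  have xc: "x \<in> carrier V" using x by (rule grade_carrier)
  have "decomposition V (\<lambda>i. if i = j then x else \<zero>\<^bsub>V\<^esub>) x"
  proof (rule decompositionI[of "{j}"])
    show "x = (\<Oplus>\<^bsub>V\<^esub> i \<in> {j}. if i = j then x else \<zero>\<^bsub>V\<^esub>)" using xc by simp
  qed (use x subspD(2)[OF subsp_grade] in auto)
  from component_unique[OF xc this] show ?thesis by simp
qed

lemma component_sum_superset:
  assumes W: "vs W" and F: "\<And>i. lin V W (F i)" and x: "x \<in> carrier V"
    and K: "finite K" "support V x \<subseteq> K"
  shows "component_sum V W F x = (\<Oplus>\<^bsub>W\<^esub> i \<in> K. F i (component V i x))"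
  unfolding component_sum_def
  by (rule finsum_zero_ext[OF W K]) (use x in \<open>auto simp: lin_closed[OF F] component_closed lin_zero[OF F]\<close>)

lemma sum_components_superset:
  assumes x: "x \<in> carrier V" and K: "finite K" "support V x \<subseteq> K"
  shows "x = (\<Oplus>\<^bsub>V\<^esub> i \<in> K. component V i x)"
proof -
  have "x = (\<Oplus>\<^bsub>V\<^esub> i \<in> support V x. component V i x)" using sum_components[OF x] by simp
  also have "\<dots> = (\<Oplus>\<^bsub>V\<^esub> i \<in> K. component V i x)"
    by (rule finsum_zero_ext[OF V K]) (use x component_closed in auto)
  finally show ?thesis .
qed

lemma lin_component: "lin V V (component V i)"
proof (rule linI[OF V V])
  interpret V: vectorspace CC V by (rule V)
  show "component V i x \<in> carrier V" if "x \<in> carrier V" for x using that by (rule component_closed)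
  show "component V i (x \<oplus>\<^bsub>V\<^esub> y) = component V i x \<oplus>\<^bsub>V\<^esub> component V i y"
    if x: "x \<in> carrier V" and y: "y \<in> carrier V" for x y
  proof (rule component_unique)
    let ?K = "support V x \<union> support V y"
    have K: "finite ?K" using x y finite_support by blast
    show "decomposition V (\<lambda>i. component V i x \<oplus>\<^bsub>V\<^esub> component V i y) (x \<oplus>\<^bsub>V\<^esub> y)"
    proof (rule decompositionI[OF K])
      have "x \<oplus>\<^bsub>V\<^esub> y = (\<Oplus>\<^bsub>V\<^esub> i \<in> ?K. component V i x) \<oplus>\<^bsub>V\<^esub> (\<Oplus>\<^bsub>V\<^esub> i \<in> ?K. component V i y)"
        using sum_components_superset[OF x K] sum_components_superset[OF y K] by simp
      also have "\<dots> = (\<Oplus>\<^bsub>V\<^esub> i \<in> ?K. component V i x \<oplus>\<^bsub>V\<^esub> component V i y)"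
        by (rule V.M.finsum_addf[symmetric]) (use x y component_closed in auto)
      finally show "x \<oplus>\<^bsub>V\<^esub> y = (\<Oplus>\<^bsub>V\<^esub> i \<in> ?K. component V i x \<oplus>\<^bsub>V\<^esub> component V i y)" .
    qed (use x y component_grade subspD(4)[OF subsp_grade] vs_zero_simps[OF V] in auto)
  qed (use x y V in auto)
  show "component V i (c \<odot>\<^bsub>V\<^esub> x) = c \<odot>\<^bsub>V\<^esub> component V i x"
    if x: "x \<in> carrier V" for c x
  proof (rule component_unique)
    have K: "finite (support V x)" using x finite_support by blast
    show "decomposition V (\<lambda>i. c \<odot>\<^bsub>V\<^esub> component V i x) (c \<odot>\<^bsub>V\<^esub> x)"
    proof (rule decompositionI[OF K])
      have "c \<odot>\<^bsub>V\<^esub> x = c \<odot>\<^bsub>V\<^esub> (\<Oplus>\<^bsub>V\<^esub> i \<in> support V x. component V i x)"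
        using sum_components[OF x] by simp
      also have "\<dots> = (\<Oplus>\<^bsub>V\<^esub> i \<in> support V x. c \<odot>\<^bsub>V\<^esub> component V i x)"
        by (rule V.finsum_smult) (use x component_closed in auto)
      finally show "c \<odot>\<^bsub>V\<^esub> x = (\<Oplus>\<^bsub>V\<^esub> i \<in> support V x. c \<odot>\<^bsub>V\<^esub> component V i x)" .
    qed (use x component_grade subspD(5)[OF subsp_grade] vs_zero_simps[OF V] in auto)
  qed (use x V in auto)
qed

lemma lin_component_sum:
  assumes W: "vs W" and F: "\<And>i. lin V W (F i)"
  shows "lin V W (component_sum V W F)"
proof (rule linI[OF V W])
  interpret W: vectorspace CC W by (rule W)
  note c = lin_closed[OF F component_closed]
  show "component_sum V W F x \<in> carrier W" if "x \<in> carrier V" for x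
    unfolding component_sum_def by (rule W.M.finsum_closed) (use that c in auto)
  show "component_sum V W F (x \<oplus>\<^bsub>V\<^esub> y) = component_sum V W F x \<oplus>\<^bsub>W\<^esub> component_sum V W F y"
    if x: "x \<in> carrier V" and y: "y \<in> carrier V" for x y
  proof -
    let ?K = "support V x \<union> support V y"
    have K: "finite ?K" using x y finite_support by blast
    have s: "support V (x \<oplus>\<^bsub>V\<^esub> y) \<subseteq> ?K"
      using x y vs_zero_simps[OF V] by (auto simp: lin_add[OF lin_component])
    have xy: "x \<oplus>\<^bsub>V\<^esub> y \<in> carrier V" using x y V by simp
    have "component_sum V W F (x \<oplus>\<^bsub>V\<^esub> y) = (\<Oplus>\<^bsub>W\<^esub> i \<in> ?K. F i (component V i (x \<oplus>\<^bsub>V\<^esub> y)))"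
      by (rule component_sum_superset[OF W F xy K s])
    also have "\<dots> = (\<Oplus>\<^bsub>W\<^esub> i \<in> ?K. F i (component V i x) \<oplus>\<^bsub>W\<^esub> F i (component V i y))"
      by (rule W.M.finsum_cong')
        (use x y c in \<open>auto simp: lin_add[OF lin_component] lin_add[OF F] component_closed\<close>)
    also have "\<dots> = (\<Oplus>\<^bsub>W\<^esub> i \<in> ?K. F i (component V i x)) \<oplus>\<^bsub>W\<^esub> (\<Oplus>\<^bsub>W\<^esub> i \<in> ?K. F i (component V i y))"
      by (rule W.M.finsum_addf) (use x y c in auto)
    finally show ?thesis
      using component_sum_superset[OF W F x K] component_sum_superset[OF W F y K] by simp
  qed
  show "component_sum V W F (a \<odot>\<^bsub>V\<^esub> x) = a \<odot>\<^bsub>W\<^esub> component_sum V W F x" if x: "x \<in> carrier V" for a x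
  proof -
    have K: "finite (support V x)" using x finite_support by blast
    have s: "support V (a \<odot>\<^bsub>V\<^esub> x) \<subseteq> support V x"
      using x vs_zero_simps[OF V] by (auto simp: lin_smult[OF lin_component])
    have ax: "a \<odot>\<^bsub>V\<^esub> x \<in> carrier V" using x V by simp
    have "component_sum V W F (a \<odot>\<^bsub>V\<^esub> x) = (\<Oplus>\<^bsub>W\<^esub> i \<in> support V x. F i (component V i (a \<odot>\<^bsub>V\<^esub> x)))"
      by (rule component_sum_superset[OF W F ax K s])
    also have "\<dots> = (\<Oplus>\<^bsub>W\<^esub> i \<in> support V x. a \<odot>\<^bsub>W\<^esub> F i (component V i x))"
      by (rule W.M.finsum_cong')
        (use x c in \<open>auto simp: lin_smult[OF lin_component] lin_smult[OF F] component_closed W\<close>)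
    also have "\<dots> = a \<odot>\<^bsub>W\<^esub> component_sum V W F x"
      unfolding component_sum_def by (rule W.finsum_smult[symmetric]) (use x c in auto)
    finally show ?thesis .
  qed
qed

lemma component_sum_homogeneous:
  assumes W: "vs W" and F: "\<And>i. lin V W (F i)" and x: "x \<in> gr V j"
  shows "component_sum V W F x = F j x"
proof -
  interpret W: vectorspace CC W by (rule W)
  have xc: "x \<in> carrier V" using x by (rule grade_carrier)
  have "component_sum V W F x = (\<Oplus>\<^bsub>W\<^esub> i \<in> {j}. F i (component V i x))"
    by (rule component_sum_superset[OF W F xc]) (auto simp: component_homogeneous[OF x])
  then show ?thesis using lin_closed[OF F xc] by (simp add: component_homogeneous[OF x])
qed

lemma homogeneous_induct:
  assumes U: "subsp V U" and "\<And>j. gr V j \<subseteq> U"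
  shows "carrier V \<subseteq> U"
proof
  fix x assume x: "x \<in> carrier V"
  have "(\<Oplus>\<^bsub>V\<^esub> i \<in> support V x. component V i x) \<in> U"
    by (rule finsum_in_subsp[OF U finite_support[OF x]]) (use assms(2) component_grade[OF x] in blast)
  then show "x \<in> U" using sum_components[OF x] by simp
qed

lemma homogeneous_lin_eq:
  assumes f: "lin V W f" and g: "lin V W g" and "\<And>j x. x \<in> gr V j \<Longrightarrow> f x = g x" and x: "x \<in> carrier V"
  shows "f x = g x"
proof -
  note W = lin_cod[OF f]
  have "carrier V \<subseteq> {x \<in> carrier V. f x \<ominus>\<^bsub>W\<^esub> g x = \<zero>\<^bsub>W\<^esub>}"
    by (rule homogeneous_induct[OF subsp_ker[OF lin_diff[OF f g]]])
      (use assms(3) grade_carrier vs_r_neg[OF W lin_closed[OF g]] in auto)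
  then have "f x \<ominus>\<^bsub>W\<^esub> g x = \<zero>\<^bsub>W\<^esub>" using x by blast
  then have "vs_emb W (f x \<ominus>\<^bsub>W\<^esub> g x) = vs_emb W \<zero>\<^bsub>W\<^esub>" by simp
  then show ?thesis
    using lin_closed[OF f x] lin_closed[OF g x] by (intro vs_eqI[OF W]) (simp_all add: emb_simps[OF W])
qed

definition sgn_op :: "int \<times> int \<Rightarrow> 'a \<Rightarrow> 'a" where
  "sgn_op i x = (if even (fst i + snd i) then x else \<ominus>\<^bsub>V\<^esub> x)"

lemma lin_sgn_op: "lin V V (sgn_op i)"
proof (cases "even (fst i + snd i)")
  case True
  show ?thesis by (rule lin_cong[OF lin_id[OF V]]) (use True in \<open>simp add: sgn_op_def\<close>)
next
  case False
  show ?thesis by (rule lin_cong[OF lin_neg[OF lin_id[OF V]]]) (use False in \<open>simp add: sgn_op_def\<close>)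
qed

lemma degree_sign_eq: "degree_sign V x = component_sum V V sgn_op x"
  by (simp add: degree_sign_def component_sum_def component_def sgn_op_def Let_def)

lemma lin_degree_sign: "lin V V (degree_sign V)"
  using lin_cong[OF lin_component_sum[OF V lin_sgn_op]] degree_sign_eq by simp

lemma degree_sign_homogeneous:
  "x \<in> gr V j \<Longrightarrow> degree_sign V x = (if even (fst j + snd j) then x else \<ominus>\<^bsub>V\<^esub> x)"
  using component_sum_homogeneous[OF V lin_sgn_op, of x j] by (simp add: degree_sign_eq sgn_op_def)

lemma degree_sign_involutive: "x \<in> carrier V \<Longrightarrow> degree_sign V (degree_sign V x) = x"
  by (rule homogeneous_lin_eq[OF lin_comp[OF lin_degree_sign lin_degree_sign] lin_id[OF V]])
    (simp_all add: degree_sign_homogeneous lin_uminus[OF lin_degree_sign] grade_carrier vs_minus_minus[OF V])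

end

section \<open>Homogeneous linear maps\<close>

definition glin ::
    "int \<Rightarrow> int \<Rightarrow> ('a, 'm) bigraded_scheme \<Rightarrow> ('b, 'n) bigraded_scheme \<Rightarrow> ('a \<Rightarrow> 'b) \<Rightarrow> bool" where
  "glin a b V W f \<longleftrightarrow> lin V W f \<and> (\<forall>p q. f ` grade V p q \<subseteq> grade W (p + a) (q + b))"

lemma glin_lin: "glin a b V W f \<Longrightarrow> lin V W f"
  by (simp add: glin_def)

lemma glin_grade: "glin a b V W f \<Longrightarrow> x \<in> gr V i \<Longrightarrow> f x \<in> gr W (fst i + a, snd i + b)"
  by (auto simp: glin_def)

lemma glinI: "lin V W f \<Longrightarrow> (\<And>i x. x \<in> gr V i \<Longrightarrow> f x \<in> gr W (fst i + a, snd i + b)) \<Longrightarrow> glin a b V W f"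
  by (force simp: glin_def)

lemma glin_comp: "glin a b V W f \<Longrightarrow> glin a' b' W X g \<Longrightarrow> a'' = a + a' \<Longrightarrow> b'' = b + b' \<Longrightarrow> glin a'' b'' V X (\<lambda>x. g (f x))"
  by (rule glinI[OF lin_comp[OF glin_lin glin_lin]]) (auto dest!: glin_grade simp: add_ac)

lemma glin_id: "vs V \<Longrightarrow> glin 0 0 V V (\<lambda>x. x)"
  by (simp add: glin_def lin_id)

lemma (in graded_space) glin_sum: "glin a b W V f \<Longrightarrow> glin a b W V g \<Longrightarrow> glin a b W V (\<lambda>x. f x \<oplus>\<^bsub>V\<^esub> g x)"
  by (intro glinI lin_sum subspD(4)[OF subsp_grade]; (rule glin_lin | rule glin_grade); assumption)

lemma (in graded_space) glin_diff: "glin a b W V f \<Longrightarrow> glin a b W V g \<Longrightarrow> glin a b W V (\<lambda>x. f x \<ominus>\<^bsub>V\<^esub> g x)"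
  by (intro glinI lin_diff subsp_minus[OF subsp_grade]; (rule glin_lin | rule glin_grade); assumption)

text \<open>The parity of the shift in total degree decides: the differentials anticommute with the
  sign, homotopies of bidegree \<open>(-1, -1)\<close> and maps of bidegree \<open>(0, 0)\<close>
  commute with it.\<close>

lemma glin_degree_sign:
  assumes V: "bigraded_space V" and W: "bigraded_space W" and f: "glin a b V W f" and x: "x \<in> carrier V"
  shows "f (degree_sign V x) = (if even (a + b) then degree_sign W (f x) else \<ominus>\<^bsub>W\<^esub> degree_sign W (f x))"
proof -
  interpret V: graded_space V by (rule graded_space.intro[OF V])
  interpret W: graded_space W by (rule graded_space.intro[OF W])
  note l = glin_lin[OF f]
  have lr: "lin V W (\<lambda>x. if even (a + b) then degree_sign W (f x) else \<ominus>\<^bsub>W\<^esub> degree_sign W (f x))"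
    using lin_comp[OF l W.lin_degree_sign] lin_neg[OF lin_comp[OF l W.lin_degree_sign]]
    by (cases "even (a + b)") (simp_all only: if_True if_False)
  show ?thesis
  proof (rule V.homogeneous_lin_eq[OF lin_comp[OF V.lin_degree_sign l] lr _ x])
    fix j x assume x: "x \<in> gr V j"
    show "f (degree_sign V x) = (if even (a + b) then degree_sign W (f x) else \<ominus>\<^bsub>W\<^esub> degree_sign W (f x))"
      using V.grade_carrier[OF x] lin_closed[OF l V.grade_carrier[OF x]]
      by (auto simp: V.degree_sign_homogeneous[OF x] W.degree_sign_homogeneous[OF glin_grade[OF f x]]
          lin_uminus[OF l] vs_minus_minus[OF W.V])
  qed
qed

lemma glin_component:
  assumes V: "bigraded_space V" and W: "bigraded_space W" and f: "glin a b V W f" and x: "x \<in> carrier V"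
  shows "f (component V i x) = component W (fst i + a, snd i + b) (f x)"
proof -
  interpret V: graded_space V by (rule graded_space.intro[OF V])
  interpret W: graded_space W by (rule graded_space.intro[OF W])
  note l = glin_lin[OF f]
  show ?thesis
  proof (rule V.homogeneous_lin_eq[OF lin_comp[OF V.lin_component l] lin_comp[OF l W.lin_component] _ x])
    fix j x assume x: "x \<in> gr V j"
    show "f (component V i x) = component W (fst i + a, snd i + b) (f x)"
      by (auto simp: V.component_homogeneous[OF x] W.component_homogeneous[OF glin_grade[OF f x]]
          lin_zero[OF l] prod_eq_iff)
  qed
qed

text \<open>Of an arbitrary generalised inverse \<open>g0\<close> only the part of bidegree
  \<open>(-a, -b)\<close> is kept. Comparing the homogeneous parts of
  \<open>f (g0 (f x)) = f x\<close> for homogeneous \<open>x\<close> shows that this part is still a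
  generalised inverse.\<close>

lemma graded_generalized_inverse:
  assumes V: "bigraded_space V" and W: "bigraded_space W" and f: "glin a b V W f"
  obtains g where "glin (-a) (-b) W V g" "\<And>x. x \<in> carrier V \<Longrightarrow> f (g (f x)) = f x"
proof -
  interpret V: graded_space V by (rule graded_space.intro[OF V])
  interpret W: graded_space W by (rule graded_space.intro[OF W])
  note l = glin_lin[OF f]
  obtain g0 where g0: "lin W V g0" "\<And>x. x \<in> carrier V \<Longrightarrow> f (g0 (f x)) = f x"
    by (rule lin_generalized_inverse[OF l]) blast
  define F where "F i x = component V (fst i - a, snd i - b) (g0 x)" for i x
  have F: "lin W V (F i)" for i
    unfolding F_def by (rule lin_comp[OF g0(1) V.lin_component])
  define g where "g = component_sum W V F"
  have lg: "lin W V g" unfolding g_def by (rule W.lin_component_sum[OF V.V F])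
  have gh: "g x = F i x" if "x \<in> gr W i" for i x
    unfolding g_def by (rule W.component_sum_homogeneous[OF V.V F that])
  show thesis
  proof (rule that[of g])
    show "glin (-a) (-b) W V g"
    proof (rule glinI[OF lg])
      fix i x assume x: "x \<in> gr W i"
      show "g x \<in> gr V (fst i + - a, snd i + - b)"
        unfolding gh[OF x] F_def
        using V.component_grade[OF lin_closed[OF g0(1) W.grade_carrier[OF x]], of "(fst i - a, snd i - b)"] by simp
    qed
    fix x assume x: "x \<in> carrier V"
    show "f (g (f x)) = f x"
    proof (rule V.homogeneous_lin_eq[OF lin_comp[OF lin_comp[OF l lg] l] l _ x])
      fix j x assume x: "x \<in> gr V j"
      note xc = V.grade_carrier[OF x] and fx = glin_grade[OF f x]
      have "f (g (f x)) = f (component V j (g0 (f x)))"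
        unfolding gh[OF fx] F_def by simp
      also have "\<dots> = component W (fst j + a, snd j + b) (f (g0 (f x)))"
        using lin_closed[OF g0(1) lin_closed[OF l xc]] by (rule glin_component[OF V W f])
      also have "\<dots> = f x"
        unfolding g0(2)[OF xc] W.component_homogeneous[OF fx] by simp
      finally show "f (g (f x)) = f x" .
    qed
  qed
qed

text \<open>The homogeneous parts of \<open>x\<close> are the images under \<open>q\<close> of those
  of \<open>r x\<close>; a second decomposition of \<open>x\<close> would give, after applying
  \<open>r\<close>, a second one of \<open>r x\<close>. In this way \<open>H_BCA\<close> and
  \<open>H_ABC\<close> inherit their decompositions from \<open>A\<close>.\<close>

lemma bigraded_retract:
  assumes V: "bigraded_space V" and q: "glin 0 0 V H q" and r: "glin 0 0 H V r"
    and qr: "\<And>x. x \<in> carrier H \<Longrightarrow> q (r x) = x" and sub: "\<And>p q. subsp H (grade H p q)"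
  shows "bigraded_space H"
  unfolding bigraded_space_def
proof (intro conjI allI ballI)
  interpret V: graded_space V by (rule graded_space.intro[OF V])
  note lq = glin_lin[OF q] and lr = glin_lin[OF r]
  note H = lin_dom[OF lr]
  interpret H: vectorspace CC H by (rule H)
  show "vs H" by (rule H)
  show "subsp H (grade H p q)" for p q by (rule sub)
  fix x assume x: "x \<in> carrier H"
  have rx: "r x \<in> carrier V" using x by (rule lin_closed[OF lr])
  show "\<exists>!c. decomposition H c x"
  proof (rule ex1I)
    let ?c = "\<lambda>i. q (component V i (r x))"
    have fin: "finite (support V (r x))" by (rule V.finite_support[OF rx])
    have cl: "?c i \<in> carrier H" for i using rx by (intro lin_closed[OF lq] V.component_closed)
    have sub': "{i. ?c i \<noteq> \<zero>\<^bsub>H\<^esub>} \<subseteq> support V (r x)" using lin_zero[OF lq] by auto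
    have "x = q (\<Oplus>\<^bsub>V\<^esub> i \<in> support V (r x). component V i (r x))"
      using qr[OF x] V.sum_components[OF rx] by simp
    also have "\<dots> = (\<Oplus>\<^bsub>H\<^esub> i \<in> support V (r x). ?c i)"
      by (rule lin_finsum[OF lq fin]) (rule V.component_closed[OF rx])
    also have "\<dots> = (\<Oplus>\<^bsub>H\<^esub> i \<in> {i. ?c i \<noteq> \<zero>\<^bsub>H\<^esub>}. ?c i)"
      by (rule finsum_zero_ext[symmetric, OF H fin sub']) (use cl in auto)
    finally have sum: "x = (\<Oplus>\<^bsub>H\<^esub> i \<in> {i. ?c i \<noteq> \<zero>\<^bsub>H\<^esub>}. ?c i)" .
    show "decomposition H ?c x"
      unfolding decomposition_def
    proof (intro conjI allI)
      show "?c (p, q') \<in> grade H p q'" for p q'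
        using glin_grade[OF q V.component_grade[OF rx, of "(p, q')"]] by simp
      show "finite {i. ?c i \<noteq> \<zero>\<^bsub>H\<^esub>}" using sub' fin by (rule finite_subset)
    qed (rule sum)
    fix c assume c: "decomposition H c x"
    then have cg: "c i \<in> gr H i" for i by (cases i) (auto simp: decomposition_def)
    have cc: "c i \<in> carrier H" for i using cg[of i] subspD(3)[OF sub] by blast
    have fc: "finite {i. c i \<noteq> \<zero>\<^bsub>H\<^esub>}" and xc: "x = (\<Oplus>\<^bsub>H\<^esub> i \<in> {i. c i \<noteq> \<zero>\<^bsub>H\<^esub>}. c i)"
      using c unfolding decomposition_def by blast+
    have "decomposition V (\<lambda>i. r (c i)) (r x)"
    proof (rule V.decompositionI[OF fc])
      show "r (c i) \<in> gr V i" for i using glin_grade[OF r cg[of i]] by simp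
      show "i \<notin> {i. c i \<noteq> \<zero>\<^bsub>H\<^esub>} \<Longrightarrow> r (c i) = \<zero>\<^bsub>V\<^esub>" for i by (simp add: lin_zero[OF lr])
      have "r x = r (\<Oplus>\<^bsub>H\<^esub> i \<in> {i. c i \<noteq> \<zero>\<^bsub>H\<^esub>}. c i)" using arg_cong[OF xc, of r] .
      also have "\<dots> = (\<Oplus>\<^bsub>V\<^esub> i \<in> {i. c i \<noteq> \<zero>\<^bsub>H\<^esub>}. r (c i))" by (rule lin_finsum[OF lr fc cc])
      finally show "r x = (\<Oplus>\<^bsub>V\<^esub> i \<in> {i. c i \<noteq> \<zero>\<^bsub>H\<^esub>}. r (c i))" .
    qed
    from V.component_unique[OF rx this] have "component V i (r x) = r (c i)" for i .
    then show "c = ?c" using qr[OF cc] by (intro ext) simp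
  qed
qed

lemma (in graded_space) homogeneous_sum3_zero:
  assumes "x \<in> gr V i" "y \<in> gr V j" "z \<in> gr V k" "i \<noteq> j" "i \<noteq> k" "j \<noteq> k"
    and s: "x \<oplus>\<^bsub>V\<^esub> (y \<oplus>\<^bsub>V\<^esub> z) = \<zero>\<^bsub>V\<^esub>"
  shows "x = \<zero>\<^bsub>V\<^esub>" "y = \<zero>\<^bsub>V\<^esub>" "z = \<zero>\<^bsub>V\<^esub>"
proof -
  have "component V l (x \<oplus>\<^bsub>V\<^esub> (y \<oplus>\<^bsub>V\<^esub> z)) = \<zero>\<^bsub>V\<^esub>" for l unfolding s by (rule lin_zero[OF lin_component])
  then have *: "component V l x \<oplus>\<^bsub>V\<^esub> (component V l y \<oplus>\<^bsub>V\<^esub> component V l z) = \<zero>\<^bsub>V\<^esub>" for l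
    using assms(1-3) grade_carrier V by (simp add: lin_add[OF lin_component])
  show "x = \<zero>\<^bsub>V\<^esub>" "y = \<zero>\<^bsub>V\<^esub>" "z = \<zero>\<^bsub>V\<^esub>"
    using *[of i] *[of j] *[of k] assms(4-6) grade_carrier[OF assms(1)] grade_carrier[OF assms(2)] grade_carrier[OF assms(3)]
    by (simp_all add: component_homogeneous[OF assms(1)] component_homogeneous[OF assms(2)]
        component_homogeneous[OF assms(3)] vs_zero_simps[OF V] V lin_zero[OF lin_component])
qed

section \<open>Splitting off the squares of a bicomplex\<close>

locale proper_bicomplex =
  fixes A :: "'a bicomplex"
  assumes bicomplex: "bicomplex A"
begin

sublocale graded_space A
  by (rule graded_space.intro) (use bicomplex in \<open>simp add: bicomplex_def\<close>)

lemma lin_del: "lin A A (del A)" and lin_delbar: "lin A A (delbar A)"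
  using bicomplex by (simp_all add: bicomplex_def)

lemma glin_del: "glin 1 0 A A (del A)" and glin_delbar: "glin 0 1 A A (delbar A)"
  using bicomplex by (simp_all add: bicomplex_def glin_def)

lemma d_squared: "x \<in> carrier A \<Longrightarrow>
    del A (del A x \<oplus>\<^bsub>A\<^esub> delbar A x) \<oplus>\<^bsub>A\<^esub> delbar A (del A x \<oplus>\<^bsub>A\<^esub> delbar A x) = \<zero>\<^bsub>A\<^esub>"
  using bicomplex by (simp add: bicomplex_def Let_def)

text \<open>The square of the total differential of a homogeneous element has its three parts in
  three different bidegrees, so each of them vanishes.\<close>

lemma homogeneous_relations:
  assumes x: "x \<in> gr A i"
  shows "del A (del A x) = \<zero>\<^bsub>A\<^esub>" and "delbar A (delbar A x) = \<zero>\<^bsub>A\<^esub>"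
    and "delbar A (del A x) = \<ominus>\<^bsub>A\<^esub> del A (delbar A x)"
proof -
  note xc = grade_carrier[OF x]
  note cl = lin_closed[OF lin_del xc] lin_closed[OF lin_delbar xc]
    lin_closed[OF lin_del lin_closed[OF lin_del xc]] lin_closed[OF lin_del lin_closed[OF lin_delbar xc]]
    lin_closed[OF lin_delbar lin_closed[OF lin_del xc]] lin_closed[OF lin_delbar lin_closed[OF lin_delbar xc]]
  let ?y = "del A (delbar A x) \<oplus>\<^bsub>A\<^esub> delbar A (del A x)"
  have 1: "del A (del A x) \<in> gr A (fst i + 2, snd i)"
    using glin_grade[OF glin_del glin_grade[OF glin_del x]] by (simp add: add.assoc)
  have 3: "delbar A (delbar A x) \<in> gr A (fst i, snd i + 2)"
    using glin_grade[OF glin_delbar glin_grade[OF glin_delbar x]] by (simp add: add.assoc)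
  have 2: "?y \<in> gr A (fst i + 1, snd i + 1)"
    using glin_grade[OF glin_delbar glin_grade[OF glin_del x]] glin_grade[OF glin_del glin_grade[OF glin_delbar x]]
    by (auto intro!: subspD(4)[OF subsp_grade])
  have "del A (del A x) \<oplus>\<^bsub>A\<^esub> (?y \<oplus>\<^bsub>A\<^esub> delbar A (delbar A x)) =
      del A (del A x \<oplus>\<^bsub>A\<^esub> delbar A x) \<oplus>\<^bsub>A\<^esub> delbar A (del A x \<oplus>\<^bsub>A\<^esub> delbar A x)"
    by (rule vs_eqI[OF V]) (use cl xc in \<open>simp_all add: V lin_add[OF lin_del] lin_add[OF lin_delbar] emb_simps[OF V]\<close>)
  then have s: "del A (del A x) \<oplus>\<^bsub>A\<^esub> (?y \<oplus>\<^bsub>A\<^esub> delbar A (delbar A x)) = \<zero>\<^bsub>A\<^esub>"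
    using d_squared[OF xc] by simp
  have ne: "(fst i + 2, snd i) \<noteq> (fst i + 1, snd i + 1)" "(fst i + 2, snd i) \<noteq> (fst i, snd i + 2)"
    "(fst i + 1, snd i + 1) \<noteq> (fst i, snd i + 2)" by auto
  show "del A (del A x) = \<zero>\<^bsub>A\<^esub>" by (rule homogeneous_sum3_zero(1)[OF 1 2 3 ne s])
  show "delbar A (delbar A x) = \<zero>\<^bsub>A\<^esub>" by (rule homogeneous_sum3_zero(3)[OF 1 2 3 ne s])
  have y: "?y = \<zero>\<^bsub>A\<^esub>" by (rule homogeneous_sum3_zero(2)[OF 1 2 3 ne s])
  have "delbar A (del A x) = ?y \<ominus>\<^bsub>A\<^esub> del A (delbar A x)"
    by (rule vs_eqI[OF V]) (use cl in \<open>simp_all add: V emb_simps[OF V]\<close>)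
  also have "\<dots> = \<ominus>\<^bsub>A\<^esub> del A (delbar A x)"
    unfolding y by (rule vs_eqI[OF V]) (use cl in \<open>simp_all add: V emb_simps[OF V]\<close>)
  finally show "delbar A (del A x) = \<ominus>\<^bsub>A\<^esub> del A (delbar A x)" .
qed

sublocale double_complex A "del A" "delbar A" "degree_sign A"
proof (rule double_complex.intro)
  fix x assume x: "x \<in> carrier A"
  show "del A (del A x) = \<zero>\<^bsub>A\<^esub>"
    by (rule homogeneous_lin_eq[OF lin_comp[OF lin_del lin_del] lin_0[OF V V] _ x]) (rule homogeneous_relations)
  show "delbar A (delbar A x) = \<zero>\<^bsub>A\<^esub>"
    by (rule homogeneous_lin_eq[OF lin_comp[OF lin_delbar lin_delbar] lin_0[OF V V] _ x]) (rule homogeneous_relations)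
  show "delbar A (del A x) = \<ominus>\<^bsub>A\<^esub> del A (delbar A x)"
    by (rule homogeneous_lin_eq[OF lin_comp[OF lin_del lin_delbar] lin_neg[OF lin_comp[OF lin_delbar lin_del]] _ x])
      (rule homogeneous_relations)
  show "degree_sign A (degree_sign A x) = x" by (rule degree_sign_involutive[OF x])
  show "del A (degree_sign A x) = \<ominus>\<^bsub>A\<^esub> degree_sign A (del A x)"
    using glin_degree_sign[OF bigraded bigraded glin_del x] by simp
  show "delbar A (degree_sign A x) = \<ominus>\<^bsub>A\<^esub> degree_sign A (delbar A x)"
    using glin_degree_sign[OF bigraded bigraded glin_delbar x] by simp
qed (rule lin_del lin_delbar lin_degree_sign)+

end

text \<open>The square summands of a bicomplex are split off by an idempotent \<open>e\<close>, homotopic to the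
  identity in the sense that \<open>1 - e\<close> is a trace. The remaining part has \<open>del delbar = 0\<close>;
  there \<open>\<pi>\<close> projects along the kernel of both operators and \<open>\<mu>\<close> onto the sum of their images.\<close>

locale splitting = proper_bicomplex A for A :: "'a bicomplex" +
  fixes g e \<pi> \<mu> :: "'a \<Rightarrow> 'a"
  assumes glin_g: "glin (-1) (-1) A A g" and glin_e: "glin 0 0 A A e"
    and glin_pi: "glin 0 0 A A \<pi>" and glin_mu: "glin 0 0 A A \<mu>"
    and trace_g: "x \<in> carrier A \<Longrightarrow> htrace A (del A) (delbar A) g x = x \<ominus>\<^bsub>A\<^esub> e x"
    and ed: "x \<in> carrier A \<Longrightarrow> e (del A x) = del A (e x)"
    and eb: "x \<in> carrier A \<Longrightarrow> e (delbar A x) = delbar A (e x)"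
    and dbe: "x \<in> carrier A \<Longrightarrow> del A (delbar A (e x)) = \<zero>\<^bsub>A\<^esub>"
    and ee: "x \<in> carrier A \<Longrightarrow> e (e x) = e x"
    and e_pi: "x \<in> carrier A \<Longrightarrow> e (\<pi> x) = \<pi> x" and pi_e: "x \<in> carrier A \<Longrightarrow> \<pi> (e x) = \<pi> x"
    and pi_pi: "x \<in> carrier A \<Longrightarrow> \<pi> (\<pi> x) = \<pi> x"
    and pi_d: "x \<in> carrier A \<Longrightarrow> \<pi> (del A x) = \<zero>\<^bsub>A\<^esub>" and pi_b: "x \<in> carrier A \<Longrightarrow> \<pi> (delbar A x) = \<zero>\<^bsub>A\<^esub>"
    and d_pi: "x \<in> carrier A \<Longrightarrow> del A (\<pi> x) = del A (e x)"
    and b_pi: "x \<in> carrier A \<Longrightarrow> delbar A (\<pi> x) = delbar A (e x)"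
    and pi_form: "\<exists>h h'. lin A A h \<and> lin A A h' \<and> (\<forall>x\<in>carrier A. \<pi> x = h (del A x) \<oplus>\<^bsub>A\<^esub> h' (delbar A x))"
    and e_mu: "x \<in> carrier A \<Longrightarrow> e (\<mu> x) = \<mu> x" and mu_e: "x \<in> carrier A \<Longrightarrow> \<mu> (e x) = \<mu> x"
    and mu_mu: "x \<in> carrier A \<Longrightarrow> \<mu> (\<mu> x) = \<mu> x"
    and mu_d: "x \<in> carrier A \<Longrightarrow> \<mu> (del A x) = e (del A x)" and mu_b: "x \<in> carrier A \<Longrightarrow> \<mu> (delbar A x) = e (delbar A x)"
    and d_mu: "x \<in> carrier A \<Longrightarrow> del A (\<mu> x) = \<zero>\<^bsub>A\<^esub>" and b_mu: "x \<in> carrier A \<Longrightarrow> delbar A (\<mu> x) = \<zero>\<^bsub>A\<^esub>"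
    and mu_form: "\<exists>h h'. lin A A h \<and> lin A A h' \<and> (\<forall>x\<in>carrier A. \<mu> x = del A (h x) \<oplus>\<^bsub>A\<^esub> delbar A (h' x))"

context double_complex
begin

text \<open>
  \<open>S\<close> itself need not be idempotent; its cube is, because \<open>S\<close> cubed annihilates the trace of \<open>g\<close>.
\<close>

lemma square_idempotent:
  assumes g: "lin V V g" and gdbg: "\<And>x. x \<in> carrier V \<Longrightarrow> g (d (b (g x))) = g x"
    and dbg: "\<And>x. x \<in> carrier V \<Longrightarrow> d (b (g (d (b x)))) = d (b x)"
  defines "S \<equiv> \<lambda>x. x \<ominus>\<^bsub>V\<^esub> htrace V d b g x"
  shows square_lin: "lin V V S"
    and square_d: "x \<in> carrier V \<Longrightarrow> S (d x) = d (S x)" and square_b: "x \<in> carrier V \<Longrightarrow> S (b x) = b (S x)"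
    and square_db: "x \<in> carrier V \<Longrightarrow> S (d (b x)) = \<zero>\<^bsub>V\<^esub>"
    and square_dbS: "x \<in> carrier V \<Longrightarrow> d (b (S x)) = \<zero>\<^bsub>V\<^esub>"
    and square_e: "x \<in> carrier V \<Longrightarrow> S (S (S (S x))) = S (S (S x))"
proof -
  note gs = lin_simps[OF g]
  have T: "lin V V (htrace V d b g)" by (rule lin_htrace[OF lin_d lin_b g])
  show l: "lin V V S" unfolding S_def by (rule lin_diff[OF lin_id[OF V] T])
  note Ss = lin_simps[OF l]
  show Sd: "S (d x) = d (S x)" if "x \<in> carrier V" for x
    by (rule vs_eqI[OF V]) (use that in \<open>simp_all add: S_def htrace_def op_simps gs emb\<close>)
  show Sb: "S (b x) = b (S x)" if "x \<in> carrier V" for x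
    by (rule vs_eqI[OF V]) (use that in \<open>simp_all add: S_def htrace_def op_simps gs emb\<close>)
  \<comment> \<open>The term \<open>d b g\<close> of the trace reproduces \<open>d (b x)\<close> by
    \<open>dbg\<close>; in the others a differential meets \<open>d (b x)\<close> and kills
    it.\<close>
  show Sdb: "S (d (b x)) = \<zero>\<^bsub>V\<^esub>" if "x \<in> carrier V" for x
    by (rule vs_eqI[OF V]) (use that in \<open>simp_all add: S_def htrace_def op_simps gs emb dbg\<close>)
  show dbS: "d (b (S x)) = \<zero>\<^bsub>V\<^esub>" if "x \<in> carrier V" for x
    using Sdb[OF that] Sd[of "b x"] Sb[OF that] that by (simp add: op_simps)
  \<comment> \<open>By \<open>gdbg\<close> the term \<open>g d b\<close> of the trace cancels
    \<open>g x\<close>, so that only images of the differentials remain.\<close>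
  have Sg: "S (g x) = d (g (b (g x))) \<ominus>\<^bsub>V\<^esub> (b (g (d (g x))) \<oplus>\<^bsub>V\<^esub> d (b (g (g x))))" if "x \<in> carrier V" for x
    by (rule vs_eqI[OF V]) (use that in \<open>simp_all add: S_def htrace_def op_simps gs emb gdbg\<close>)
  have dSg: "\<exists>y\<in>carrier V. d (S (g x)) = d (b y)" if "x \<in> carrier V" for x
    by (rule bexI[of _ "\<ominus>\<^bsub>V\<^esub> g (d (g x))"], unfold Sg[OF that], rule vs_eqI[OF V])
      (use that in \<open>simp_all add: op_simps gs emb\<close>)
  have bSg: "\<exists>y\<in>carrier V. b (S (g x)) = d (b y)" if "x \<in> carrier V" for x
    by (rule bexI[of _ "\<ominus>\<^bsub>V\<^esub> g (b (g x))"], unfold Sg[OF that], rule vs_eqI[OF V])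
      (use that in \<open>simp_all add: op_simps gs emb\<close>)
  \<comment> \<open>Each application of \<open>S\<close> gains a differential: \<open>S g\<close> is
    a sum of images of \<open>d\<close> and \<open>b\<close>, \<open>S S g\<close> lies in the image
    of \<open>d b\<close> by \<open>dSg\<close> and \<open>bSg\<close>, and there \<open>S\<close>
    vanishes by \<open>Sdb\<close>.\<close>
  have SSSg: "S (S (S (g x))) = \<zero>\<^bsub>V\<^esub>" if x: "x \<in> carrier V" for x
  proof -
    obtain y where y: "y \<in> carrier V" "d (S (g (b (g x)))) = d (b y)"
      using dSg[of "b (g x)"] x by (auto simp: op_simps gs)
    obtain z where z: "z \<in> carrier V" "b (S (g (d (g x)))) = d (b z)"
      using bSg[of "d (g x)"] x by (auto simp: op_simps gs)
    have "S (S (g x)) = d (S (g (b (g x)))) \<ominus>\<^bsub>V\<^esub> (b (S (g (d (g x)))) \<oplus>\<^bsub>V\<^esub> \<zero>\<^bsub>V\<^esub>)"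
      unfolding Sg[OF x] using x by (simp add: op_simps gs Ss Sd Sb dbS)
    also have "\<dots> = d (b (y \<ominus>\<^bsub>V\<^esub> z))" unfolding y(2) z(2) using y(1) z(1) by (simp add: op_simps)
    finally show ?thesis using Sdb[of "y \<ominus>\<^bsub>V\<^esub> z"] y(1) z(1) by (simp add: op_simps)
  qed
  have SSST: "S (S (S (htrace V d b g x))) = \<zero>\<^bsub>V\<^esub>" if x: "x \<in> carrier V" for x
    using x by (simp add: htrace_def op_simps gs Ss Sd Sb SSSg)
  show "S (S (S (S x))) = S (S (S x))" if x: "x \<in> carrier V" for x
  proof -
    have "S x = x \<ominus>\<^bsub>V\<^esub> htrace V d b g x" by (simp add: S_def)
    then have "S (S (S (S x))) = S (S (S (x \<ominus>\<^bsub>V\<^esub> htrace V d b g x)))" by (rule arg_cong)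
    also have "\<dots> = S (S (S x)) \<ominus>\<^bsub>V\<^esub> S (S (S (htrace V d b g x)))"
      using x by (simp add: Ss lin_closed[OF T])
    finally have "S (S (S (S x))) = S (S (S x)) \<ominus>\<^bsub>V\<^esub> S (S (S (htrace V d b g x)))" .
    then show ?thesis using x by (simp add: SSST Ss op_simps)
  qed
qed

end

lemma (in proper_bicomplex) splitting_exists: "\<exists>g e \<pi> \<mu>. splitting A g e \<pi> \<mu>"
proof -
  let ?d = "del A" and ?b = "delbar A"
  have "glin 1 1 A A (\<lambda>x. ?d (?b x))" by (rule glin_comp[OF glin_delbar glin_del]) simp_all
  then obtain g0 where g0: "glin (-1) (-1) A A g0"
    "\<And>x. x \<in> carrier A \<Longrightarrow> ?d (?b (g0 (?d (?b x)))) = ?d (?b x)"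
    by (rule graded_generalized_inverse[OF bigraded bigraded]) blast
  \<comment> \<open>Makes the inverse reflexive: \<open>g\<close> keeps the identity satisfied by
    \<open>g0\<close> and also satisfies \<open>gdbg\<close>, which \<open>square_idempotent\<close>
    requires.\<close>
  define g where "g x = g0 (?d (?b (g0 x)))" for x
  have g: "glin (-1) (-1) A A g"
    unfolding g_def by (rule glin_comp[OF glin_comp[OF glin_comp[OF g0(1) glin_delbar] glin_del] g0(1)]) auto
  note lg0 = glin_lin[OF g0(1)] and lg = glin_lin[OF g]
  have gdbg: "g (?d (?b (g x))) = g x" if "x \<in> carrier A" for x
    using that g0(2) by (simp add: g_def op_simps lin_simps[OF lg0])
  have dbg: "?d (?b (g (?d (?b x)))) = ?d (?b x)" if "x \<in> carrier A" for x
    using that g0(2) by (simp add: g_def op_simps lin_simps[OF lg0])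
  define S where "S x = x \<ominus>\<^bsub>A\<^esub> htrace A ?d ?b g x" for x
  note sq = square_idempotent[OF lg gdbg dbg, folded S_def]
  note lS = sq(1) note Ss = lin_simps[OF lS] sq(2,3,5,6)
  have gT: "glin 0 0 A A (htrace A ?d ?b g)"
    unfolding htrace_def
    by (intro glin_sum glin_diff; (rule glin_comp[OF glin_comp[OF glin_delbar glin_del] g]
          glin_comp[OF glin_comp[OF glin_delbar g] glin_del] glin_comp[OF glin_comp[OF glin_del g] glin_delbar]
          glin_comp[OF glin_comp[OF g glin_delbar] glin_del])) auto
  have gS: "glin 0 0 A A S" unfolding S_def by (rule glin_diff[OF glin_id[OF V] gT])
  \<comment> \<open>A geometric sum: the trace of \<open>g\<close> is \<open>1 - S\<close> and
    \<open>u\<close> commutes with the differentials, so the trace of \<open>g u\<close> is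
    \<open>(1 - S) (1 + S + S^2) = 1 - S^3\<close>.\<close>
  define u where "u x = x \<oplus>\<^bsub>A\<^esub> (S x \<oplus>\<^bsub>A\<^esub> S (S x))" for x
  have gu: "glin 0 0 A A u"
    unfolding u_def by (intro glin_sum glin_id[OF V] gS glin_comp[OF gS gS]) auto
  note lu = glin_lin[OF gu]
  have ud: "u (?d x) = ?d (u x)" "u (?b x) = ?b (u x)" if "x \<in> carrier A" for x
    using that by (simp_all add: u_def op_simps Ss)
  define G where "G x = g (u x)" for x
  define e where "e x = S (S (S x))" for x
  have gG: "glin (-1) (-1) A A G" unfolding G_def by (rule glin_comp[OF gu g]) auto
  have ge: "glin 0 0 A A e" unfolding e_def by (intro glin_comp[OF glin_comp[OF gS gS] gS]) auto
  note le = glin_lin[OF ge]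
  note es = lin_simps[OF le]
  have ed: "e (?d x) = ?d (e x)" "e (?b x) = ?b (e x)" if "x \<in> carrier A" for x
    using that by (simp_all add: e_def op_simps Ss)
  have dbe: "?d (?b (e x)) = \<zero>\<^bsub>A\<^esub>" if "x \<in> carrier A" for x
    using that by (simp add: e_def op_simps Ss)
  have ee: "e (e x) = e x" if "x \<in> carrier A" for x
    using that by (simp add: e_def Ss)
  have tr: "htrace A ?d ?b G x = x \<ominus>\<^bsub>A\<^esub> e x" if x: "x \<in> carrier A" for x
  proof -
    have ux: "u x \<in> carrier A" using x by (rule lin_closed[OF lu])
    note T = lin_closed[OF glin_lin[OF gT]]
    have "htrace A ?d ?b G x = htrace A ?d ?b g (u x)"
      using x by (simp add: htrace_def G_def ud op_simps)
    also have "\<dots> = u x \<ominus>\<^bsub>A\<^esub> S (u x)"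
      by (rule vs_eqI[OF V]) (use ux T[OF ux] in \<open>simp_all add: S_def op_simps emb\<close>)
    also have "\<dots> = x \<ominus>\<^bsub>A\<^esub> e x"
      by (rule vs_eqI[OF V]) (use x in \<open>simp_all add: u_def e_def op_simps Ss emb\<close>)
    finally show ?thesis .
  qed
  obtain g2 where g2: "glin (-1) 0 A A g2" "\<And>x. x \<in> carrier A \<Longrightarrow> ?d (g2 (?d x)) = ?d x"
    by (rule graded_generalized_inverse[OF bigraded bigraded glin_del]) auto
  note lg2 = glin_lin[OF g2(1)]
  \<comment> \<open>\<open>c\<close> projects onto the kernel of \<open>del\<close>,
    \<open>c'\<close> projects along its image. Below, \<open>g3\<close> inverts
    \<open>delbar\<close> on that kernel and \<open>g4\<close> inverts \<open>delbar\<close> modulo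
    that image.\<close>
  define c where "c x = x \<ominus>\<^bsub>A\<^esub> g2 (?d x)" for x
  define c' where "c' x = x \<ominus>\<^bsub>A\<^esub> ?d (g2 x)" for x
  have gc: "glin 0 0 A A c" unfolding c_def by (intro glin_diff glin_id[OF V] glin_comp[OF glin_del g2(1)]) auto
  have gc': "glin 0 0 A A c'" unfolding c'_def by (intro glin_diff glin_id[OF V] glin_comp[OF g2(1) glin_del]) auto
  note lc = glin_lin[OF gc] and lc' = glin_lin[OF gc']
  have dc: "?d (c x) = \<zero>\<^bsub>A\<^esub>" if "x \<in> carrier A" for x
    by (rule vs_eqI[OF V]) (use that in \<open>simp_all add: c_def g2(2) op_simps lin_simps[OF lg2] emb\<close>)
  have c'd: "c' (?d x) = \<zero>\<^bsub>A\<^esub>" if "x \<in> carrier A" for x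
    by (rule vs_eqI[OF V]) (use that in \<open>simp_all add: c'_def g2(2) op_simps lin_simps[OF lg2] emb\<close>)
  have "glin 0 1 A A (\<lambda>x. ?b (c x))" by (rule glin_comp[OF gc glin_delbar]) auto
  then obtain g3 where g3: "glin 0 (-1) A A g3" "\<And>x. x \<in> carrier A \<Longrightarrow> ?b (c (g3 (?b (c x)))) = ?b (c x)"
    by (rule graded_generalized_inverse[OF bigraded bigraded]) auto
  have "glin 0 1 A A (\<lambda>x. c' (?b x))" by (rule glin_comp[OF glin_delbar gc']) auto
  then obtain g4 where g4: "glin 0 (-1) A A g4" "\<And>x. x \<in> carrier A \<Longrightarrow> c' (?b (g4 (c' (?b x)))) = c' (?b x)"
    by (rule graded_generalized_inverse[OF bigraded bigraded]) auto
  note lg3 = glin_lin[OF g3(1)] and lg4 = glin_lin[OF g4(1)]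
  note ls = lin_simps[OF lg2] lin_simps[OF lg3] lin_simps[OF lg4] lin_simps[OF lc] lin_simps[OF lc']
  \<comment> \<open>\<open>p\<close> is to have the same \<open>del\<close> and
    \<open>delbar\<close> as its argument: the first summand restores \<open>del\<close>, the second
    corrects \<open>delbar\<close> without leaving the kernel of \<open>del\<close>. Dually,
    \<open>m\<close> is to be the identity on both images: the first summand is so on the image of
    \<open>del\<close>, the second on that of \<open>delbar\<close> modulo the former.\<close>
  define p where "p x = g2 (?d x) \<oplus>\<^bsub>A\<^esub> c (g3 (?b (c x)))" for x
  define m where "m x = ?d (g2 x) \<oplus>\<^bsub>A\<^esub> c' (?b (g4 (c' x)))" for x
  have gp: "glin 0 0 A A p"
    unfolding p_def
    by (intro glin_sum; (rule glin_comp[OF glin_del g2(1)] glin_comp[OF glin_comp[OF glin_comp[OF gc glin_delbar] g3(1)] gc])) auto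
  have gm: "glin 0 0 A A m"
    unfolding m_def
    by (intro glin_sum; (rule glin_comp[OF g2(1) glin_del] glin_comp[OF glin_comp[OF glin_comp[OF gc' g4(1)] glin_delbar] gc'])) auto
  note lp = glin_lin[OF gp] and lm = glin_lin[OF gm]
  have dp: "?d (p x) = ?d x" if "x \<in> carrier A" for x
    using that by (simp add: p_def op_simps ls g2(2) dc)
  have bp: "?b (p x) = ?b x" if x: "x \<in> carrier A" for x
  proof -
    have "?b (p x) = ?b (g2 (?d x)) \<oplus>\<^bsub>A\<^esub> ?b (c x)"
      using x by (simp add: p_def op_simps ls g3(2))
    also have "\<dots> = ?b x"
      by (rule vs_eqI[OF V]) (use x in \<open>simp_all add: c_def op_simps ls emb\<close>)
    finally show ?thesis .
  qed
  have md: "m (?d x) = ?d x" if "x \<in> carrier A" for x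
    using that by (simp add: m_def op_simps ls g2(2) c'd)
  have mb: "m (?b x) = ?b x" if x: "x \<in> carrier A" for x
  proof -
    have "m (?b x) = ?d (g2 (?b x)) \<oplus>\<^bsub>A\<^esub> c' (?b x)"
      using x by (simp add: m_def op_simps ls g4(2))
    also have "\<dots> = ?b x"
      by (rule vs_eqI[OF V]) (use x in \<open>simp_all add: c'_def op_simps ls emb\<close>)
    finally show ?thesis .
  qed
  \<comment> \<open>Writing out the inner \<open>c\<close> in \<open>p\<close> shows that
    \<open>p x\<close> depends on \<open>del x\<close> and \<open>delbar x\<close> only.\<close>
  define h where "h y = g2 y \<ominus>\<^bsub>A\<^esub> c (g3 (?b (g2 y)))" for y
  define h' where "h' y = c (g3 y)" for y
  have lh: "lin A A h"
    unfolding h_def by (rule lin_diff[OF lg2 lin_comp[OF lin_comp[OF lin_comp[OF lg2 lin_delbar] lg3] lc]])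
  have lh': "lin A A h'" unfolding h'_def by (rule lin_comp[OF lg3 lc])
  have p_form: "p x = h (?d x) \<oplus>\<^bsub>A\<^esub> h' (?b x)" if x: "x \<in> carrier A" for x
  proof -
    have "?b (c x) = ?b x \<ominus>\<^bsub>A\<^esub> ?b (g2 (?d x))" using x by (simp add: c_def op_simps ls)
    then have "p x = g2 (?d x) \<oplus>\<^bsub>A\<^esub> (c (g3 (?b x)) \<ominus>\<^bsub>A\<^esub> c (g3 (?b (g2 (?d x)))))"
      using x by (simp add: p_def op_simps ls)
    also have "\<dots> = h (?d x) \<oplus>\<^bsub>A\<^esub> h' (?b x)"
      by (rule vs_eqI[OF V]) (use x in \<open>simp_all add: h_def h'_def op_simps ls emb\<close>)
    finally show ?thesis .
  qed
  \<comment> \<open>Writing out the outer \<open>c'\<close> in \<open>m\<close> shows dually that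
    \<open>m x\<close> is a sum of images of the two differentials.\<close>
  define k where "k y = g2 y \<ominus>\<^bsub>A\<^esub> g2 (?b (g4 (c' y)))" for y
  define k' where "k' y = g4 (c' y)" for y
  have lk: "lin A A k"
    unfolding k_def by (rule lin_diff[OF lg2 lin_comp[OF lin_comp[OF lin_comp[OF lc' lg4] lin_delbar] lg2]])
  have lk': "lin A A k'" unfolding k'_def by (rule lin_comp[OF lc' lg4])
  have m_form: "m x = ?d (k x) \<oplus>\<^bsub>A\<^esub> ?b (k' x)" if x: "x \<in> carrier A" for x
  proof -
    have y: "c' (?b y) = ?b y \<ominus>\<^bsub>A\<^esub> ?d (g2 (?b y))" if "y \<in> carrier A" for y by (simp add: c'_def)
    have "m x = ?d (g2 x) \<oplus>\<^bsub>A\<^esub> (?b (g4 (c' x)) \<ominus>\<^bsub>A\<^esub> ?d (g2 (?b (g4 (c' x)))))"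
      using x y[of "g4 (c' x)"] by (simp add: m_def ls)
    also have "\<dots> = ?d (k x) \<oplus>\<^bsub>A\<^esub> ?b (k' x)"
      by (rule vs_eqI[OF V]) (use x in \<open>simp_all add: k_def k'_def op_simps ls emb\<close>)
    finally show ?thesis .
  qed
  \<comment> \<open>Compression by \<open>e\<close> brings in \<open>dbe\<close>: with
    \<open>del delbar\<close> gone, \<open>\<pi>\<close> kills the images of both differentials, and
    both differentials kill the range of \<open>\<mu>\<close>.\<close>
  define \<pi> where "\<pi> x = e (p (e x))" for x
  define \<mu> where "\<mu> x = e (m (e x))" for x
  have g\<pi>: "glin 0 0 A A \<pi>" unfolding \<pi>_def by (rule glin_comp[OF glin_comp[OF ge gp] ge]) auto
  have g\<mu>: "glin 0 0 A A \<mu>" unfolding \<mu>_def by (rule glin_comp[OF glin_comp[OF ge gm] ge]) auto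
  note es' = es lin_simps[OF lp] lin_simps[OF lm] op_simps
  note fs = lin_simps[OF lh] lin_simps[OF lh'] lin_simps[OF lk] lin_simps[OF lk']
  have d\<pi>: "?d (\<pi> x) = ?d (e x)" "?b (\<pi> x) = ?b (e x)" if "x \<in> carrier A" for x
    using that by (simp_all add: \<pi>_def es' ed[symmetric] dp bp) (simp_all add: es' ed dp bp ee)
  have \<pi>_form: "\<pi> x = e (h (e (?d x))) \<oplus>\<^bsub>A\<^esub> e (h' (e (?b x)))" if "x \<in> carrier A" for x
    using that by (simp add: \<pi>_def es' p_form ed fs)
  have \<mu>_form: "\<mu> x = ?d (e (k (e x))) \<oplus>\<^bsub>A\<^esub> ?b (e (k' (e x)))" if "x \<in> carrier A" for x
    using that by (simp add: \<mu>_def es' m_form ed fs)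
  have z: "\<pi> x = \<zero>\<^bsub>A\<^esub>" if "x \<in> carrier A" "?d (e x) = \<zero>\<^bsub>A\<^esub>" "?b (e x) = \<zero>\<^bsub>A\<^esub>" for x
    using that by (simp add: \<pi>_form ed es' fs)
  note l\<pi> = glin_lin[OF g\<pi>]
  have \<mu>d: "\<mu> (?d x) = e (?d x)" "\<mu> (?b x) = e (?b x)" if "x \<in> carrier A" for x
    using that by (simp_all add: \<mu>_def ed es' md mb ee)
  have "splitting A G e \<pi> \<mu>"
  proof (rule splitting.intro[OF proper_bicomplex_axioms], rule splitting_axioms.intro, goal_cases)
    case 1 show ?case by (rule gG)
  next
    case 2 show ?case by (rule ge)
  next
    case 3 show ?case by (rule g\<pi>)
  next
    case 4 show ?case by (rule g\<mu>)
  next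
    case (5 x) then show ?case by (rule tr)
  next
    case (6 x) then show ?case by (rule ed)
  next
    case (7 x) then show ?case by (rule ed)
  next
    case (8 x) then show ?case by (rule dbe)
  next
    case (9 x) then show ?case by (rule ee)
  next
    case (10 x) then show ?case by (simp add: \<pi>_def ee es')
  next
    case (11 x) then show ?case by (simp add: \<pi>_def ee es')
  next
    case (12 x)
    have c: "\<pi> x \<in> carrier A" using 12 by (rule lin_closed[OF l\<pi>])
    have ep: "e (\<pi> x) = \<pi> x" using 12 by (simp add: \<pi>_def ee es')
    \<comment> \<open>\<open>e x\<close> and \<open>\<pi> x\<close> have the same differentials, so
      \<open>\<pi>\<close> kills their difference.\<close>
    have "\<pi> (e x \<ominus>\<^bsub>A\<^esub> \<pi> x) = \<zero>\<^bsub>A\<^esub>"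
      by (rule z) (use 12 c in \<open>simp_all add: es' ep ee d\<pi> vs_r_neg[OF V]\<close>)
    then have "\<pi> (e x) \<ominus>\<^bsub>A\<^esub> \<pi> (\<pi> x) = \<zero>\<^bsub>A\<^esub>" using 12 c by (simp add: lin_minus[OF l\<pi>] es')
    moreover have "\<pi> (e x) = \<pi> x" using 12 by (simp add: \<pi>_def ee es')
    ultimately have "\<pi> x \<ominus>\<^bsub>A\<^esub> \<pi> (\<pi> x) = \<zero>\<^bsub>A\<^esub>" by simp
    then have "vs_emb A (\<pi> x \<ominus>\<^bsub>A\<^esub> \<pi> (\<pi> x)) = vs_emb A \<zero>\<^bsub>A\<^esub>" by simp
    then show ?case
      by (intro vs_eqI[OF V]) (use c lin_closed[OF l\<pi> c] in \<open>simp_all add: emb\<close>)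
  next
    case (13 x) then show ?case by (intro z) (simp_all add: ed es' dbe)
  next
    case (14 x) then show ?case by (intro z) (simp_all add: ed es' dbe)
  next
    case (15 x) then show ?case by (rule d\<pi>)
  next
    case (16 x) then show ?case by (rule d\<pi>)
  next
    case 17
    show ?case
      by (rule exI[of _ "\<lambda>y. e (h (e y))"], rule exI[of _ "\<lambda>y. e (h' (e y))"])
        (simp add: \<pi>_form lin_comp[OF lin_comp[OF le lh] le] lin_comp[OF lin_comp[OF le lh'] le])
  next
    case (18 x) then show ?case by (simp add: \<mu>_def ee es')
  next
    case (19 x) then show ?case by (simp add: \<mu>_def ee es')
  next
    case (20 x)
    \<comment> \<open>\<open>\<mu> x\<close> is a sum of images, on which \<open>\<mu>\<close> acts
      as \<open>e\<close>.\<close>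
    have "\<mu> (\<mu> x) = e (\<mu> x)"
      using arg_cong[OF \<mu>_form[OF 20], of \<mu>] arg_cong[OF \<mu>_form[OF 20], of e] 20
      by (simp add: lin_simps[OF glin_lin[OF g\<mu>]] \<mu>d es' fs)
    then show ?case using 20 by (simp add: \<mu>_def ee es')
  next
    case (21 x) then show ?case by (rule \<mu>d)
  next
    case (22 x) then show ?case by (rule \<mu>d)
  next
    case (23 x) then show ?case by (simp add: \<mu>_form es' fs dbe)
  next
    case (24 x) then show ?case by (simp add: \<mu>_form es' fs dbe)
  next
    case 25
    show ?case
      by (rule exI[of _ "\<lambda>y. e (k (e y))"], rule exI[of _ "\<lambda>y. e (k' (e y))"])
        (simp add: \<mu>_form lin_comp[OF lin_comp[OF le lk] le] lin_comp[OF lin_comp[OF le lk'] le])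
  qed
  then show ?thesis by blast
qed

section \<open>Bott--Chern and Aeppli cohomology\<close>

lemma sub_space_simps [simp]:
  "carrier (sub_space V U) = U" "add (sub_space V U) = add V" "\<zero>\<^bsub>sub_space V U\<^esub> = \<zero>\<^bsub>V\<^esub>"
  "smult (sub_space V U) = smult V" "grade (sub_space V U) p q = grade V p q \<inter> U"
  by (simp_all add: sub_space_def)

lemma sub_space_coset [simp]: "W +>\<^bsub>sub_space V U\<^esub> x = W +>\<^bsub>V\<^esub> x"
  by (simp add: a_r_coset_def')

lemma vs_sub_space:
  assumes U: "subsp V U"
  shows "vs (sub_space V U)"
proof (rule vs_eqv)
  interpret V: vectorspace CC V by (rule subspD(1)[OF U])
  show "vs (V\<lparr>carrier := U\<rparr>)" by (rule V.subspace_is_vs[OF U])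
qed simp_all

lemma subsp_sub_space: "subsp V U \<Longrightarrow> subsp V W \<Longrightarrow> W \<subseteq> U \<Longrightarrow> subsp (sub_space V U) W"
  by (rule subspI[OF vs_sub_space]) (auto simp: subspD)

lemma lin_sub_space_from: "subsp V U \<Longrightarrow> lin V W f \<Longrightarrow> lin (sub_space V U) W f"
  by (rule linI[OF vs_sub_space]) (simp_all add: lin_cod lin_closed[of V W f] lin_add[of V W f] lin_smult[of V W f] subspD(3)[of U V])

lemma lin_sub_space_to:
  assumes f: "lin V W f" and U: "subsp W U" and "\<And>x. x \<in> carrier V \<Longrightarrow> f x \<in> U"
  shows "lin V (sub_space W U) f"
  by (rule linI[OF lin_dom[OF f] vs_sub_space[OF U]]) (simp_all add: assms(3) lin_add[OF f] lin_smult[OF f])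

lemma lin_sub_space_incl: "subsp V U \<Longrightarrow> lin (sub_space V U) V (\<lambda>x. x)"
  by (rule lin_sub_space_from[OF _ lin_id]) (auto simp: subspD)

lemma quot_space_simps [simp]:
  "carrier (quot_space V U) = (\<lambda>x. U +>\<^bsub>V\<^esub> x) ` carrier V" "\<zero>\<^bsub>quot_space V U\<^esub> = U"
  "add (quot_space V U) = add (quot_module V U)" "smult (quot_space V U) = smult (quot_module V U)"
  "grade (quot_space V U) p q = (\<lambda>x. U +>\<^bsub>V\<^esub> x) ` grade V p q"
proof -
  have "carrier (quot_space V U) = carrier (quot_module V U)" "\<zero>\<^bsub>quot_space V U\<^esub> = \<zero>\<^bsub>quot_module V U\<^esub>"
    by (simp_all add: quot_space_def module.defs bigraded.defs)
  then show "carrier (quot_space V U) = (\<lambda>x. U +>\<^bsub>V\<^esub> x) ` carrier V" "\<zero>\<^bsub>quot_space V U\<^esub> = U"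
    by simp_all
qed (simp_all add: quot_space_def module.defs bigraded.defs)

lemma lin_eqv:
  assumes "lin V W f" "vs V'" "vs W'"
    and "carrier V' = carrier V" "add V' = add V" "smult V' = smult V"
    and "carrier W' = carrier W" "add W' = add W" "smult W' = smult W"
  shows "lin V' W' f"
  by (rule linI[OF assms(2,3)])
    (simp_all add: assms(4-9) lin_closed[OF assms(1)] lin_add[OF assms(1)] lin_smult[OF assms(1)])

lemma vs_quot_space: "subsp V U \<Longrightarrow> vs (quot_space V U)"
  by (rule vs_eqv[OF vs_quot_module]) simp_all

lemma lin_quot_space_coset: "subsp V U \<Longrightarrow> lin V (quot_space V U) (\<lambda>x. U +>\<^bsub>V\<^esub> x)"
  by (rule lin_eqv[OF lin_coset]) (simp_all add: subspD(1) vs_quot_space)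

lemma lin_quot_space_lift:
  assumes "lin V W f" and U: "subsp V U" and "\<And>u. u \<in> U \<Longrightarrow> f u = \<zero>\<^bsub>W\<^esub>"
  shows "lin (quot_space V U) W (quot_lift f)"
  by (rule lin_eqv[OF lin_quot_lift[OF assms] vs_quot_space[OF U] lin_cod[OF assms(1)]]) simp_all

lemma lin_quot_space_map:
  assumes "lin V W f" and U: "subsp V U" and U': "subsp W U'" and "\<And>u. u \<in> U \<Longrightarrow> f u \<in> U'"
  shows "lin (quot_space V U) (quot_space W U') (quot_map W U' f)"
  by (rule lin_eqv[OF lin_quot_map(1)[OF assms] vs_quot_space[OF U] vs_quot_space[OF U']]) simp_all

lemma quot_map_sub_space [simp]: "quot_map (sub_space V U) W f = quot_map V W f"
  by (simp add: quot_map_def set_add_def' fun_eq_iff)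

lemma sum_space_simps [simp]:
  "carrier (sum_space V W) = carrier V \<times> carrier W" "\<zero>\<^bsub>sum_space V W\<^esub> = (\<zero>\<^bsub>V\<^esub>, \<zero>\<^bsub>W\<^esub>)"
  "x \<oplus>\<^bsub>sum_space V W\<^esub> y = (fst x \<oplus>\<^bsub>V\<^esub> fst y, snd x \<oplus>\<^bsub>W\<^esub> snd y)"
  "c \<odot>\<^bsub>sum_space V W\<^esub> x = (c \<odot>\<^bsub>V\<^esub> fst x, c \<odot>\<^bsub>W\<^esub> snd x)"
  "grade (sum_space V W) p q = grade V p q \<times> grade W p q"
  by (simp_all add: sum_space_def module.defs bigraded.defs direct_sum_def)

lemma vs_sum_space:
  assumes "vs V" "vs W"
  shows "vs (sum_space V W)"
proof (rule vs_eqv[OF direct_sum_is_vs[OF assms]])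
qed (simp_all add: sum_space_def module.defs bigraded.defs)

text \<open>
  Stated without the bigrading so that it applies to a tensor product, whose decomposition into
  homogeneous parts is never needed.
\<close>

locale ungraded_bicomplex =
  fixes X :: "'a bicomplex"
  assumes lin_d: "lin X X (del X)" and lin_b: "lin X X (delbar X)"
    and dd: "x \<in> carrier X \<Longrightarrow> del X (del X x) = \<zero>\<^bsub>X\<^esub>"
    and bb: "x \<in> carrier X \<Longrightarrow> delbar X (delbar X x) = \<zero>\<^bsub>X\<^esub>"
    and bd: "x \<in> carrier X \<Longrightarrow> delbar X (del X x) = \<ominus>\<^bsub>X\<^esub> del X (delbar X x)"
begin

lemma X: "vs X" by (rule lin_dom[OF lin_d])

abbreviation "Z \<equiv> ker_both X"
abbreviation "I \<equiv> im_deldelbar X"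
abbreviation "Y \<equiv> ker_deldelbar X"
abbreviation "M \<equiv> im_sum X"

definition "cBC x = I +>\<^bsub>X\<^esub> x"
definition "cA x = M +>\<^bsub>X\<^esub> x"

lemmas X_simps = lin_simps[OF lin_d] lin_simps[OF lin_b] dd bb bd vs_closed[OF X] vs_zero_simps[OF X]

lemma Z: "subsp X Z"
proof -
  have "Z = {x \<in> carrier X. del X x = \<zero>\<^bsub>X\<^esub>} \<inter> {x \<in> carrier X. delbar X x = \<zero>\<^bsub>X\<^esub>}"
    by (auto simp: ker_both_def)
  then show ?thesis using subsp_Int[OF subsp_ker[OF lin_d] subsp_ker[OF lin_b]] by simp
qed

lemma lin_db: "lin X X (\<lambda>x. del X (delbar X x))"
  by (rule lin_comp[OF lin_b lin_d])

lemma I: "subsp X I"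
  unfolding im_deldelbar_def by (rule subsp_image[OF lin_db subsp_carrier[OF X]])

lemma Y: "subsp X Y"
  unfolding ker_deldelbar_def by (rule subsp_ker[OF lin_db])

lemma M: "subsp X M"
  unfolding im_sum_def by (intro subsp_set_add subsp_image[OF lin_d] subsp_image[OF lin_b] subsp_carrier X)

lemma Z_iff: "z \<in> Z \<longleftrightarrow> z \<in> carrier X \<and> del X z = \<zero>\<^bsub>X\<^esub> \<and> delbar X z = \<zero>\<^bsub>X\<^esub>"
  by (simp add: ker_both_def)

lemma Y_iff: "y \<in> Y \<longleftrightarrow> y \<in> carrier X \<and> del X (delbar X y) = \<zero>\<^bsub>X\<^esub>"
  by (simp add: ker_deldelbar_def)

lemma M_iff: "m \<in> M \<longleftrightarrow> (\<exists>x\<in>carrier X. \<exists>y\<in>carrier X. m = del X x \<oplus>\<^bsub>X\<^esub> delbar X y)"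
  by (auto simp: im_sum_def set_add_eq)

lemma Z_carrier: "z \<in> Z \<Longrightarrow> z \<in> carrier X" and Y_carrier: "z \<in> Y \<Longrightarrow> z \<in> carrier X"
  and M_carrier: "z \<in> M \<Longrightarrow> z \<in> carrier X"
  using subspD(3)[OF Z] subspD(3)[OF Y] subspD(3)[OF M] by auto

lemma d_M: "x \<in> carrier X \<Longrightarrow> del X x \<in> M"
  unfolding M_iff by (intro bexI[of _ x] bexI[of _ "\<zero>\<^bsub>X\<^esub>"]) (simp_all add: X_simps)

lemma b_M: "x \<in> carrier X \<Longrightarrow> delbar X x \<in> M"
  unfolding M_iff by (rule bexI[of _ "\<zero>\<^bsub>X\<^esub>"], rule bexI[of _ x]) (simp_all add: X_simps)

lemma db_I: "x \<in> carrier X \<Longrightarrow> del X (delbar X x) \<in> I"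
  by (simp add: im_deldelbar_def)

lemma Z_Y: "Z \<subseteq> Y"
  by (auto simp: Z_iff Y_iff lin_zero[OF lin_d])

lemma I_Z: "I \<subseteq> Z"
  by (auto simp: im_deldelbar_def Z_iff X_simps)

lemma I_M: "I \<subseteq> M"
  by (auto simp: im_deldelbar_def X_simps intro!: d_M)

lemma M_Y: "M \<subseteq> Y"
  by (auto simp: M_iff Y_iff X_simps)

lemma d_Z: "y \<in> Y \<Longrightarrow> del X y \<in> Z" and b_Z: "y \<in> Y \<Longrightarrow> delbar X y \<in> Z"
  by (auto simp: Z_iff Y_iff X_simps)

lemma subZ: "subsp (sub_space X Z) I" and subY: "subsp (sub_space X Y) M"
  by (rule subsp_sub_space[OF Z I I_Z], rule subsp_sub_space[OF Y M M_Y])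

lemma vs_H_BC: "vs (H_BC X)" and vs_H_A: "vs (H_A X)"
  unfolding H_BC_def H_A_def by (rule vs_quot_space[OF subZ], rule vs_quot_space[OF subY])

lemma H_BC_simps [simp]:
  "carrier (H_BC X) = cBC ` Z" "\<zero>\<^bsub>H_BC X\<^esub> = I" "grade (H_BC X) p q = cBC ` (grade X p q \<inter> Z)"
  by (simp_all add: H_BC_def cBC_def)

lemma H_A_simps [simp]:
  "carrier (H_A X) = cA ` Y" "\<zero>\<^bsub>H_A X\<^esub> = M" "grade (H_A X) p q = cA ` (grade X p q \<inter> Y)"
  by (simp_all add: H_A_def cA_def)

lemma lin_cBC: "lin (sub_space X Z) (H_BC X) cBC"
  using lin_quot_space_coset[OF subZ] by (simp add: H_BC_def cBC_def[abs_def])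

lemma lin_cA: "lin (sub_space X Y) (H_A X) cA"
  using lin_quot_space_coset[OF subY] by (simp add: H_A_def cA_def[abs_def])

lemma cBC_eq: "x \<in> carrier X \<Longrightarrow> y \<in> carrier X \<Longrightarrow> cBC x = cBC y \<longleftrightarrow> x \<ominus>\<^bsub>X\<^esub> y \<in> I"
  unfolding cBC_def by (rule coset_eq_iff[OF I])

lemma cA_eq: "x \<in> carrier X \<Longrightarrow> y \<in> carrier X \<Longrightarrow> cA x = cA y \<longleftrightarrow> x \<ominus>\<^bsub>X\<^esub> y \<in> M"
  unfolding cA_def by (rule coset_eq_iff[OF M])

lemma cBC_zero: "x \<in> carrier X \<Longrightarrow> cBC x = I \<longleftrightarrow> x \<in> I"
  unfolding cBC_def by (rule coset_zero[OF I])

lemma cA_zero: "x \<in> carrier X \<Longrightarrow> cA x = M \<longleftrightarrow> x \<in> M"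
  unfolding cA_def by (rule coset_zero[OF M])

lemma lin_lift_BC:
  assumes f: "lin (sub_space X Z) W f" and "\<And>u. u \<in> I \<Longrightarrow> f u = \<zero>\<^bsub>W\<^esub>"
  shows "lin (H_BC X) W (quot_lift f)" and "z \<in> Z \<Longrightarrow> quot_lift f (cBC z) = f z"
  using lin_quot_space_lift[OF f subZ assms(2)] quot_lift_coset[OF f subZ assms(2), of z]
  by (simp_all add: H_BC_def cBC_def)

lemma lin_lift_A:
  assumes f: "lin (sub_space X Y) W f" and "\<And>u. u \<in> M \<Longrightarrow> f u = \<zero>\<^bsub>W\<^esub>"
  shows "lin (H_A X) W (quot_lift f)" and "y \<in> Y \<Longrightarrow> quot_lift f (cA y) = f y"
  using lin_quot_space_lift[OF f subY assms(2)] quot_lift_coset[OF f subY assms(2), of y]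
  by (simp_all add: H_A_def cA_def)

lemma BC_to_A_cBC: "z \<in> Z \<Longrightarrow> BC_to_A X (cBC z) = cA z"
  and lin_BC_to_A: "lin (H_BC X) (H_A X) (BC_to_A X)"
proof -
  have l: "lin (sub_space X Z) (sub_space X Y) (\<lambda>x. x)"
    by (rule lin_sub_space_to[OF lin_sub_space_incl[OF Z] Y]) (use Z_Y in auto)
  have m: "\<And>u. u \<in> I \<Longrightarrow> u \<in> M" using I_M by blast
  show "z \<in> Z \<Longrightarrow> BC_to_A X (cBC z) = cA z"
    using lin_quot_map(2)[OF l subZ subY m, of z] by (simp add: BC_to_A_def cBC_def cA_def)
  show "lin (H_BC X) (H_A X) (BC_to_A X)"
    using lin_quot_space_map[OF l subZ subY m] by (simp add: BC_to_A_def H_BC_def H_A_def)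
qed

lemma subsp_tilde: "subsp (H_BC X) {W \<in> carrier (H_BC X). BC_to_A X W = \<zero>\<^bsub>H_A X\<^esub>}"
  by (rule subsp_ker[OF lin_BC_to_A])

lemma vs_tilde_H_BC: "vs (tilde_H_BC X)"
  unfolding tilde_H_BC_def by (rule vs_sub_space[OF subsp_tilde])

lemma tilde_H_BC_simps [simp]:
  "carrier (tilde_H_BC X) = cBC ` (Z \<inter> M)" "\<zero>\<^bsub>tilde_H_BC X\<^esub> = I" "add (tilde_H_BC X) = add (H_BC X)"
  "smult (tilde_H_BC X) = smult (H_BC X)" "grade (tilde_H_BC X) p q = grade (H_BC X) p q \<inter> cBC ` (Z \<inter> M)"
proof -
  have a: "BC_to_A X (cBC z) = M \<longleftrightarrow> z \<in> M" if "z \<in> Z" for z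
    using BC_to_A_cBC[OF that] cA_zero[OF Z_carrier[OF that]] by simp
  have *: "{W \<in> carrier (H_BC X). BC_to_A X W = \<zero>\<^bsub>H_A X\<^esub>} = cBC ` (Z \<inter> M)"
    using a by auto
  show "carrier (tilde_H_BC X) = cBC ` (Z \<inter> M)" "\<zero>\<^bsub>tilde_H_BC X\<^esub> = I" "add (tilde_H_BC X) = add (H_BC X)"
    "smult (tilde_H_BC X) = smult (H_BC X)" "grade (tilde_H_BC X) p q = grade (H_BC X) p q \<inter> cBC ` (Z \<inter> M)"
    unfolding tilde_H_BC_def * by simp_all
qed

lemma subsp_image_BC: "subsp (H_A X) (BC_to_A X ` carrier (H_BC X))"
  by (rule subsp_image[OF lin_BC_to_A subsp_carrier[OF vs_H_BC]])

lemma image_BC: "BC_to_A X ` carrier (H_BC X) = cA ` Z"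
  by (auto simp: BC_to_A_cBC image_iff)

text \<open>An element of \<open>tilde_H_A\<close> is a coset of cosets; \<open>cTA\<close> denotes
  it by a representative in \<open>Y\<close>. It vanishes on \<open>Z\<close> and on
  \<open>M\<close>.\<close>

definition "cTA y = (BC_to_A X ` carrier (H_BC X)) +>\<^bsub>H_A X\<^esub> cA y"

lemma vs_tilde_H_A: "vs (tilde_H_A X)"
  unfolding tilde_H_A_def by (rule vs_quot_space[OF subsp_image_BC])

lemma tilde_H_A_simps [simp]:
  "carrier (tilde_H_A X) = cTA ` Y" "grade (tilde_H_A X) p q = cTA ` (grade X p q \<inter> Y)"
  unfolding tilde_H_A_def by (simp_all only: quot_space_simps H_A_simps image_image cTA_def[symmetric])

lemma lin_cTA: "lin (sub_space X Y) (tilde_H_A X) cTA"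
  unfolding cTA_def[abs_def] tilde_H_A_def by (rule lin_comp[OF lin_cA lin_quot_space_coset[OF subsp_image_BC]])

lemma cTA_Z: "z \<in> Z \<Longrightarrow> cTA z = \<zero>\<^bsub>tilde_H_A X\<^esub>"
  unfolding cTA_def tilde_H_A_def quot_space_simps
  by (subst coset_zero[OF subsp_image_BC]) (use Z_Y in \<open>auto simp: BC_to_A_cBC image_iff\<close>)

lemma cTA_M: "z \<in> M \<Longrightarrow> cTA z = \<zero>\<^bsub>tilde_H_A X\<^esub>"
proof -
  assume z: "z \<in> M"
  then have "cA z = \<zero>\<^bsub>H_A X\<^esub>" using cA_zero[OF M_carrier[OF z]] by simp
  then have "cTA z = (BC_to_A X ` carrier (H_BC X)) +>\<^bsub>H_A X\<^esub> \<zero>\<^bsub>H_A X\<^esub>" by (simp only: cTA_def)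
  also have "\<dots> = BC_to_A X ` carrier (H_BC X)"
    using coset_zero[OF subsp_image_BC vs_closed(1)[OF vs_H_A]] subspD(2)[OF subsp_image_BC] by blast
  finally show ?thesis by (simp only: tilde_H_A_def quot_space_simps)
qed

text \<open>The quotient is formed in two stages, modulo \<open>M\<close> and then modulo the image
  of \<open>Z\<close>; hence the double \<open>quot_lift\<close>.\<close>

lemma lin_lift_TA:
  assumes f: "lin (sub_space X Y) W f" and m: "\<And>u. u \<in> M \<Longrightarrow> f u = \<zero>\<^bsub>W\<^esub>" and z: "\<And>u. u \<in> Z \<Longrightarrow> f u = \<zero>\<^bsub>W\<^esub>"
  shows "lin (tilde_H_A X) W (quot_lift (quot_lift f))" and "y \<in> Y \<Longrightarrow> quot_lift (quot_lift f) (cTA y) = f y"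
proof -
  note l = lin_lift_A[OF f m]
  have z': "quot_lift f u = \<zero>\<^bsub>W\<^esub>" if "u \<in> BC_to_A X ` carrier (H_BC X)" for u
    using that z l(2) Z_Y unfolding image_BC by auto
  show "lin (tilde_H_A X) W (quot_lift (quot_lift f))"
    unfolding tilde_H_A_def by (rule lin_quot_space_lift[OF l(1) subsp_image_BC z'])
  show "y \<in> Y \<Longrightarrow> quot_lift (quot_lift f) (cTA y) = f y"
    unfolding cTA_def using quot_lift_coset[OF l(1) subsp_image_BC z', of "cA y"] l(2)[of y] by simp
qed

text \<open>On \<open>M\<close> each differential kills its own image and sends the image of the
  other into \<open>I\<close>, up to sign; on \<open>Z\<close> both vanish. Hence the two
  descents.\<close>

lemma A_to_BC:
  assumes D: "D = del X \<or> D = delbar X"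
  shows A_to_BC_cA: "y \<in> Y \<Longrightarrow> A_to_BC X D (cA y) = cBC (D y)"
    and lin_A_to_BC: "lin (H_A X) (H_BC X) (A_to_BC X D)"
    and tilde_A_to_BC_cTA: "y \<in> Y \<Longrightarrow> tilde_A_to_BC X D (cTA y) = cBC (D y)"
proof -
  have l0: "lin X X D" using D lin_d lin_b by blast
  have DY: "D y \<in> Z" if "y \<in> Y" for y using D d_Z b_Z that by blast
  have l: "lin (sub_space X Y) (sub_space X Z) D"
    by (rule lin_sub_space_to[OF lin_sub_space_from[OF Y l0] Z]) (use DY in auto)
  have m: "D u \<in> I" if "u \<in> M" for u
  proof -
    obtain x y where xy: "x \<in> carrier X" "y \<in> carrier X" "u = del X x \<oplus>\<^bsub>X\<^esub> delbar X y"
      using \<open>u \<in> M\<close> unfolding M_iff by blast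
    show ?thesis using D
    proof
      assume "D = del X"
      then show ?thesis using xy db_I[of y] by (simp add: X_simps)
    next
      assume "D = delbar X"
      then show ?thesis using xy subsp_uminus[OF I db_I[of x]] by (simp add: X_simps)
    qed
  qed
  show A: "y \<in> Y \<Longrightarrow> A_to_BC X D (cA y) = cBC (D y)" for y
    using lin_quot_map(2)[OF l subY subZ m, of y] by (simp add: A_to_BC_def cBC_def cA_def)
  show lA: "lin (H_A X) (H_BC X) (A_to_BC X D)"
    using lin_quot_space_map[OF l subY subZ m] by (simp add: A_to_BC_def H_BC_def H_A_def)
  have "A_to_BC X D u = \<zero>\<^bsub>H_BC X\<^esub>" if u: "u \<in> BC_to_A X ` carrier (H_BC X)" for u
  proof -
    obtain z where z: "z \<in> Z" "u = cA z" using u unfolding image_BC by blast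
    have "D z = \<zero>\<^bsub>X\<^esub>" using D z(1) unfolding Z_iff by blast
    then show ?thesis
      using A[of z] z Z_Y cBC_zero[of "\<zero>\<^bsub>X\<^esub>"] subspD(2)[OF I] X by auto
  qed
  from quot_lift_coset[OF lA subsp_image_BC this]
  show "y \<in> Y \<Longrightarrow> tilde_A_to_BC X D (cTA y) = cBC (D y)"
    using A by (simp add: tilde_A_to_BC_def cTA_def quot_lift_def)
qed

end

sublocale proper_bicomplex \<subseteq> ungraded_bicomplex A
  by (rule ungraded_bicomplex.intro) (simp_all add: lin_del lin_delbar dd bb bd)

section \<open>Functoriality of the cohomologies\<close>

lemma cohomology_maps:
  assumes "ungraded_bicomplex A" "ungraded_bicomplex A'" and f: "lin A A' f"
    and commutes: "\<forall>x\<in>carrier A. f (del A x) = del A' (f x) \<and> f (delbar A x) = delbar A' (f x)"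
  shows map_Z: "z \<in> ker_both A \<Longrightarrow> f z \<in> ker_both A'"
    and map_Y: "z \<in> ker_deldelbar A \<Longrightarrow> f z \<in> ker_deldelbar A'"
    and map_M: "z \<in> im_sum A \<Longrightarrow> f z \<in> im_sum A'"
    and map_I: "z \<in> im_deldelbar A \<Longrightarrow> f z \<in> im_deldelbar A'"
    and lin_H_BC_map: "lin (H_BC A) (H_BC A') (H_BC_map A' f)"
    and H_BC_map_cBC: "z \<in> ker_both A \<Longrightarrow> H_BC_map A' f (ungraded_bicomplex.cBC A z) = ungraded_bicomplex.cBC A' (f z)"
    and lin_H_A_map: "lin (H_A A) (H_A A') (H_A_map A' f)"
    and H_A_map_cA: "z \<in> ker_deldelbar A \<Longrightarrow> H_A_map A' f (ungraded_bicomplex.cA A z) = ungraded_bicomplex.cA A' (f z)"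
    and lin_tilde_H_A_map: "lin (tilde_H_A A) (tilde_H_A A') (tilde_H_A_map A' f)"
    and tilde_H_A_map_cTA: "z \<in> ker_deldelbar A \<Longrightarrow> tilde_H_A_map A' f (ungraded_bicomplex.cTA A z) = ungraded_bicomplex.cTA A' (f z)"
proof -
  interpret A: ungraded_bicomplex A by fact
  interpret B: ungraded_bicomplex A' by fact
  note fs = lin_simps[OF f]
  have fd: "f (del A x) = del A' (f x)" and fb: "f (delbar A x) = delbar A' (f x)" if "x \<in> carrier A" for x
    using commutes that by auto
  show Z: "f z \<in> B.Z" if "z \<in> A.Z" for z
    using that fd[of z] fb[of z] by (simp add: A.Z_iff B.Z_iff fs)
  show Y: "f z \<in> B.Y" if "z \<in> A.Y" for z
  proof -
    have z: "z \<in> carrier A" "del A (delbar A z) = \<zero>\<^bsub>A\<^esub>" using that by (simp_all add: A.Y_iff)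
    have "del A' (delbar A' (f z)) = f (del A (delbar A z))" using z(1) fb fd by (simp add: A.X_simps)
    then show ?thesis using z by (simp add: B.Y_iff fs)
  qed
  show M: "f z \<in> B.M" if zM: "z \<in> A.M" for z
  proof -
    obtain x y where "x \<in> carrier A" "y \<in> carrier A" "z = del A x \<oplus>\<^bsub>A\<^esub> delbar A y"
      using zM unfolding A.M_iff by blast
    then show ?thesis
      unfolding B.M_iff by (intro bexI[of _ "f x"] bexI[of _ "f y"]) (simp_all add: fs A.X_simps fd fb)
  qed
  show I: "f z \<in> B.I" if zI: "z \<in> A.I" for z
  proof -
    obtain x where x: "x \<in> carrier A" "z = del A (delbar A x)" using zI by (auto simp: im_deldelbar_def)
    have "f z = del A' (delbar A' (f x))" using x by (simp add: fd fb A.X_simps)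
    then show ?thesis using B.db_I[of "f x"] x by (simp add: fs)
  qed
  have lZ: "lin (sub_space A A.Z) (sub_space A' B.Z) f"
    by (rule lin_sub_space_to[OF lin_sub_space_from[OF A.Z f] B.Z]) (use Z in auto)
  have lY: "lin (sub_space A A.Y) (sub_space A' B.Y) f"
    by (rule lin_sub_space_to[OF lin_sub_space_from[OF A.Y f] B.Y]) (use Y in auto)
  show "lin (H_BC A) (H_BC A') (H_BC_map A' f)"
    using lin_quot_space_map[OF lZ A.subZ B.subZ I] by (simp add: H_BC_map_def H_BC_def)
  show BC: "z \<in> A.Z \<Longrightarrow> H_BC_map A' f (A.cBC z) = B.cBC (f z)" for z
    using lin_quot_map(2)[OF lZ A.subZ B.subZ I, of z] by (simp add: H_BC_map_def A.cBC_def B.cBC_def)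
  show lA: "lin (H_A A) (H_A A') (H_A_map A' f)"
    using lin_quot_space_map[OF lY A.subY B.subY M] by (simp add: H_A_map_def H_A_def)
  show cA: "z \<in> A.Y \<Longrightarrow> H_A_map A' f (A.cA z) = B.cA (f z)" for z
    using lin_quot_map(2)[OF lY A.subY B.subY M, of z] by (simp add: H_A_map_def A.cA_def B.cA_def)
  have im: "H_A_map A' f u \<in> BC_to_A A' ` carrier (H_BC A')" if uI: "u \<in> BC_to_A A ` carrier (H_BC A)" for u
  proof -
    obtain z where z: "z \<in> A.Z" "u = A.cA z" using uI unfolding A.image_BC by blast
    then show ?thesis unfolding B.image_BC using cA[of z] Z[of z] A.Z_Y by auto
  qed
  show "lin (tilde_H_A A) (tilde_H_A A') (tilde_H_A_map A' f)"
    using lin_quot_space_map[OF lA A.subsp_image_BC B.subsp_image_BC im] by (simp only: tilde_H_A_map_def tilde_H_A_def)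
  show "z \<in> A.Y \<Longrightarrow> tilde_H_A_map A' f (A.cTA z) = B.cTA (f z)"
    using lin_quot_map(2)[OF lA A.subsp_image_BC B.subsp_image_BC im, of "A.cA z"] cA[of z]
    by (simp add: tilde_H_A_map_def A.cTA_def B.cTA_def del: A.H_BC_simps B.H_BC_simps)
qed

section \<open>Direct sums and the complexes \<open>H_BCA\<close> and \<open>H_ABC\<close>\<close>

lemma lin_pair:
  assumes f: "lin U V f" and g: "lin U W g"
  shows "lin U (sum_space V W) (\<lambda>x. (f x, g x))"
  by (rule linI[OF lin_dom[OF f] vs_sum_space[OF lin_cod[OF f] lin_cod[OF g]]])
    (simp_all add: lin_simps[OF f] lin_simps[OF g])

lemma lin_copair:
  assumes f: "lin V U f" and g: "lin W U g"
  shows "lin (sum_space V W) U (\<lambda>x. f (fst x) \<oplus>\<^bsub>U\<^esub> g (snd x))"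
proof (rule linI[OF vs_sum_space[OF lin_dom[OF f] lin_dom[OF g]] lin_cod[OF f]])
  note U = lin_cod[OF f]
  fix x y assume "x \<in> carrier (sum_space V W)" "y \<in> carrier (sum_space V W)"
  then have c: "fst x \<in> carrier V" "snd x \<in> carrier W" "fst y \<in> carrier V" "snd y \<in> carrier W" by auto
  show "f (fst (x \<oplus>\<^bsub>sum_space V W\<^esub> y)) \<oplus>\<^bsub>U\<^esub> g (snd (x \<oplus>\<^bsub>sum_space V W\<^esub> y)) =
      f (fst x) \<oplus>\<^bsub>U\<^esub> g (snd x) \<oplus>\<^bsub>U\<^esub> (f (fst y) \<oplus>\<^bsub>U\<^esub> g (snd y))"
    by (rule vs_eqI[OF U]) (use c in \<open>simp_all add: lin_simps[OF f] lin_simps[OF g] U emb_simps[OF U]\<close>)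
next
  note U = lin_cod[OF f]
  fix a x assume "x \<in> carrier (sum_space V W)"
  then have c: "fst x \<in> carrier V" "snd x \<in> carrier W" by auto
  show "f (fst (a \<odot>\<^bsub>sum_space V W\<^esub> x)) \<oplus>\<^bsub>U\<^esub> g (snd (a \<odot>\<^bsub>sum_space V W\<^esub> x)) =
      a \<odot>\<^bsub>U\<^esub> (f (fst x) \<oplus>\<^bsub>U\<^esub> g (snd x))"
    by (rule vs_eqI[OF U])
      (use c in \<open>simp_all add: lin_simps[OF f] lin_simps[OF g] U emb_simps[OF U] pm.scale_right_distrib\<close>)
qed (use lin_cod[OF f] in \<open>auto simp: lin_simps[OF f] lin_simps[OF g]\<close>)

lemma lin_fst: "vs V \<Longrightarrow> vs W \<Longrightarrow> lin (sum_space V W) V fst"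
  and lin_snd: "vs V \<Longrightarrow> vs W \<Longrightarrow> lin (sum_space V W) W snd"
  by (auto intro!: linI vs_sum_space)

lemma subsp_sum_space_grade:
  assumes "subsp V (grade V p q)" "subsp W (grade W p q)"
  shows "subsp (sum_space V W) (grade (sum_space V W) p q)"
proof (rule subspI[OF vs_sum_space[OF subspD(1)[OF assms(1)] subspD(1)[OF assms(2)]]])
  show "grade (sum_space V W) p q \<subseteq> carrier (sum_space V W)"
    using subspD(3)[OF assms(1)] subspD(3)[OF assms(2)] by auto
qed (use subspD(2,4,5)[OF assms(1)] subspD(2,4,5)[OF assms(2)] in auto)

lemma H_BCA_simps [simp]:
  "carrier (H_BCA A) = carrier (H_BC A) \<times> carrier (tilde_H_A A)"
  "\<zero>\<^bsub>H_BCA A\<^esub> = (\<zero>\<^bsub>H_BC A\<^esub>, \<zero>\<^bsub>tilde_H_A A\<^esub>)"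
  "add (H_BCA A) = add (sum_space (H_BC A) (tilde_H_A A))"
  "smult (H_BCA A) = smult (sum_space (H_BC A) (tilde_H_A A))"
  "grade (H_BCA A) p q = grade (H_BC A) p q \<times> grade (tilde_H_A A) p q"
  "del (H_BCA A) x = (tilde_A_to_BC A (del A) (snd x), \<zero>\<^bsub>tilde_H_A A\<^esub>)"
  "delbar (H_BCA A) x = (tilde_A_to_BC A (delbar A) (snd x), \<zero>\<^bsub>tilde_H_A A\<^esub>)"
  by (simp_all add: H_BCA_def sum_space_def module.defs bigraded.defs bicomplex.defs direct_sum_def case_prod_beta)

lemma H_ABC_simps [simp]:
  "carrier (H_ABC A) = carrier (H_A A) \<times> carrier (tilde_H_BC A)"
  "\<zero>\<^bsub>H_ABC A\<^esub> = (\<zero>\<^bsub>H_A A\<^esub>, \<zero>\<^bsub>tilde_H_BC A\<^esub>)"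
  "add (H_ABC A) = add (sum_space (H_A A) (tilde_H_BC A))"
  "smult (H_ABC A) = smult (sum_space (H_A A) (tilde_H_BC A))"
  "grade (H_ABC A) p q = grade (H_A A) p q \<times> grade (tilde_H_BC A) p q"
  "del (H_ABC A) x = (\<zero>\<^bsub>H_A A\<^esub>, A_to_BC A (del A) (fst x))"
  "delbar (H_ABC A) x = (\<zero>\<^bsub>H_A A\<^esub>, A_to_BC A (delbar A) (fst x))"
  by (simp_all add: H_ABC_def sum_space_def module.defs bigraded.defs bicomplex.defs direct_sum_def case_prod_beta)

lemma lin_of_sum_BCA:
  "lin U (sum_space (H_BC A) (tilde_H_A A)) f \<Longrightarrow> lin U (H_BCA A) f"
  "lin (sum_space (H_BC A) (tilde_H_A A)) U f' \<Longrightarrow> lin (H_BCA A) U f'"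
proof -
  have v: "vs (sum_space (H_BC A) (tilde_H_A A)) \<Longrightarrow> vs (H_BCA A)"
    by (erule vs_eqv) simp_all
  show "lin U (H_BCA A) f" if f: "lin U (sum_space (H_BC A) (tilde_H_A A)) f"
    by (rule lin_eqv[OF f lin_dom[OF f] v[OF lin_cod[OF f]]]) simp_all
  show "lin (H_BCA A) U f'" if f: "lin (sum_space (H_BC A) (tilde_H_A A)) U f'"
    by (rule lin_eqv[OF f v[OF lin_dom[OF f]] lin_cod[OF f]]) simp_all
qed

lemma lin_of_sum_ABC:
  "lin U (sum_space (H_A A) (tilde_H_BC A)) f \<Longrightarrow> lin U (H_ABC A) f"
  "lin (sum_space (H_A A) (tilde_H_BC A)) U f' \<Longrightarrow> lin (H_ABC A) U f'"
proof -
  have v: "vs (sum_space (H_A A) (tilde_H_BC A)) \<Longrightarrow> vs (H_ABC A)"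
    by (erule vs_eqv) simp_all
  show "lin U (H_ABC A) f" if f: "lin U (sum_space (H_A A) (tilde_H_BC A)) f"
    by (rule lin_eqv[OF f lin_dom[OF f] v[OF lin_cod[OF f]]]) simp_all
  show "lin (H_ABC A) U f'" if f: "lin (sum_space (H_A A) (tilde_H_BC A)) U f'"
    by (rule lin_eqv[OF f v[OF lin_dom[OF f]] lin_cod[OF f]]) simp_all
qed

lemma subsp_eqv:
  assumes "subsp V U" "vs V'" "carrier V' = carrier V" "\<zero>\<^bsub>V'\<^esub> = \<zero>\<^bsub>V\<^esub>" "add V' = add V" "smult V' = smult V"
  shows "subsp V' U"
  by (rule subspI[OF assms(2)]) (use subspD[OF assms(1)] assms(3-6) in auto)

text \<open>In all four projections \<open>lower\<close> refers to the summand where the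
  differentials take their values and \<open>upper\<close> to the one where they start. The order of
  the components is opposite in \<open>H_BCA\<close> and \<open>H_ABC\<close>.\<close>

definition "BCA_lower A x = (fst x, \<zero>\<^bsub>tilde_H_A A\<^esub>)"
definition "BCA_upper A x = (\<zero>\<^bsub>H_BC A\<^esub>, snd x)"
definition "ABC_lower A x = (\<zero>\<^bsub>H_A A\<^esub>, snd x)"
definition "ABC_upper A x = (fst x, \<zero>\<^bsub>tilde_H_BC A\<^esub>)"

context splitting
begin

lemmas lin_g = glin_lin[OF glin_g] and lin_e = glin_lin[OF glin_e]
  and lin_pi = glin_lin[OF glin_pi] and lin_mu = glin_lin[OF glin_mu]

lemmas sp_simps = lin_simps[OF lin_g] lin_simps[OF lin_e] lin_simps[OF lin_pi] lin_simps[OF lin_mu]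
  ed eb dbe ee e_pi pi_e pi_pi pi_d pi_b d_pi b_pi e_mu mu_e mu_mu mu_d mu_b d_mu b_mu op_simps

text \<open>\<open>e\<close> is the identity of the complement of the squares, so \<open>piZ\<close>
  and \<open>piC\<close> are the projections complementary to \<open>\<pi>\<close> and
  \<open>\<mu>\<close>.\<close>

definition "piZ x = e x \<ominus>\<^bsub>A\<^esub> \<pi> x"
definition "piC x = e x \<ominus>\<^bsub>A\<^esub> \<mu> x"

lemma lin_piZ: "lin A A piZ" and lin_piC: "lin A A piC"
  unfolding piZ_def piC_def by (rule lin_diff[OF lin_e lin_pi], rule lin_diff[OF lin_e lin_mu])

lemma glin_piZ: "glin 0 0 A A piZ" and glin_piC: "glin 0 0 A A piC"
  unfolding piZ_def piC_def by (rule glin_diff[OF glin_e glin_pi], rule glin_diff[OF glin_e glin_mu])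

lemma e_Y: "x \<in> carrier A \<Longrightarrow> e x \<in> Y" by (simp add: Y_iff sp_simps)

lemma pi_Y: "x \<in> carrier A \<Longrightarrow> \<pi> x \<in> Y"
  using e_Y[of "\<pi> x"] by (simp add: sp_simps)

lemma piZ_Z: "x \<in> carrier A \<Longrightarrow> piZ x \<in> Z"
  by (simp add: Z_iff piZ_def sp_simps vs_r_neg[OF V])

lemma mu_Z: "x \<in> carrier A \<Longrightarrow> \<mu> x \<in> Z"
  by (simp add: Z_iff sp_simps)

lemma mu_M: "x \<in> carrier A \<Longrightarrow> \<mu> x \<in> M"
  using mu_form unfolding M_iff by (meson lin_closed)

lemma piC_Y: "x \<in> carrier A \<Longrightarrow> piC x \<in> Y"
  unfolding piC_def using subsp_minus[OF Y e_Y] mu_Z Z_Y by blast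

text \<open>On \<open>Z\<close> the trace reduces to \<open>del delbar g\<close>; thus
  \<open>e\<close> preserves classes in \<open>H_BC\<close>.\<close>

lemma trace_Z: "z \<in> Z \<Longrightarrow> z \<ominus>\<^bsub>A\<^esub> e z \<in> I"
  using trace_g[of z] db_I[of "g z"] by (simp add: htrace_def Z_iff sp_simps)

text \<open>On \<open>Y\<close> the term \<open>g del delbar\<close> of the trace drops out and the
  others are images; thus \<open>e\<close> preserves classes in \<open>H_A\<close>.\<close>

lemma trace_Y: "y \<in> Y \<Longrightarrow> y \<ominus>\<^bsub>A\<^esub> e y \<in> M"
proof -
  assume y: "y \<in> Y"
  then have yc: "y \<in> carrier A" "del A (delbar A y) = \<zero>\<^bsub>A\<^esub>" by (simp_all add: Y_iff)
  have "y \<ominus>\<^bsub>A\<^esub> e y = del A (delbar A (g y) \<ominus>\<^bsub>A\<^esub> g (delbar A y)) \<oplus>\<^bsub>A\<^esub> delbar A (g (del A y))"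
    unfolding trace_g[OF yc(1), symmetric]
    by (rule vs_eqI[OF V]) (use yc in \<open>simp_all add: htrace_def sp_simps emb\<close>)
  moreover have "delbar A (g y) \<ominus>\<^bsub>A\<^esub> g (delbar A y) \<in> carrier A" "g (del A y) \<in> carrier A"
    using yc(1) by (simp_all add: sp_simps)
  ultimately show ?thesis unfolding M_iff by blast
qed

lemma pi_on_Z: "z \<in> Z \<Longrightarrow> \<pi> z = \<zero>\<^bsub>A\<^esub>"
proof -
  assume z: "z \<in> Z"
  obtain h h' where "lin A A h" "lin A A h'" "\<And>x. x \<in> carrier A \<Longrightarrow> \<pi> x = h (del A x) \<oplus>\<^bsub>A\<^esub> h' (delbar A x)"
    using pi_form by blast
  then show ?thesis using z by (simp add: Z_iff lin_zero[of A A h] lin_zero[of A A h'] vs_zero_simps[OF V])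
qed

lemma pi_on_M: "m \<in> M \<Longrightarrow> \<pi> m = \<zero>\<^bsub>A\<^esub>"
  by (auto simp: M_iff sp_simps)

lemma mu_on_M: "m \<in> M \<Longrightarrow> \<mu> m = e m"
  by (auto simp: M_iff sp_simps)

lemma e_on_I: "m \<in> I \<Longrightarrow> e m = \<zero>\<^bsub>A\<^esub>"
  by (auto simp: im_deldelbar_def sp_simps)

lemma piZ_on_Z: "z \<in> Z \<Longrightarrow> piZ z = e z"
  by (simp add: piZ_def pi_on_Z Z_carrier sp_simps)

lemma piZ_on_I: "z \<in> I \<Longrightarrow> piZ z = \<zero>\<^bsub>A\<^esub>"
  using piZ_on_Z e_on_I I_Z by auto

lemma mu_on_I: "z \<in> I \<Longrightarrow> \<mu> z = \<zero>\<^bsub>A\<^esub>"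
  using mu_on_M e_on_I I_M by auto

lemma piC_on_M: "m \<in> M \<Longrightarrow> piC m = \<zero>\<^bsub>A\<^esub>"
  by (simp add: piC_def mu_on_M M_carrier sp_simps vs_r_neg[OF V])

lemma cBC_e: "z \<in> Z \<Longrightarrow> cBC (e z) = cBC z"
  using cBC_eq[of z "e z"] trace_Z[of z] by (simp add: Z_carrier sp_simps)

text \<open>\<open>y\<close> and \<open>\<pi> y\<close> differ by \<open>y - e y\<close> in
  \<open>M\<close> and by \<open>piZ y\<close> in \<open>Z\<close>, both of which are zero in
  \<open>tilde_H_A\<close>.\<close>

lemma cTA_pi: "y \<in> Y \<Longrightarrow> cTA (\<pi> y) = cTA y"
proof -
  assume y: "y \<in> Y"
  note yc = Y_carrier[OF y]
  note l = lin_cTA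
  have eq: "y = (y \<ominus>\<^bsub>A\<^esub> e y) \<oplus>\<^bsub>A\<^esub> (piZ y \<oplus>\<^bsub>A\<^esub> \<pi> y)"
    by (rule vs_eqI[OF V]) (use yc in \<open>simp_all add: piZ_def sp_simps emb\<close>)
  have m: "y \<ominus>\<^bsub>A\<^esub> e y \<in> M" "y \<ominus>\<^bsub>A\<^esub> e y \<in> Y" using trace_Y[OF y] M_Y by auto
  have p: "piZ y \<in> Z" "piZ y \<in> Y" using piZ_Z[OF yc] Z_Y by auto
  have "cTA y = cTA (y \<ominus>\<^bsub>A\<^esub> e y) \<oplus>\<^bsub>tilde_H_A A\<^esub> (cTA (piZ y) \<oplus>\<^bsub>tilde_H_A A\<^esub> cTA (\<pi> y))"
    using lin_add[OF l, of "y \<ominus>\<^bsub>A\<^esub> e y" "piZ y \<oplus>\<^bsub>A\<^esub> \<pi> y"] lin_add[OF l, of "piZ y" "\<pi> y"]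
      m p pi_Y[OF yc] subspD(4)[OF Y p(2) pi_Y[OF yc]] eq by simp
  also have "\<dots> = cTA (\<pi> y)"
    unfolding cTA_M[OF m(1)] cTA_Z[OF p(1)]
    using vs_zero_simps(4)[OF vs_tilde_H_A] lin_closed[OF l, of "\<pi> y"] pi_Y[OF yc] by simp
  finally show ?thesis by simp
qed

text \<open>\<open>y\<close> and \<open>piC y\<close> differ by \<open>y - e y\<close> and
  \<open>\<mu> y\<close>, which both lie in \<open>M\<close>.\<close>

lemma cA_piC: "y \<in> Y \<Longrightarrow> cA (piC y) = cA y"
proof -
  assume y: "y \<in> Y"
  note yc = Y_carrier[OF y]
  have eq: "y \<ominus>\<^bsub>A\<^esub> piC y = (y \<ominus>\<^bsub>A\<^esub> e y) \<oplus>\<^bsub>A\<^esub> \<mu> y"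
    by (rule vs_eqI[OF V]) (use yc in \<open>simp_all add: piC_def sp_simps emb\<close>)
  have "y \<ominus>\<^bsub>A\<^esub> piC y \<in> M" unfolding eq by (rule subspD(4)[OF M trace_Y[OF y] mu_M[OF yc]])
  then show ?thesis using cA_eq[OF yc lin_closed[OF lin_piC yc]] by simp
qed

text \<open>
  The ranges of \<open>piZ\<close>, \<open>\<pi>\<close>, \<open>piC\<close> and \<open>\<mu>\<close> represent \<open>H_BC\<close>, \<open>tilde_H_A\<close>, \<open>H_A\<close> and
  \<open>tilde_H_BC\<close>.
\<close>

definition "q_BCA a = (cBC (piZ a), cTA (\<pi> a))"
definition "r_BCA x = quot_lift piZ (fst x) \<oplus>\<^bsub>A\<^esub> quot_lift (quot_lift \<pi>) (snd x)"
definition "q_ABC a = (cA (piC a), cBC (\<mu> a))"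
definition "r_ABC x = quot_lift piC (fst x) \<oplus>\<^bsub>A\<^esub> quot_lift \<mu> (snd x)"

lemma BCA_cases:
  assumes "x \<in> carrier (H_BCA A)"
  obtains z y where "z \<in> Z" "y \<in> Y" "x = (cBC z, cTA y)"
  using assms by auto

lemma ABC_cases:
  assumes "x \<in> carrier (H_ABC A)"
  obtains y z where "y \<in> Y" "z \<in> Z" "z \<in> M" "x = (cA y, cBC z)"
  using assms by auto

lemmas lift_BCA1 = lin_lift_BC[OF lin_sub_space_from[OF Z lin_piZ] piZ_on_I]
lemmas lift_BCA2 = lin_lift_TA[OF lin_sub_space_from[OF Y lin_pi] pi_on_M pi_on_Z]
lemmas lift_ABC1 = lin_lift_A[OF lin_sub_space_from[OF Y lin_piC] piC_on_M]
lemmas lift_ABC2 = lin_lift_BC[OF lin_sub_space_from[OF Z lin_mu] mu_on_I]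

lemma lin_r_BCA: "lin (H_BCA A) A r_BCA"
  unfolding r_BCA_def[abs_def] by (rule lin_of_sum_BCA(2)[OF lin_copair[OF lift_BCA1(1) lift_BCA2(1)]])

lemma lin_tilde_H_BC_from: "lin (H_BC A) W f \<Longrightarrow> lin (tilde_H_BC A) W f"
  unfolding tilde_H_BC_def by (rule lin_sub_space_from[OF subsp_tilde])

lemma lin_r_ABC: "lin (H_ABC A) A r_ABC"
  unfolding r_ABC_def[abs_def]
  by (rule lin_of_sum_ABC(2)[OF lin_copair[OF lift_ABC1(1) lin_tilde_H_BC_from[OF lift_ABC2(1)]]])

lemma lin_q_BCA: "lin A (H_BCA A) q_BCA"
proof -
  have 1: "lin A (sub_space A Z) piZ" and 2: "lin A (sub_space A Y) \<pi>"
    using lin_sub_space_to[OF lin_piZ Z piZ_Z] lin_sub_space_to[OF lin_pi Y pi_Y] by auto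
  show ?thesis
    unfolding q_BCA_def[abs_def] by (rule lin_of_sum_BCA(1)[OF lin_pair[OF lin_comp[OF 1 lin_cBC] lin_comp[OF 2 lin_cTA]]])
qed

lemma lin_q_ABC: "lin A (H_ABC A) q_ABC"
proof -
  have 1: "lin A (sub_space A Y) piC" and 2: "lin A (sub_space A Z) \<mu>"
    using lin_sub_space_to[OF lin_piC Y piC_Y] lin_sub_space_to[OF lin_mu Z mu_Z] by auto
  have 3: "lin A (tilde_H_BC A) (\<lambda>a. cBC (\<mu> a))"
    unfolding tilde_H_BC_def
  proof (rule lin_sub_space_to[OF lin_comp[OF 2 lin_cBC] subsp_tilde])
    fix x assume x: "x \<in> carrier A"
    have "cBC (\<mu> x) \<in> carrier (tilde_H_BC A)" using mu_Z[OF x] mu_M[OF x] by simp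
    then show "cBC (\<mu> x) \<in> {W \<in> carrier (H_BC A). BC_to_A A W = \<zero>\<^bsub>H_A A\<^esub>}"
      unfolding tilde_H_BC_def sub_space_simps .
  qed
  show ?thesis
    unfolding q_ABC_def[abs_def] by (rule lin_of_sum_ABC(1)[OF lin_pair[OF lin_comp[OF 1 lin_cA] 3]])
qed

lemma r_BCA_class: "z \<in> Z \<Longrightarrow> y \<in> Y \<Longrightarrow> r_BCA (cBC z, cTA y) = piZ z \<oplus>\<^bsub>A\<^esub> \<pi> y"
  by (simp add: r_BCA_def lift_BCA1(2) lift_BCA2(2))

lemma r_ABC_class: "y \<in> Y \<Longrightarrow> z \<in> Z \<Longrightarrow> r_ABC (cA y, cBC z) = piC y \<oplus>\<^bsub>A\<^esub> \<mu> z"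
  by (simp add: r_ABC_def lift_ABC1(2) lift_ABC2(2))

lemma glin_q_BCA: "glin 0 0 A (H_BCA A) q_BCA"
proof (rule glinI[OF lin_q_BCA])
  fix i x assume x: "x \<in> gr A i"
  note xc = grade_carrier[OF x]
  show "q_BCA x \<in> gr (H_BCA A) (fst i + 0, snd i + 0)"
    using glin_grade[OF glin_piZ x] glin_grade[OF glin_pi x] piZ_Z[OF xc] pi_Y[OF xc] by (simp add: q_BCA_def)
qed

lemma glin_q_ABC: "glin 0 0 A (H_ABC A) q_ABC"
proof (rule glinI[OF lin_q_ABC])
  fix i x assume x: "x \<in> gr A i"
  note xc = grade_carrier[OF x]
  show "q_ABC x \<in> gr (H_ABC A) (fst i + 0, snd i + 0)"
    using glin_grade[OF glin_piC x] glin_grade[OF glin_mu x] piC_Y[OF xc] mu_Z[OF xc] mu_M[OF xc]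
    by (simp add: q_ABC_def)
qed

lemma glin_r_BCA: "glin 0 0 (H_BCA A) A r_BCA"
proof (rule glinI[OF lin_r_BCA])
  fix i x assume "x \<in> gr (H_BCA A) i"
  then obtain z y where zy: "z \<in> gr A i" "z \<in> Z" "y \<in> gr A i" "y \<in> Y" "x = (cBC z, cTA y)" by auto
  then show "r_BCA x \<in> gr A (fst i + 0, snd i + 0)"
    using glin_grade[OF glin_piZ zy(1)] glin_grade[OF glin_pi zy(3)]
    by (simp add: r_BCA_class subspD(4)[OF subsp_grade])
qed

lemma glin_r_ABC: "glin 0 0 (H_ABC A) A r_ABC"
proof (rule glinI[OF lin_r_ABC])
  fix i x assume "x \<in> gr (H_ABC A) i"
  then obtain z y where zy: "z \<in> gr A i" "z \<in> Z" "y \<in> gr A i" "y \<in> Y" "x = (cA y, cBC z)" by auto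
  then show "r_ABC x \<in> gr A (fst i + 0, snd i + 0)"
    using glin_grade[OF glin_mu zy(1)] glin_grade[OF glin_piC zy(3)]
    by (simp add: r_ABC_class subspD(4)[OF subsp_grade])
qed

lemma pi_piZ: "x \<in> carrier A \<Longrightarrow> \<pi> (piZ x) = \<zero>\<^bsub>A\<^esub>" and piZ_piZ: "x \<in> carrier A \<Longrightarrow> piZ (piZ x) = piZ x"
  and piZ_pi: "x \<in> carrier A \<Longrightarrow> piZ (\<pi> x) = \<zero>\<^bsub>A\<^esub>"
  by (simp_all add: piZ_def sp_simps vs_r_neg[OF V])

lemma mu_piC: "x \<in> carrier A \<Longrightarrow> \<mu> (piC x) = \<zero>\<^bsub>A\<^esub>" and piC_piC: "x \<in> carrier A \<Longrightarrow> piC (piC x) = piC x"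
  and piC_mu: "x \<in> carrier A \<Longrightarrow> piC (\<mu> x) = \<zero>\<^bsub>A\<^esub>"
  by (simp_all add: piC_def sp_simps vs_r_neg[OF V])

lemmas proj_simps = pi_piZ piZ_piZ piZ_pi mu_piC piC_piC piC_mu lin_simps[OF lin_piZ] lin_simps[OF lin_piC]

lemma qr_BCA: "x \<in> carrier (H_BCA A) \<Longrightarrow> q_BCA (r_BCA x) = x"
proof (erule BCA_cases)
  fix z y assume zy: "z \<in> Z" "y \<in> Y" "x = (cBC z, cTA y)"
  have "q_BCA (r_BCA x) = (cBC (piZ z), cTA (\<pi> y))"
    using zy Z_carrier Y_carrier by (simp add: r_BCA_class q_BCA_def proj_simps sp_simps)
  then show ?thesis using zy by (simp add: piZ_on_Z cBC_e cTA_pi)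
qed

lemma qr_ABC: "x \<in> carrier (H_ABC A) \<Longrightarrow> q_ABC (r_ABC x) = x"
proof (erule ABC_cases)
  fix z y assume zy: "y \<in> Y" "z \<in> Z" "z \<in> M" "x = (cA y, cBC z)"
  have "q_ABC (r_ABC x) = (cA (piC y), cBC (\<mu> z))"
    using zy Z_carrier Y_carrier by (simp add: r_ABC_class q_ABC_def proj_simps sp_simps)
  then show ?thesis using zy by (simp add: mu_on_M cBC_e cA_piC)
qed

lemma rq_BCA: "a \<in> carrier A \<Longrightarrow> r_BCA (q_BCA a) = e a"
proof -
  assume a: "a \<in> carrier A"
  have "r_BCA (q_BCA a) = piZ (piZ a) \<oplus>\<^bsub>A\<^esub> \<pi> (\<pi> a)" using a by (simp add: q_BCA_def r_BCA_class piZ_Z pi_Y)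
  also have "\<dots> = e a"
    by (rule vs_eqI[OF V]) (use a in \<open>simp_all add: proj_simps sp_simps, simp_all add: piZ_def sp_simps emb\<close>)
  finally show ?thesis .
qed

lemma rq_ABC: "a \<in> carrier A \<Longrightarrow> r_ABC (q_ABC a) = e a"
proof -
  assume a: "a \<in> carrier A"
  have "r_ABC (q_ABC a) = piC (piC a) \<oplus>\<^bsub>A\<^esub> \<mu> (\<mu> a)" using a by (simp add: q_ABC_def r_ABC_class piC_Y mu_Z)
  also have "\<dots> = e a"
    by (rule vs_eqI[OF V]) (use a in \<open>simp_all add: proj_simps sp_simps, simp_all add: piC_def sp_simps emb\<close>)
  finally show ?thesis .
qed

text \<open>The differentials of \<open>H_BCA\<close>, which are defined by classes, are those of
  \<open>A\<close> transported along the retract, as \<open>trace_retractI\<close> asks. The summand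
  in \<open>Z\<close> is closed, and \<open>D (\<pi> y) = e (D y)\<close>.\<close>

lemma q_BCA_d: "D = del A \<or> D = delbar A \<Longrightarrow> x \<in> carrier (H_BCA A) \<Longrightarrow>
    (tilde_A_to_BC A D (snd x), \<zero>\<^bsub>tilde_H_A A\<^esub>) = q_BCA (D (r_BCA x))"
proof (erule BCA_cases)
  fix z y assume D: "D = del A \<or> D = delbar A" and zy: "z \<in> Z" "y \<in> Y" "x = (cBC z, cTA y)"
  note c = Z_carrier[OF zy(1)] Y_carrier[OF zy(2)]
  have DY: "D y \<in> Z" using D d_Z[OF zy(2)] b_Z[OF zy(2)] by auto
  have 1: "D (r_BCA x) = e (D y)"
    using D c piZ_Z[OF c(1)] by (auto simp: zy(3) r_BCA_class[OF zy(1,2)] Z_iff sp_simps proj_simps)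
  have 2: "q_BCA (e (D y)) = (cBC (D y), cTA \<zero>\<^bsub>A\<^esub>)"
    unfolding q_BCA_def using DY Z_carrier[OF DY] by (simp add: piZ_def sp_simps pi_on_Z cBC_e)
  show ?thesis
    unfolding 1 2 using tilde_A_to_BC_cTA[OF D zy(2)] cTA_Z[OF subspD(2)[OF Z]] by (simp add: zy(3))
qed

text \<open>As in \<open>q_BCA_d\<close>; here \<open>D\<close> annihilates the range of
  \<open>\<mu>\<close>, so the summand from \<open>tilde_H_BC\<close> disappears and
  \<open>D (piC y) = e (D y)\<close>.\<close>

lemma q_ABC_d: "D = del A \<or> D = delbar A \<Longrightarrow> x \<in> carrier (H_ABC A) \<Longrightarrow>
    (\<zero>\<^bsub>H_A A\<^esub>, A_to_BC A D (fst x)) = q_ABC (D (r_ABC x))"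
proof (erule ABC_cases)
  fix z y assume D: "D = del A \<or> D = delbar A" and zy: "y \<in> Y" "z \<in> Z" "z \<in> M" "x = (cA y, cBC z)"
  note c = Z_carrier[OF zy(2)] Y_carrier[OF zy(1)]
  have DY: "D y \<in> Z" "D y \<in> M" using D d_Z[OF zy(1)] b_Z[OF zy(1)] d_M[OF c(2)] b_M[OF c(2)] by auto
  have 1: "D (r_ABC x) = e (D y)"
    using D c by (auto simp: zy(4) r_ABC_class[OF zy(1,2)] piC_def sp_simps)
  have 2: "q_ABC (e (D y)) = (cA \<zero>\<^bsub>A\<^esub>, cBC (D y))"
    unfolding q_ABC_def using DY Z_carrier[OF DY(1)]
    by (simp add: piC_def sp_simps mu_on_M cBC_e vs_r_neg[OF V])
  show ?thesis
    unfolding 1 2 using A_to_BC_cA[OF D zy(1)] cA_zero[of "\<zero>\<^bsub>A\<^esub>"] subspD(2)[OF M] V by (simp add: zy(4))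
qed

text \<open>\<open>r\<close> is injective and commutes with differentials and signs, so
  \<open>H\<close> inherits the relations of a double complex from \<open>A\<close>. The bigrading
  of \<open>H\<close> has to come first, since it gives the sign operator its meaning.\<close>

lemma trace_retractI:
  fixes H :: "'h bicomplex"
  assumes q: "glin 0 0 A H q" and r: "glin 0 0 H A r"
    and qr: "\<And>x. x \<in> carrier H \<Longrightarrow> q (r x) = x" and rq: "\<And>a. a \<in> carrier A \<Longrightarrow> r (q a) = e a"
    and dH: "\<And>x. x \<in> carrier H \<Longrightarrow> del H x = q (del A (r x))"
    and bH: "\<And>x. x \<in> carrier H \<Longrightarrow> delbar H x = q (delbar A (r x))"
    and sub: "\<And>p q. subsp H (grade H p q)"
  shows trace_retract_of: "trace_retract A (del A) (delbar A) (degree_sign A) H (del H) (delbar H) (degree_sign H) q r g"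
    and bigraded_of: "bigraded_space H"
proof -
  show bH': "bigraded_space H" by (rule bigraded_retract[OF bigraded q r qr sub])
  interpret H: graded_space H by (rule graded_space.intro[OF bH'])
  note lq = glin_lin[OF q] and lr = glin_lin[OF r]
  note ls = lin_simps[OF lq] lin_simps[OF lr]
  have ldH: "lin H H (del H)" and lbH: "lin H H (delbar H)"
    using lin_cong[OF lin_comp[OF lin_comp[OF lr lin_del] lq], of "del H"]
      lin_cong[OF lin_comp[OF lin_comp[OF lr lin_delbar] lq], of "delbar H"] dH bH by auto
  \<comment> \<open>\<open>r q = e\<close> fixes the range of \<open>r\<close> and disappears under
    \<open>q\<close>; as \<open>e\<close> commutes with the differentials, those of \<open>H\<close>
    commute with \<open>q\<close> and \<open>r\<close>.\<close>
  have er: "e (r x) = r x" if "x \<in> carrier H" for x using rq[of "r x"] qr[OF that] that by (simp add: ls)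
  have qe: "q (e a) = q a" if "a \<in> carrier A" for a using rq[OF that] qr[of "q a"] that by (simp add: ls)
  have rd: "r (del H x) = del A (r x)" if "x \<in> carrier H" for x
    using that by (simp add: dH rq ls sp_simps er)
  have rb: "r (delbar H x) = delbar A (r x)" if "x \<in> carrier H" for x
    using that by (simp add: bH rq ls sp_simps er)
  have qd: "q (del A a) = del H (q a)" if "a \<in> carrier A" for a
    using that qe[of "del A a"] by (simp add: dH rq ls sp_simps)
  have qb: "q (delbar A a) = delbar H (q a)" if "a \<in> carrier A" for a
    using that qe[of "delbar A a"] by (simp add: bH rq ls sp_simps)
  have qs: "q (degree_sign A a) = degree_sign H (q a)" if "a \<in> carrier A" for a
    using glin_degree_sign[OF bigraded bH' q that] by simp
  have rs: "r (degree_sign H x) = degree_sign A (r x)" if "x \<in> carrier H" for x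
    using glin_degree_sign[OF bH' bigraded r that] by simp
  have inj: "x = y" if "r x = r y" "x \<in> carrier H" "y \<in> carrier H" for x y
    by (rule box_equals[OF arg_cong[OF that(1), of q] qr[OF that(2)] qr[OF that(3)]])
  note cl = lin_closed[OF ldH] lin_closed[OF lbH] H.V lin_closed[OF H.lin_degree_sign]
  show "trace_retract A (del A) (delbar A) (degree_sign A) H (del H) (delbar H) (degree_sign H) q r g"
  proof (intro trace_retract.intro double_complex_axioms double_complex.intro trace_retract_axioms.intro)
    show "del H (del H x) = \<zero>\<^bsub>H\<^esub>" if "x \<in> carrier H" for x
      by (rule inj) (use that in \<open>simp_all add: cl rd ls op_simps\<close>)
    show "delbar H (delbar H x) = \<zero>\<^bsub>H\<^esub>" if "x \<in> carrier H" for x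
      by (rule inj) (use that in \<open>simp_all add: cl rb ls op_simps\<close>)
    show "delbar H (del H x) = \<ominus>\<^bsub>H\<^esub> del H (delbar H x)" if "x \<in> carrier H" for x
      by (rule inj) (use that in \<open>simp_all add: cl rb rd ls op_simps\<close>)
    show "degree_sign H (degree_sign H x) = x" if "x \<in> carrier H" for x
      using that by (rule H.degree_sign_involutive)
    show "del H (degree_sign H x) = \<ominus>\<^bsub>H\<^esub> degree_sign H (del H x)" if "x \<in> carrier H" for x
      by (rule inj) (use that in \<open>simp_all add: cl rd rs ls op_simps\<close>)
    show "delbar H (degree_sign H x) = \<ominus>\<^bsub>H\<^esub> degree_sign H (delbar H x)" if "x \<in> carrier H" for x
      by (rule inj) (use that in \<open>simp_all add: cl rb rs ls op_simps\<close>)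
    show "g (degree_sign A a) = degree_sign A (g a)" if "a \<in> carrier A" for a
      using glin_degree_sign[OF bigraded bigraded glin_g that] by simp
    show "htrace A (del A) (delbar A) g a = a \<ominus>\<^bsub>A\<^esub> r (q a)" if "a \<in> carrier A" for a
      using trace_g[OF that] rq[OF that] by simp
  qed (use lq lr lin_g ldH lbH H.lin_degree_sign qr qd qb qs rd rb rs in auto)
qed

lemma vs_H_BCA: "vs (H_BCA A)" and vs_H_ABC: "vs (H_ABC A)"
  using lin_q_BCA lin_q_ABC by (auto dest: lin_cod)

lemma subsp_H_BC_grade: "subsp (H_BC A) (grade (H_BC A) p q)"
  using subsp_image[OF lin_cBC subsp_sub_space[OF Z subsp_Int[OF subsp_grade Z]]] by simp

lemma subsp_H_A_grade: "subsp (H_A A) (grade (H_A A) p q)"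
  using subsp_image[OF lin_cA subsp_sub_space[OF Y subsp_Int[OF subsp_grade Y]]] by simp

lemma subsp_tilde_H_A_grade: "subsp (tilde_H_A A) (grade (tilde_H_A A) p q)"
  using subsp_image[OF lin_cTA subsp_sub_space[OF Y subsp_Int[OF subsp_grade Y]]] by simp

lemma subsp_tilde_H_BC_grade: "subsp (tilde_H_BC A) (grade (tilde_H_BC A) p q)"
proof -
  have "subsp (tilde_H_BC A) (grade (H_BC A) p q \<inter> carrier (tilde_H_BC A))"
    unfolding tilde_H_BC_def sub_space_simps
    by (rule subsp_sub_space[OF subsp_tilde subsp_Int[OF subsp_H_BC_grade subsp_tilde]]) auto
  then show ?thesis by simp
qed

lemma subsp_H_BCA_grade: "subsp (H_BCA A) (grade (H_BCA A) p q)"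
  using subsp_eqv[OF subsp_sum_space_grade[OF subsp_H_BC_grade subsp_tilde_H_A_grade] vs_H_BCA, of p q]
  by (simp only: H_BCA_simps sum_space_simps simp_thms)

lemma subsp_H_ABC_grade: "subsp (H_ABC A) (grade (H_ABC A) p q)"
  using subsp_eqv[OF subsp_sum_space_grade[OF subsp_H_A_grade subsp_tilde_H_BC_grade] vs_H_ABC, of p q]
  by (simp only: H_ABC_simps sum_space_simps simp_thms)

lemma trace_retract_BCA: "trace_retract A (del A) (delbar A) (degree_sign A) (H_BCA A) (del (H_BCA A)) (delbar (H_BCA A))
    (degree_sign (H_BCA A)) q_BCA r_BCA g"
  and bigraded_BCA: "bigraded_space (H_BCA A)"
  using trace_retractI[OF glin_q_BCA glin_r_BCA qr_BCA rq_BCA _ _ subsp_H_BCA_grade]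
    q_BCA_d[of "del A"] q_BCA_d[of "delbar A"] by (auto simp del: H_BCA_simps(1))

lemma trace_retract_ABC: "trace_retract A (del A) (delbar A) (degree_sign A) (H_ABC A) (del (H_ABC A)) (delbar (H_ABC A))
    (degree_sign (H_ABC A)) q_ABC r_ABC g"
  and bigraded_ABC: "bigraded_space (H_ABC A)"
  using trace_retractI[OF glin_q_ABC glin_r_ABC qr_ABC rq_ABC _ _ subsp_H_ABC_grade]
    q_ABC_d[of "del A"] q_ABC_d[of "delbar A"] by (auto simp del: H_ABC_simps(1))

lemmas no_carrier = H_BC_simps H_A_simps tilde_H_BC_simps tilde_H_A_simps

lemma lin_BCA_parts: "lin (H_BCA A) (H_BCA A) (BCA_lower A)" "lin (H_BCA A) (H_BCA A) (BCA_upper A)"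
proof -
  note v = vs_H_BC vs_tilde_H_A
  note F = lin_of_sum_BCA(2)[OF lin_fst[OF v]] and S = lin_of_sum_BCA(2)[OF lin_snd[OF v]]
  show "lin (H_BCA A) (H_BCA A) (BCA_lower A)"
    unfolding BCA_lower_def[abs_def]
    by (rule lin_of_sum_BCA(1)[OF lin_pair[OF F lin_0[OF vs_H_BCA vs_tilde_H_A]]])
  show "lin (H_BCA A) (H_BCA A) (BCA_upper A)"
    unfolding BCA_upper_def[abs_def]
    by (rule lin_of_sum_BCA(1)[OF lin_pair[OF lin_0[OF vs_H_BCA vs_H_BC] S]])
qed

lemma lin_ABC_parts: "lin (H_ABC A) (H_ABC A) (ABC_lower A)" "lin (H_ABC A) (H_ABC A) (ABC_upper A)"
proof -
  note v = vs_H_A vs_tilde_H_BC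
  note F = lin_of_sum_ABC(2)[OF lin_fst[OF v]] and S = lin_of_sum_ABC(2)[OF lin_snd[OF v]]
  show "lin (H_ABC A) (H_ABC A) (ABC_lower A)"
    unfolding ABC_lower_def[abs_def]
    by (rule lin_of_sum_ABC(1)[OF lin_pair[OF lin_0[OF vs_H_ABC vs_H_A] S]])
  show "lin (H_ABC A) (H_ABC A) (ABC_upper A)"
    unfolding ABC_upper_def[abs_def]
    by (rule lin_of_sum_ABC(1)[OF lin_pair[OF F lin_0[OF vs_H_ABC vs_tilde_H_BC]]])
qed

lemma glin_BCA_parts: "glin 0 0 (H_BCA A) (H_BCA A) (BCA_lower A)" "glin 0 0 (H_BCA A) (H_BCA A) (BCA_upper A)"
  using subspD(2)[OF subsp_H_BC_grade] subspD(2)[OF subsp_tilde_H_A_grade]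
  by (auto intro!: glinI lin_BCA_parts simp: BCA_lower_def BCA_upper_def simp del: no_carrier)

lemma glin_ABC_parts: "glin 0 0 (H_ABC A) (H_ABC A) (ABC_lower A)" "glin 0 0 (H_ABC A) (H_ABC A) (ABC_upper A)"
  using subspD(2)[OF subsp_H_A_grade] subspD(2)[OF subsp_tilde_H_BC_grade]
  by (auto intro!: glinI lin_ABC_parts simp: ABC_lower_def ABC_upper_def simp del: no_carrier)

lemma two_step_BCA: "two_step A (del A) (delbar A) (degree_sign A) (H_BCA A) (del (H_BCA A)) (delbar (H_BCA A))
    (degree_sign (H_BCA A)) q_BCA r_BCA g (BCA_lower A) (BCA_upper A)"
proof (rule two_step.intro[OF trace_retract_BCA two_step_axioms.intro])
  interpret R: trace_retract A "del A" "delbar A" "degree_sign A" "H_BCA A" "del (H_BCA A)" "delbar (H_BCA A)"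
    "degree_sign (H_BCA A)" q_BCA r_BCA g by (rule trace_retract_BCA)
  note z1 = vs_zero_simps[OF vs_H_BC] and z2 = vs_zero_simps[OF vs_tilde_H_A]
  fix x assume x: "x \<in> carrier (H_BCA A)"
  then have x': "fst x \<in> carrier (H_BC A)" "snd x \<in> carrier (tilde_H_A A)"
    by (auto simp del: no_carrier)
  show "BCA_lower A x \<oplus>\<^bsub>H_BCA A\<^esub> BCA_upper A x = x"
    using x' by (simp add: BCA_lower_def BCA_upper_def z1 z2 del: no_carrier)
  show "del (H_BCA A) (BCA_lower A x) = \<zero>\<^bsub>H_BCA A\<^esub>"
    using lin_zero[OF R.H.lin_d] by (simp add: BCA_lower_def del: no_carrier)
  show "delbar (H_BCA A) (BCA_lower A x) = \<zero>\<^bsub>H_BCA A\<^esub>"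
    using lin_zero[OF R.H.lin_b] by (simp add: BCA_lower_def del: no_carrier)
  show "degree_sign (H_BCA A) (BCA_lower A x) = BCA_lower A (degree_sign (H_BCA A) x)"
    using glin_degree_sign[OF bigraded_BCA bigraded_BCA glin_BCA_parts(1) x] by simp
  show "degree_sign (H_BCA A) (BCA_upper A x) = BCA_upper A (degree_sign (H_BCA A) x)"
    using glin_degree_sign[OF bigraded_BCA bigraded_BCA glin_BCA_parts(2) x] by simp
qed (use lin_BCA_parts in \<open>auto simp: BCA_lower_def BCA_upper_def simp del: no_carrier\<close>)

lemma two_step_ABC: "two_step A (del A) (delbar A) (degree_sign A) (H_ABC A) (del (H_ABC A)) (delbar (H_ABC A))
    (degree_sign (H_ABC A)) q_ABC r_ABC g (ABC_lower A) (ABC_upper A)"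
proof (rule two_step.intro[OF trace_retract_ABC two_step_axioms.intro])
  interpret R: trace_retract A "del A" "delbar A" "degree_sign A" "H_ABC A" "del (H_ABC A)" "delbar (H_ABC A)"
    "degree_sign (H_ABC A)" q_ABC r_ABC g by (rule trace_retract_ABC)
  note z1 = vs_zero_simps[OF vs_H_A] and z2 = vs_zero_simps[OF vs_tilde_H_BC]
  fix x assume x: "x \<in> carrier (H_ABC A)"
  then have x': "fst x \<in> carrier (H_A A)" "snd x \<in> carrier (tilde_H_BC A)"
    by (auto simp del: no_carrier)
  show "ABC_lower A x \<oplus>\<^bsub>H_ABC A\<^esub> ABC_upper A x = x"
    using x' by (simp add: ABC_lower_def ABC_upper_def z1 z2 del: no_carrier)
  show "del (H_ABC A) (ABC_lower A x) = \<zero>\<^bsub>H_ABC A\<^esub>"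
    using lin_zero[OF R.H.lin_d] by (simp add: ABC_lower_def del: no_carrier)
  show "delbar (H_ABC A) (ABC_lower A x) = \<zero>\<^bsub>H_ABC A\<^esub>"
    using lin_zero[OF R.H.lin_b] by (simp add: ABC_lower_def del: no_carrier)
  show "degree_sign (H_ABC A) (ABC_lower A x) = ABC_lower A (degree_sign (H_ABC A) x)"
    using glin_degree_sign[OF bigraded_ABC bigraded_ABC glin_ABC_parts(1) x] by simp
  show "degree_sign (H_ABC A) (ABC_upper A x) = ABC_upper A (degree_sign (H_ABC A) x)"
    using glin_degree_sign[OF bigraded_ABC bigraded_ABC glin_ABC_parts(2) x] by simp
qed (use lin_ABC_parts in \<open>auto simp: ABC_lower_def ABC_upper_def simp del: no_carrier\<close>)

text \<open>\<open>\<pi> x\<close> depends on the differentials of \<open>x\<close> only, and the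
  retract carries this over to the projection onto \<open>tilde_H_A\<close>. It is the hypothesis of
  \<open>P2_closed\<close>.\<close>

lemma BCA_upper_form: "\<exists>h h'. lin (H_BCA A) (H_BCA A) h \<and> lin (H_BCA A) (H_BCA A) h' \<and>
    (\<forall>x\<in>carrier (H_BCA A). BCA_upper A x = h (del (H_BCA A) x) \<oplus>\<^bsub>H_BCA A\<^esub> h' (delbar (H_BCA A) x))"
proof -
  interpret R: trace_retract A "del A" "delbar A" "degree_sign A" "H_BCA A" "del (H_BCA A)" "delbar (H_BCA A)"
    "degree_sign (H_BCA A)" q_BCA r_BCA g by (rule trace_retract_BCA)
  obtain h h' where h: "lin A A h" "lin A A h'" "\<And>x. x \<in> carrier A \<Longrightarrow> \<pi> x = h (del A x) \<oplus>\<^bsub>A\<^esub> h' (delbar A x)"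
    using pi_form by blast
  have u: "BCA_upper A (q_BCA a) = q_BCA (\<pi> a)" if "a \<in> carrier A" for a
    using that cBC_zero[of "\<zero>\<^bsub>A\<^esub>"] subspD(2)[OF I] by (simp add: BCA_upper_def q_BCA_def proj_simps sp_simps)
  show ?thesis
  proof (intro exI conjI ballI)
    show "lin (H_BCA A) (H_BCA A) (\<lambda>x. q_BCA (h (r_BCA x)))" "lin (H_BCA A) (H_BCA A) (\<lambda>x. q_BCA (h' (r_BCA x)))"
      by (rule lin_comp[OF lin_comp[OF lin_r_BCA h(1)] lin_q_BCA] lin_comp[OF lin_comp[OF lin_r_BCA h(2)] lin_q_BCA])+
    fix x assume x: "x \<in> carrier (H_BCA A)"
    have rx: "r_BCA x \<in> carrier A" using x by (rule lin_closed[OF lin_r_BCA])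
    have "BCA_upper A x = q_BCA (\<pi> (r_BCA x))" using u[OF rx] qr_BCA[OF x] by simp
    also have "\<dots> = q_BCA (h (del A (r_BCA x))) \<oplus>\<^bsub>H_BCA A\<^esub> q_BCA (h' (delbar A (r_BCA x)))"
      unfolding h(3)[OF rx] using rx
      by (intro lin_add[OF lin_q_BCA]) (simp_all add: lin_closed[OF h(1)] lin_closed[OF h(2)] sp_simps)
    finally show "BCA_upper A x = q_BCA (h (r_BCA (del (H_BCA A) x))) \<oplus>\<^bsub>H_BCA A\<^esub> q_BCA (h' (r_BCA (delbar (H_BCA A) x)))"
      by (simp only: R.rd[OF x] R.rb[OF x])
  qed
qed

text \<open>\<open>\<mu>\<close> is a sum of images of differentials, and the retract carries this
  over to the projection onto \<open>tilde_H_BC\<close>. It is the hypothesis of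
  \<open>P0_im\<close>.\<close>

lemma ABC_lower_form: "\<exists>h h'. lin (H_ABC A) (H_ABC A) h \<and> lin (H_ABC A) (H_ABC A) h' \<and>
    (\<forall>x\<in>carrier (H_ABC A). ABC_lower A x = del (H_ABC A) (h x) \<oplus>\<^bsub>H_ABC A\<^esub> delbar (H_ABC A) (h' x))"
proof -
  interpret R: trace_retract A "del A" "delbar A" "degree_sign A" "H_ABC A" "del (H_ABC A)" "delbar (H_ABC A)"
    "degree_sign (H_ABC A)" q_ABC r_ABC g by (rule trace_retract_ABC)
  obtain h h' where h: "lin A A h" "lin A A h'" "\<And>x. x \<in> carrier A \<Longrightarrow> \<mu> x = del A (h x) \<oplus>\<^bsub>A\<^esub> delbar A (h' x)"
    using mu_form by blast
  have u: "ABC_lower A (q_ABC a) = q_ABC (\<mu> a)" if "a \<in> carrier A" for a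
    using that cA_zero[of "\<zero>\<^bsub>A\<^esub>"] subspD(2)[OF M] by (simp add: ABC_lower_def q_ABC_def proj_simps sp_simps)
  show ?thesis
  proof (intro exI conjI ballI)
    show "lin (H_ABC A) (H_ABC A) (\<lambda>x. q_ABC (h (r_ABC x)))" "lin (H_ABC A) (H_ABC A) (\<lambda>x. q_ABC (h' (r_ABC x)))"
      by (rule lin_comp[OF lin_comp[OF lin_r_ABC h(1)] lin_q_ABC] lin_comp[OF lin_comp[OF lin_r_ABC h(2)] lin_q_ABC])+
    fix x assume x: "x \<in> carrier (H_ABC A)"
    have rx: "r_ABC x \<in> carrier A" using x by (rule lin_closed[OF lin_r_ABC])
    note c = lin_closed[OF h(1) rx] lin_closed[OF h(2) rx]
    have "ABC_lower A x = q_ABC (\<mu> (r_ABC x))" using u[OF rx] qr_ABC[OF x] by simp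
    also have "\<dots> = q_ABC (del A (h (r_ABC x))) \<oplus>\<^bsub>H_ABC A\<^esub> q_ABC (delbar A (h' (r_ABC x)))"
      unfolding h(3)[OF rx] using c by (intro lin_add[OF lin_q_ABC]) (simp_all add: sp_simps)
    finally show "ABC_lower A x = del (H_ABC A) (q_ABC (h (r_ABC x))) \<oplus>\<^bsub>H_ABC A\<^esub> delbar (H_ABC A) (q_ABC (h' (r_ABC x)))"
      by (simp only: R.qd[OF c(1)] R.qb[OF c(2)])
  qed
qed

end

section \<open>Morphisms of bicomplexes compared with the retracts\<close>

locale splitting_morphism = S: splitting A g e \<pi> \<mu> + S': splitting A' g' e' \<pi>' \<mu>'
  for A :: "'a bicomplex" and g e \<pi> \<mu> and A' :: "'a2 bicomplex" and g' e' \<pi>' \<mu>' +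
  fixes f :: "'a \<Rightarrow> 'a2"
  assumes morphism: "bicomplex_morphism A A' f"
begin

lemma glin_f: "glin 0 0 A A' f"
  using morphism by (simp add: bicomplex_morphism_def graded_linear_map_def glin_def)

lemmas lin_f = glin_lin[OF glin_f]

lemma f_d: "x \<in> carrier A \<Longrightarrow> f (del A x) = del A' (f x)" and f_b: "x \<in> carrier A \<Longrightarrow> f (delbar A x) = delbar A' (f x)"
  using morphism by (simp_all add: bicomplex_morphism_def)

lemma f_s: "x \<in> carrier A \<Longrightarrow> f (degree_sign A x) = degree_sign A' (f x)"
  using glin_degree_sign[OF S.bigraded S'.bigraded glin_f, of x] by simp

lemma f_commutes: "\<forall>x\<in>carrier A. f (del A x) = del A' (f x) \<and> f (delbar A x) = delbar A' (f x)"
  using f_d f_b by blast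

lemmas coh = cohomology_maps[OF S.ungraded_bicomplex_axioms S'.ungraded_bicomplex_axioms lin_f f_commutes]

lemma lin_H_BCA_map: "lin (H_BCA A) (H_BCA A') (H_BCA_map A' f)"
proof -
  note v = S.vs_H_BC S.vs_tilde_H_A
  note F = lin_of_sum_BCA(2)[OF lin_fst[OF v]] and G = lin_of_sum_BCA(2)[OF lin_snd[OF v]]
  have "lin (H_BCA A) (H_BCA A') (\<lambda>x. (H_BC_map A' f (fst x), tilde_H_A_map A' f (snd x)))"
    by (rule lin_of_sum_BCA(1)[OF lin_pair[OF lin_comp[OF F coh(5)] lin_comp[OF G coh(9)]]])
  then show ?thesis by (rule lin_cong) (simp add: H_BCA_map_def map_prod_def case_prod_beta)
qed

lemma lin_tilde_map: "lin (tilde_H_BC A) (tilde_H_BC A') (H_BC_map A' f)"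
proof -
  have "lin (tilde_H_BC A) (sub_space (H_BC A') {W \<in> carrier (H_BC A'). BC_to_A A' W = \<zero>\<^bsub>H_A A'\<^esub>}) (H_BC_map A' f)"
  proof (rule lin_sub_space_to[OF S.lin_tilde_H_BC_from[OF coh(5)] S'.subsp_tilde])
    fix x assume "x \<in> carrier (tilde_H_BC A)"
    then obtain z where z: "z \<in> S.Z" "z \<in> S.M" "x = S.cBC z" by auto
    have "H_BC_map A' f x \<in> carrier (tilde_H_BC A')"
      using coh(1)[OF z(1)] coh(3)[OF z(2)] coh(6)[OF z(1)] z(3) by auto
    then show "H_BC_map A' f x \<in> {W \<in> carrier (H_BC A'). BC_to_A A' W = \<zero>\<^bsub>H_A A'\<^esub>}"
      unfolding tilde_H_BC_def sub_space_simps .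
  qed
  then show ?thesis unfolding tilde_H_BC_def[of A'] .
qed

lemma lin_H_ABC_map: "lin (H_ABC A) (H_ABC A') (H_ABC_map A' f)"
proof -
  note v = S.vs_H_A S.vs_tilde_H_BC
  note F = lin_of_sum_ABC(2)[OF lin_fst[OF v]] and G = lin_of_sum_ABC(2)[OF lin_snd[OF v]]
  have "lin (H_ABC A) (H_ABC A') (\<lambda>x. (H_A_map A' f (fst x), H_BC_map A' f (snd x)))"
    by (rule lin_of_sum_ABC(1)[OF lin_pair[OF lin_comp[OF F coh(7)] lin_comp[OF G lin_tilde_map]]])
  then show ?thesis by (rule lin_cong) (simp add: H_ABC_map_def map_prod_def case_prod_beta)
qed

lemma BCA_map_parts:
  "x \<in> carrier (H_BCA A) \<Longrightarrow> H_BCA_map A' f (BCA_lower A x) = BCA_lower A' (H_BCA_map A' f x)"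
  "x \<in> carrier (H_BCA A) \<Longrightarrow> H_BCA_map A' f (BCA_upper A x) = BCA_upper A' (H_BCA_map A' f x)"
  using lin_zero[OF coh(5)] lin_zero[OF coh(9)]
  by (simp_all add: H_BCA_map_def BCA_lower_def BCA_upper_def map_prod_def case_prod_beta del: S.no_carrier S'.no_carrier)

lemma ABC_map_parts:
  "x \<in> carrier (H_ABC A) \<Longrightarrow> H_ABC_map A' f (ABC_lower A x) = ABC_lower A' (H_ABC_map A' f x)"
  "x \<in> carrier (H_ABC A) \<Longrightarrow> H_ABC_map A' f (ABC_upper A x) = ABC_upper A' (H_ABC_map A' f x)"
  using lin_zero[OF coh(7)] lin_zero[OF lin_tilde_map]
  by (simp_all add: H_ABC_map_def ABC_lower_def ABC_upper_def map_prod_def case_prod_beta del: S.no_carrier S'.no_carrier)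

text \<open>\<open>f\<close> maps \<open>Z\<close> into \<open>Z\<close>, where
  \<open>\<pi>'\<close> vanishes and \<open>piZ'\<close> preserves classes; so on
  \<open>H_BC\<close> the retracts reproduce the induced map exactly.\<close>

lemma BCA_lower_natural:
  "x \<in> carrier (H_BCA A) \<Longrightarrow> S'.q_BCA (f (S.r_BCA (BCA_lower A x))) = H_BCA_map A' f (BCA_lower A x)"
proof (erule S.BCA_cases)
  fix z y assume zy: "z \<in> S.Z" "y \<in> S.Y" "x = (S.cBC z, S.cTA y)"
  note zc = S.Z_carrier[OF zy(1)]
  have 0: "BCA_lower A x = (S.cBC z, S.cTA \<zero>\<^bsub>A\<^esub>)"
    using S.cTA_Z[OF subspD(2)[OF S.Z]] by (simp add: BCA_lower_def zy(3))
  have n0: "\<zero>\<^bsub>A\<^esub> \<in> S.Y" by (rule subspD(2)[OF S.Y])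
  have "S.r_BCA (BCA_lower A x) = S.piZ z"
    unfolding 0 S.r_BCA_class[OF zy(1) n0] using zc by (simp add: S.sp_simps S.proj_simps)
  moreover have w: "f (S.piZ z) \<in> S'.Z" by (rule coh(1)[OF S.piZ_Z[OF zc]])
  ultimately have "S'.q_BCA (f (S.r_BCA (BCA_lower A x))) = (S'.cBC (f (S.piZ z)), S'.cTA \<zero>\<^bsub>A'\<^esub>)"
    by (simp add: S'.q_BCA_def S'.piZ_on_Z S'.pi_on_Z S'.cBC_e)
  also have "S'.cBC (f (S.piZ z)) = H_BC_map A' f (S.cBC z)"
    using coh(6)[OF S.piZ_Z[OF zc]] S.cBC_e[OF zy(1)] S.piZ_on_Z[OF zy(1)] by simp
  also have "S'.cTA \<zero>\<^bsub>A'\<^esub> = tilde_H_A_map A' f (S.cTA \<zero>\<^bsub>A\<^esub>)"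
    using coh(10)[OF n0] by (simp add: lin_zero[OF lin_f])
  finally show ?thesis by (simp add: 0 H_BCA_map_def)
qed

text \<open>\<open>f (\<pi> y)\<close> lies in \<open>Y\<close> but may leave the range of
  \<open>\<pi>'\<close>. The error is a class in \<open>H_BC\<close>, which \<open>BCA_upper\<close>
  discards.\<close>

lemma BCA_upper_natural:
  "x \<in> carrier (H_BCA A) \<Longrightarrow>
   BCA_upper A' (S'.q_BCA (f (S.r_BCA (BCA_upper A x)))) = H_BCA_map A' f (BCA_upper A x)"
proof (erule S.BCA_cases)
  fix z y assume zy: "z \<in> S.Z" "y \<in> S.Y" "x = (S.cBC z, S.cTA y)"
  note yc = S.Y_carrier[OF zy(2)]
  have i0: "S.cBC \<zero>\<^bsub>A\<^esub> = \<zero>\<^bsub>H_BC A\<^esub>"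
    using S.cBC_zero[of "\<zero>\<^bsub>A\<^esub>"] subspD(2)[OF S.I] S.V by simp
  have 0: "BCA_upper A x = (S.cBC \<zero>\<^bsub>A\<^esub>, S.cTA y)"
    using i0 by (simp add: BCA_upper_def zy(3))
  have n0: "\<zero>\<^bsub>A\<^esub> \<in> S.Z" by (rule subspD(2)[OF S.Z])
  have "S.r_BCA (BCA_upper A x) = \<pi> y"
    unfolding 0 S.r_BCA_class[OF n0 zy(2)] using yc by (simp add: S.sp_simps S.proj_simps)
  moreover have w: "f (\<pi> y) \<in> S'.Y" by (rule coh(2)[OF S.pi_Y[OF yc]])
  ultimately have "BCA_upper A' (S'.q_BCA (f (S.r_BCA (BCA_upper A x)))) = (\<zero>\<^bsub>H_BC A'\<^esub>, S'.cTA (f (\<pi> y)))"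
    by (simp add: S'.q_BCA_def BCA_upper_def S'.cTA_pi)
  also have "S'.cTA (f (\<pi> y)) = tilde_H_A_map A' f (S.cTA y)"
    using coh(10)[OF S.pi_Y[OF yc]] S.cTA_pi[OF zy(2)] by simp
  also have "\<zero>\<^bsub>H_BC A'\<^esub> = H_BC_map A' f (S.cBC \<zero>\<^bsub>A\<^esub>)"
    unfolding i0 lin_zero[OF coh(5)] ..
  finally show ?thesis by (simp add: 0 H_BCA_map_def)
qed

text \<open>\<open>f\<close> maps \<open>Z \<inter> M\<close> into \<open>Z \<inter> M\<close>,
  where \<open>piC'\<close> vanishes and \<open>\<mu>'\<close> preserves Bott-Chern classes; no
  error arises.\<close>

lemma ABC_lower_natural:
  "x \<in> carrier (H_ABC A) \<Longrightarrow> S'.q_ABC (f (S.r_ABC (ABC_lower A x))) = H_ABC_map A' f (ABC_lower A x)"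
proof (erule S.ABC_cases)
  fix z y assume zy: "y \<in> S.Y" "z \<in> S.Z" "z \<in> S.M" "x = (S.cA y, S.cBC z)"
  note zc = S.Z_carrier[OF zy(2)]
  have a0: "S.cA \<zero>\<^bsub>A\<^esub> = \<zero>\<^bsub>H_A A\<^esub>"
    using S.cA_zero[of "\<zero>\<^bsub>A\<^esub>"] subspD(2)[OF S.M] S.V by simp
  have 0: "ABC_lower A x = (S.cA \<zero>\<^bsub>A\<^esub>, S.cBC z)"
    using a0 by (simp add: ABC_lower_def zy(4))
  have n0: "\<zero>\<^bsub>A\<^esub> \<in> S.Y" by (rule subspD(2)[OF S.Y])
  have "S.r_ABC (ABC_lower A x) = \<mu> z"
    unfolding 0 S.r_ABC_class[OF n0 zy(2)] using zc by (simp add: S.sp_simps S.proj_simps)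
  moreover have w: "f (\<mu> z) \<in> S'.Z" "f (\<mu> z) \<in> S'.M" by (rule coh(1)[OF S.mu_Z[OF zc]], rule coh(3)[OF S.mu_M[OF zc]])
  ultimately have "S'.q_ABC (f (S.r_ABC (ABC_lower A x))) = (S'.cA \<zero>\<^bsub>A'\<^esub>, S'.cBC (f (\<mu> z)))"
    by (simp add: S'.q_ABC_def S'.mu_on_M S'.piC_on_M S'.cBC_e)
  also have "S'.cBC (f (\<mu> z)) = H_BC_map A' f (S.cBC z)"
    using coh(6)[OF S.mu_Z[OF zc]] S.cBC_e[OF zy(2)] S.mu_on_M[OF zy(3)] by simp
  also have "S'.cA \<zero>\<^bsub>A'\<^esub> = H_A_map A' f (S.cA \<zero>\<^bsub>A\<^esub>)"
    using coh(8)[OF n0] by (simp add: lin_zero[OF lin_f])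
  finally show ?thesis by (simp add: 0 H_ABC_map_def)
qed

text \<open>\<open>f (piC y)\<close> may have a part in the range of \<open>\<mu>'\<close>. It
  contributes a class in \<open>tilde_H_BC\<close>, which \<open>ABC_upper\<close> discards.\<close>

lemma ABC_upper_natural:
  "x \<in> carrier (H_ABC A) \<Longrightarrow>
   ABC_upper A' (S'.q_ABC (f (S.r_ABC (ABC_upper A x)))) = H_ABC_map A' f (ABC_upper A x)"
proof (erule S.ABC_cases)
  fix z y assume zy: "y \<in> S.Y" "z \<in> S.Z" "z \<in> S.M" "x = (S.cA y, S.cBC z)"
  note yc = S.Y_carrier[OF zy(1)]
  have i0: "S.cBC \<zero>\<^bsub>A\<^esub> = \<zero>\<^bsub>tilde_H_BC A\<^esub>"
    using S.cBC_zero[of "\<zero>\<^bsub>A\<^esub>"] subspD(2)[OF S.I] S.V by simp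
  have 0: "ABC_upper A x = (S.cA y, S.cBC \<zero>\<^bsub>A\<^esub>)"
    using i0 by (simp add: ABC_upper_def zy(4))
  have n0: "\<zero>\<^bsub>A\<^esub> \<in> S.Z" by (rule subspD(2)[OF S.Z])
  have "S.r_ABC (ABC_upper A x) = S.piC y"
    unfolding 0 S.r_ABC_class[OF zy(1) n0] using yc by (simp add: S.sp_simps S.proj_simps)
  moreover have w: "f (S.piC y) \<in> S'.Y" by (rule coh(2)[OF S.piC_Y[OF yc]])
  ultimately have "ABC_upper A' (S'.q_ABC (f (S.r_ABC (ABC_upper A x)))) = (S'.cA (f (S.piC y)), \<zero>\<^bsub>tilde_H_BC A'\<^esub>)"
    by (simp add: S'.q_ABC_def ABC_upper_def S'.cA_piC)
  also have "S'.cA (f (S.piC y)) = H_A_map A' f (S.cA y)"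
    using coh(8)[OF S.piC_Y[OF yc]] S.cA_piC[OF zy(1)] by simp
  also have "\<zero>\<^bsub>tilde_H_BC A'\<^esub> = H_BC_map A' f (S.cBC \<zero>\<^bsub>A\<^esub>)"
    unfolding i0 lin_zero[OF lin_tilde_map] ..
  finally show ?thesis by (simp add: 0 H_ABC_map_def)
qed

end

context two_step_pair
begin

lemma middle_parts:
  assumes "t \<in> carrier S"
  shows "P1 (tS kA1 kB0 t) = tS kA1 kB0 t" "P1 (tS kA0 kB1 t) = tS kA0 kB1 t"
proof -
  note r = tensor_lin_eq[OF X.H.V Y.H.V _ _ _ assms]
  note l = lin_comp[OF lin_k(2) lin_P1] lin_comp[OF lin_k(3) lin_P1]
  note p = tensor_map_pure[OF X.lin_k1 Y.lin_k0] tensor_map_pure[OF X.lin_k0 Y.lin_k1]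
  show "P1 (tS kA1 kB0 t) = tS kA1 kB0 t" by (rule r[OF l(1) lin_k(2)]) (simp add: P_simps p)
  show "P1 (tS kA0 kB1 t) = tS kA0 kB1 t" by (rule r[OF l(2) lin_k(3)]) (simp add: P_simps p)
qed

text \<open>The terms of the sequences are given as spans of pure tensors; as fixed points of
  \<open>P2\<close> and \<open>P1\<close> they become accessible to calculation. The second and
  third equations differ in the order of the summands, which is that of \<open>K_space\<close> and
  of \<open>L_space\<close> respectively.\<close>

lemma sub_parts:
  assumes A1: "A1 \<subseteq> carrier HA" "\<And>x. x \<in> carrier HA \<Longrightarrow> kA1 x \<in> A1" "\<And>x. x \<in> A1 \<Longrightarrow> kA1 x = x"
    and A0: "A0 \<subseteq> carrier HA" "\<And>x. x \<in> carrier HA \<Longrightarrow> kA0 x \<in> A0" "\<And>x. x \<in> A0 \<Longrightarrow> kA0 x = x"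
    and B1: "B1 \<subseteq> carrier HB" "\<And>x. x \<in> carrier HB \<Longrightarrow> kB1 x \<in> B1" "\<And>x. x \<in> B1 \<Longrightarrow> kB1 x = x"
    and B0: "B0 \<subseteq> carrier HB" "\<And>x. x \<in> carrier HB \<Longrightarrow> kB0 x \<in> B0" "\<And>x. x \<in> B0 \<Longrightarrow> kB0 x = x"
  shows "tensor_sub HA HB A1 B1 = {t \<in> carrier S. P2 t = t}"
    and "tensor_sub HA HB A1 B0 <+>\<^bsub>S\<^esub> tensor_sub HA HB A0 B1 = {t \<in> carrier S. P1 t = t}"
    and "tensor_sub HA HB A0 B1 <+>\<^bsub>S\<^esub> tensor_sub HA HB A1 B0 = {t \<in> carrier S. P1 t = t}"
proof -
  note V = X.H.V Y.H.V
  have c: "t \<in> carrier S" if "t \<in> tensor_sub HA HB U W" "U \<subseteq> carrier HA" "W \<subseteq> carrier HB" for t U W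
    using subspD(3)[OF subsp_tensor_sub[OF V that(2,3)] that(1)] .
  have f: "tS kA1 kB1 t = t" if "t \<in> tensor_sub HA HB A1 B1" for t
    by (rule tensor_map_fixes_tensor_sub[OF X.lin_k1 Y.lin_k1 A1(1) B1(1) A1(3) B1(3) that])
  have f10: "tS kA1 kB0 t = t" if "t \<in> tensor_sub HA HB A1 B0" for t
    by (rule tensor_map_fixes_tensor_sub[OF X.lin_k1 Y.lin_k0 A1(1) B0(1) A1(3) B0(3) that])
  have f01: "tS kA0 kB1 t = t" if "t \<in> tensor_sub HA HB A0 B1" for t
    by (rule tensor_map_fixes_tensor_sub[OF X.lin_k0 Y.lin_k1 A0(1) B1(1) A0(3) B1(3) that])
  have i: "tS kA1 kB1 t \<in> tensor_sub HA HB A1 B1" "tS kA1 kB0 t \<in> tensor_sub HA HB A1 B0"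
    "tS kA0 kB1 t \<in> tensor_sub HA HB A0 B1" if "t \<in> carrier S" for t
    by (rule tensor_map_in_tensor_sub[OF X.lin_k1 Y.lin_k1 A1(1) B1(1) A1(2) B1(2) that]
        tensor_map_in_tensor_sub[OF X.lin_k1 Y.lin_k0 A1(1) B0(1) A1(2) B0(2) that]
        tensor_map_in_tensor_sub[OF X.lin_k0 Y.lin_k1 A0(1) B1(1) A0(2) B1(2) that]; assumption)+
  show "tensor_sub HA HB A1 B1 = {t \<in> carrier S. P2 t = t}"
    unfolding P2_def using f i(1) c[OF _ A1(1) B1(1)] by force
  have p10: "P1 t = t" "t \<in> carrier S" if "t \<in> tensor_sub HA HB A1 B0" for t
    using middle_parts(1)[OF c[OF that A1(1) B0(1)]] f10[OF that] c[OF that A1(1) B0(1)] by auto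
  have p01: "P1 t = t" "t \<in> carrier S" if "t \<in> tensor_sub HA HB A0 B1" for t
    using middle_parts(2)[OF c[OF that A0(1) B1(1)]] f01[OF that] c[OF that A0(1) B1(1)] by auto
  have com: "x \<oplus>\<^bsub>S\<^esub> y = y \<oplus>\<^bsub>S\<^esub> x" if "x \<in> carrier S" "y \<in> carrier S" for x y
    by (rule vs_eqI[OF TH.T]) (use that in \<open>simp_all add: TH.T TH.Temb\<close>)
  have l: "t \<in> carrier S \<and> P1 t = t"
    if "t = x \<oplus>\<^bsub>S\<^esub> y" "x \<in> tensor_sub HA HB A1 B0" "y \<in> tensor_sub HA HB A0 B1" for t x y
    using that p10[OF that(2)] p01[OF that(3)] by (simp add: P_lin_simps TH.T)
  have r: "t = tS kA1 kB0 t \<oplus>\<^bsub>S\<^esub> tS kA0 kB1 t" if "P1 t = t" for t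
    using that by (simp add: P1_def)
  show "tensor_sub HA HB A1 B0 <+>\<^bsub>S\<^esub> tensor_sub HA HB A0 B1 = {t \<in> carrier S. P1 t = t}"
  proof (intro equalityI subsetI)
    fix t assume "t \<in> tensor_sub HA HB A1 B0 <+>\<^bsub>S\<^esub> tensor_sub HA HB A0 B1"
    then obtain x y where "t = x \<oplus>\<^bsub>S\<^esub> y" "x \<in> tensor_sub HA HB A1 B0" "y \<in> tensor_sub HA HB A0 B1"
      unfolding set_add_eq by blast
    from l[OF this] show "t \<in> {t \<in> carrier S. P1 t = t}" by simp
  next
    fix t assume "t \<in> {t \<in> carrier S. P1 t = t}"
    then have t: "t \<in> carrier S" "P1 t = t" by auto
    show "t \<in> tensor_sub HA HB A1 B0 <+>\<^bsub>S\<^esub> tensor_sub HA HB A0 B1"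
      unfolding set_add_eq by (intro CollectI exI conjI, rule r[OF t(2)], rule i(2)[OF t(1)], rule i(3)[OF t(1)])
  qed
  show "tensor_sub HA HB A0 B1 <+>\<^bsub>S\<^esub> tensor_sub HA HB A1 B0 = {t \<in> carrier S. P1 t = t}"
  proof (intro equalityI subsetI)
    fix t assume "t \<in> tensor_sub HA HB A0 B1 <+>\<^bsub>S\<^esub> tensor_sub HA HB A1 B0"
    then obtain x y where xy: "t = y \<oplus>\<^bsub>S\<^esub> x" "x \<in> tensor_sub HA HB A1 B0" "y \<in> tensor_sub HA HB A0 B1"
      unfolding set_add_eq by blast
    then have "t = x \<oplus>\<^bsub>S\<^esub> y" using com[OF p01(2)[OF xy(3)] p10(2)[OF xy(2)]] by simp
    from l[OF this xy(2,3)] show "t \<in> {t \<in> carrier S. P1 t = t}" by simp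
  next
    fix t assume "t \<in> {t \<in> carrier S. P1 t = t}"
    then have t: "t \<in> carrier S" "P1 t = t" by auto
    have eq: "t = tS kA0 kB1 t \<oplus>\<^bsub>S\<^esub> tS kA1 kB0 t"
      using r[OF t(2)] com[OF lin_closed[OF lin_k(2) t(1)] lin_closed[OF lin_k(3) t(1)]] by simp
    show "t \<in> tensor_sub HA HB A0 B1 <+>\<^bsub>S\<^esub> tensor_sub HA HB A1 B0"
      unfolding set_add_eq by (intro CollectI exI conjI, rule eq, rule i(3)[OF t(1)], rule i(2)[OF t(1)])
  qed
qed

end

section \<open>Morphisms of filtered tensor products\<close>

locale two_step_pair_morphism =
  P: two_step_pair A dA bA sA HA dHA bHA sHA qA rA gA kA0 kA1 B dB bB sB HB dHB bHB sHB qB rB gB kB0 kB1 +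
  P': two_step_pair A' dA' bA' sA' HA' dHA' bHA' sHA' qA' rA' gA' kA0' kA1' B' dB' bB' sB' HB' dHB' bHB' sHB' qB' rB' gB' kB0' kB1'
  for A :: "(complex, 'a, 'm) module_scheme" and dA bA sA
    and HA :: "(complex, 'h, 'n) module_scheme" and dHA bHA sHA qA rA gA kA0 kA1
    and B :: "(complex, 'b, 'o) module_scheme" and dB bB sB
    and HB :: "(complex, 'k, 'p) module_scheme" and dHB bHB sHB qB rB gB kB0 kB1
    and A' :: "(complex, 'a2, 'm2) module_scheme" and dA' bA' sA'
    and HA' :: "(complex, 'h2, 'n2) module_scheme" and dHA' bHA' sHA' qA' rA' gA' kA0' kA1'
    and B' :: "(complex, 'b2, 'o2) module_scheme" and dB' bB' sB'
    and HB' :: "(complex, 'k2, 'p2) module_scheme" and dHB' bHB' sHB' qB' rB' gB' kB0' kB1' +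
  fixes f g u w
  assumes lin_f: "lin A A' f" and lin_g: "lin B B' g" and lin_u: "lin HA HA' u" and lin_w: "lin HB HB' w"
    and f_d: "x \<in> carrier A \<Longrightarrow> f (dA x) = dA' (f x)" and f_b: "x \<in> carrier A \<Longrightarrow> f (bA x) = bA' (f x)"
    and f_s: "x \<in> carrier A \<Longrightarrow> f (sA x) = sA' (f x)"
    and g_d: "y \<in> carrier B \<Longrightarrow> g (dB y) = dB' (g y)" and g_b: "y \<in> carrier B \<Longrightarrow> g (bB y) = bB' (g y)"
    and u_k0: "v \<in> carrier HA \<Longrightarrow> u (kA0 v) = kA0' (u v)" and u_k1: "v \<in> carrier HA \<Longrightarrow> u (kA1 v) = kA1' (u v)"
    and w_k0: "v' \<in> carrier HB \<Longrightarrow> w (kB0 v') = kB0' (w v')" and w_k1: "v' \<in> carrier HB \<Longrightarrow> w (kB1 v') = kB1' (w v')"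
    and u_lower: "v \<in> carrier HA \<Longrightarrow> qA' (f (rA (kA0 v))) = u (kA0 v)"
    and u_upper: "v \<in> carrier HA \<Longrightarrow> kA1' (qA' (f (rA (kA1 v)))) = u (kA1 v)"
    and w_lower: "v' \<in> carrier HB \<Longrightarrow> qB' (g (rB (kB0 v'))) = w (kB0 v')"
    and w_upper: "v' \<in> carrier HB \<Longrightarrow> kB1' (qB' (g (rB (kB1 v')))) = w (kB1 v')"
begin

text \<open>
  \<open>u\<close> and \<open>w\<close> are the maps in cohomology; \<open>q' f r\<close> agrees with \<open>u\<close> only up to the filtration
  by \<open>k0\<close>.
\<close>

definition "F = tensor_map A' B' f g"
definition "U = tensor_map HA' HB' u w"

lemma lin_F: "lin P.T P'.T F" and lin_U: "lin P.S P'.S U"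
  unfolding F_def U_def by (rule lin_tensor_map lin_f lin_g lin_u lin_w)+

lemma F_pure: "v \<in> carrier A \<Longrightarrow> v' \<in> carrier B \<Longrightarrow> F (pure_tensor A B v v') = pure_tensor A' B' (f v) (g v')"
  unfolding F_def by (rule tensor_map_pure[OF lin_f lin_g])

lemma U_pure: "v \<in> carrier HA \<Longrightarrow> v' \<in> carrier HB \<Longrightarrow> U (pure_tensor HA HB v v') = pure_tensor HA' HB' (u v) (w v')"
  unfolding U_def by (rule tensor_map_pure[OF lin_u lin_w])

lemmas FU_simps = lin_simps[OF lin_F] lin_simps[OF lin_U] F_pure U_pure
  lin_simps[OF lin_f] lin_simps[OF lin_g] lin_simps[OF lin_u] lin_simps[OF lin_w]

lemma F_D: "t \<in> carrier P.T \<Longrightarrow> F (P.TA.D t) = P'.TA.D (F t)"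
  by (rule tensor_lin_eq[OF P.X.A.V P.Y.A.V lin_comp[OF P.TA.lin_D lin_F] lin_comp[OF lin_F P'.TA.lin_D]])
    (simp_all add: FU_simps P.TA.D_pure P'.TA.D_pure P.TA.pure_simps P.X.A.op_simps P.Y.A.op_simps f_d f_s g_d)

lemma F_Db: "t \<in> carrier P.T \<Longrightarrow> F (P.TA.Db t) = P'.TA.Db (F t)"
  by (rule tensor_lin_eq[OF P.X.A.V P.Y.A.V lin_comp[OF P.TA.lin_Db lin_F] lin_comp[OF lin_F P'.TA.lin_Db]])
    (simp_all add: FU_simps P.TA.Db_pure P'.TA.Db_pure P.TA.pure_simps P.X.A.op_simps P.Y.A.op_simps f_b f_s g_b)

text \<open>What \<open>F\<close> becomes in the models. It need not be \<open>U\<close>, but by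
  \<open>Phi_P2\<close>, \<open>Phi_P1\<close> and \<open>Phi_P0\<close> it respects the filtration
  and induces \<open>U\<close> on the graded pieces.\<close>

definition "\<Phi> s = P'.Q (F (P.R s))"

lemma lin_Phi: "lin P.S P'.S \<Phi>"
  unfolding \<Phi>_def by (rule lin_comp[OF lin_comp[OF P.lin_R lin_F] P'.lin_Q])

text \<open>Extends \<open>u_upper\<close> from the range of \<open>kA1\<close> to all of
  \<open>HA\<close>: the lower part of \<open>v\<close> is sent to a lower part, which
  \<open>kA1'\<close> kills.\<close>

lemma u_upper': "v \<in> carrier HA \<Longrightarrow> kA1' (qA' (f (rA v))) = u (kA1 v)"
proof -
  assume v: "v \<in> carrier HA"
  have "qA' (f (rA (kA0 v \<oplus>\<^bsub>HA\<^esub> kA1 v))) = qA' (f (rA (kA0 v))) \<oplus>\<^bsub>HA'\<^esub> qA' (f (rA (kA1 v)))"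
    using v by (simp add: FU_simps P.QR_simps P'.QR_simps P.X.k_simps)
  then have "kA1' (qA' (f (rA v))) = kA1' (u (kA0 v)) \<oplus>\<^bsub>HA'\<^esub> kA1' (qA' (f (rA (kA1 v))))"
    using v by (simp add: P.X.k_sum u_lower P'.X.k_simps P.X.k_simps FU_simps P.QR_simps P'.QR_simps)
  then show ?thesis
    using v by (simp add: u_upper u_k0 P'.X.k_simps FU_simps P.X.k_simps P'.X.H.op_simps)
qed

lemma w_upper': "v \<in> carrier HB \<Longrightarrow> kB1' (qB' (g (rB v))) = w (kB1 v)"
proof -
  assume v: "v \<in> carrier HB"
  have "qB' (g (rB (kB0 v \<oplus>\<^bsub>HB\<^esub> kB1 v))) = qB' (g (rB (kB0 v))) \<oplus>\<^bsub>HB'\<^esub> qB' (g (rB (kB1 v)))"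
    using v by (simp add: FU_simps P.QR_simps P'.QR_simps P.Y.k_simps)
  then have "kB1' (qB' (g (rB v))) = kB1' (w (kB0 v)) \<oplus>\<^bsub>HB'\<^esub> kB1' (qB' (g (rB (kB1 v))))"
    using v by (simp add: P.Y.k_sum w_lower P'.Y.k_simps P.Y.k_simps FU_simps P.QR_simps P'.QR_simps)
  then show ?thesis
    using v by (simp add: w_upper w_k0 P'.Y.k_simps FU_simps P.Y.k_simps P'.Y.H.op_simps)
qed

lemma Phi_pure: "v \<in> carrier HA \<Longrightarrow> v' \<in> carrier HB \<Longrightarrow>
    \<Phi> (pure_tensor HA HB v v') = pure_tensor HA' HB' (qA' (f (rA v))) (qB' (g (rB v')))"
  by (simp add: \<Phi>_def P.QR_simps P'.QR_simps FU_simps)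

lemmas Phi_simps = lin_simps[OF lin_Phi] Phi_pure u_lower w_lower u_upper' w_upper' u_k0 u_k1 w_k0 w_k1
  FU_simps P.P_simps P'.P_simps P.QR_simps P'.QR_simps

lemma Phi_P2: "s \<in> carrier P.S \<Longrightarrow> P'.P2 (\<Phi> s) = U (P.P2 s)"
  by (rule tensor_lin_eq[OF P.X.H.V P.Y.H.V lin_comp[OF lin_Phi P'.lin_P2] lin_comp[OF P.lin_P2 lin_U]])
    (simp_all add: Phi_simps)

lemma Phi_P0: "s \<in> carrier P.S \<Longrightarrow> \<Phi> (P.P0 s) = U (P.P0 s)"
  by (rule tensor_lin_eq[OF P.X.H.V P.Y.H.V lin_comp[OF P.lin_P0 lin_Phi] lin_comp[OF P.lin_P0 lin_U]])
    (simp_all add: Phi_simps)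

lemma Phi_P1: "s \<in> carrier P.S \<Longrightarrow> P'.P1 (\<Phi> (P.P1 s)) = U (P.P1 s)"
  by (rule tensor_lin_eq[OF P.X.H.V P.Y.H.V lin_comp[OF lin_comp[OF P.lin_P1 lin_Phi] P'.lin_P1] lin_comp[OF P.lin_P1 lin_U]])
    (simp_all add: Phi_simps)

lemma U_P: "s \<in> carrier P.S \<Longrightarrow> P'.P1 (U s) = U (P.P1 s)" "s \<in> carrier P.S \<Longrightarrow> P'.P0 (U s) = U (P.P0 s)"
  by (rule tensor_lin_eq[OF P.X.H.V P.Y.H.V lin_comp[OF lin_U P'.lin_P1] lin_comp[OF P.lin_P1 lin_U]])
    (simp_all add: Phi_simps,
     rule tensor_lin_eq[OF P.X.H.V P.Y.H.V lin_comp[OF lin_U P'.lin_P0] lin_comp[OF P.lin_P0 lin_U]], simp_all add: Phi_simps)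

end

section \<open>The tensor product records and their bigrading\<close>

lemma graded_linear_map_eq: "graded_linear_map V W f \<longleftrightarrow> glin 0 0 V W f"
  by (simp add: graded_linear_map_def glin_def)

lemma tensor_space_simps [simp]:
  "carrier (tensor_space V W) = carrier (tensor_module V W)" "\<zero>\<^bsub>tensor_space V W\<^esub> = \<zero>\<^bsub>tensor_module V W\<^esub>"
  "add (tensor_space V W) = add (tensor_module V W)" "smult (tensor_space V W) = smult (tensor_module V W)"
  by (simp_all add: tensor_space_def module.defs bigraded.defs)

lemma grade_tensor_space:
  "grade (tensor_space V W) p q = vspan (tensor_module V W)
     {pure_tensor V W v w | v w i j k l. i + k = p \<and> j + l = q \<and> v \<in> grade V i j \<and> w \<in> grade W k l}"
  by (simp add: tensor_space_def module.defs bigraded.defs)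

lemma tensor_bicomplex_simps [simp]:
  "carrier (tensor_bicomplex A B) = carrier (tensor_module A B)"
  "\<zero>\<^bsub>tensor_bicomplex A B\<^esub> = \<zero>\<^bsub>tensor_module A B\<^esub>"
  "add (tensor_bicomplex A B) = add (tensor_module A B)"
  "smult (tensor_bicomplex A B) = smult (tensor_module A B)"
  "grade (tensor_bicomplex A B) = grade (tensor_space A B)"
  "del (tensor_bicomplex A B) = tensor_diff A B (del A) (del B)"
  "delbar (tensor_bicomplex A B) = tensor_diff A B (delbar A) (delbar B)"
  by (simp_all add: tensor_bicomplex_def tensor_space_def module.defs bigraded.defs bicomplex.defs)

lemma set_add_tensor_bicomplex [simp]: "set_add (tensor_bicomplex A B) = set_add (tensor_module A B)"
  by (simp add: set_add_def' fun_eq_iff)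

lemma quot_map_tensor_bicomplex [simp]: "quot_map (tensor_bicomplex A B) W f = quot_map (tensor_module A B) W f"
  "quot_map (tensor_space V V') W f = quot_map (tensor_module V V') W f"
  by (simp_all add: quot_map_def set_add_def' fun_eq_iff)

lemma coset_tensor [simp]: "W +>\<^bsub>tensor_bicomplex A B\<^esub> x = W +>\<^bsub>tensor_module A B\<^esub> x"
  "W +>\<^bsub>tensor_space V V'\<^esub> x = W +>\<^bsub>tensor_module V V'\<^esub> x"
  by (simp_all add: a_r_coset_def')

lemma vs_tensor_records:
  "vs (tensor_module A B) \<Longrightarrow> vs (tensor_bicomplex A B)" "vs (tensor_module V W) \<Longrightarrow> vs (tensor_space V W)"
  by (erule vs_eqv; simp)+

lemma
  assumes V: "vs V" and W: "vs W"
    and gV: "\<And>p q. grade V p q \<subseteq> carrier V" and gW: "\<And>p q. grade W p q \<subseteq> carrier W"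
  shows subsp_tensor_grade: "subsp (tensor_module V W) (grade (tensor_space V W) p q)"
    and pure_tensor_grade: "v \<in> grade V i j \<Longrightarrow> w \<in> grade W k l \<Longrightarrow> i + k = p \<Longrightarrow> j + l = q \<Longrightarrow>
      pure_tensor V W v w \<in> grade (tensor_space V W) p q"
    and tensor_generators_carrier:
      "{pure_tensor V W v w | v w i j k l. i + k = p \<and> j + l = q \<and> v \<in> grade V i j \<and> w \<in> grade W k l}
        \<subseteq> carrier (tensor_module V W)"
proof -
  show c: "{pure_tensor V W v w | v w i j k l. i + k = p \<and> j + l = q \<and> v \<in> grade V i j \<and> w \<in> grade W k l}
      \<subseteq> carrier (tensor_module V W)"
    by (blast intro: pure_tensor_closed[OF V W] subsetD[OF gV] subsetD[OF gW])
  show "subsp (tensor_module V W) (grade (tensor_space V W) p q)"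
    unfolding grade_tensor_space by (rule subsp_span[OF vs_tensor_module[OF V W] c])
  show "v \<in> grade V i j \<Longrightarrow> w \<in> grade W k l \<Longrightarrow> i + k = p \<Longrightarrow> j + l = q \<Longrightarrow>
      pure_tensor V W v w \<in> grade (tensor_space V W) p q"
    unfolding grade_tensor_space by (rule span_base[OF vs_tensor_module[OF V W] c]) blast
qed

lemma tensor_map_graded:
  assumes f: "glin 0 0 V V' f" and g: "glin 0 0 W W' g"
    and gr: "\<And>p q. grade V p q \<subseteq> carrier V" "\<And>p q. grade W p q \<subseteq> carrier W"
      "\<And>p q. grade V' p q \<subseteq> carrier V'" "\<And>p q. grade W' p q \<subseteq> carrier W'"
    and t: "t \<in> grade (tensor_space V W) p q"
  shows "tensor_map V' W' f g t \<in> grade (tensor_space V' W') p q"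
proof -
  note lf = glin_lin[OF f] and lg = glin_lin[OF g]
  note vs = lin_dom[OF lf] lin_dom[OF lg] and vs' = lin_cod[OF lf] lin_cod[OF lg]
  show ?thesis
  proof (rule lin_span[OF lin_tensor_map[OF lf lg] tensor_generators_carrier[OF vs gr(1,2)] _
        subsp_tensor_grade[OF vs' gr(3,4)] t[unfolded grade_tensor_space]])
    fix x assume "x \<in> {pure_tensor V W v w | v w i j k l. i + k = p \<and> j + l = q \<and> v \<in> grade V i j \<and> w \<in> grade W k l}"
    then obtain v w i j k l where x: "x = pure_tensor V W v w" "i + k = p" "j + l = q" "v \<in> grade V i j" "w \<in> grade W k l"
      by blast
    have "v \<in> carrier V" "w \<in> carrier W" using subsetD[OF gr(1) x(4)] subsetD[OF gr(2) x(5)] by auto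
    moreover have "f v \<in> grade V' i j" "g w \<in> grade W' k l"
      using glin_grade[OF f, of v "(i, j)"] glin_grade[OF g, of w "(k, l)"] x by simp_all
    ultimately show "tensor_map V' W' f g x \<in> grade (tensor_space V' W') p q"
      unfolding x(1) using pure_tensor_grade[OF vs' gr(3,4) _ _ x(2,3)] by (simp add: tensor_map_pure[OF lf lg])
  qed
qed

section \<open>The two exact sequences\<close>

text \<open>The common pattern of both sequences. The maps are given before division by
  \<open>N0\<close> and \<open>N1\<close>, so that exactness becomes a list of conditions on
  representatives; \<open>ker_i\<close> gives both well-definedness and injectivity on the
  quotient.\<close>

lemma short_exact_quotients:
  assumes N0: "subsp V0 N0" and N1: "subsp V1 N1"
    and i: "lin V0 (quot_space V1 N1) i" and p: "lin V1 W p"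
    and gi: "\<And>a b t. t \<in> grade V0 a b \<Longrightarrow> i t \<in> grade (quot_space V1 N1) a b"
    and gp: "\<And>a b x. x \<in> grade V1 a b \<Longrightarrow> p x \<in> grade W a b"
    and g0: "\<And>a b. grade V0 a b \<subseteq> carrier V0" and g1: "\<And>a b. grade V1 a b \<subseteq> carrier V1"
    and ker_i: "\<And>t. t \<in> carrier V0 \<Longrightarrow> i t = N1 \<longleftrightarrow> t \<in> N0"
    and ker_p: "\<And>x. x \<in> N1 \<Longrightarrow> p x = \<zero>\<^bsub>W\<^esub>"
    and ex1: "\<And>t. t \<in> carrier V0 \<Longrightarrow> \<exists>x\<in>carrier V1. i t = N1 +>\<^bsub>V1\<^esub> x \<and> p x = \<zero>\<^bsub>W\<^esub>"
    and ex2: "\<And>x. x \<in> carrier V1 \<Longrightarrow> p x = \<zero>\<^bsub>W\<^esub> \<Longrightarrow> \<exists>t\<in>carrier V0. i t = N1 +>\<^bsub>V1\<^esub> x"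
    and surj: "\<And>w. w \<in> carrier W \<Longrightarrow> \<exists>x\<in>carrier V1. p x = w"
  shows "short_exact (quot_space V0 N0) (quot_lift i) (quot_space V1 N1) (quot_lift p) W"
proof -
  have V0: "vs V0" and V1: "vs V1" using i p by (auto dest: lin_dom)
  have ki: "i t = \<zero>\<^bsub>quot_space V1 N1\<^esub>" if "t \<in> N0" for t
    using ker_i[OF subspD(3)[OF N0 that]] that by simp
  note li = lin_quot_space_lift[OF i N0 ki] and lp = lin_quot_space_lift[OF p N1 ker_p]
  have ci: "quot_lift i (N0 +>\<^bsub>V0\<^esub> t) = i t" if "t \<in> carrier V0" for t
    by (rule quot_lift_coset[OF i N0 _ that]) (rule ki)
  have cp: "quot_lift p (N1 +>\<^bsub>V1\<^esub> x) = p x" if "x \<in> carrier V1" for x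
    by (rule quot_lift_coset[OF p N1 _ that]) (rule ker_p)
  have c0: "\<exists>t\<in>carrier V0. X = N0 +>\<^bsub>V0\<^esub> t \<and> quot_lift i X = i t" if X: "X \<in> carrier (quot_space V0 N0)" for X
  proof -
    obtain t where "t \<in> carrier V0" "X = N0 +>\<^bsub>V0\<^esub> t" using X by auto
    then show ?thesis using ci by blast
  qed
  show ?thesis
    unfolding short_exact_def graded_linear_map_eq
  proof (intro conjI)
    show "glin 0 0 (quot_space V0 N0) (quot_space V1 N1) (quot_lift i)"
    proof (rule glinI[OF li])
      fix j X assume "X \<in> gr (quot_space V0 N0) j"
      then obtain t where t: "t \<in> gr V0 j" "X = N0 +>\<^bsub>V0\<^esub> t" by auto
      have "quot_lift i X = i t" unfolding t(2) using ci subsetD[OF g0 t(1)] by blast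
      then show "quot_lift i X \<in> gr (quot_space V1 N1) (fst j + 0, snd j + 0)" using gi[OF t(1)] by simp
    qed
    show "glin 0 0 (quot_space V1 N1) W (quot_lift p)"
    proof (rule glinI[OF lp])
      fix j X assume "X \<in> gr (quot_space V1 N1) j"
      then obtain x where x: "x \<in> gr V1 j" "X = N1 +>\<^bsub>V1\<^esub> x" by auto
      have "quot_lift p X = p x" unfolding x(2) using cp subsetD[OF g1 x(1)] by blast
      then show "quot_lift p X \<in> gr W (fst j + 0, snd j + 0)" using gp[OF x(1)] by simp
    qed
    show "inj_on (quot_lift i) (carrier (quot_space V0 N0))"
    proof (rule inj_onI)
      fix X X' assume "X \<in> carrier (quot_space V0 N0)" "X' \<in> carrier (quot_space V0 N0)" and eq: "quot_lift i X = quot_lift i X'"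
      then obtain t t' where t: "t \<in> carrier V0" "X = N0 +>\<^bsub>V0\<^esub> t" "quot_lift i X = i t"
        and t': "t' \<in> carrier V0" "X' = N0 +>\<^bsub>V0\<^esub> t'" "quot_lift i X' = i t'" using c0 by metis
      have e: "i t = i t'" using t(3) t'(3) eq by simp
      have "i (t \<ominus>\<^bsub>V0\<^esub> t') = i t' \<ominus>\<^bsub>quot_space V1 N1\<^esub> i t'"
        unfolding lin_minus[OF i t(1) t'(1)] e ..
      also have "\<dots> = N1" unfolding vs_r_neg[OF lin_cod[OF i] lin_closed[OF i t'(1)]] by simp
      finally have "t \<ominus>\<^bsub>V0\<^esub> t' \<in> N0" using ker_i[of "t \<ominus>\<^bsub>V0\<^esub> t'"] t(1) t'(1) V0 by simp
      then show "X = X'" unfolding t(2) t'(2) using coset_eq_iff[OF N0 t(1) t'(1)] by blast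
    qed
    show "quot_lift i ` carrier (quot_space V0 N0) = {v \<in> carrier (quot_space V1 N1). quot_lift p v = \<zero>\<^bsub>W\<^esub>}"
    proof (intro equalityI subsetI)
      fix v assume "v \<in> quot_lift i ` carrier (quot_space V0 N0)"
      then obtain t where t: "t \<in> carrier V0" "v = i t" using c0 by force
      then obtain x where "x \<in> carrier V1" "v = N1 +>\<^bsub>V1\<^esub> x" "p x = \<zero>\<^bsub>W\<^esub>" using ex1 by blast
      then show "v \<in> {v \<in> carrier (quot_space V1 N1). quot_lift p v = \<zero>\<^bsub>W\<^esub>}" using cp by simp
    next
      fix v assume "v \<in> {v \<in> carrier (quot_space V1 N1). quot_lift p v = \<zero>\<^bsub>W\<^esub>}"
      then obtain x where x: "x \<in> carrier V1" "v = N1 +>\<^bsub>V1\<^esub> x" "quot_lift p v = \<zero>\<^bsub>W\<^esub>" by auto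
      then have "p x = \<zero>\<^bsub>W\<^esub>" using cp[OF x(1)] by simp
      then obtain t where t: "t \<in> carrier V0" "i t = v" using ex2[OF x(1)] x(2) by blast
      have "quot_lift i (N0 +>\<^bsub>V0\<^esub> t) = v" using ci[OF t(1)] t(2) by simp
      then show "v \<in> quot_lift i ` carrier (quot_space V0 N0)" using t(1) by (simp add: image_image) blast
    qed
    show "quot_lift p ` carrier (quot_space V1 N1) = carrier W"
    proof (intro equalityI subsetI)
      fix w assume "w \<in> quot_lift p ` carrier (quot_space V1 N1)"
      then show "w \<in> carrier W" using lin_closed[OF lp] by blast
    next
      fix w assume "w \<in> carrier W"
      then obtain x where x: "x \<in> carrier V1" "p x = w" using surj by blast
      then have "quot_lift p (N1 +>\<^bsub>V1\<^esub> x) = w" using cp by simp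
      then show "w \<in> quot_lift p ` carrier (quot_space V1 N1)" using x(1) by (simp add: image_image) blast
    qed
  qed
qed

locale kunneth = SA: splitting A gA eA \<pi>A \<mu>A + SB: splitting B gB eB \<pi>B \<mu>B
  for A :: "'a bicomplex" and gA eA \<pi>A \<mu>A and B :: "'b bicomplex" and gB eB \<pi>B \<mu>B
begin

sublocale BCA: two_step_pair A "del A" "delbar A" "degree_sign A" "H_BCA A" "del (H_BCA A)" "delbar (H_BCA A)"
  "degree_sign (H_BCA A)" SA.q_BCA SA.r_BCA gA "BCA_lower A" "BCA_upper A"
  B "del B" "delbar B" "degree_sign B" "H_BCA B" "del (H_BCA B)" "delbar (H_BCA B)"
  "degree_sign (H_BCA B)" SB.q_BCA SB.r_BCA gB "BCA_lower B" "BCA_upper B"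
  by (rule two_step_pair.intro[OF SA.two_step_BCA SB.two_step_BCA])

sublocale ABC: two_step_pair A "del A" "delbar A" "degree_sign A" "H_ABC A" "del (H_ABC A)" "delbar (H_ABC A)"
  "degree_sign (H_ABC A)" SA.q_ABC SA.r_ABC gA "ABC_lower A" "ABC_upper A"
  B "del B" "delbar B" "degree_sign B" "H_ABC B" "del (H_ABC B)" "delbar (H_ABC B)"
  "degree_sign (H_ABC B)" SB.q_ABC SB.r_ABC gB "ABC_lower B" "ABC_upper B"
  by (rule two_step_pair.intro[OF SA.two_step_ABC SB.two_step_ABC])

abbreviation "T \<equiv> tensor_module A B"
abbreviation "D \<equiv> BCA.TA.D"
abbreviation "Db \<equiv> BCA.TA.Db"

lemma tensor_diff_eq:
  "tensor_diff A B (del A) (del B) = D" "tensor_diff A B (delbar A) (delbar B) = Db"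
  "tensor_diff (H_BCA A) (H_BCA B) (del (H_BCA A)) (del (H_BCA B)) = BCA.TH.D"
  "tensor_diff (H_BCA A) (H_BCA B) (delbar (H_BCA A)) (delbar (H_BCA B)) = BCA.TH.Db"
  "tensor_diff (H_ABC A) (H_ABC B) (del (H_ABC A)) (del (H_ABC B)) = ABC.TH.D"
  "tensor_diff (H_ABC A) (H_ABC B) (delbar (H_ABC A)) (delbar (H_ABC B)) = ABC.TH.Db"
  unfolding tensor_diff_def BCA.TA.D_def BCA.TA.Db_def BCA.TH.D_def BCA.TH.Db_def ABC.TH.D_def ABC.TH.Db_def fun_eq_iff
  by simp_all

lemmas T = BCA.TA.T

sublocale TT: ungraded_bicomplex "tensor_bicomplex A B"
proof (rule ungraded_bicomplex.intro)
  show "lin (tensor_bicomplex A B) (tensor_bicomplex A B) (del (tensor_bicomplex A B))"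
    "lin (tensor_bicomplex A B) (tensor_bicomplex A B) (delbar (tensor_bicomplex A B))"
    unfolding tensor_bicomplex_simps(6,7) tensor_diff_eq
    by (rule lin_eqv[OF BCA.TA.lin_D] lin_eqv[OF BCA.TA.lin_Db]; simp add: vs_tensor_records T)+
  fix x assume "x \<in> carrier (tensor_bicomplex A B)"
  then have x: "x \<in> carrier T" by simp
  show "del (tensor_bicomplex A B) (del (tensor_bicomplex A B) x) = \<zero>\<^bsub>tensor_bicomplex A B\<^esub>"
    "delbar (tensor_bicomplex A B) (delbar (tensor_bicomplex A B) x) = \<zero>\<^bsub>tensor_bicomplex A B\<^esub>"
    using x by (simp_all add: tensor_diff_eq BCA.TA.DD BCA.TA.DbDb)
  \<comment> \<open>The additive inverse is formed in the record; multiplication by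
    \<open>-1\<close>, which both records share, shows that the two inverses agree.\<close>
  have "\<ominus>\<^bsub>tensor_bicomplex A B\<^esub> y = \<ominus>\<^bsub>T\<^esub> y" if "y \<in> carrier T" for y
    using vs_smult_minus1[OF T that] vs_smult_minus1[OF vs_tensor_records(1)[OF T], of y] that by simp
  then show "delbar (tensor_bicomplex A B) (del (tensor_bicomplex A B) x) =
      \<ominus>\<^bsub>tensor_bicomplex A B\<^esub> del (tensor_bicomplex A B) (delbar (tensor_bicomplex A B) x)"
    using x by (simp add: tensor_diff_eq BCA.TA.DbD BCA.TA.T_simps)
qed

lemma TZ: "z \<in> TT.Z \<longleftrightarrow> z \<in> carrier T \<and> D z = \<zero>\<^bsub>T\<^esub> \<and> Db z = \<zero>\<^bsub>T\<^esub>"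
  by (simp add: TT.Z_iff tensor_diff_eq)

lemma TY: "z \<in> TT.Y \<longleftrightarrow> z \<in> carrier T \<and> D (Db z) = \<zero>\<^bsub>T\<^esub>"
  by (simp add: TT.Y_iff tensor_diff_eq)

lemma TM: "z \<in> TT.M \<longleftrightarrow> (\<exists>x\<in>carrier T. \<exists>y\<in>carrier T. z = D x \<oplus>\<^bsub>T\<^esub> Db y)"
  by (simp add: TT.M_iff tensor_diff_eq)

lemma TI: "z \<in> TT.I \<longleftrightarrow> (\<exists>x\<in>carrier T. z = D (Db x))"
  by (auto simp: im_deldelbar_def tensor_diff_eq)

lemma minus_TB: "x \<in> carrier T \<Longrightarrow> y \<in> carrier T \<Longrightarrow> x \<ominus>\<^bsub>tensor_bicomplex A B\<^esub> y = x \<ominus>\<^bsub>T\<^esub> y"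
  using vs_smult_minus1[OF T, of y] vs_smult_minus1[OF vs_tensor_records(1)[OF T], of y] by (simp add: a_minus_def)

lemma cBC_cong:
  assumes "x = y \<oplus>\<^bsub>T\<^esub> D (Db u)" "y \<in> carrier T" "u \<in> carrier T"
  shows "TT.cBC x = TT.cBC y"
proof -
  have x: "x \<in> carrier T" using assms by (simp add: BCA.TA.T_simps)
  have "x \<ominus>\<^bsub>T\<^esub> y = D (Db u)"
    by (rule vs_eqI[OF T]) (use assms in \<open>simp_all add: BCA.TA.T_simps BCA.TA.Temb\<close>)
  then show ?thesis using TT.cBC_eq[of x y] x assms by (auto simp: minus_TB TI)
qed

lemma cA_cong:
  assumes "x = y \<oplus>\<^bsub>T\<^esub> (D u \<oplus>\<^bsub>T\<^esub> Db v)" "y \<in> carrier T" "u \<in> carrier T" "v \<in> carrier T"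
  shows "TT.cA x = TT.cA y"
proof -
  have x: "x \<in> carrier T" using assms by (simp add: BCA.TA.T_simps)
  have "x \<ominus>\<^bsub>T\<^esub> y = D u \<oplus>\<^bsub>T\<^esub> Db v"
    by (rule vs_eqI[OF T]) (use assms in \<open>simp_all add: BCA.TA.T_simps BCA.TA.Temb\<close>)
  then show ?thesis using TT.cA_eq[of x y] x assms by (auto simp: minus_TB TM)
qed

end

context two_step_pair
begin

text \<open>\<open>D Db\<close> descends two steps of the filtration: it sees the top part only and
  takes its values in the bottom step.\<close>

lemma DDb_P2: "s \<in> carrier S \<Longrightarrow> TH.D (TH.Db (P2 s)) = TH.D (TH.Db s)"
  and P0_DDb: "s \<in> carrier S \<Longrightarrow> P0 (TH.D (TH.Db s)) = TH.D (TH.Db s)"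
  and P1_DDb: "s \<in> carrier S \<Longrightarrow> P1 (TH.D (TH.Db s)) = \<zero>\<^bsub>S\<^esub>"
  and DDb_P1: "s \<in> carrier S \<Longrightarrow> TH.D (TH.Db (P1 s)) = \<zero>\<^bsub>S\<^esub>"
proof -
  assume s: "s \<in> carrier S"
  note c = lin_closed[OF lin_P2 s] lin_closed[OF lin_P1 s] lin_closed[OF lin_P0 s] lin_closed[OF TH.lin_Db s]
  have 1: "TH.D (TH.Db (P1 s)) = \<zero>\<^bsub>S\<^esub>"
    unfolding P_D(8)[OF s, symmetric] by (rule P_D(3)[OF c(4)])
  then show "TH.D (TH.Db (P1 s)) = \<zero>\<^bsub>S\<^esub>" .
  have 0: "TH.D (TH.Db (P0 s)) = \<zero>\<^bsub>S\<^esub>" unfolding P_D(4)[OF s] by (rule lin_zero[OF TH.lin_D])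
  have "TH.D (TH.Db (P2 s \<oplus>\<^bsub>S\<^esub> (P1 s \<oplus>\<^bsub>S\<^esub> P0 s))) = TH.D (TH.Db (P2 s))"
    using c by (simp add: TH.T_simps 0 1)
  then show e: "TH.D (TH.Db (P2 s)) = TH.D (TH.Db s)" unfolding P_sum[OF s] by simp
  have "P0 (TH.D (TH.Db s)) = TH.D (P1 (TH.Db s))" by (rule P_D(7)[OF c(4)])
  also have "\<dots> = TH.D (TH.Db (P2 s))" unfolding P_D(6)[OF s] ..
  finally show "P0 (TH.D (TH.Db s)) = TH.D (TH.Db s)" unfolding e .
  have "P1 (TH.D (TH.Db s)) = TH.D (P2 (TH.Db s))" by (rule P_D(5)[OF c(4)])
  then show "P1 (TH.D (TH.Db s)) = \<zero>\<^bsub>S\<^esub>" unfolding P_D(2)[OF s] lin_zero[OF TH.lin_D] .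
qed

end

context splitting
begin

lemmas grade_subs = subspD(3)[OF subsp_H_BC_grade] subspD(3)[OF subsp_H_A_grade]
  subspD(3)[OF subsp_H_BCA_grade] subspD(3)[OF subsp_H_ABC_grade] grade_carrier

lemma lin_fst_BCA: "lin (H_BCA A) (H_BC A) fst" and lin_snd_ABC: "lin (H_ABC A) (H_BC A) snd"
proof -
  show "lin (H_BCA A) (H_BC A) fst" by (rule lin_of_sum_BCA(2)[OF lin_fst[OF vs_H_BC vs_tilde_H_A]])
  have "lin (tilde_H_BC A) (H_BC A) (\<lambda>x. x)" unfolding tilde_H_BC_def by (rule lin_sub_space_incl[OF subsp_tilde])
  then show "lin (H_ABC A) (H_BC A) snd"
    by (rule lin_comp[OF lin_of_sum_ABC(2)[OF lin_snd[OF vs_H_A vs_tilde_H_BC]], simplified])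
qed

lemma BCA_subs:
  "BC_in_BCA A \<subseteq> carrier (H_BCA A)" "\<And>x. x \<in> carrier (H_BCA A) \<Longrightarrow> BCA_lower A x \<in> BC_in_BCA A"
  "\<And>x. x \<in> BC_in_BCA A \<Longrightarrow> BCA_lower A x = x"
  "A_in_BCA A \<subseteq> carrier (H_BCA A)" "\<And>x. x \<in> carrier (H_BCA A) \<Longrightarrow> BCA_upper A x \<in> A_in_BCA A"
  "\<And>x. x \<in> A_in_BCA A \<Longrightarrow> BCA_upper A x = x"
  using vs_closed(1)[OF vs_H_BC] vs_closed(1)[OF vs_tilde_H_A]
  by (auto simp: BC_in_BCA_def A_in_BCA_def BCA_lower_def BCA_upper_def simp del: no_carrier)

lemma ABC_subs:
  "BC_in_ABC A \<subseteq> carrier (H_ABC A)" "\<And>x. x \<in> carrier (H_ABC A) \<Longrightarrow> ABC_lower A x \<in> BC_in_ABC A"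
  "\<And>x. x \<in> BC_in_ABC A \<Longrightarrow> ABC_lower A x = x"
  "A_in_ABC A \<subseteq> carrier (H_ABC A)" "\<And>x. x \<in> carrier (H_ABC A) \<Longrightarrow> ABC_upper A x \<in> A_in_ABC A"
  "\<And>x. x \<in> A_in_ABC A \<Longrightarrow> ABC_upper A x = x"
  using vs_closed(1)[OF vs_H_A] vs_closed(1)[OF vs_tilde_H_BC]
  by (auto simp: BC_in_ABC_def A_in_ABC_def ABC_lower_def ABC_upper_def simp del: no_carrier)

text \<open>The inclusion of \<open>H_BC\<close> in \<open>H_BCA\<close>, a section of
  \<open>fst\<close>.\<close>

definition "j x = (x, \<zero>\<^bsub>tilde_H_A A\<^esub>)"

lemma glin_j: "glin 0 0 (H_BC A) (H_BCA A) j"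
proof (rule glinI)
  show "lin (H_BC A) (H_BCA A) j"
    unfolding j_def[abs_def]
    by (rule lin_of_sum_BCA(1)[OF lin_pair[OF lin_id[OF vs_H_BC] lin_0[OF vs_H_BC vs_tilde_H_A]]])
  fix i x assume "x \<in> gr (H_BC A) i"
  then show "j x \<in> gr (H_BCA A) (fst i + 0, snd i + 0)"
    using subspD(2)[OF subsp_tilde_H_A_grade] by (simp add: j_def del: no_carrier)
qed

lemmas lin_j = glin_lin[OF glin_j]

lemma j_fst: "j (fst x) = BCA_lower A x" and fst_j: "fst (j y) = y"
  by (simp_all add: j_def BCA_lower_def)

text \<open>\<open>fq\<close> and \<open>sq\<close> are the two ways to assign a Bott-Chern class to
  an element of \<open>A\<close>: as first component of \<open>q_BCA\<close> and as second component
  of \<open>q_ABC\<close>.\<close>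

definition "fq a = cBC (piZ a)"
definition "sq a = cBC (\<mu> a)"

lemma lin_fq: "lin A (H_BC A) fq" and lin_sq: "lin A (H_BC A) sq"
  using lin_comp[OF lin_q_BCA lin_fst_BCA] lin_comp[OF lin_q_ABC lin_snd_ABC]
  by (simp_all add: q_BCA_def q_ABC_def fq_def[abs_def] sq_def[abs_def])

text \<open>On an image of a differential \<open>\<pi>\<close> vanishes and \<open>\<mu>\<close>
  equals \<open>e\<close>, so that \<open>piZ\<close> and \<open>\<mu>\<close> coincide
  there.\<close>

lemma fq_sq:
  "x \<in> carrier A \<Longrightarrow> fq (del A x) = sq (del A x)" "x \<in> carrier A \<Longrightarrow> fq (delbar A x) = sq (delbar A x)"
  "x \<in> carrier A \<Longrightarrow> sq (del A (delbar A x)) = \<zero>\<^bsub>H_BC A\<^esub>"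
proof -
  have 1: "piZ y = \<mu> y" if "y = del A x \<or> y = delbar A x" "x \<in> carrier A" for x y
    using that by (auto simp: piZ_def sp_simps)
  then show "x \<in> carrier A \<Longrightarrow> fq (del A x) = sq (del A x)" "x \<in> carrier A \<Longrightarrow> fq (delbar A x) = sq (delbar A x)"
    by (auto simp: fq_def sq_def intro!: arg_cong[where f = cBC])
  show "x \<in> carrier A \<Longrightarrow> sq (del A (delbar A x)) = \<zero>\<^bsub>H_BC A\<^esub>"
    using mu_on_I[OF db_I, of x] cBC_zero[of "\<zero>\<^bsub>A\<^esub>"] subspD(2)[OF I] by (simp add: sq_def V)
qed

lemma fq_sq_sign:
  "x \<in> carrier A \<Longrightarrow> fq (degree_sign A (del A x)) = sq (degree_sign A (del A x))"
  "x \<in> carrier A \<Longrightarrow> fq (degree_sign A (delbar A x)) = sq (degree_sign A (delbar A x))"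
  using fq_sq(1,2)[of "\<ominus>\<^bsub>A\<^esub> degree_sign A x"] by (simp_all add: op_simps vs_minus_minus[OF V])

end

section \<open>The Bott-Chern sequence\<close>

context kunneth
begin

abbreviation "H0 \<equiv> tensor_module (H_BC A) (H_BC B)"

definition "jj = tensor_map (H_BCA A) (H_BCA B) SA.j SB.j"
definition "ff = tensor_map (H_BC A) (H_BC B) fst fst"
definition "sn = tensor_map (H_BC A) (H_BC B) snd snd"

lemma lin_jj: "lin H0 BCA.S jj" and lin_ff: "lin BCA.S H0 ff"
  unfolding jj_def ff_def
  by (rule lin_tensor_map SA.lin_j SB.lin_j SA.lin_fst_BCA SB.lin_fst_BCA)+

lemma ff_jj: "t \<in> carrier H0 \<Longrightarrow> ff (jj t) = t"
  unfolding jj_def ff_def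
  by (subst tensor_map_comp[OF SA.lin_j SB.lin_j SA.lin_fst_BCA SB.lin_fst_BCA])
    (simp_all add: SA.fst_j SB.fst_j tensor_map_id[OF SA.vs_H_BC SB.vs_H_BC])

lemma jj_ff: "s \<in> carrier BCA.S \<Longrightarrow> jj (ff s) = BCA.P0 s"
  unfolding jj_def ff_def BCA.P0_def
  by (subst tensor_map_comp[OF SA.lin_fst_BCA SB.lin_fst_BCA SA.lin_j SB.lin_j]) (simp_all only: SA.j_fst SB.j_fst)

lemma P0_jj: "t \<in> carrier H0 \<Longrightarrow> BCA.P0 (jj t) = jj t"
  using jj_ff[of "jj t"] ff_jj[of t] lin_closed[OF lin_jj] by simp

text \<open>The denominator is defined with \<open>H_ABC\<close>, whereas the kernel of
  \<open>i1\<close> is computed with \<open>H_BCA\<close>; here the two are compared. In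
  \<open>D (Db (v \<otimes> w))\<close> each term has either \<open>del delbar\<close> in one
  factor, which both sides kill, or one differential in each factor, where \<open>fq\<close> and
  \<open>sq\<close> agree.\<close>

lemma ff_Q_eq_sn_Q:
  assumes y: "y \<in> carrier T"
  shows "ff (BCA.Q (D (Db y))) = sn (ABC.Q (D (Db y)))"
proof -
  note V = SA.V SB.V
  note lf = lin_tensor_map[OF SA.lin_fq SB.lin_fq] and ls = lin_tensor_map[OF SA.lin_sq SB.lin_sq]
  note pf = tensor_map_pure[OF SA.lin_fq SB.lin_fq] and ps = tensor_map_pure[OF SA.lin_sq SB.lin_sq]
  have c: "D (Db y) \<in> carrier T" using y by (simp add: BCA.TA.T_simps)
  have 1: "ff (BCA.Q (D (Db y))) = tensor_map (H_BC A) (H_BC B) SA.fq SB.fq (D (Db y))"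
    unfolding ff_def BCA.Q_def
      tensor_map_comp[OF SA.lin_q_BCA SB.lin_q_BCA SA.lin_fst_BCA SB.lin_fst_BCA c]
    by (simp add: SA.q_BCA_def SB.q_BCA_def SA.fq_def[abs_def] SB.fq_def[abs_def])
  have 2: "sn (ABC.Q (D (Db y))) = tensor_map (H_BC A) (H_BC B) SA.sq SB.sq (D (Db y))"
    unfolding sn_def ABC.Q_def
      tensor_map_comp[OF SA.lin_q_ABC SB.lin_q_ABC SA.lin_snd_ABC SB.lin_snd_ABC c]
    by (simp add: SA.q_ABC_def SB.q_ABC_def SA.sq_def[abs_def] SB.sq_def[abs_def])
  have "tensor_map (H_BC A) (H_BC B) SA.fq SB.fq (D (Db y)) = tensor_map (H_BC A) (H_BC B) SA.sq SB.sq (D (Db y))"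
    by (rule tensor_lin_eq[OF V lin_comp[OF lin_comp[OF BCA.TA.lin_Db BCA.TA.lin_D] lf]
          lin_comp[OF lin_comp[OF BCA.TA.lin_Db BCA.TA.lin_D] ls] _ y])
      (simp add: BCA.TA.T_simps BCA.TA.D_pure BCA.TA.Db_pure BCA.TA.pure_simps SA.op_simps SB.op_simps
        lin_simps[OF lf] lin_simps[OF ls] pf ps SA.fq_sq SB.fq_sq SA.fq_sq_sign lin_closed[OF SA.lin_fq] lin_closed[OF SB.lin_fq]
        lin_closed[OF SA.lin_sq] lin_closed[OF SB.lin_sq] pure_tensor_zero[OF SA.vs_H_BC SB.vs_H_BC]
        lin_uminus[OF SA.lin_fq] lin_uminus[OF SA.lin_sq]
        del: SA.no_carrier SB.no_carrier)
  then show ?thesis using 1 2 by simp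
qed

lemma BCA_parts: "tensor_sub (H_BCA A) (H_BCA B) (A_in_BCA A) (BC_in_BCA B) <+>\<^bsub>BCA.S\<^esub>
    tensor_sub (H_BCA A) (H_BCA B) (BC_in_BCA A) (A_in_BCA B) = {s \<in> carrier BCA.S. BCA.P1 s = s}"
  by (rule BCA.sub_parts(2)[OF SA.BCA_subs(4-6) SA.BCA_subs(1-3) SB.BCA_subs(4-6) SB.BCA_subs(1-3)])

lemma ABC_parts: "tensor_sub (H_ABC A) (H_ABC B) (BC_in_ABC A) (A_in_ABC B) <+>\<^bsub>ABC.S\<^esub>
    tensor_sub (H_ABC A) (H_ABC B) (A_in_ABC A) (BC_in_ABC B) = {s \<in> carrier ABC.S. ABC.P1 s = s}"
  by (rule ABC.sub_parts(3)[OF SA.ABC_subs(4-6) SA.ABC_subs(1-3) SB.ABC_subs(4-6) SB.ABC_subs(1-3)])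

lemma A_tensor_A_eq: "A_tensor_A A B = {s \<in> carrier ABC.S. ABC.P2 s = s}"
  unfolding A_tensor_A_def
  by (rule ABC.sub_parts(1)[OF SA.ABC_subs(4-6) SA.ABC_subs(1-3) SB.ABC_subs(4-6) SB.ABC_subs(1-3)])

abbreviation "N \<equiv> deldelbar_A_tensor_A A B"

text \<open>Parametrises the denominator by elements of \<open>T\<close>. This is possible because
  \<open>R\<close> is a section of \<open>Q\<close> and because \<open>P2\<close> may be inserted
  before \<open>D Db\<close> by \<open>DDb_P2\<close>.\<close>

lemma N_iff: "n \<in> N \<longleftrightarrow> (\<exists>y\<in>carrier T. n = ff (BCA.Q (D (Db y))))"
proof
  assume "n \<in> N"
  then obtain s where s: "s \<in> carrier ABC.S" "n = sn (ABC.TH.D (ABC.TH.Db s))"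
    by (auto simp: deldelbar_A_tensor_A_def A_tensor_A_eq sn_def tensor_diff_eq)
  have c: "ABC.R s \<in> carrier T" using s(1) by (rule lin_closed[OF ABC.lin_R])
  have "ABC.Q (D (Db (ABC.R s))) = ABC.TH.D (ABC.TH.Db s)"
    using s c by (simp add: ABC.QD ABC.QDb ABC.QR BCA.TA.T_simps)
  then have "n = ff (BCA.Q (D (Db (ABC.R s))))" using ff_Q_eq_sn_Q[OF c] s(2) by simp
  then show "\<exists>y\<in>carrier T. n = ff (BCA.Q (D (Db y)))" using c by blast
next
  assume "\<exists>y\<in>carrier T. n = ff (BCA.Q (D (Db y)))"
  then obtain y where y: "y \<in> carrier T" "n = ff (BCA.Q (D (Db y)))" by blast
  let ?s = "ABC.P2 (ABC.Q y)"
  have q: "ABC.Q y \<in> carrier ABC.S" using y(1) by (rule lin_closed[OF ABC.lin_Q])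
  have "n = sn (ABC.TH.D (ABC.TH.Db ?s))"
    using y q ff_Q_eq_sn_Q[OF y(1)] by (simp add: ABC.QD ABC.QDb BCA.TA.T_simps ABC.DDb_P2)
  moreover have "?s \<in> A_tensor_A A B"
    using q ABC.P_idem(1)[OF q] lin_closed[OF ABC.lin_P2 q] by (simp add: A_tensor_A_eq)
  ultimately show "n \<in> N" by (auto simp: deldelbar_A_tensor_A_def sn_def tensor_diff_eq)
qed

text \<open>In the model \<open>H_BCA\<close> closed elements have a middle and a bottom part:
  \<open>p1\<close> reads off the former, \<open>i1\<close> starts from the latter. In the model
  \<open>H_ABC\<close> the bottom part dies in \<open>H_A\<close>: \<open>p2\<close> reads off the
  top part, \<open>i2\<close> starts from the middle part.\<close>

definition "i1 t = TT.cBC (BCA.R (jj t))"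
definition "p1 x = BCA.P1 (BCA.Q x)"
definition "i2 s = TT.cA (ABC.R s)"
definition "p2 x = ABC.P2 (ABC.Q x)"

lemma R_jj_Z: "t \<in> carrier H0 \<Longrightarrow> BCA.R (jj t) \<in> TT.Z"
proof -
  assume t: "t \<in> carrier H0"
  have c: "jj t \<in> carrier BCA.S" using t by (rule lin_closed[OF lin_jj])
  have "BCA.TH.D (jj t) = \<zero>\<^bsub>BCA.S\<^esub>" "BCA.TH.Db (jj t) = \<zero>\<^bsub>BCA.S\<^esub>"
    using BCA.P_D(3,4)[OF c] P0_jj[OF t] by simp_all
  then show ?thesis
    using c by (simp add: TZ BCA.RD[symmetric] BCA.RDb[symmetric] lin_closed[OF BCA.lin_R] lin_zero[OF BCA.lin_R])
qed

lemma lin_i1: "lin (tensor_space (H_BC A) (H_BC B)) (H_BC (tensor_bicomplex A B)) i1"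
proof -
  have "lin H0 T (\<lambda>t. BCA.R (jj t))" by (rule lin_comp[OF lin_jj BCA.lin_R])
  then have "lin (tensor_space (H_BC A) (H_BC B)) (tensor_bicomplex A B) (\<lambda>t. BCA.R (jj t))"
    by (rule lin_eqv) (simp_all add: vs_tensor_records T vs_tensor_module[OF SA.vs_H_BC SB.vs_H_BC])
  from lin_sub_space_to[OF this TT.Z] R_jj_Z
  have "lin (tensor_space (H_BC A) (H_BC B)) (sub_space (tensor_bicomplex A B) TT.Z) (\<lambda>t. BCA.R (jj t))" by simp
  from lin_comp[OF this TT.lin_cBC] show ?thesis by (simp add: i1_def[abs_def])
qed

text \<open>\<open>ff Q\<close> is a left inverse of \<open>R jj\<close>, which gives one direction.
  For the other, \<open>D Db\<close> takes its values in the bottom step, so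
  \<open>jj ff = P0\<close> leaves \<open>Q (D (Db y))\<close> unchanged.\<close>

lemma ker_i1: "t \<in> carrier H0 \<Longrightarrow> i1 t = TT.I \<longleftrightarrow> t \<in> N"
proof
  assume t: "t \<in> carrier H0"
  note c = lin_closed[OF lin_jj t]
  note Rc = lin_closed[OF BCA.lin_R c]
  { assume "i1 t = TT.I"
    then have "BCA.R (jj t) \<in> TT.I" using TT.cBC_zero[of "BCA.R (jj t)"] Rc by (simp add: i1_def)
    then obtain y where y: "y \<in> carrier T" "BCA.R (jj t) = D (Db y)" by (auto simp: TI)
    have "t = ff (BCA.Q (BCA.R (jj t)))" using BCA.QR[OF c] ff_jj[OF t] by simp
    then show "t \<in> N" using y N_iff by auto }
  { assume "t \<in> N"
    then obtain y where y: "y \<in> carrier T" "t = ff (BCA.Q (D (Db y)))" by (auto simp: N_iff)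
    note q = lin_closed[OF BCA.lin_Q y(1)]
    have e: "BCA.Q (D (Db y)) = BCA.TH.D (BCA.TH.Db (BCA.Q y))" using y(1) by (simp add: BCA.QD BCA.QDb BCA.TA.T_simps)
    have "jj t = BCA.P0 (BCA.Q (D (Db y)))"
      unfolding y(2) by (rule jj_ff) (use y(1) in \<open>simp add: lin_closed[OF BCA.lin_Q] BCA.TA.T_simps\<close>)
    also have "\<dots> = BCA.TH.D (BCA.TH.Db (BCA.Q y))" unfolding e by (rule BCA.P0_DDb[OF q])
    finally have "BCA.R (jj t) = D (Db (BCA.R (BCA.Q y)))"
      using q by (simp add: BCA.RD BCA.RDb BCA.TH.T_simps)
    then have "BCA.R (jj t) \<in> TT.I" using lin_closed[OF BCA.lin_R q] by (auto simp: TI)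
    then show "i1 t = TT.I" using TT.cBC_zero[of "BCA.R (jj t)"] Rc by (simp add: i1_def) }
qed

lemma K_carrier: "carrier (K_space A B) =
    {s \<in> carrier BCA.S. BCA.P1 s = s \<and> BCA.TH.D s = \<zero>\<^bsub>BCA.S\<^esub> \<and> BCA.TH.Db s = \<zero>\<^bsub>BCA.S\<^esub>}"
  unfolding K_space_def sub_space_simps set_add_tensor_bicomplex BCA_parts
  by (auto simp: tensor_diff_eq)

lemma K_subsp: "subsp (tensor_bicomplex (H_BCA A) (H_BCA B)) (carrier (K_space A B))"
proof -
  have "carrier (K_space A B) = {s \<in> carrier BCA.S. BCA.P1 s \<ominus>\<^bsub>BCA.S\<^esub> s = \<zero>\<^bsub>BCA.S\<^esub>} \<inter>
      ({s \<in> carrier BCA.S. BCA.TH.D s = \<zero>\<^bsub>BCA.S\<^esub>} \<inter> {s \<in> carrier BCA.S. BCA.TH.Db s = \<zero>\<^bsub>BCA.S\<^esub>})"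
  proof -
    have "BCA.P1 s \<ominus>\<^bsub>BCA.S\<^esub> s = \<zero>\<^bsub>BCA.S\<^esub> \<longleftrightarrow> BCA.P1 s = s" if "s \<in> carrier BCA.S" for s
      using that lin_closed[OF BCA.lin_P1 that]
      by (simp add: vs_emb_eq[OF BCA.TH.T] BCA.TH.Temb BCA.TH.T)
    then show ?thesis unfolding K_carrier by auto
  qed
  then have "subsp BCA.S (carrier (K_space A B))"
    using subsp_Int[OF subsp_ker[OF lin_diff[OF BCA.lin_P1 lin_id[OF BCA.TH.T]]]
        subsp_Int[OF subsp_ker[OF BCA.TH.lin_D] subsp_ker[OF BCA.TH.lin_Db]]] by simp
  then show ?thesis by (rule subsp_eqv) (simp_all add: vs_tensor_records BCA.TH.T)
qed

lemma p1_K: "x \<in> TT.Z \<Longrightarrow> p1 x \<in> carrier (K_space A B)"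
proof -
  assume "x \<in> TT.Z"
  then have x: "x \<in> carrier T" "D x = \<zero>\<^bsub>T\<^esub>" "Db x = \<zero>\<^bsub>T\<^esub>" by (simp_all add: TZ)
  note q = lin_closed[OF BCA.lin_Q x(1)]
  have "BCA.TH.D (BCA.P1 (BCA.Q x)) = \<zero>\<^bsub>BCA.S\<^esub>" "BCA.TH.Db (BCA.P1 (BCA.Q x)) = \<zero>\<^bsub>BCA.S\<^esub>"
    unfolding BCA.P_D(7,8)[OF q, symmetric] BCA.QD[OF x(1), symmetric] BCA.QDb[OF x(1), symmetric] x(2,3)
    by (simp_all add: lin_zero[OF BCA.lin_P0] lin_zero[OF BCA.lin_Q])
  then show ?thesis using BCA.P_idem(2)[OF q] lin_closed[OF BCA.lin_P1 q] by (simp add: K_carrier p1_def)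
qed

lemma p1_I: "y \<in> carrier T \<Longrightarrow> p1 (D (Db y)) = \<zero>\<^bsub>BCA.S\<^esub>"
  using BCA.P1_DDb[OF lin_closed[OF BCA.lin_Q]] by (simp add: p1_def BCA.QD BCA.QDb BCA.TA.T_simps)

lemma lin_p1_T: "lin T BCA.S p1"
  unfolding p1_def[abs_def] by (rule lin_comp[OF BCA.lin_Q BCA.lin_P1])

lemma lin_p1: "lin (sub_space (tensor_bicomplex A B) TT.Z) (K_space A B) p1"
proof -
  have "lin (tensor_bicomplex A B) (tensor_bicomplex (H_BCA A) (H_BCA B)) p1"
    by (rule lin_eqv[OF lin_p1_T]) (simp_all add: vs_tensor_records T BCA.TH.T)
  from lin_sub_space_to[OF lin_sub_space_from[OF TT.Z this] K_subsp] p1_K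
  show ?thesis unfolding K_space_def by simp
qed

text \<open>A closed element has no part in \<open>tilde_H_A \<otimes> tilde_H_A\<close>, because
  such a part would be detected by the differentials. This is why the first sequence is read off
  from \<open>H_BCA\<close>.\<close>

lemma P2_Q_closed: "x \<in> TT.Z \<Longrightarrow> BCA.P2 (BCA.Q x) = \<zero>\<^bsub>BCA.S\<^esub>"
proof -
  assume "x \<in> TT.Z"
  then have x: "x \<in> carrier T" "D x = \<zero>\<^bsub>T\<^esub>" "Db x = \<zero>\<^bsub>T\<^esub>" by (simp_all add: TZ)
  have d: "BCA.TH.D (BCA.Q x) = \<zero>\<^bsub>BCA.S\<^esub>" "BCA.TH.Db (BCA.Q x) = \<zero>\<^bsub>BCA.S\<^esub>"
    using BCA.QD[OF x(1)] BCA.QDb[OF x(1)] by (simp_all add: x lin_zero[OF BCA.lin_Q])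
  obtain h h' where h: "lin (H_BCA A) (H_BCA A) h" "lin (H_BCA A) (H_BCA A) h'"
    "\<And>x. x \<in> carrier (H_BCA A) \<Longrightarrow> BCA_upper A x = h (del (H_BCA A) x) \<oplus>\<^bsub>H_BCA A\<^esub> h' (delbar (H_BCA A) x)"
    using SA.BCA_upper_form by blast
  show ?thesis by (rule BCA.P2_closed[OF h lin_closed[OF BCA.lin_Q x(1)] d])
qed

lemma grades:
  "\<And>p q. grade A p q \<subseteq> carrier A" "\<And>p q. grade B p q \<subseteq> carrier B"
  "\<And>p q. grade (H_BCA A) p q \<subseteq> carrier (H_BCA A)" "\<And>p q. grade (H_BCA B) p q \<subseteq> carrier (H_BCA B)"
  "\<And>p q. grade (H_ABC A) p q \<subseteq> carrier (H_ABC A)" "\<And>p q. grade (H_ABC B) p q \<subseteq> carrier (H_ABC B)"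
  "\<And>p q. grade (H_BC A) p q \<subseteq> carrier (H_BC A)" "\<And>p q. grade (H_BC B) p q \<subseteq> carrier (H_BC B)"
  by (auto dest: SA.grade_subs SB.grade_subs simp del: SA.no_carrier SB.no_carrier H_BCA_simps H_ABC_simps)

lemmas tensor_grades = subsp_tensor_grade[OF BCA.X.H.V BCA.Y.H.V grades(3,4)]
  subsp_tensor_grade[OF ABC.X.H.V ABC.Y.H.V grades(5,6)] subsp_tensor_grade[OF SA.V SB.V grades(1,2)]
  subsp_tensor_grade[OF SA.vs_H_BC SB.vs_H_BC grades(7,8)]

lemma BCA_graded:
  "x \<in> grade (tensor_space A B) a b \<Longrightarrow> p1 x \<in> grade (tensor_space (H_BCA A) (H_BCA B)) a b"
  "t \<in> grade (tensor_space (H_BC A) (H_BC B)) a b \<Longrightarrow> BCA.R (jj t) \<in> grade (tensor_space A B) a b"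
proof -
  note g = SA.glin_q_BCA SB.glin_q_BCA SA.glin_BCA_parts SB.glin_BCA_parts SA.glin_r_BCA SB.glin_r_BCA SA.glin_j SB.glin_j
  assume x: "x \<in> grade (tensor_space A B) a b"
  have "BCA.Q x \<in> grade (tensor_space (H_BCA A) (H_BCA B)) a b"
    unfolding BCA.Q_def by (rule tensor_map_graded[OF g(1,2) grades(1-4) x])
  then show "p1 x \<in> grade (tensor_space (H_BCA A) (H_BCA B)) a b"
    unfolding p1_def BCA.P1_def
    by (intro subspD(4)[OF tensor_grades(1)] tensor_map_graded[OF g(4,5) grades(3,4,3,4)] tensor_map_graded[OF g(3,6) grades(3,4,3,4)])
next
  note g = SA.glin_r_BCA SB.glin_r_BCA SA.glin_j SB.glin_j
  assume t: "t \<in> grade (tensor_space (H_BC A) (H_BC B)) a b"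
  show "BCA.R (jj t) \<in> grade (tensor_space A B) a b"
    unfolding BCA.R_def jj_def
    by (rule tensor_map_graded[OF g(1,2) grades(3,4,1,2) tensor_map_graded[OF g(3,4) grades(7,8,3,4) t]])
qed

lemma subsp_N: "subsp (tensor_space (H_BC A) (H_BC B)) N"
proof -
  have "N = (\<lambda>y. ff (BCA.Q (D (Db y)))) ` carrier T" using N_iff by blast
  then have "subsp H0 N"
    using subsp_image[OF lin_comp[OF lin_comp[OF lin_comp[OF BCA.TA.lin_Db BCA.TA.lin_D] BCA.lin_Q] lin_ff] subsp_carrier[OF T]]
    by simp
  then show ?thesis
    by (rule subsp_eqv) (simp_all add: vs_tensor_records vs_tensor_module[OF SA.vs_H_BC SB.vs_H_BC])
qed

theorem exact_BC: "short_exact (BC_quotient A B) (quot_lift i1) (H_BC_tensor A B) (quot_lift p1) (K_space A B)"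
  unfolding BC_quotient_def H_BC_tensor_def H_BC_def[of "tensor_bicomplex A B"]
proof (rule short_exact_quotients[OF subsp_N TT.subZ lin_i1[unfolded H_BC_def[of "tensor_bicomplex A B"]] lin_p1])
  have z: "\<zero>\<^bsub>K_space A B\<^esub> = \<zero>\<^bsub>BCA.S\<^esub>" by (simp add: K_space_def)
  have co: "TT.I +>\<^bsub>sub_space (tensor_bicomplex A B) TT.Z\<^esub> x = TT.cBC x" for x by (simp add: TT.cBC_def)
  show "grade (sub_space (tensor_bicomplex A B) TT.Z) a b \<subseteq> carrier (sub_space (tensor_bicomplex A B) TT.Z)" for a b
    by simp
  show "grade (tensor_space (H_BC A) (H_BC B)) a b \<subseteq> carrier (tensor_space (H_BC A) (H_BC B))" for a b
    using subspD(3)[OF tensor_grades(4)] by auto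
  show "i1 t \<in> grade (quot_space (sub_space (tensor_bicomplex A B) TT.Z) TT.I) a b"
    if t: "t \<in> grade (tensor_space (H_BC A) (H_BC B)) a b" for a b t
    using BCA_graded(2)[OF t] R_jj_Z[OF subspD(3)[OF tensor_grades(4) t]] by (simp add: i1_def TT.cBC_def)
  show "p1 x \<in> grade (K_space A B) a b" if "x \<in> grade (sub_space (tensor_bicomplex A B) TT.Z) a b" for a b x
  proof -
    have x: "x \<in> grade (tensor_space A B) a b" "x \<in> TT.Z" using that by auto
    show ?thesis
      using BCA_graded(1)[OF x(1)] p1_K[OF x(2)] unfolding K_space_def by simp
  qed
  show "i1 t = TT.I \<longleftrightarrow> t \<in> N" if "t \<in> carrier (tensor_space (H_BC A) (H_BC B))" for t
    using ker_i1[of t] that by simp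
  show "p1 x = \<zero>\<^bsub>K_space A B\<^esub>" if "x \<in> TT.I" for x using that p1_I unfolding z TI by auto
  show "\<exists>x\<in>carrier (sub_space (tensor_bicomplex A B) TT.Z).
      i1 t = TT.I +>\<^bsub>sub_space (tensor_bicomplex A B) TT.Z\<^esub> x \<and> p1 x = \<zero>\<^bsub>K_space A B\<^esub>"
    if "t \<in> carrier (tensor_space (H_BC A) (H_BC B))" for t
  proof (rule bexI[of _ "BCA.R (jj t)"], rule conjI)
    have t: "t \<in> carrier H0" using that by simp
    note c = lin_closed[OF lin_jj t]
    show "i1 t = TT.I +>\<^bsub>sub_space (tensor_bicomplex A B) TT.Z\<^esub> BCA.R (jj t)" unfolding co i1_def ..
    show "p1 (BCA.R (jj t)) = \<zero>\<^bsub>K_space A B\<^esub>"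
      using BCA.P_idem(7)[OF c] P0_jj[OF t] BCA.QR[OF c] by (simp add: z p1_def)
    show "BCA.R (jj t) \<in> carrier (sub_space (tensor_bicomplex A B) TT.Z)" using R_jj_Z[OF t] by simp
  qed
  show "\<exists>t\<in>carrier (tensor_space (H_BC A) (H_BC B)). i1 t = TT.I +>\<^bsub>sub_space (tensor_bicomplex A B) TT.Z\<^esub> x"
    if "x \<in> carrier (sub_space (tensor_bicomplex A B) TT.Z)" and p: "p1 x = \<zero>\<^bsub>K_space A B\<^esub>" for x
  proof (rule bexI[of _ "ff (BCA.Q x)"])
    have xZ: "x \<in> TT.Z" using that by simp
    then have x: "x \<in> carrier T" "D x = \<zero>\<^bsub>T\<^esub>" "Db x = \<zero>\<^bsub>T\<^esub>" by (simp_all add: TZ)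
    note q = lin_closed[OF BCA.lin_Q x(1)]
    \<comment> \<open>The top part vanishes as \<open>x\<close> is closed, the middle part by
      hypothesis; so \<open>Q x\<close> lies in the bottom step, which is the range of
      \<open>jj\<close>.\<close>
    have "BCA.Q x = \<zero>\<^bsub>BCA.S\<^esub> \<oplus>\<^bsub>BCA.S\<^esub> (\<zero>\<^bsub>BCA.S\<^esub> \<oplus>\<^bsub>BCA.S\<^esub> BCA.P0 (BCA.Q x))"
      using BCA.P_sum[OF q] p P2_Q_closed[OF xZ] by (simp add: p1_def z)
    then have e: "jj (ff (BCA.Q x)) = BCA.Q x"
      using lin_closed[OF BCA.lin_P0 q] by (simp add: jj_ff[OF q] vs_zero_simps[OF BCA.TH.T])
    obtain y where y: "y \<in> carrier T" "x = BCA.R (BCA.Q x) \<oplus>\<^bsub>T\<^esub> D (Db y)"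
      by (rule BCA.closed_homotopy[OF x])
    show "i1 (ff (BCA.Q x)) = TT.I +>\<^bsub>sub_space (tensor_bicomplex A B) TT.Z\<^esub> x"
      unfolding co i1_def e using cBC_cong[OF y(2) lin_closed[OF BCA.lin_R q] y(1)] by simp
    show "ff (BCA.Q x) \<in> carrier (tensor_space (H_BC A) (H_BC B))" using lin_closed[OF lin_ff q] by simp
  qed
  show "\<exists>x\<in>carrier (sub_space (tensor_bicomplex A B) TT.Z). p1 x = k" if "k \<in> carrier (K_space A B)" for k
  \<comment> \<open>\<open>R\<close> is a section of \<open>Q\<close> that commutes with the
    differentials, so it lifts \<open>k\<close> to a closed element.\<close>
  proof (rule bexI[of _ "BCA.R k"])
    have k: "k \<in> carrier BCA.S" "BCA.P1 k = k" "BCA.TH.D k = \<zero>\<^bsub>BCA.S\<^esub>" "BCA.TH.Db k = \<zero>\<^bsub>BCA.S\<^esub>"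
      using that by (simp_all add: K_carrier)
    show "p1 (BCA.R k) = k" using BCA.QR[OF k(1)] k(2) by (simp add: p1_def)
    show "BCA.R k \<in> carrier (sub_space (tensor_bicomplex A B) TT.Z)"
      using k by (simp add: TZ BCA.RD[symmetric] BCA.RDb[symmetric] lin_closed[OF BCA.lin_R] lin_zero[OF BCA.lin_R])
  qed
qed

end

section \<open>The Aeppli sequence\<close>

context kunneth
begin

lemma L_N: "n \<in> L_denominator A B \<longleftrightarrow>
    (\<exists>u\<in>carrier T. \<exists>v\<in>carrier T. n = ABC.TH.D (ABC.P2 (ABC.Q u)) \<oplus>\<^bsub>ABC.S\<^esub> ABC.TH.Db (ABC.P2 (ABC.Q v)))"
proof -
  have *: "a \<in> A_tensor_A A B \<longleftrightarrow> (\<exists>u\<in>carrier T. a = ABC.P2 (ABC.Q u))" for a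
  proof
    assume "a \<in> A_tensor_A A B"
    then have a: "a \<in> carrier ABC.S" "ABC.P2 a = a" by (simp_all add: A_tensor_A_eq)
    show "\<exists>u\<in>carrier T. a = ABC.P2 (ABC.Q u)"
      using a ABC.QR[OF a(1)] lin_closed[OF ABC.lin_R a(1)] by (intro bexI[of _ "ABC.R a"]) simp_all
  next
    assume "\<exists>u\<in>carrier T. a = ABC.P2 (ABC.Q u)"
    then obtain u where u: "u \<in> carrier T" "a = ABC.P2 (ABC.Q u)" by blast
    note q = lin_closed[OF ABC.lin_Q u(1)]
    show "a \<in> A_tensor_A A B"
      using u(2) ABC.P_idem(1)[OF q] lin_closed[OF ABC.lin_P2 q] by (simp add: A_tensor_A_eq)
  qed
  show ?thesis
    unfolding L_denominator_def set_add_tensor_bicomplex set_add_eq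
    by (simp add: tensor_diff_eq image_iff Bex_def[of "A_tensor_A A B"] *) blast
qed

text \<open>Each differential descends one step of the filtration: a sum of images has no top part,
  and its middle part comes from the top parts of \<open>u\<close> and \<open>v\<close>, hence lies
  in the denominator of \<open>L_space\<close>.\<close>

lemma ABC_P2_im:
  assumes u: "u \<in> carrier T" and v: "v \<in> carrier T"
  shows "ABC.P2 (ABC.Q (D u \<oplus>\<^bsub>T\<^esub> Db v)) = \<zero>\<^bsub>ABC.S\<^esub>"
    and "ABC.P1 (ABC.Q (D u \<oplus>\<^bsub>T\<^esub> Db v)) = ABC.TH.D (ABC.P2 (ABC.Q u)) \<oplus>\<^bsub>ABC.S\<^esub> ABC.TH.Db (ABC.P2 (ABC.Q v))"
proof -
  note q = lin_closed[OF ABC.lin_Q u] lin_closed[OF ABC.lin_Q v]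
  have e: "ABC.Q (D u \<oplus>\<^bsub>T\<^esub> Db v) = ABC.TH.D (ABC.Q u) \<oplus>\<^bsub>ABC.S\<^esub> ABC.TH.Db (ABC.Q v)"
    using u v by (simp add: lin_simps[OF ABC.lin_Q] BCA.TA.T_simps ABC.QD ABC.QDb)
  show "ABC.P2 (ABC.Q (D u \<oplus>\<^bsub>T\<^esub> Db v)) = \<zero>\<^bsub>ABC.S\<^esub>"
    unfolding e using q by (simp add: ABC.P_lin_simps ABC.TH.T_simps ABC.P_D(1,2))
  show "ABC.P1 (ABC.Q (D u \<oplus>\<^bsub>T\<^esub> Db v)) = ABC.TH.D (ABC.P2 (ABC.Q u)) \<oplus>\<^bsub>ABC.S\<^esub> ABC.TH.Db (ABC.P2 (ABC.Q v))"
    unfolding e using q by (simp add: ABC.P_lin_simps ABC.TH.T_simps ABC.P_D(5,6))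
qed

abbreviation "S1 \<equiv> {s \<in> carrier ABC.S. ABC.P1 s = s}"

lemma S1_subsp: "subsp (tensor_bicomplex (H_ABC A) (H_ABC B)) S1"
proof -
  have "ABC.P1 s \<ominus>\<^bsub>ABC.S\<^esub> s = \<zero>\<^bsub>ABC.S\<^esub> \<longleftrightarrow> ABC.P1 s = s" if "s \<in> carrier ABC.S" for s
    using that lin_closed[OF ABC.lin_P1 that]
    by (simp add: vs_emb_eq[OF ABC.TH.T] ABC.TH.Temb ABC.TH.T)
  then have "S1 = {s \<in> carrier ABC.S. ABC.P1 s \<ominus>\<^bsub>ABC.S\<^esub> s = \<zero>\<^bsub>ABC.S\<^esub>}" by auto
  then have "subsp ABC.S S1"
    using subsp_ker[OF lin_diff[OF ABC.lin_P1 lin_id[OF ABC.TH.T]]] by simp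
  then show ?thesis by (rule subsp_eqv) (simp_all add: vs_tensor_records ABC.TH.T)
qed

lemma R_S1_Y: "s \<in> S1 \<Longrightarrow> ABC.R s \<in> TT.Y"
proof -
  assume "s \<in> S1"
  then have s: "s \<in> carrier ABC.S" "ABC.P1 s = s" by auto
  have "D (Db (ABC.R s)) = ABC.R (ABC.TH.D (ABC.TH.Db (ABC.P1 s)))"
    using s by (simp add: ABC.RD ABC.RDb ABC.TH.T_simps)
  then show ?thesis
    unfolding ABC.DDb_P1[OF s(1)] using lin_closed[OF ABC.lin_R s(1)] by (simp add: TY lin_zero[OF ABC.lin_R])
qed

lemma lin_i2: "lin (sub_space (tensor_bicomplex (H_ABC A) (H_ABC B)) S1) (H_A (tensor_bicomplex A B)) i2"
proof -
  have "lin (tensor_bicomplex (H_ABC A) (H_ABC B)) (tensor_bicomplex A B) ABC.R"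
    by (rule lin_eqv[OF ABC.lin_R]) (simp_all add: vs_tensor_records T ABC.TH.T)
  from lin_sub_space_to[OF lin_sub_space_from[OF S1_subsp this] TT.Y] R_S1_Y
  have "lin (sub_space (tensor_bicomplex (H_ABC A) (H_ABC B)) S1) (sub_space (tensor_bicomplex A B) TT.Y) ABC.R" by simp
  from lin_comp[OF this TT.lin_cA] show ?thesis by (simp add: i2_def[abs_def])
qed

text \<open>If \<open>R s\<close> is a sum of images, then \<open>s\<close>, being the middle part
  of \<open>Q (R s)\<close>, lies in the denominator by \<open>ABC_P2_im\<close>. Conversely
  \<open>R\<close> commutes with the differentials.\<close>

lemma ker_i2: "s \<in> S1 \<Longrightarrow> i2 s = TT.M \<longleftrightarrow> s \<in> L_denominator A B"
proof
  assume "s \<in> S1"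
  then have s: "s \<in> carrier ABC.S" "ABC.P1 s = s" by auto
  note Rc = lin_closed[OF ABC.lin_R s(1)]
  { assume "i2 s = TT.M"
    then have "ABC.R s \<in> TT.M" using TT.cA_zero[of "ABC.R s"] Rc by (simp add: i2_def)
    then obtain u v where uv: "u \<in> carrier T" "v \<in> carrier T" "ABC.R s = D u \<oplus>\<^bsub>T\<^esub> Db v" by (auto simp: TM)
    have "s = ABC.P1 (ABC.Q (ABC.R s))" using ABC.QR[OF s(1)] s(2) by simp
    then show "s \<in> L_denominator A B" unfolding uv(3) L_N using uv(1,2) ABC_P2_im(2)[OF uv(1,2)] by auto }
  { assume "s \<in> L_denominator A B"
    then obtain u v where uv: "u \<in> carrier T" "v \<in> carrier T"
      "s = ABC.TH.D (ABC.P2 (ABC.Q u)) \<oplus>\<^bsub>ABC.S\<^esub> ABC.TH.Db (ABC.P2 (ABC.Q v))" by (auto simp: L_N)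
    note c = lin_closed[OF ABC.lin_P2 lin_closed[OF ABC.lin_Q uv(1)]] lin_closed[OF ABC.lin_P2 lin_closed[OF ABC.lin_Q uv(2)]]
    have "ABC.R s = D (ABC.R (ABC.P2 (ABC.Q u))) \<oplus>\<^bsub>T\<^esub> Db (ABC.R (ABC.P2 (ABC.Q v)))"
      unfolding uv(3) using c by (simp add: lin_simps[OF ABC.lin_R] ABC.TH.T_simps ABC.RD ABC.RDb)
    then have "ABC.R s \<in> TT.M" using c lin_closed[OF ABC.lin_R] unfolding TM by blast
    then show "i2 s = TT.M" using TT.cA_zero[of "ABC.R s"] Rc by (simp add: i2_def) }
qed

lemma ker_carrier: "carrier (ker_deldelbar_A_tensor_A A B) =
    {s \<in> carrier ABC.S. ABC.P2 s = s \<and> ABC.TH.D (ABC.TH.Db s) = \<zero>\<^bsub>ABC.S\<^esub>}"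
  unfolding ker_deldelbar_A_tensor_A_def sub_space_simps A_tensor_A_eq
  by (auto simp: tensor_diff_eq)

lemma ker_subsp: "subsp (tensor_bicomplex (H_ABC A) (H_ABC B)) (carrier (ker_deldelbar_A_tensor_A A B))"
proof -
  have "ABC.P2 s \<ominus>\<^bsub>ABC.S\<^esub> s = \<zero>\<^bsub>ABC.S\<^esub> \<longleftrightarrow> ABC.P2 s = s" if "s \<in> carrier ABC.S" for s
    using that lin_closed[OF ABC.lin_P2 that]
    by (simp add: vs_emb_eq[OF ABC.TH.T] ABC.TH.Temb ABC.TH.T)
  then have "carrier (ker_deldelbar_A_tensor_A A B) = {s \<in> carrier ABC.S. ABC.P2 s \<ominus>\<^bsub>ABC.S\<^esub> s = \<zero>\<^bsub>ABC.S\<^esub>} \<inter>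
      {s \<in> carrier ABC.S. ABC.TH.D (ABC.TH.Db s) = \<zero>\<^bsub>ABC.S\<^esub>}"
    unfolding ker_carrier by auto
  then have "subsp ABC.S (carrier (ker_deldelbar_A_tensor_A A B))"
    using subsp_Int[OF subsp_ker[OF lin_diff[OF ABC.lin_P2 lin_id[OF ABC.TH.T]]]
        subsp_ker[OF lin_comp[OF ABC.TH.lin_Db ABC.TH.lin_D]]] by simp
  then show ?thesis by (rule subsp_eqv) (simp_all add: vs_tensor_records ABC.TH.T)
qed

lemma p2_ker: "x \<in> TT.Y \<Longrightarrow> p2 x \<in> carrier (ker_deldelbar_A_tensor_A A B)"
proof -
  assume "x \<in> TT.Y"
  then have x: "x \<in> carrier T" "D (Db x) = \<zero>\<^bsub>T\<^esub>" by (simp_all add: TY)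
  note q = lin_closed[OF ABC.lin_Q x(1)]
  have "ABC.TH.D (ABC.TH.Db (ABC.P2 (ABC.Q x))) = ABC.Q (D (Db x))"
    using x(1) q by (simp add: ABC.DDb_P2 ABC.QD ABC.QDb BCA.TA.T_simps)
  then show ?thesis
    unfolding x(2) lin_zero[OF ABC.lin_Q] using ABC.P_idem(1)[OF q] lin_closed[OF ABC.lin_P2 q]
    by (simp add: ker_carrier p2_def)
qed

lemma lin_p2_T: "lin T ABC.S p2"
  unfolding p2_def[abs_def] by (rule lin_comp[OF ABC.lin_Q ABC.lin_P2])

lemma lin_p2: "lin (sub_space (tensor_bicomplex A B) TT.Y) (ker_deldelbar_A_tensor_A A B) p2"
proof -
  have "lin (tensor_bicomplex A B) (tensor_bicomplex (H_ABC A) (H_ABC B)) p2"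
    by (rule lin_eqv[OF lin_p2_T]) (simp_all add: vs_tensor_records T ABC.TH.T)
  from lin_sub_space_to[OF lin_sub_space_from[OF TT.Y this] ker_subsp] p2_ker
  show ?thesis unfolding ker_deldelbar_A_tensor_A_def by simp
qed

text \<open>\<open>tilde_H_BC\<close> consists of sums of images of differentials, so the bottom
  step is trivial in Aeppli cohomology. This is why the second sequence is read off from
  \<open>H_ABC\<close>.\<close>

lemma ABC_P0_R_im: "s \<in> carrier ABC.S \<Longrightarrow>
    \<exists>y z. y \<in> carrier T \<and> z \<in> carrier T \<and> ABC.R (ABC.P0 s) = D y \<oplus>\<^bsub>T\<^esub> Db z"
proof -
  assume s: "s \<in> carrier ABC.S"
  obtain h h' where h: "lin (H_ABC A) (H_ABC A) h" "lin (H_ABC A) (H_ABC A) h'"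
    "\<And>x. x \<in> carrier (H_ABC A) \<Longrightarrow> ABC_lower A x = del (H_ABC A) (h x) \<oplus>\<^bsub>H_ABC A\<^esub> delbar (H_ABC A) (h' x)"
    using SA.ABC_lower_form by blast
  obtain y z where yz: "y \<in> carrier ABC.S" "z \<in> carrier ABC.S" "ABC.P0 s = ABC.TH.D y \<oplus>\<^bsub>ABC.S\<^esub> ABC.TH.Db z"
    by (rule ABC.P0_im[OF h s])
  show ?thesis
    using yz by (intro exI[of _ "ABC.R y"] exI[of _ "ABC.R z"])
      (simp add: lin_simps[OF ABC.lin_R] ABC.TH.T_simps ABC.RD ABC.RDb)
qed

text \<open>Without a top part, \<open>s\<close> differs from its middle part by its bottom part
  only.\<close>

lemma cA_R_P1:
  assumes s: "s \<in> carrier ABC.S" and z: "ABC.P2 s = \<zero>\<^bsub>ABC.S\<^esub>"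
  shows "TT.cA (ABC.R s) = TT.cA (ABC.R (ABC.P1 s))"
proof -
  note c = lin_closed[OF ABC.lin_P1 s] lin_closed[OF ABC.lin_P0 s]
  obtain u v where uv: "u \<in> carrier T" "v \<in> carrier T" "ABC.R (ABC.P0 s) = D u \<oplus>\<^bsub>T\<^esub> Db v"
    using ABC_P0_R_im[OF s] by blast
  have "s = ABC.P1 s \<oplus>\<^bsub>ABC.S\<^esub> ABC.P0 s"
    using ABC.P_sum[OF s] c by (simp add: z vs_zero_simps[OF ABC.TH.T] ABC.TH.T)
  then have "ABC.R s = ABC.R (ABC.P1 s) \<oplus>\<^bsub>T\<^esub> (D u \<oplus>\<^bsub>T\<^esub> Db v)"
    unfolding uv(3)[symmetric] lin_add[OF ABC.lin_R c, symmetric] by simp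
  then show ?thesis by (rule cA_cong) (use uv c in \<open>simp_all add: lin_closed[OF ABC.lin_R]\<close>)
qed

lemma ABC_graded:
  "x \<in> grade (tensor_space A B) a b \<Longrightarrow> p2 x \<in> grade (tensor_space (H_ABC A) (H_ABC B)) a b"
  "s \<in> grade (tensor_space (H_ABC A) (H_ABC B)) a b \<Longrightarrow> ABC.R s \<in> grade (tensor_space A B) a b"
proof -
  note g = SA.glin_q_ABC SB.glin_q_ABC SA.glin_ABC_parts SB.glin_ABC_parts SA.glin_r_ABC SB.glin_r_ABC
  show "x \<in> grade (tensor_space A B) a b \<Longrightarrow> p2 x \<in> grade (tensor_space (H_ABC A) (H_ABC B)) a b"
    unfolding p2_def ABC.P2_def ABC.Q_def
    by (rule tensor_map_graded[OF g(4,6) grades(5,6,5,6)], rule tensor_map_graded[OF g(1,2) grades(1,2,5,6)])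
  show "s \<in> grade (tensor_space (H_ABC A) (H_ABC B)) a b \<Longrightarrow> ABC.R s \<in> grade (tensor_space A B) a b"
    unfolding ABC.R_def by (rule tensor_map_graded[OF g(7,8) grades(5,6,1,2)])
qed

lemma L_subset: "n \<in> L_denominator A B \<Longrightarrow> n \<in> S1"
proof -
  assume "n \<in> L_denominator A B"
  then obtain u v where uv: "u \<in> carrier T" "v \<in> carrier T"
    "n = ABC.TH.D (ABC.P2 (ABC.Q u)) \<oplus>\<^bsub>ABC.S\<^esub> ABC.TH.Db (ABC.P2 (ABC.Q v))" by (auto simp: L_N)
  have "n = ABC.P1 (ABC.Q (D u \<oplus>\<^bsub>T\<^esub> Db v))" unfolding uv(3) ABC_P2_im(2)[OF uv(1,2)] ..
  moreover have "ABC.Q (D u \<oplus>\<^bsub>T\<^esub> Db v) \<in> carrier ABC.S"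
    using uv(1,2) by (simp add: lin_closed[OF ABC.lin_Q] BCA.TA.T_simps)
  ultimately show ?thesis using ABC.P_idem(2) lin_closed[OF ABC.lin_P1] by simp
qed

lemma subsp_L: "subsp (sub_space (tensor_bicomplex (H_ABC A) (H_ABC B)) S1) (L_denominator A B)"
proof -
  \<comment> \<open>That the denominator is a subspace follows from its being the kernel of
    \<open>i2\<close>.\<close>
  have "L_denominator A B = {s \<in> carrier (sub_space (tensor_bicomplex (H_ABC A) (H_ABC B)) S1).
      i2 s = \<zero>\<^bsub>H_A (tensor_bicomplex A B)\<^esub>}"
    using ker_i2 L_subset by auto
  then show ?thesis using subsp_ker[OF lin_i2] by simp
qed

text \<open>Gives exactness in the middle: \<open>x\<close> has the Aeppli class of its model
  \<open>R (Q x)\<close>, whose top part vanishes by hypothesis and whose bottom part is a sum of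
  images.\<close>

lemma cA_p2_zero:
  assumes "x \<in> TT.Y" and p: "p2 x = \<zero>\<^bsub>ABC.S\<^esub>"
  shows "TT.cA x = i2 (ABC.P1 (ABC.Q x))"
proof -
  have x: "x \<in> carrier T" "D (Db x) = \<zero>\<^bsub>T\<^esub>" using assms by (simp_all add: TY)
  note q = lin_closed[OF ABC.lin_Q x(1)]
  obtain y z where yz: "y \<in> carrier T" "z \<in> carrier T" "x = ABC.R (ABC.Q x) \<oplus>\<^bsub>T\<^esub> (D y \<oplus>\<^bsub>T\<^esub> Db z)"
    by (rule ABC.ddb_homotopy[OF x])
  have "TT.cA x = TT.cA (ABC.R (ABC.Q x))" by (rule cA_cong[OF yz(3) lin_closed[OF ABC.lin_R q] yz(1,2)])
  also have "\<dots> = i2 (ABC.P1 (ABC.Q x))" unfolding i2_def by (rule cA_R_P1[OF q p[unfolded p2_def]])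
  finally show ?thesis .
qed

theorem exact_A:
  "short_exact (L_space A B) (quot_lift i2) (H_A_tensor A B) (quot_lift p2) (ker_deldelbar_A_tensor_A A B)"
  unfolding L_space_def set_add_tensor_bicomplex ABC_parts H_A_tensor_def H_A_def[of "tensor_bicomplex A B"]
proof (rule short_exact_quotients[OF subsp_L TT.subY lin_i2[unfolded H_A_def[of "tensor_bicomplex A B"]] lin_p2])
  let ?V0 = "sub_space (tensor_bicomplex (H_ABC A) (H_ABC B)) S1"
  let ?V1 = "sub_space (tensor_bicomplex A B) TT.Y"
  have z: "\<zero>\<^bsub>ker_deldelbar_A_tensor_A A B\<^esub> = \<zero>\<^bsub>ABC.S\<^esub>" by (simp add: ker_deldelbar_A_tensor_A_def)
  have co: "TT.M +>\<^bsub>?V1\<^esub> x = TT.cA x" for x by (simp add: TT.cA_def)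
  show "grade ?V1 a b \<subseteq> carrier ?V1" "grade ?V0 a b \<subseteq> carrier ?V0" for a b by simp_all
  show "i2 s \<in> grade (quot_space ?V1 TT.M) a b" if "s \<in> grade ?V0 a b" for a b s
  proof -
    have s: "s \<in> grade (tensor_space (H_ABC A) (H_ABC B)) a b" "s \<in> S1" using that by auto
    show ?thesis using ABC_graded(2)[OF s(1)] R_S1_Y[OF s(2)] by (simp add: i2_def TT.cA_def)
  qed
  show "p2 x \<in> grade (ker_deldelbar_A_tensor_A A B) a b" if "x \<in> grade ?V1 a b" for a b x
  proof -
    have x: "x \<in> grade (tensor_space A B) a b" "x \<in> TT.Y" using that by auto
    show ?thesis using ABC_graded(1)[OF x(1)] p2_ker[OF x(2)] unfolding ker_deldelbar_A_tensor_A_def by simp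
  qed
  show "i2 s = TT.M \<longleftrightarrow> s \<in> L_denominator A B" if "s \<in> carrier ?V0" for s
    using ker_i2[of s] that by simp
  show "p2 x = \<zero>\<^bsub>ker_deldelbar_A_tensor_A A B\<^esub>" if "x \<in> TT.M" for x
    using that ABC_P2_im(1) unfolding z TM p2_def by auto
  show "\<exists>x\<in>carrier ?V1. i2 s = TT.M +>\<^bsub>?V1\<^esub> x \<and> p2 x = \<zero>\<^bsub>ker_deldelbar_A_tensor_A A B\<^esub>" if "s \<in> carrier ?V0" for s
  proof (rule bexI[of _ "ABC.R s"], rule conjI)
    have s: "s \<in> carrier ABC.S" "ABC.P1 s = s" using that by auto
    show "i2 s = TT.M +>\<^bsub>?V1\<^esub> ABC.R s" unfolding co i2_def ..
    show "p2 (ABC.R s) = \<zero>\<^bsub>ker_deldelbar_A_tensor_A A B\<^esub>"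
      using ABC.P_idem(4)[OF s(1)] s(2) ABC.QR[OF s(1)] by (simp add: z p2_def)
    show "ABC.R s \<in> carrier ?V1" using R_S1_Y that by simp
  qed
  show "\<exists>s\<in>carrier ?V0. i2 s = TT.M +>\<^bsub>?V1\<^esub> x"
    if "x \<in> carrier ?V1" and p: "p2 x = \<zero>\<^bsub>ker_deldelbar_A_tensor_A A B\<^esub>" for x
  proof (rule bexI[of _ "ABC.P1 (ABC.Q x)"])
    have x: "x \<in> TT.Y" using that by simp
    then have q: "ABC.Q x \<in> carrier ABC.S" by (simp add: TY lin_closed[OF ABC.lin_Q])
    show "i2 (ABC.P1 (ABC.Q x)) = TT.M +>\<^bsub>?V1\<^esub> x" unfolding co cA_p2_zero[OF x p[unfolded z]] ..
    show "ABC.P1 (ABC.Q x) \<in> carrier ?V0" using lin_closed[OF ABC.lin_P1 q] ABC.P_idem(2)[OF q] by simp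
  qed
  show "\<exists>x\<in>carrier ?V1. p2 x = k" if "k \<in> carrier (ker_deldelbar_A_tensor_A A B)" for k
  proof (rule bexI[of _ "ABC.R k"])
    have k: "k \<in> carrier ABC.S" "ABC.P2 k = k" "ABC.TH.D (ABC.TH.Db k) = \<zero>\<^bsub>ABC.S\<^esub>"
      using that by (simp_all add: ker_carrier)
    show "p2 (ABC.R k) = k" using ABC.QR[OF k(1)] k(2) by (simp add: p2_def)
    have "D (Db (ABC.R k)) = ABC.R (ABC.TH.D (ABC.TH.Db k))"
      using k(1) by (simp add: ABC.RD ABC.RDb ABC.TH.T_simps)
    then show "ABC.R k \<in> carrier ?V1"
      unfolding k(3) using k(1) by (simp add: TY lin_closed[OF ABC.lin_R] lin_zero[OF ABC.lin_R])
  qed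
qed

end

context kunneth
begin

lemma lift_i1: "t \<in> carrier H0 \<Longrightarrow> quot_lift i1 (N +>\<^bsub>tensor_space (H_BC A) (H_BC B)\<^esub> t) = i1 t"
  using quot_lift_coset[OF lin_i1 subsp_N, of t] ker_i1 subspD(3)[OF subsp_N] by simp

lemma lift_p1: "x \<in> TT.Z \<Longrightarrow> quot_lift p1 (TT.cBC x) = p1 x"
  by (rule TT.lin_lift_BC(2)[OF lin_p1]) (use p1_I in \<open>auto simp: TI K_space_def\<close>)

lemma lift_i2: "s \<in> S1 \<Longrightarrow>
    quot_lift i2 (L_denominator A B +>\<^bsub>sub_space (tensor_bicomplex (H_ABC A) (H_ABC B)) S1\<^esub> s) = i2 s"
  using quot_lift_coset[OF lin_i2 subsp_L, of s] ker_i2 L_subset by auto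

lemma lift_p2: "x \<in> TT.Y \<Longrightarrow> quot_lift p2 (TT.cA x) = p2 x"
  by (rule TT.lin_lift_A(2)[OF lin_p2])
    (use ABC_P2_im(1) in \<open>auto simp: TM p2_def ker_deldelbar_A_tensor_A_def\<close>)

end

section \<open>Naturality\<close>

text \<open>The splittings of the sources and of the targets are unrelated to each other and to
  \<open>f\<close> and \<open>g\<close>; all squares commute whatever the choices are.\<close>

locale kunneth_morphism =
  K: kunneth A gA eA \<pi>A \<mu>A B gB eB \<pi>B \<mu>B + K': kunneth A' gA' eA' \<pi>A' \<mu>A' B' gB' eB' \<pi>B' \<mu>B' +
  MA: splitting_morphism A gA eA \<pi>A \<mu>A A' gA' eA' \<pi>A' \<mu>A' f +
  MB: splitting_morphism B gB eB \<pi>B \<mu>B B' gB' eB' \<pi>B' \<mu>B' g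
  for A :: "'a bicomplex" and gA eA \<pi>A \<mu>A and B :: "'b bicomplex" and gB eB \<pi>B \<mu>B
    and A' :: "'a2 bicomplex" and gA' eA' \<pi>A' \<mu>A' and B' :: "'b2 bicomplex" and gB' eB' \<pi>B' \<mu>B'
    and f g
begin

sublocale BCA: two_step_pair_morphism
  A "del A" "delbar A" "degree_sign A" "H_BCA A" "del (H_BCA A)" "delbar (H_BCA A)"
  "degree_sign (H_BCA A)" K.SA.q_BCA K.SA.r_BCA gA "BCA_lower A" "BCA_upper A"
  B "del B" "delbar B" "degree_sign B" "H_BCA B" "del (H_BCA B)" "delbar (H_BCA B)"
  "degree_sign (H_BCA B)" K.SB.q_BCA K.SB.r_BCA gB "BCA_lower B" "BCA_upper B"
  A' "del A'" "delbar A'" "degree_sign A'" "H_BCA A'" "del (H_BCA A')" "delbar (H_BCA A')"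
  "degree_sign (H_BCA A')" K'.SA.q_BCA K'.SA.r_BCA gA' "BCA_lower A'" "BCA_upper A'"
  B' "del B'" "delbar B'" "degree_sign B'" "H_BCA B'" "del (H_BCA B')" "delbar (H_BCA B')"
  "degree_sign (H_BCA B')" K'.SB.q_BCA K'.SB.r_BCA gB' "BCA_lower B'" "BCA_upper B'"
  f g "H_BCA_map A' f" "H_BCA_map B' g"
  by (rule two_step_pair_morphism.intro[OF K.BCA.two_step_pair_axioms K'.BCA.two_step_pair_axioms],
      rule two_step_pair_morphism_axioms.intro)
    (fact MA.lin_f MB.lin_f MA.lin_H_BCA_map MB.lin_H_BCA_map MA.f_d MA.f_b MA.f_s MB.f_d MB.f_b
      MA.BCA_map_parts MB.BCA_map_parts MA.BCA_lower_natural MA.BCA_upper_natural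
      MB.BCA_lower_natural MB.BCA_upper_natural)+

sublocale ABC: two_step_pair_morphism
  A "del A" "delbar A" "degree_sign A" "H_ABC A" "del (H_ABC A)" "delbar (H_ABC A)"
  "degree_sign (H_ABC A)" K.SA.q_ABC K.SA.r_ABC gA "ABC_lower A" "ABC_upper A"
  B "del B" "delbar B" "degree_sign B" "H_ABC B" "del (H_ABC B)" "delbar (H_ABC B)"
  "degree_sign (H_ABC B)" K.SB.q_ABC K.SB.r_ABC gB "ABC_lower B" "ABC_upper B"
  A' "del A'" "delbar A'" "degree_sign A'" "H_ABC A'" "del (H_ABC A')" "delbar (H_ABC A')"
  "degree_sign (H_ABC A')" K'.SA.q_ABC K'.SA.r_ABC gA' "ABC_lower A'" "ABC_upper A'"
  B' "del B'" "delbar B'" "degree_sign B'" "H_ABC B'" "del (H_ABC B')" "delbar (H_ABC B')"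
  "degree_sign (H_ABC B')" K'.SB.q_ABC K'.SB.r_ABC gB' "ABC_lower B'" "ABC_upper B'"
  f g "H_ABC_map A' f" "H_ABC_map B' g"
  by (rule two_step_pair_morphism.intro[OF K.ABC.two_step_pair_axioms K'.ABC.two_step_pair_axioms],
      rule two_step_pair_morphism_axioms.intro)
    (fact MA.lin_f MB.lin_f MA.lin_H_ABC_map MB.lin_H_ABC_map MA.f_d MA.f_b MA.f_s MB.f_d MB.f_b
      MA.ABC_map_parts MB.ABC_map_parts MA.ABC_lower_natural MA.ABC_upper_natural
      MB.ABC_lower_natural MB.ABC_upper_natural)+

abbreviation "F \<equiv> tensor_map A' B' f g"

lemma F_eq: "BCA.F = F" "ABC.F = F"
  by (simp_all add: BCA.F_def ABC.F_def)

lemmas lin_F = BCA.lin_F[unfolded F_eq] and F_D = BCA.F_D[unfolded F_eq] and F_Db = BCA.F_Db[unfolded F_eq]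
lemmas Phi_eq = BCA.\<Phi>_def[unfolded F_eq] ABC.\<Phi>_def[unfolded F_eq]
lemmas F_simps = lin_simps[OF lin_F] F_D F_Db K.BCA.TA.T_simps

lemma lin_F_TB: "lin (tensor_bicomplex A B) (tensor_bicomplex A' B') F"
  by (rule lin_eqv[OF lin_F]) (simp_all add: vs_tensor_records K.T K'.T)

lemma F_commutes: "\<forall>x\<in>carrier (tensor_bicomplex A B). F (del (tensor_bicomplex A B) x) = del (tensor_bicomplex A' B') (F x) \<and>
    F (delbar (tensor_bicomplex A B) x) = delbar (tensor_bicomplex A' B') (F x)"
  by (simp add: K.tensor_diff_eq K'.tensor_diff_eq F_D F_Db)

lemmas coh = cohomology_maps[OF K.TT.ungraded_bicomplex_axioms K'.TT.ungraded_bicomplex_axioms lin_F_TB F_commutes]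

abbreviation "U0 \<equiv> tensor_map (H_BC A') (H_BC B') (H_BC_map A' f) (H_BC_map B' g)"

lemma lin_U0: "lin K.H0 K'.H0 U0"
  by (rule lin_tensor_map[OF MA.coh(5) MB.coh(5)])

lemma jj_U0: "t \<in> carrier K.H0 \<Longrightarrow> K'.jj (U0 t) = BCA.U (K.jj t)"
proof -
  have 1: "H_BCA_map A' f (K.SA.j x) = K'.SA.j (H_BC_map A' f x)" for x
    using lin_zero[OF MA.coh(9)] by (simp add: H_BCA_map_def K.SA.j_def K'.SA.j_def)
  have 2: "H_BCA_map B' g (K.SB.j x) = K'.SB.j (H_BC_map B' g x)" for x
    using lin_zero[OF MB.coh(9)] by (simp add: H_BCA_map_def K.SB.j_def K'.SB.j_def)
  show "t \<in> carrier K.H0 \<Longrightarrow> K'.jj (U0 t) = BCA.U (K.jj t)"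
    by (rule tensor_lin_eq[OF K.SA.vs_H_BC K.SB.vs_H_BC lin_comp[OF lin_U0 K'.lin_jj] lin_comp[OF K.lin_jj BCA.lin_U]])
      (simp_all add: tensor_map_pure[OF MA.coh(5) MB.coh(5)] K.jj_def K'.jj_def BCA.U_pure 1 2
        tensor_map_pure[OF K.SA.lin_j K.SB.lin_j] tensor_map_pure[OF K'.SA.lin_j K'.SB.lin_j]
        lin_closed[OF MA.coh(5)] lin_closed[OF MB.coh(5)] lin_closed[OF K.SA.lin_j] lin_closed[OF K.SB.lin_j]
        del: K.SA.no_carrier K.SB.no_carrier K'.SA.no_carrier K'.SB.no_carrier H_BCA_simps)
qed

text \<open>The range of \<open>jj\<close> is the bottom step, where \<open>\<Phi>\<close> equals
  \<open>U\<close> exactly. The image under \<open>F\<close> of a representative then differs from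
  the wanted one by an element of the image of \<open>D Db\<close>.\<close>

lemma i1_natural: "t \<in> carrier K.H0 \<Longrightarrow> K'.i1 (U0 t) = H_BC_map (tensor_bicomplex A' B') F (K.i1 t)"
proof -
  assume t: "t \<in> carrier K.H0"
  note s = lin_closed[OF K.lin_jj t]
  let ?x = "F (K.BCA.R (K.jj t))"
  have x: "?x \<in> K'.TT.Z" by (rule coh(1)[OF K.R_jj_Z[OF t]])
  then have x': "?x \<in> carrier K'.T" "K'.D ?x = \<zero>\<^bsub>K'.T\<^esub>" "K'.Db ?x = \<zero>\<^bsub>K'.T\<^esub>" by (simp_all add: K'.TZ)
  obtain y where y: "y \<in> carrier K'.T" "?x = K'.BCA.R (K'.BCA.Q ?x) \<oplus>\<^bsub>K'.T\<^esub> K'.D (K'.Db y)"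
    by (rule K'.BCA.closed_homotopy[OF x'])
  have "K'.BCA.Q ?x = K'.jj (U0 t)"
    using BCA.Phi_P0[OF s] unfolding K.P0_jj[OF t] jj_U0[OF t] Phi_eq .
  then have "K'.TT.cBC ?x = K'.i1 (U0 t)"
    unfolding K'.i1_def
    using K'.cBC_cong[OF y(2) _ y(1)] lin_closed[OF K'.BCA.lin_R lin_closed[OF K'.BCA.lin_Q x'(1)]] by simp
  then show ?thesis unfolding K.i1_def coh(6)[OF K.R_jj_Z[OF t]] ..
qed

text \<open>As \<open>N\<close> is the kernel of \<open>i1\<close>, compatibility of the
  denominators follows from the commuting square on representatives.\<close>

lemma U0_N: "n \<in> K.N \<Longrightarrow> U0 n \<in> K'.N"
proof -
  assume n: "n \<in> K.N"
  then have c: "n \<in> carrier K.H0" using subspD(3)[OF K.subsp_N] by simp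
  have "K'.i1 (U0 n) = K'.TT.I"
    using i1_natural[OF c] K.ker_i1[OF c] n lin_zero[OF coh(5)] by simp
  then show ?thesis using K'.ker_i1[OF lin_closed[OF lin_U0 c]] by simp
qed

theorem i_BC_natural:
  assumes "X \<in> carrier (BC_quotient A B)"
  shows "quot_lift K'.i1 (BC_quotient_map A' B' f g X) = H_BC_tensor_map A' B' f g (quot_lift K.i1 X)"
proof -
  obtain t where t: "t \<in> carrier K.H0" "X = K.N +>\<^bsub>tensor_space (H_BC A) (H_BC B)\<^esub> t"
    using assms by (auto simp: BC_quotient_def)
  have "lin (tensor_space (H_BC A) (H_BC B)) (tensor_space (H_BC A') (H_BC B')) U0"
    by (rule lin_eqv[OF lin_U0])
      (simp_all add: vs_tensor_records vs_tensor_module K.SA.vs_H_BC K.SB.vs_H_BC K'.SA.vs_H_BC K'.SB.vs_H_BC)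
  from lin_quot_map(2)[OF this K.subsp_N K'.subsp_N U0_N, of t]
  have "BC_quotient_map A' B' f g X = K'.N +>\<^bsub>tensor_space (H_BC A') (H_BC B')\<^esub> U0 t"
    using t by (simp add: BC_quotient_map_def)
  then show ?thesis
    unfolding t(2) using i1_natural[OF t(1)] K.lift_i1[OF t(1)] K'.lift_i1[OF lin_closed[OF lin_U0 t(1)]]
    by (simp add: H_BC_tensor_map_def)
qed

text \<open>A closed element has a middle and a bottom part. \<open>\<Phi>\<close> acts on the
  middle part as \<open>U\<close> up to a bottom term and keeps the bottom part in the bottom step;
  \<open>P1\<close> discards both.\<close>

lemma p1_natural: "x \<in> K.TT.Z \<Longrightarrow> K'.p1 (F x) = BCA.U (K.p1 x)"
proof -
  assume xZ: "x \<in> K.TT.Z"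
  then have x: "x \<in> carrier K.T" "K.D x = \<zero>\<^bsub>K.T\<^esub>" "K.Db x = \<zero>\<^bsub>K.T\<^esub>" by (simp_all add: K.TZ)
  let ?q = "K.BCA.Q x"
  note q = lin_closed[OF K.BCA.lin_Q x(1)]
  note c = lin_closed[OF K.BCA.lin_P1 q] lin_closed[OF K.BCA.lin_P0 q]
  obtain y where y: "y \<in> carrier K.T" "x = K.BCA.R ?q \<oplus>\<^bsub>K.T\<^esub> K.D (K.Db y)"
    by (rule K.BCA.closed_homotopy[OF x])
  have Fx: "F x = F (K.BCA.R ?q) \<oplus>\<^bsub>K'.T\<^esub> K'.D (K'.Db (F y))"
    using arg_cong[OF y(2), of F] y(1) lin_closed[OF K.BCA.lin_R q] by (simp add: F_simps)
  have r: "F (K.BCA.R ?q) \<in> carrier K'.T" "F y \<in> carrier K'.T"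
    using y(1) lin_closed[OF K.BCA.lin_R q] by (simp_all add: F_simps)
  have "K'.p1 (F x) = K'.p1 (F (K.BCA.R ?q)) \<oplus>\<^bsub>K'.BCA.S\<^esub> K'.p1 (K'.D (K'.Db (F y)))"
    unfolding Fx using r by (intro lin_add[OF K'.lin_p1_T]) (simp_all add: K'.BCA.TA.T_simps)
  also have "\<dots> = K'.p1 (F (K.BCA.R ?q))"
    unfolding K'.p1_I[OF r(2)] using lin_closed[OF K'.lin_p1_T r(1)] by (simp add: vs_zero_simps[OF K'.BCA.TH.T])
  also have "\<dots> = K'.BCA.P1 (BCA.\<Phi> ?q)" by (simp add: K'.p1_def Phi_eq)
  also have "?q = K.BCA.P1 ?q \<oplus>\<^bsub>K.BCA.S\<^esub> K.BCA.P0 ?q"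
    using K.BCA.P_sum[OF q] c by (simp add: K.P2_Q_closed[OF xZ] vs_zero_simps[OF K.BCA.TH.T] K.BCA.TH.T)
  also have "K'.BCA.P1 (BCA.\<Phi> (K.BCA.P1 ?q \<oplus>\<^bsub>K.BCA.S\<^esub> K.BCA.P0 ?q)) =
      K'.BCA.P1 (BCA.\<Phi> (K.BCA.P1 ?q)) \<oplus>\<^bsub>K'.BCA.S\<^esub> K'.BCA.P1 (BCA.\<Phi> (K.BCA.P0 ?q))"
    using c by (simp add: lin_simps[OF BCA.lin_Phi] lin_simps[OF K'.BCA.lin_P1])
  also have "\<dots> = BCA.U (K.BCA.P1 ?q)"
    unfolding BCA.Phi_P1[OF q] BCA.Phi_P0[OF q] BCA.U_P(1)[OF c(2)] K.BCA.P_idem(7)[OF q] lin_zero[OF BCA.lin_U]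
    using lin_closed[OF BCA.lin_U c(1)] by (simp add: vs_zero_simps[OF K'.BCA.TH.T])
  finally show ?thesis by (simp add: K.p1_def)
qed

theorem p_BC_natural:
  assumes "X \<in> carrier (H_BC_tensor A B)"
  shows "quot_lift K'.p1 (H_BC_tensor_map A' B' f g X) = K_map A' B' f g (quot_lift K.p1 X)"
proof -
  obtain x where x: "x \<in> K.TT.Z" "X = K.TT.cBC x" using assms by (auto simp: H_BC_tensor_def)
  show ?thesis
    unfolding x(2) H_BC_tensor_map_def coh(6)[OF x(1)] K.lift_p1[OF x(1)] K'.lift_p1[OF coh(1)[OF x(1)]]
      p1_natural[OF x(1)] by (simp add: K_map_def BCA.U_def)
qed

text \<open>For \<open>s\<close> in the middle step \<open>\<Phi> s\<close> has no top part and
  middle part \<open>U s\<close>; its bottom part does not change the class in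
  \<open>H_A\<close>.\<close>

lemma i2_natural: "s \<in> K.S1 \<Longrightarrow> K'.i2 (ABC.U s) = H_A_map (tensor_bicomplex A' B') F (K.i2 s)"
proof -
  assume sS: "s \<in> K.S1"
  then have s: "s \<in> carrier K.ABC.S" "K.ABC.P1 s = s" by auto
  let ?x = "F (K.ABC.R s)"
  have x: "?x \<in> K'.TT.Y" by (rule coh(2)[OF K.R_S1_Y[OF sS]])
  then have x': "?x \<in> carrier K'.T" "K'.D (K'.Db ?x) = \<zero>\<^bsub>K'.T\<^esub>" by (simp_all add: K'.TY)
  note q = lin_closed[OF K'.ABC.lin_Q x'(1)]
  obtain y z where yz: "y \<in> carrier K'.T" "z \<in> carrier K'.T"
    "?x = K'.ABC.R (K'.ABC.Q ?x) \<oplus>\<^bsub>K'.T\<^esub> (K'.D y \<oplus>\<^bsub>K'.T\<^esub> K'.Db z)"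
    by (rule K'.ABC.ddb_homotopy[OF x'])
  have e: "K'.ABC.Q ?x = ABC.\<Phi> s" by (simp add: Phi_eq)
  have 2: "K'.ABC.P2 (ABC.\<Phi> s) = \<zero>\<^bsub>K'.ABC.S\<^esub>"
    using ABC.Phi_P2[OF s(1)] K.ABC.P_idem(4)[OF s(1)] unfolding s(2) by (simp add: lin_zero[OF ABC.lin_U])
  have 1: "K'.ABC.P1 (ABC.\<Phi> s) = ABC.U s" using ABC.Phi_P1[OF s(1)] unfolding s(2) .
  have "K'.TT.cA ?x = K'.TT.cA (K'.ABC.R (K'.ABC.Q ?x))"
    by (rule K'.cA_cong[OF yz(3) lin_closed[OF K'.ABC.lin_R q] yz(1,2)])
  also have "\<dots> = K'.TT.cA (K'.ABC.R (ABC.U s))"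
    using K'.cA_R_P1[OF q] unfolding e 1 using 2 by blast
  finally show ?thesis unfolding K.i2_def K'.i2_def coh(8)[OF K.R_S1_Y[OF sS]] by simp
qed

lemma U_S1: "s \<in> K.S1 \<Longrightarrow> ABC.U s \<in> K'.S1"
  using ABC.U_P(1) lin_closed[OF ABC.lin_U] by auto

lemma U_L: "n \<in> L_denominator A B \<Longrightarrow> ABC.U n \<in> L_denominator A' B'"
proof -
  assume n: "n \<in> L_denominator A B"
  note c = K.L_subset[OF n]
  have "K'.i2 (ABC.U n) = K'.TT.M"
    using i2_natural[OF c] K.ker_i2[OF c] n lin_zero[OF coh(7)] by simp
  then show ?thesis using K'.ker_i2[OF U_S1[OF c]] by simp
qed

theorem i_A_natural:
  assumes "X \<in> carrier (L_space A B)"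
  shows "quot_lift K'.i2 (L_map A' B' f g X) = H_A_tensor_map A' B' f g (quot_lift K.i2 X)"
proof -
  let ?V = "sub_space (ABC_tensor A B) K.S1" and ?V' = "sub_space (ABC_tensor A' B') K'.S1"
  obtain s where s: "s \<in> K.S1" "X = L_denominator A B +>\<^bsub>?V\<^esub> s"
    using assms unfolding L_space_def set_add_tensor_bicomplex K.ABC_parts by auto
  have "lin (ABC_tensor A B) (ABC_tensor A' B') ABC.U"
    by (rule lin_eqv[OF ABC.lin_U]) (simp_all add: vs_tensor_records K.ABC.TH.T K'.ABC.TH.T)
  from lin_sub_space_to[OF lin_sub_space_from[OF K.S1_subsp this] K'.S1_subsp] U_S1
  have "lin ?V ?V' ABC.U" by simp
  from lin_quot_map(2)[OF this K.subsp_L K'.subsp_L U_L, of s]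
  have "quot_map ?V' (L_denominator A' B') ABC.U X = L_denominator A' B' +>\<^bsub>?V'\<^esub> ABC.U s"
    using s by simp
  then have "L_map A' B' f g X = L_denominator A' B' +>\<^bsub>?V'\<^esub> ABC.U s"
    by (simp add: L_map_def ABC_tensor_map_def ABC.U_def)
  then show ?thesis
    unfolding s(2) using i2_natural[OF s(1)] K.lift_i2[OF s(1)] K'.lift_i2[OF U_S1[OF s(1)]]
    by (simp add: H_A_tensor_map_def)
qed

text \<open>\<open>x\<close> and \<open>R (Q x)\<close> differ by a sum of images, which
  \<open>F\<close> preserves and which has no top part; on top parts \<open>\<Phi>\<close> and
  \<open>U\<close> agree.\<close>

lemma p2_natural: "x \<in> K.TT.Y \<Longrightarrow> K'.p2 (F x) = ABC.U (K.p2 x)"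
proof -
  assume "x \<in> K.TT.Y"
  then have x: "x \<in> carrier K.T" "K.D (K.Db x) = \<zero>\<^bsub>K.T\<^esub>" by (simp_all add: K.TY)
  let ?q = "K.ABC.Q x"
  note q = lin_closed[OF K.ABC.lin_Q x(1)]
  obtain y z where yz: "y \<in> carrier K.T" "z \<in> carrier K.T" "x = K.ABC.R ?q \<oplus>\<^bsub>K.T\<^esub> (K.D y \<oplus>\<^bsub>K.T\<^esub> K.Db z)"
    by (rule K.ABC.ddb_homotopy[OF x])
  have Fx: "F x = F (K.ABC.R ?q) \<oplus>\<^bsub>K'.T\<^esub> (K'.D (F y) \<oplus>\<^bsub>K'.T\<^esub> K'.Db (F z))"
    using arg_cong[OF yz(3), of F] yz(1,2) lin_closed[OF K.ABC.lin_R q] by (simp add: F_simps)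
  have r: "F (K.ABC.R ?q) \<in> carrier K'.T" "F y \<in> carrier K'.T" "F z \<in> carrier K'.T"
    using yz(1,2) lin_closed[OF K.ABC.lin_R q] by (simp_all add: F_simps)
  have "K'.p2 (F x) = K'.p2 (F (K.ABC.R ?q)) \<oplus>\<^bsub>K'.ABC.S\<^esub> K'.p2 (K'.D (F y) \<oplus>\<^bsub>K'.T\<^esub> K'.Db (F z))"
    unfolding Fx using r by (intro lin_add[OF K'.lin_p2_T]) (simp_all add: K'.BCA.TA.T_simps)
  also have "\<dots> = K'.p2 (F (K.ABC.R ?q))"
    unfolding K'.p2_def K'.ABC_P2_im(1)[OF r(2,3)] using lin_closed[OF K'.lin_p2_T r(1)]
    by (simp add: vs_zero_simps[OF K'.ABC.TH.T] K'.p2_def)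
  also have "\<dots> = ABC.U (K.p2 x)"
    using ABC.Phi_P2[OF q] by (simp add: K.p2_def K'.p2_def Phi_eq)
  finally show ?thesis .
qed

theorem p_A_natural:
  assumes "X \<in> carrier (H_A_tensor A B)"
  shows "quot_lift K'.p2 (H_A_tensor_map A' B' f g X) = ABC_tensor_map A' B' f g (quot_lift K.p2 X)"
proof -
  obtain x where x: "x \<in> K.TT.Y" "X = K.TT.cA x" using assms by (auto simp: H_A_tensor_def)
  show ?thesis
    unfolding x(2) H_A_tensor_map_def coh(8)[OF x(1)] K.lift_p2[OF x(1)] K'.lift_p2[OF coh(2)[OF x(1)]]
      p2_natural[OF x(1)] by (simp add: ABC_tensor_map_def ABC.U_def)
qed

end

lemma bounded_splitting: "bounded_bicomplex A \<Longrightarrow> \<exists>g e \<pi> \<mu>. splitting A g e \<pi> \<mu>"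
  by (rule proper_bicomplex.splitting_exists) (simp add: proper_bicomplex_def bounded_bicomplex_def)

theorem theorem1p35:
  shows
    "(\<exists>(i :: 'a bicomplex \<Rightarrow> 'b bicomplex \<Rightarrow> _) p.
        natural_short_exact
          BC_quotient BC_quotient_map i
          H_BC_tensor H_BC_tensor_map p
          K_space K_map) \<and>
     (\<exists>(i :: 'a bicomplex \<Rightarrow> 'b bicomplex \<Rightarrow> _) p.
        natural_short_exact
          L_space L_map i
          H_A_tensor H_A_tensor_map p
          ker_deldelbar_A_tensor_A ABC_tensor_map)"
proof -
  \<comment> \<open>The maps of the sequences are families over all bicomplexes, so one splitting is
    chosen for every bicomplex at once; the two factors have independent types and receive separate
    choices.\<close>
  obtain gA eA \<pi>A \<mu>A where a: "\<And>A :: 'a bicomplex. bounded_bicomplex A \<Longrightarrow> splitting A (gA A) (eA A) (\<pi>A A) (\<mu>A A)"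
    using bounded_splitting by metis
  obtain gB eB \<pi>B \<mu>B where b: "\<And>B :: 'b bicomplex. bounded_bicomplex B \<Longrightarrow> splitting B (gB B) (eB B) (\<pi>B B) (\<mu>B B)"
    using bounded_splitting by metis
  have k: "kunneth A (gA A) (eA A) (\<pi>A A) (\<mu>A A) B (gB B) (eB B) (\<pi>B B) (\<mu>B B)"
    if "bounded_bicomplex A" "bounded_bicomplex B" for A B
    by (rule kunneth.intro[OF a[OF that(1)] b[OF that(2)]])
  have m: "kunneth_morphism A (gA A) (eA A) (\<pi>A A) (\<mu>A A) B (gB B) (eB B) (\<pi>B B) (\<mu>B B)
      A' (gA A') (eA A') (\<pi>A A') (\<mu>A A') B' (gB B') (eB B') (\<pi>B B') (\<mu>B B') f g"
    if "bounded_bicomplex A" "bounded_bicomplex A'" "bounded_bicomplex B" "bounded_bicomplex B'"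
      "bicomplex_morphism A A' f" "bicomplex_morphism B B' g" for A A' B B' f g
    using that by (intro kunneth_morphism.intro splitting_morphism.intro splitting_morphism_axioms.intro k a b)
  let ?i1 = "\<lambda>A B. quot_lift (kunneth.i1 A (eA A) (\<pi>A A) B (eB B) (\<pi>B B))"
    and ?p1 = "\<lambda>A B. quot_lift (kunneth.p1 A (eA A) (\<pi>A A) B (eB B) (\<pi>B B))"
    and ?i2 = "\<lambda>A B. quot_lift (kunneth.i2 A (eA A) (\<mu>A A) B (eB B) (\<mu>B B))"
    and ?p2 = "\<lambda>A B. quot_lift (kunneth.p2 A (eA A) (\<mu>A A) B (eB B) (\<mu>B B))"
  have "natural_short_exact BC_quotient BC_quotient_map ?i1 H_BC_tensor H_BC_tensor_map ?p1 K_space K_map"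
    unfolding natural_short_exact_def
    by (intro conjI allI impI ballI; elim conjE)
      (rule kunneth.exact_BC kunneth_morphism.i_BC_natural kunneth_morphism.p_BC_natural, (rule k m; assumption), assumption?)+
  moreover have "natural_short_exact L_space L_map ?i2 H_A_tensor H_A_tensor_map ?p2 ker_deldelbar_A_tensor_A ABC_tensor_map"
    unfolding natural_short_exact_def
    by (intro conjI allI impI ballI; elim conjE)
      (rule kunneth.exact_A kunneth_morphism.i_A_natural kunneth_morphism.p_A_natural, (rule k m; assumption), assumption?)+
  ultimately show ?thesis by blast
qed

end
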